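(* Let $(M^n,g)$ be a closed connected Riemannian manifold of dimension $n\ge 3$ and let $f$ be a proper isoparametric function on $M$. Let $\mu_k$, $k\ge 1$, be the positive eigenvalues (in increasing order) of $-\Delta_g$ restricted to $C_f^{2,\alpha}$. For any $q>1$ let $\lambda_k=\lambda_k(q)=\frac{\mu_k}{q-1}$. Then for every $k\ge 1$ there are $\varepsilon>0$ and a branch $t\mapsto (u(t),\lambda(t))\in C_f^{2,\alpha}\times(0,\infty)$, $t\in(-\varepsilon,\varepsilon)$, such that each $u(t)$ is a positive $f$-invariant solution of $$-\Delta_g u+\lambda u=\lambda u^q$$ with $\lambda=\lambda(t)$, and $\lambda(0)=\lambda_k$, $u(0)=1$, and $u(t)\neq 1$ if $t\neq 0$.
   Context: $\Delta_g$ is the Laplace–Beltrami operator, with the sign convention that $-\Delta_g$ is nonnegative. A smooth non-constant function $f:M\to[t_0,t_1]$ (onto) is called isoparametric if $|\nabla f|^2=b(f)$ and $\Delta_g f=a(f)$ for some smooth functions $a,b$ on $[t_0,t_1]$. The sets $M_1=f^{-1}(t_0)$ and $M_2=f^{-1}(t_1)$ are then smooth submanifolds, called the focal submanifolds; $d_i$ denotes the dimension of $M_i$. $f$ is called proper if $d_1,d_2\le n-2$. Let $\mathbf d(x)=d_g(M_1,x)$ and $t^*=d_g(M_1,M_2)$. A function $u$ on $M$ is $f$-invariant if $u(x)=\phi(\mathbf d(x))$ for some function $\phi:[0,t^*]\to\mathbb R$ (equivalently, $u$ is constant on the level sets of $f$). $C_f^{2,\alpha}$ is the space of $f$-invariant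 functions of class $C^{2,\alpha}$ on $M$, for a fixed $\alpha\in(0,1)$. The eigenvalues of $-\Delta_g$ restricted to $C_f^{2,\alpha}$ are those eigenvalues of $-\Delta_g$ that have a non-trivial eigenfunction in $C_f^{2,\alpha}$; the positive ones form an infinite sequence $\mu_1<\mu_2<\cdots$. A branch means a continuous curve. *)

theory Defs
  imports "HOL-Analysis.Analysis"
begin

section \<open>Smoothness in Euclidean space\<close>

definition pd :: "'n::finite \<Rightarrow> (real^'n \<Rightarrow> 'b::real_normed_vector) \<Rightarrow> real^'n \<Rightarrow> 'b" where
  "pd i h x = frechet_derivative h (at x) (axis i 1)"

text \<open>Only meaningful for open sets.\<close>

fun Ck_on :: "nat \<Rightarrow> (real^'n::finite \<Rightarrow> 'b::real_normed_vector) \<Rightarrow> (real^'n) set \<Rightarrow> bool" where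
  "Ck_on 0 h S \<longleftrightarrow> continuous_on S h"
| "Ck_on (Suc k) h S \<longleftrightarrow> h differentiable_on S \<and> (\<forall>i. Ck_on k (pd i h) S)"

definition smooth_on :: "(real^'n::finite \<Rightarrow> 'b::real_normed_vector) \<Rightarrow> (real^'n) set \<Rightarrow> bool" where
  "smooth_on h S \<longleftrightarrow> (\<forall>k. Ck_on k h S)"

text \<open>Smoothness on a closed interval, with one-sided derivatives at the end points:
  \<open>D k\<close> is the \<open>k\<close>-th derivative.\<close>

definition smooth_on_interval :: "(real \<Rightarrow> real) \<Rightarrow> real \<Rightarrow> real \<Rightarrow> bool" where
  "smooth_on_interval h a b \<longleftrightarrow>
     (\<exists>D :: nat \<Rightarrow> real \<Rightarrow> real. D 0 = h \<and>
        (\<forall>k. \<forall>t\<in>{a..b}. (D k has_real_derivative D (Suc k) t) (at t within {a..b})))"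


section \<open>Closed smooth manifolds\<close>

text \<open>A chart is a pair of its domain and its coordinate map; the values of the map outside
  the domain are irrelevant. The dimension of the manifold is \<open>CARD('n)\<close>.\<close>

type_synonym ('m, 'n) chart = "'m set \<times> ('m \<Rightarrow> real^'n)"

definition is_chart :: "'m topology \<Rightarrow> ('m, 'n::finite) chart \<Rightarrow> bool" where
  "is_chart X c \<longleftrightarrow> openin X (fst c) \<and> open (snd c ` fst c) \<and>
     homeomorphic_map (subtopology X (fst c)) (top_of_set (snd c ` fst c)) (snd c)"

text \<open>The expression of a function on the manifold in the coordinates of a chart.\<close>

definition local_rep :: "('m, 'n::finite) chart \<Rightarrow> ('m \<Rightarrow> 'b) \<Rightarrow> real^'n \<Rightarrow> 'b" where
  "local_rep c u = u \<circ> inv_into (fst c) (snd c)"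

definition compatible :: "('m, 'n::finite) chart \<Rightarrow> ('m, 'n) chart \<Rightarrow> bool" where
  "compatible c c' \<longleftrightarrow>
     smooth_on (local_rep c (snd c')) (snd c ` (fst c \<inter> fst c')) \<and>
     smooth_on (local_rep c' (snd c)) (snd c' ` (fst c \<inter> fst c'))"

text \<open>The atlas is not required to be maximal.\<close>

definition smooth_atlas :: "'m topology \<Rightarrow> ('m, 'n::finite) chart set \<Rightarrow> bool" where
  "smooth_atlas X A \<longleftrightarrow>
     (\<forall>c\<in>A. is_chart X c) \<and> (\<Union>c\<in>A. fst c) = topspace X \<and> (\<forall>c\<in>A. \<forall>c'\<in>A. compatible c c')"

definition chart_at :: "('m, 'n::finite) chart set \<Rightarrow> 'm \<Rightarrow> ('m, 'n) chart" where
  "chart_at A p = (SOME c. c \<in> A \<and> p \<in> fst c)"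

definition smooth_fun :: "('m, 'n::finite) chart set \<Rightarrow> ('m \<Rightarrow> real) \<Rightarrow> bool" where
  "smooth_fun A u \<longleftrightarrow> (\<forall>c\<in>A. smooth_on (local_rep c u) (snd c ` fst c))"

text \<open>Embedded submanifolds of dimension \<open>d\<close>, by slice charts: near each of its points,
  \<open>S\<close> is given by the vanishing of \<open>n - d\<close> of the coordinates.\<close>

definition submanifold ::
    "'m topology \<Rightarrow> ('m, 'n::finite) chart set \<Rightarrow> 'm set \<Rightarrow> nat \<Rightarrow> bool" where
  "submanifold X A S d \<longleftrightarrow> S \<subseteq> topspace X \<and>
     (\<forall>p\<in>S. \<exists>c. is_chart X c \<and> (\<forall>c'\<in>A. compatible c c') \<and> p \<in> fst c \<and>
        (\<exists>I. d + card I = CARD('n) \<and>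
             snd c ` (fst c \<inter> S) = {x \<in> snd c ` fst c. \<forall>i\<in>I. x $ i = 0}))"


section \<open>Riemannian metrics\<close>

text \<open>\<open>g c p\<close> is the Gram matrix of the metric at the point \<open>p\<close> in the coordinates of the
  chart \<open>c\<close>; the last clause is the transformation law of covariant 2-tensors.\<close>

definition riemannian_metric ::
    "('m, 'n::finite) chart set \<Rightarrow> (('m, 'n) chart \<Rightarrow> 'm \<Rightarrow> real^'n^'n) \<Rightarrow> bool" where
  "riemannian_metric A g \<longleftrightarrow>
     (\<forall>c\<in>A. smooth_on (local_rep c (g c)) (snd c ` fst c)) \<and>
     (\<forall>c\<in>A. \<forall>p\<in>fst c. transpose (g c p) = g c p \<and> (\<forall>v. v \<noteq> 0 \<longrightarrow> v \<bullet> (g c p *v v) > 0)) \<and>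
     (\<forall>c\<in>A. \<forall>c'\<in>A. \<forall>p\<in>fst c \<inter> fst c'.
        let J = matrix (frechet_derivative (local_rep c (snd c')) (at (snd c p)))
        in g c p = transpose J ** g c' p ** J)"

definition closed_connected_riemannian_manifold ::
    "'m topology \<Rightarrow> ('m, 'n::finite) chart set \<Rightarrow> (('m, 'n) chart \<Rightarrow> 'm \<Rightarrow> real^'n^'n) \<Rightarrow> bool"
  where
  "closed_connected_riemannian_manifold X A g \<longleftrightarrow>
     Hausdorff_space X \<and> compact_space X \<and> connected_space X \<and>
     smooth_atlas X A \<and> riemannian_metric A g"

text \<open>The following notions are computed in a chosen chart around the point; they do not
  depend on the choice, by the transformation law of the metric.\<close>

text \<open>The components of the gradient: \<open>(\<nabla>u)\<^sup>i = \<Sum>\<^sub>j g\<^sup>i\<^sup>j \<partial>\<^sub>j u\<close>.\<close>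

definition gradient ::
    "(('m, 'n::finite) chart \<Rightarrow> 'm \<Rightarrow> real^'n^'n) \<Rightarrow> ('m, 'n) chart \<Rightarrow> ('m \<Rightarrow> real) \<Rightarrow> 'm \<Rightarrow> real^'n"
  where
  "gradient g c u p = matrix_inv (g c p) *v (\<chi> i. pd i (local_rep c u) (snd c p))"

definition gradient_norm_sq ::
    "('m, 'n::finite) chart set \<Rightarrow> (('m, 'n) chart \<Rightarrow> 'm \<Rightarrow> real^'n^'n) \<Rightarrow> ('m \<Rightarrow> real) \<Rightarrow> 'm \<Rightarrow> real"
  where
  "gradient_norm_sq A g u p =
     (let c = chart_at A p in gradient g c u p \<bullet> (g c p *v gradient g c u p))"

text \<open>\<open>\<Delta>u = div (\<nabla>u) = (1 / sqrt (det g)) \<Sum>\<^sub>i \<partial>\<^sub>i (sqrt (det g) (\<nabla>u)\<^sup>i)\<close>\<close>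

definition laplace_beltrami ::
    "('m, 'n::finite) chart set \<Rightarrow> (('m, 'n) chart \<Rightarrow> 'm \<Rightarrow> real^'n^'n) \<Rightarrow> ('m \<Rightarrow> real) \<Rightarrow> 'm \<Rightarrow> real"
  where
  "laplace_beltrami A g u p =
     (let c = chart_at A p in
       (1 / sqrt (det (g c p))) *
       (\<Sum>i\<in>UNIV. pd i (local_rep c (\<lambda>r. sqrt (det (g c r)) * gradient g c u r $ i)) (snd c p)))"


section \<open>Riemannian distance\<close>

text \<open>In the second clause, \<open>{t. \<gamma> t \<in> fst c}\<close> is relatively open in \<open>{a..b}\<close>, so the
  derivatives are the usual ones, one-sided at \<open>a\<close> and \<open>b\<close>.\<close>

definition C1_curve ::
    "'m topology \<Rightarrow> ('m, 'n::finite) chart set \<Rightarrow> (real \<Rightarrow> 'm) \<Rightarrow> real \<Rightarrow> real \<Rightarrow> bool" where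
  "C1_curve X A \<gamma> a b \<longleftrightarrow> a < b \<and> continuous_map (top_of_set {a..b}) X \<gamma> \<and>
     (\<forall>c\<in>A. (\<forall>t\<in>{a..b}. \<gamma> t \<in> fst c \<longrightarrow> (snd c \<circ> \<gamma>) differentiable (at t within {a..b})) \<and>
        continuous_on {t\<in>{a..b}. \<gamma> t \<in> fst c}
          (\<lambda>t. vector_derivative (snd c \<circ> \<gamma>) (at t within {a..b})))"

definition curve_length ::
    "('m, 'n::finite) chart set \<Rightarrow> (('m, 'n) chart \<Rightarrow> 'm \<Rightarrow> real^'n^'n) \<Rightarrow>
     (real \<Rightarrow> 'm) \<Rightarrow> real \<Rightarrow> real \<Rightarrow> real" where
  "curve_length A g \<gamma> a b =
     integral {a..b} (\<lambda>t. let c = chart_at A (\<gamma> t);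
                              v = vector_derivative (snd c \<circ> \<gamma>) (at t within {a..b})
                          in sqrt (v \<bullet> (g c (\<gamma> t) *v v)))"

text \<open>\<open>pw_C1_path X A g p q L\<close>: there is a piecewise \<open>C\<^sup>1\<close> path (a finite chain of
  \<open>C\<^sup>1\<close> curves) from \<open>p\<close> to \<open>q\<close> of length \<open>L\<close>.\<close>

inductive pw_C1_path ::
    "'m topology \<Rightarrow> ('m, 'n::finite) chart set \<Rightarrow> (('m, 'n) chart \<Rightarrow> 'm \<Rightarrow> real^'n^'n) \<Rightarrow>
     'm \<Rightarrow> 'm \<Rightarrow> real \<Rightarrow> bool"
  for X A g where
  const: "p \<in> topspace X \<Longrightarrow> pw_C1_path X A g p p 0"
| append: "pw_C1_path X A g p (\<gamma> a) L \<Longrightarrow> C1_curve X A \<gamma> a b \<Longrightarrow>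
     pw_C1_path X A g p (\<gamma> b) (L + curve_length A g \<gamma> a b)"

definition riem_dist ::
    "'m topology \<Rightarrow> ('m, 'n::finite) chart set \<Rightarrow> (('m, 'n) chart \<Rightarrow> 'm \<Rightarrow> real^'n^'n) \<Rightarrow>
     'm \<Rightarrow> 'm \<Rightarrow> real" where
  "riem_dist X A g p q = Inf {L. pw_C1_path X A g p q L}"

definition riem_setdist ::
    "'m topology \<Rightarrow> ('m, 'n::finite) chart set \<Rightarrow> (('m, 'n) chart \<Rightarrow> 'm \<Rightarrow> real^'n^'n) \<Rightarrow>
     'm set \<Rightarrow> 'm \<Rightarrow> real" where
  "riem_setdist X A g S x = (INF p\<in>S. riem_dist X A g p x)"


section \<open>Isoparametric functions\<close>

definition isoparametric ::
    "'m topology \<Rightarrow> ('m, 'n::finite) chart set \<Rightarrow> (('m, 'n) chart \<Rightarrow> 'm \<Rightarrow> real^'n^'n) \<Rightarrow>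
     ('m \<Rightarrow> real) \<Rightarrow> real \<Rightarrow> real \<Rightarrow> bool" where
  "isoparametric X A g f t0 t1 \<longleftrightarrow>
     smooth_fun A f \<and> t0 < t1 \<and> f ` topspace X = {t0..t1} \<and>
     (\<exists>a b. smooth_on_interval a t0 t1 \<and> smooth_on_interval b t0 t1 \<and>
        (\<forall>p\<in>topspace X. gradient_norm_sq A g f p = b (f p) \<and> laplace_beltrami A g f p = a (f p)))"

definition level_set :: "'m topology \<Rightarrow> ('m \<Rightarrow> real) \<Rightarrow> real \<Rightarrow> 'm set" where
  "level_set X f t = {p \<in> topspace X. f p = t}"

text \<open>\<open>d + 2 \<le> CARD('n)\<close> says \<open>d \<le> n - 2\<close>.\<close>

definition proper_isoparametric ::
    "'m topology \<Rightarrow> ('m, 'n::finite) chart set \<Rightarrow> (('m, 'n) chart \<Rightarrow> 'm \<Rightarrow> real^'n^'n) \<Rightarrow>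
     ('m \<Rightarrow> real) \<Rightarrow> real \<Rightarrow> real \<Rightarrow> bool" where
  "proper_isoparametric X A g f t0 t1 \<longleftrightarrow> isoparametric X A g f t0 t1 \<and>
     (\<exists>d1 d2. submanifold X A (level_set X f t0) d1 \<and> submanifold X A (level_set X f t1) d2 \<and>
        d1 + 2 \<le> CARD('n) \<and> d2 + 2 \<le> CARD('n))"

definition f_invariant ::
    "'m topology \<Rightarrow> ('m, 'n::finite) chart set \<Rightarrow> (('m, 'n) chart \<Rightarrow> 'm \<Rightarrow> real^'n^'n) \<Rightarrow>
     ('m \<Rightarrow> real) \<Rightarrow> real \<Rightarrow> ('m \<Rightarrow> real) \<Rightarrow> bool" where
  "f_invariant X A g f t0 u \<longleftrightarrow>
     (\<exists>\<phi> :: real \<Rightarrow> real. \<forall>x\<in>topspace X. u x = \<phi> (riem_setdist X A g (level_set X f t0) x))"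


section \<open>Hoelder spaces\<close>

text \<open>The \<open>C\<^sup>2\<^sup>,\<^sup>\<alpha>\<close> norm of \<open>v\<close> on \<open>K\<close>; possibly infinite.\<close>

definition C2a_norm :: "real \<Rightarrow> (real^'n::finite) set \<Rightarrow> (real^'n \<Rightarrow> real) \<Rightarrow> ennreal" where
  "C2a_norm \<alpha> K v =
     (SUP x\<in>K. ennreal \<bar>v x\<bar>) +
     (\<Sum>i\<in>UNIV. SUP x\<in>K. ennreal \<bar>pd i v x\<bar>) +
     (\<Sum>i\<in>UNIV. \<Sum>j\<in>UNIV. SUP x\<in>K. ennreal \<bar>pd i (pd j v) x\<bar>) +
     (\<Sum>i\<in>UNIV. \<Sum>j\<in>UNIV. SUP x\<in>K. SUP y\<in>K - {x}.
        ennreal (\<bar>pd i (pd j v) x - pd i (pd j v) y\<bar> / dist x y powr \<alpha>))"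

definition C2a :: "('m, 'n::finite) chart set \<Rightarrow> real \<Rightarrow> ('m \<Rightarrow> real) set" where
  "C2a A \<alpha> = {u. \<forall>c\<in>A. Ck_on 2 (local_rep c u) (snd c ` fst c) \<and>
      (\<forall>K. compact K \<and> K \<subseteq> snd c ` fst c \<longrightarrow> C2a_norm \<alpha> K (local_rep c u) < \<infinity>)}"

definition C2a_inv ::
    "'m topology \<Rightarrow> ('m, 'n::finite) chart set \<Rightarrow> (('m, 'n) chart \<Rightarrow> 'm \<Rightarrow> real^'n^'n) \<Rightarrow>
     ('m \<Rightarrow> real) \<Rightarrow> real \<Rightarrow> real \<Rightarrow> ('m \<Rightarrow> real) set" where
  "C2a_inv X A g f t0 \<alpha> = {u \<in> C2a A \<alpha>. f_invariant X A g f t0 u}"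

text \<open>Continuity of a curve into \<open>C\<^sup>2\<^sup>,\<^sup>\<alpha>(M)\<close>. On a compact manifold the norms over compact
  subsets of charts generate the usual norm topology: the sum of finitely many of them, for
  compact sets covering the manifold by their interiors, is a \<open>C\<^sup>2\<^sup>,\<^sup>\<alpha>\<close> norm, and it
  dominates all the others.\<close>

definition C2a_continuous ::
    "('m, 'n::finite) chart set \<Rightarrow> real \<Rightarrow> real set \<Rightarrow> (real \<Rightarrow> 'm \<Rightarrow> real) \<Rightarrow> bool" where
  "C2a_continuous A \<alpha> T u \<longleftrightarrow>
     (\<forall>s\<in>T. \<forall>c\<in>A. \<forall>K. compact K \<and> K \<subseteq> snd c ` fst c \<longrightarrow>
        ((\<lambda>t. C2a_norm \<alpha> K (local_rep c (\<lambda>p. u t p - u s p))) \<longlongrightarrow> 0) (at s within T))"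

definition positive_invariant_eigenvalues ::
    "'m topology \<Rightarrow> ('m, 'n::finite) chart set \<Rightarrow> (('m, 'n) chart \<Rightarrow> 'm \<Rightarrow> real^'n^'n) \<Rightarrow>
     ('m \<Rightarrow> real) \<Rightarrow> real \<Rightarrow> real \<Rightarrow> real set" where
  "positive_invariant_eigenvalues X A g f t0 \<alpha> =
     {m. m > 0 \<and> (\<exists>u \<in> C2a_inv X A g f t0 \<alpha>. (\<exists>p\<in>topspace X. u p \<noteq> 0) \<and>
        (\<forall>p\<in>topspace X. - laplace_beltrami A g u p = m * u p))}"

end

theory Submission
  imports Defs "HOL-Analysis.Analysis"
begin

text \<open>
For a function of the form \<open>psi \<circ> f\<close> the two structure equations \<open>|\<nabla>f|\<^sup>2 = b(f)\<close> and
\<open>\<Delta>f = a(f)\<close> give \<open>\<Delta>(psi \<circ> f) = (b psi'' + a psi') \<circ> f\<close> (\<open>laplace_compose\<close>). The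
invariant functions are exactly the functions of this form, because the distance from the focal
set \<open>f = t0\<close> is \<open>F \<circ> f\<close> with \<open>F\<close> the integral of \<open>1 / sqrt b\<close>, which is strictly increasing
(\<open>focal_dist\<close>). The problem thus becomes one for the operator \<open>b psi'' + a psi'\<close> on
\<open>{t0..t1}\<close>.

This operator degenerates at the end points, in a controlled way. A Gronwall argument and the
connectedness of the manifold show that \<open>b\<close> is positive inside the interval and has simple
zeros at its ends (\<open>simple_zeros\<close>). Expanding both structure equations to second order at a
minimum point of \<open>f\<close> shows that \<open>a(t0)\<close> is the trace of the Hessian there and that some direction
contributes \<open>b'(t0) / 2\<close> to it, whence \<open>2 a(t0) \<ge> b'(t0) > 0\<close> (\<open>focal_slope\<close>); the other end
point is treated by passing to \<open>- f\<close>. Consequently, with \<open>p\<close> the integrating factor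
\<open>p' = a p / b\<close>, the weight \<open>p / b\<close> is integrable and \<open>p\<close> vanishes at both ends, so that
\<open>p psi' \<rightarrow> 0\<close> is the natural boundary condition.

A solution of \<open>b psi'' + a psi' = h - \<mu> psi\<close> with this boundary condition at \<open>t0\<close> is determined by
its value there. Hence every eigenvalue is simple, and the inhomogeneous equation is solvable if
and only if \<open>h\<close> is orthogonal to the eigenfunction \<open>w0\<close>, with a bounded inverse
(\<open>bvp_sol_exists\<close>, \<open>bvp_sol_stable\<close>). Write \<open>u = 1 + t w\<close>. The equation
\<open>b u'' + a u' = \<lambda> (u - u powr q)\<close> becomes \<open>b w'' + a w' + \<mu> w = h\<close> with \<open>h\<close> of order \<open>t\<close>, where
\<open>\<lambda>\<close> is determined by the orthogonality of \<open>h\<close> and \<open>w0\<close>. For small \<open>t\<close> this is a fixed point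
equation for a contraction, and its solution \<open>w\<close> starts at \<open>w0\<close> and depends on \<open>t\<close> in a
Lipschitz way (\<open>bifurcation_branch\<close>). This is the bifurcation from a simple eigenvalue.

It remains to pass between the manifold and the interval. An invariant eigenfunction \<open>psi \<circ> f\<close>
gives a solution \<open>psi\<close> of the ordinary differential equation, and the evenness of \<open>f\<close> to second
order at a minimum makes \<open>psi - psi(t0)\<close> small compared with \<open>sqrt (s - t0)\<close>, which implies
the boundary condition (\<open>invariant_small_at_focal\<close>, \<open>flux_vanishes\<close>). Conversely, the solutions on
the interval are three times continuously differentiable up to the end points, continuously in \<open>t\<close>
(\<open>regularity\<close>), and the Hoelder norm of \<open>eta \<circ> f\<close> is bounded by the first three derivatives of
\<open>eta\<close> (\<open>C2a_norm_compose\<close>).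
\<close>

abbreviation (input) tendsto_ascii (infixr "--->" 55) where "tendsto_ascii == tendsto"


section \<open>A differential equation with two singular end points\<close>

text \<open>A comparison test whose majorant may be unbounded: it has to be the derivative of a
function that is continuous up to the end points, as \<open>1 / sqrt (s - l)\<close> is.\<close>

lemma absolutely_integrable_on_dominated_by_derivative:
 fixes h G g :: "real => real"
 assumes lr: "l <= r" and G: "continuous_on {l..r} G"
  and D: "!!s. s \<in> {l<..<r} ==> (G has_real_derivative g s) (at s)"
  and h: "continuous_on {l<..<r} h" and hg: "!!s. s \<in> {l<..<r} ==> \<bar>h s\<bar> <= g s"
 shows "h absolutely_integrable_on {l..r}"
proof -
 have "(g has_integral (G r - G l)) {l..r}" by (rule fundamental_theorem_of_calculus_interior[OF lr G])
   (use D in "auto simp: has_real_derivative_iff_has_vector_derivative")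
 hence "g integrable_on {l<..<r}" using integrable_on_Icc_iff_Ioo by blast
 moreover have "h \<in> borel_measurable (lebesgue_on {l<..<r})" by (rule continuous_imp_measurable_on_sets_lebesgue[OF h]) auto
 ultimately have "h absolutely_integrable_on {l<..<r}"
  by (intro measurable_bounded_by_integrable_imp_absolutely_integrable[of _ _ g])
   (use hg in auto)
 thus ?thesis by (rule absolutely_integrable_spike_set)
   (auto intro: negligible_subset[of "{l,r}"])
qed

lemma tendsto_le_left_end:
 fixes g :: "real => real"
 assumes "l < s" and "!!x. l < x ==> x < s ==> g s <= g x" and "(g ---> L) (at_right l)"
 shows "g s <= L"
proof (rule tendsto_lowerbound[OF assms(3)])
 show "\<forall>\<^sub>F x in at_right l. g s <= g x" using eventually_at_right_field assms(1,2) by blast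
qed auto

lemma has_real_derivative_continuous_on:
 assumes "!!x. x \<in> S ==> (f has_real_derivative f' x) (at x)"
 shows "continuous_on S f" by (meson DERIV_continuous assms continuous_at_imp_continuous_on)

text \<open>The equation is \<open>b y' + a y = k\<close>, where \<open>y\<close> is the
derivative of the unknown function. The integrating factor \<open>p\<close> turns it into
\<open>(p y)' = p k / b\<close>.\<close>

locale singular_ode =
 fixes a b p :: "real => real" and t0 t1 b0 b1 :: real
 assumes t01: "t0 < t1"
  and cont_a: "continuous_on {t0..t1} a" and cont_b: "continuous_on {t0..t1} b"
  and b_pos: "!!s. t0 < s ==> s < t1 ==> 0 < b s"
  and b_t0: "b t0 = 0" and b_t1: "b t1 = 0"
  and b_deriv0: "(b has_real_derivative b0) (at t0 within {t0..t1})" and b0: "0 < b0"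
  and b_deriv1: "(b has_real_derivative - b1) (at t1 within {t0..t1})" and b1: "0 < b1"
  and a_t0: "0 < a t0" and a_t1: "a t1 < 0"
  and p_pos: "!!s. t0 < s ==> s < t1 ==> 0 < p s"
  and p_deriv: "!!s. t0 < s ==> s < t1 ==> (p has_real_derivative p s * a s / b s) (at s)"
begin

text \<open>Reflection exchanges the end points, so that it suffices to study the left
one.\<close>

lemma mirror: "singular_ode (%s. - a (- s)) (%s. b (- s)) (%s. p (- s)) (- t1) (- t0) b1 b0"
proof
 have im: "uminus ` {- t1..- t0} = {t0..t1}" by simp
 have um: "(uminus has_real_derivative - 1) (at x within S)" for x :: real and S by (auto intro!: derivative_eq_intros)
 show "continuous_on {- t1..- t0} (%s. - a (- s))" "continuous_on {- t1..- t0} (%s. b (- s))"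
  by (intro continuous_intros continuous_on_compose2[OF cont_a] continuous_on_compose2[OF cont_b]; force)+
 show "((%s. b (- s)) has_real_derivative b1) (at (- t1) within {- t1..- t0})"
  using DERIV_image_chain[of b "- b1" "uminus" "- t1" "{- t1..- t0}" "-1"] b_deriv1 im um by (simp add: o_def)
 show "((%s. b (- s)) has_real_derivative - b0) (at (- t0) within {- t1..- t0})"
  using DERIV_image_chain[of b "b0" "uminus" "- t0" "{- t1..- t0}" "-1"] b_deriv0 im um by (simp add: o_def)
 show "((%s. p (- s)) has_real_derivative p (- s) * - a (- s) / b (- s)) (at s)"
  if "- t1 < s" "s < - t0" for s
  using that DERIV_chain2[where f = p and g = uminus and x = s and s = UNIV, OF p_deriv[of "-s"] um] by simp
qed (use t01 b_pos b_t0 b_t1 b0 b1 a_t0 a_t1 p_pos in auto)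

text \<open>Both zeros of \<open>b\<close> are simple, so the quotient extends to a continuous
positive function.\<close>

lemma b_quotient_bounds:
 obtains c C where "0 < c" "0 < C"
  "!!s. s \<in> {t0..t1} ==> c * ((s - t0) * (t1 - s)) <= b s & b s <= C * ((s - t0) * (t1 - s))"
proof -
 define B where "B s = (if s = t0 then b0 / (t1 - t0) else if s = t1 then b1 / (t1 - t0)
   else b s / ((s - t0) * (t1 - s)))" for s
 have B_pos: "0 < B s" if "s \<in> {t0..t1}" for s using that t01 b0 b1 b_pos[of s] unfolding B_def by auto
 have lim0: "((%s. (b s - b t0) / (s - t0)) ---> b0) (at t0 within {t0..t1})" using b_deriv0 by (simp add: has_field_derivative_iff)
 have "((%s. (b s - b t0) / (s - t0) / (t1 - s)) ---> b0 / (t1 - t0)) (at t0 within {t0..t1})"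
  by (intro tendsto_intros lim0) (use t01 in auto)
 moreover have "\<forall>\<^sub>F s in at t0 within {t0..t1}. (b s - b t0) / (s - t0) / (t1 - s) = B s"
 proof -
  have "\<forall>\<^sub>F s in at t0 within {t0..t1}. s < t1" by (rule order_tendstoD(2)[OF tendsto_ident_at t01])
  moreover have "\<forall>\<^sub>F s in at t0 within {t0..t1}. s ~= t0" by (auto simp: eventually_at_filter)
  ultimately show ?thesis by eventually_elim (auto simp: B_def b_t0)
 qed
 ultimately have 0: "(B ---> B t0) (at t0 within {t0..t1})" by (auto simp: B_def[of t0] intro: Lim_transform_eventually)
 have lim1: "((%s. (b s - b t1) / (s - t1)) ---> - b1) (at t1 within {t0..t1})"
  using b_deriv1 by (simp add: has_field_derivative_iff)
 have "((%s. - ((b s - b t1) / (s - t1)) / (s - t0)) ---> - (- b1) / (t1 - t0)) (at t1 within {t0..t1})"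
  by (intro tendsto_intros lim1) (use t01 in auto)
 moreover have "\<forall>\<^sub>F s in at t1 within {t0..t1}. - ((b s - b t1) / (s - t1)) / (s - t0) = B s"
 proof -
  have "\<forall>\<^sub>F s in at t1 within {t0..t1}. t0 < s" by (rule order_tendstoD(1)[OF tendsto_ident_at t01])
  moreover have "\<forall>\<^sub>F s in at t1 within {t0..t1}. s ~= t1" by (auto simp: eventually_at_filter)
  ultimately show ?thesis by eventually_elim (auto simp: B_def b_t1 divide_simps, auto simp: algebra_simps)
 qed
 ultimately have 1: "(B ---> B t1) (at t1 within {t0..t1})" using t01 by (auto simp: B_def[of t1] intro: Lim_transform_eventually)
 have 2: "(B ---> B s) (at s within {t0..t1})" if s: "t0 < s" "s < t1" for s
 proof -
  have "((%s. b s / ((s - t0) * (t1 - s))) ---> b s / ((s - t0) * (t1 - s))) (at s within {t0..t1})"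
   by (intro tendsto_intros) (use s cont_b in "auto simp: continuous_on_def")
  moreover have "\<forall>\<^sub>F x in at s within {t0..t1}. b x / ((x - t0) * (t1 - x)) = B x"
  proof -
   have "\<forall>\<^sub>F x in at s within {t0..t1}. t0 < x" "\<forall>\<^sub>F x in at s within {t0..t1}. x < t1"
   using order_tendstoD[OF tendsto_ident_at] s by blast+
   thus ?thesis by eventually_elim (auto simp: B_def)
  qed
  ultimately show ?thesis using s by (auto simp: B_def[of s] intro: Lim_transform_eventually)
 qed
 have cont: "continuous_on {t0..t1} B" unfolding continuous_on_def
 proof
  fix s assume "s \<in> {t0..t1}"
  then consider "s = t0" | "s = t1" | "t0 < s" "s < t1" by force
  thus "(B ---> B s) (at s within {t0..t1})" using 0 1 2 by cases auto
 qed
 obtain x where x: "x \<in> {t0..t1}" "!!s. s \<in> {t0..t1} ==> B x <= B s" using continuous_attains_inf[OF _ _ cont] t01 by auto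
 obtain y where y: "y \<in> {t0..t1}" "!!s. s \<in> {t0..t1} ==> B s <= B y" using continuous_attains_sup[OF _ _ cont] t01 by auto
 have "b s = B s * ((s - t0) * (t1 - s))" if "s \<in> {t0..t1}" for s using that b_t0 b_t1 by (auto simp: B_def)
 moreover have "0 <= (s - t0) * (t1 - s)" if "s \<in> {t0..t1}" for s using that by auto
 ultimately have "B x * ((s - t0) * (t1 - s)) <= b s & b s <= B y * ((s - t0) * (t1 - s))"
  if "s \<in> {t0..t1}" for s using x(2)[OF that] y(2)[OF that] that by (simp add: mult_right_mono)
 thus ?thesis using that[of "B x" "B y"] B_pos x(1) y(1) by blast
qed

lemma a_pos_near_t0:
 obtains s0 \<alpha> where "t0 < s0" "s0 < t1" "0 < \<alpha>" "!!s. t0 <= s ==> s <= s0 ==> \<alpha> <= a s"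
proof -
 have "(a ---> a t0) (at t0 within {t0..t1})" using cont_a t01 by (auto simp: continuous_on_def)
 hence "\<forall>\<^sub>F s in at t0 within {t0..t1}. a t0 / 2 < a s" by (rule order_tendstoD) (use a_t0 in auto)
 then obtain d where d: "d > 0" "!!s. s \<in> {t0..t1} ==> s ~= t0 ==> dist s t0 < d ==> a t0 / 2 < a s"
  unfolding eventually_at by blast
 define s0 where "s0 = min (t0 + d / 2) ((t0 + t1) / 2)"
 have "a t0 / 2 <= a s" if "t0 <= s" "s <= s0" for s
 proof (cases "s = t0")
  case False
  thus ?thesis using that d(1) t01 by (intro less_imp_le[OF d(2)]) (auto simp: s0_def dist_real_def)
 qed (use a_t0 in auto)
 moreover have "t0 < s0" "s0 < t1" using d(1) t01 by (auto simp: s0_def min_less_iff_disj)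
 ultimately show ?thesis using that[of s0 "a t0 / 2"] a_t0 by auto
qed

text \<open>Near \<open>t0\<close> the logarithmic derivative \<open>a / b\<close> of
\<open>p\<close> is at least \<open>e / (s - t0)\<close> for some positive \<open>e\<close>, so
\<open>p\<close> is bounded by a multiple of \<open>(s - t0) powr e\<close>.\<close>

lemma p_tendsto_0: "(p ---> 0) (at_right t0)"
proof -
 obtain c C where C: "0 < C" and bC: "!!s. s \<in> {t0..t1} ==> b s <= C * ((s - t0) * (t1 - s))" using b_quotient_bounds by metis
 obtain s0 \<alpha> where s0: "t0 < s0" "s0 < t1" and \<alpha>: "0 < \<alpha>" "!!s. t0 <= s ==> s <= s0 ==> \<alpha> <= a s"
  using a_pos_near_t0 by metis
 define e where "e = \<alpha> / (C * (t1 - t0))"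
 have e: "0 < e" using \<alpha> C t01 by (simp add: e_def)
 have le: "p s <= p s0 * ((s - t0) / (s0 - t0)) powr e" if s: "t0 < s" "s <= s0" for s
 proof -
  define q where "q x = p x * (x - t0) powr (- e)" for x
  have "EX y. DERIV q x :> y & y \<ge> 0" if x: "s <= x" "x <= s0" for x
  proof -
   have xt: "t0 < x" "x < t1" using x s s0 by auto
   have "DERIV q x :> p x * a x / b x * (x - t0) powr (- e) + p x * (- e * (x - t0) powr (- e - 1))"
   unfolding q_def using xt by (auto intro!: derivative_eq_intros p_deriv)
   moreover have "0 <= p x * a x / b x * (x - t0) powr (- e) + p x * (- e * (x - t0) powr (- e - 1))"
   proof -
   have "b x <= C * ((x - t0) * (t1 - x))" using bC[of x] xt by auto
   also have "... <= C * ((x - t0) * (t1 - t0))" using C xt by (intro mult_left_mono) auto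
   finally have bQ: "b x <= C * ((x - t0) * (t1 - t0))" .
   define Q where "Q = C * ((x - t0) * (t1 - t0))"
   have "0 < Q" using C xt t01 by (simp add: Q_def)
   moreover have "b x * \<alpha> <= Q * a x"
   using \<alpha>(2)[of x] x xt \<alpha>(1) b_pos[of x] bQ \<open>0 < Q\<close> unfolding Q_def[symmetric] by (intro mult_mono) auto
   ultimately have "\<alpha> / Q <= a x / b x" using b_pos[of x] xt by (simp add: field_simps)
   hence "e / (x - t0) <= a x / b x" by (simp only: e_def Q_def divide_divide_eq_left mult.assoc) (simp only: mult.commute[of "x - t0"])
   hence "e / (x - t0) * (p x * (x - t0) powr (- e)) <= a x / b x * (p x * (x - t0) powr (- e))"
   using p_pos[of x] xt by (intro mult_right_mono) auto
   moreover have "(x - t0) powr (- e - 1) = (x - t0) powr (- e) / (x - t0)" using xt by (simp add: powr_diff)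
   ultimately show ?thesis by (simp add: field_simps)
   qed
   ultimately show ?thesis by blast
  qed
  hence "q s <= q s0" by (rule DERIV_nonneg_imp_nondecreasing[OF s(2)])
  hence "p s / (s - t0) powr e <= p s0 / (s0 - t0) powr e" by (simp add: q_def powr_minus_divide)
  moreover have "0 < (s - t0) powr e" using s by simp
  ultimately have "p s <= p s0 / (s0 - t0) powr e * (s - t0) powr e" by (simp add: pos_divide_le_eq)
  thus ?thesis using s s0 by (simp add: powr_divide)
 qed
 have "((%s. p s0 * ((s - t0) / (s0 - t0)) powr e) ---> p s0 * ((t0 - t0) / (s0 - t0)) powr e) (at_right t0)"
  using e s0 by (intro tendsto_intros tendsto_powr') (auto simp: eventually_at_right_field intro!: exI[of _ s0])
 hence up: "((%s. p s0 * ((s - t0) / (s0 - t0)) powr e) ---> 0) (at_right t0)" by simp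
 show ?thesis
 proof (rule tendsto_sandwich[OF _ _ tendsto_const up])
  show "\<forall>\<^sub>F s in at_right t0. 0 <= p s"
   using t01 p_pos by (auto simp: eventually_at_right_field intro!: exI[of _ t1] less_imp_le)
  show "\<forall>\<^sub>F s in at_right t0. p s <= p s0 * ((s - t0) / (s0 - t0)) powr e"
   using s0 le by (auto simp: eventually_at_right_field intro!: exI[of _ s0])
 qed
qed

text \<open>The weight that makes the operator symmetric: \<open>om (b z'' + a z') = (p
z')'\<close>.\<close>

definition om :: "real => real" where "om s = p s / b s"

lemma p_continuous: "continuous_on {t0<..<t1} p"
 by (rule has_real_derivative_continuous_on[OF p_deriv]) auto

lemma om_continuous: "continuous_on {t0<..<t1} om"
 unfolding om_def using b_pos by (intro continuous_intros p_continuous continuous_on_subset[OF cont_b]) force+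

lemma om_pos: "t0 < s ==> s < t1 ==> 0 < om s"
 using b_pos p_pos by (simp add: om_def)

lemma om_nonneg: "t0 <= s ==> s <= t1 ==> 0 <= om s"
 using om_pos[of s] b_t0 b_t1 by (cases "s = t0 | s = t1") (auto simp: om_def)

text \<open>Since \<open>p' = a om\<close> and \<open>a\<close> is bounded below by a positive
constant near \<open>t0\<close>, the function \<open>p\<close> itself controls the integral of
\<open>om\<close>.\<close>

lemma om_integrable_left: "EX s0. t0 < s0 & s0 < t1 & om absolutely_integrable_on {t0..s0}"
proof -
 obtain s0 \<alpha> where s0: "t0 < s0" "s0 < t1" and \<alpha>: "0 < \<alpha>" "!!s. t0 <= s ==> s <= s0 ==> \<alpha> <= a s"
  using a_pos_near_t0 by metis
 define P where "P s = (if s = t0 then 0 else p s / \<alpha>)" for s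
 have "om absolutely_integrable_on {t0..s0}"
 proof (rule absolutely_integrable_on_dominated_by_derivative[of _ _ P "%s. p s * a s / b s / \<alpha>"])
  show "continuous_on {t0..s0} P" unfolding continuous_on_def
  proof
   fix s assume s: "s \<in> {t0..s0}"
   show "(P ---> P s) (at s within {t0..s0})"
   proof (cases "s = t0")
   case True
   have "((%s. p s / \<alpha>) ---> 0 / \<alpha>) (at_right t0)" by (intro tendsto_intros p_tendsto_0) (use \<alpha> in auto)
   hence "((%s. p s / \<alpha>) ---> 0) (at t0 within {t0..s0})" using s0 by (simp add: at_within_Icc_at_right)
   hence "(P ---> 0) (at t0 within {t0..s0})" by (rule Lim_transform_eventually) (auto simp: P_def eventually_at_filter)
   thus ?thesis using True by (simp add: P_def)
   next
   case False
   have "isCont (%s. p s / \<alpha>) s" using p_deriv[of s] s s0 False \<alpha> by (intro continuous_intros DERIV_isCont) auto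
   hence "((%s. p s / \<alpha>) ---> p s / \<alpha>) (at s)" by (simp add: isCont_def)
   hence "((%s. p s / \<alpha>) ---> P s) (at s within {t0..s0})" using False by (simp add: P_def Lim_at_imp_Lim_at_within)
   moreover have "\<forall>\<^sub>F x in at s within {t0..s0}. x ~= t0"
   by (rule eventually_mono[OF order_tendstoD(1)[OF tendsto_ident_at, of t0 s "{t0..s0}"]])
   (use s False in auto)
   ultimately show ?thesis by (rule Lim_transform_eventually[OF _ eventually_mono]) (auto simp: P_def)
   qed
  qed
  show "(P has_real_derivative p s * a s / b s / \<alpha>) (at s)" if "s \<in> {t0<..<s0}" for s
  proof -
   have "((%s. p s / \<alpha>) has_real_derivative p s * a s / b s / \<alpha>) (at s)"
   using DERIV_cdivide[OF p_deriv[of s], of \<alpha>] that s0 by simp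
   thus ?thesis by (rule has_field_derivative_transform_within_open[of _ _ _ "{t0<..<s0}"]) (use that in "auto simp: P_def")
  qed
  show "continuous_on {t0<..<s0} om" by (rule continuous_on_subset[OF om_continuous]) (use s0 in auto)
  show "\<bar>om s\<bar> <= p s * a s / b s / \<alpha>" if "s \<in> {t0<..<s0}" for s
  proof -
   have "p s * \<alpha> <= p s * a s" using that s0 \<alpha>(2)[of s] p_pos[of s] by (intro mult_left_mono) auto
   thus ?thesis using that s0 p_pos[of s] b_pos[of s] \<alpha>(1) by (simp add: om_def field_simps)
  qed
 qed (use s0 in auto)
 thus ?thesis using s0 by blast
qed

end

lemma (in singular_ode) om_integrable: "om absolutely_integrable_on {t0..t1}"
proof -
 obtain s0 where s0: "t0 < s0" "s0 < t1" and i0: "om absolutely_integrable_on {t0..s0}" using om_integrable_left by blast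
 interpret m: singular_ode "%s. - a (- s)" "%s. b (- s)" "%s. p (- s)" "- t1" "- t0" b1 b0 by (rule mirror)
 have mom: "m.om s = om (- s)" for s by (simp add: m.om_def om_def)
 obtain s1 where s1: "- t1 < s1" "s1 < - t0" and i1: "m.om absolutely_integrable_on {- t1..s1}" using m.om_integrable_left by blast
 have i1: "om absolutely_integrable_on {- s1..t1}"
  using i1 absolutely_integrable_reflect_real[of t1 "- s1" om] by (simp add: mom[abs_def])
 have i2: "om absolutely_integrable_on {s0..-s1}"
  by (rule absolutely_integrable_continuous_real, rule continuous_on_subset[OF om_continuous]) (use s0 s1 in auto)
 show ?thesis
 proof (cases "s0 <= - s1")
  case True
  have "om absolutely_integrable_on {t0..-s1}" by (rule absolutely_integrable_on_combine[OF i0 i2]) (use True s0 in auto)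
  thus ?thesis by (rule absolutely_integrable_on_combine[OF _ i1]) (use s0 s1 in auto)
 next
  case False
  have "om absolutely_integrable_on {s0..t1}" by (rule absolutely_integrable_on_subinterval[OF i1]) (use False in auto)
  thus ?thesis by (rule absolutely_integrable_on_combine[OF i0]) (use s0 in auto)
 qed
qed


section \<open>Solutions that are regular at an end point\<close>

context singular_ode
begin

text \<open>The homogeneous solutions are the multiples of \<open>1 / p\<close>, which is
unbounded at \<open>t0\<close>; the limit condition excludes them.\<close>

definition reg_sol :: "(real => real) => (real => real) => real => bool" where
 "reg_sol y k m \<longleftrightarrow>
   (ALL s. t0 < s --> s < m --> (y has_real_derivative (k s - a s * y s) / b s) (at s)) &
   ((%s. p s * y s) ---> 0) (at_right t0)"

lemma reg_solD:
 assumes "reg_sol y k m"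
 shows "t0 < s ==> s < m ==> (y has_real_derivative (k s - a s * y s) / b s) (at s)"
  and "((%s. p s * y s) ---> 0) (at_right t0)" using assms by (auto simp: reg_sol_def)

lemma reg_sol_mono: "reg_sol y k m ==> m' <= m ==> reg_sol y k m'"
 by (auto simp: reg_sol_def)

lemma reg_sol_diff:
 assumes "reg_sol y k m" "reg_sol y' k' m"
 shows "reg_sol (%s. y s - y' s) (%s. k s - k' s) m" unfolding reg_sol_def
proof (intro conjI allI impI)
 fix s assume "t0 < s" "s < m"
 hence "((%s. y s - y' s) has_real_derivative (k s - a s * y s) / b s - (k' s - a s * y' s) / b s) (at s)"
  by (intro DERIV_diff reg_solD(1)[OF assms(1)] reg_solD(1)[OF assms(2)])
 moreover have "(k s - a s * y s) / b s - (k' s - a s * y' s) / b s = (k s - k' s - a s * (y s - y' s)) / b s"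
  by (simp add: diff_divide_distrib right_diff_distrib)
 ultimately show "((%s. y s - y' s) has_real_derivative (k s - k' s - a s * (y s - y' s)) / b s) (at s)" by metis
next
 show "((%s. p s * (y s - y' s)) ---> 0) (at_right t0)"
  using tendsto_diff[OF reg_solD(2)[OF assms(1)] reg_solD(2)[OF assms(2)]] by (simp add: algebra_simps)
qed

lemma reg_sol_cmult:
 assumes "reg_sol y k m"
 shows "reg_sol (%s. c * y s) (%s. c * k s) m" unfolding reg_sol_def
proof (intro conjI allI impI)
 fix s assume "t0 < s" "s < m"
 hence "((%s. c * y s) has_real_derivative c * ((k s - a s * y s) / b s)) (at s)" by (intro DERIV_cmult reg_solD(1)[OF assms])
 thus "((%s. c * y s) has_real_derivative (c * k s - a s * (c * y s)) / b s) (at s)" by (simp add: algebra_simps)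
next
 show "((%s. p s * (c * y s)) ---> 0) (at_right t0)"
  using tendsto_mult_left[OF reg_solD(2)[OF assms], of c] by (simp add: algebra_simps)
qed

text \<open>A maximum principle: \<open>(p (y - S))' = om (k - a S) \<le> 0\<close>, and \<open>p
(y - S)\<close> tends to zero at \<open>t0\<close>.\<close>

lemma reg_sol_le:
 assumes sol: "reg_sol y k m" and m: "m <= t1"
  and le: "!!s. t0 < s ==> s < m ==> k s <= a s * S"
  and s: "t0 < s" "s < m"
 shows "y s <= S"
proof -
 define g where "g x = p x * (y x - S)" for x
 have D: "EX d. DERIV g x :> d & d <= 0" if x: "t0 < x" "x < m" for x
 proof -
  have b: "0 < b x" "0 < p x" using b_pos p_pos x m by auto
  have "DERIV g x :> p x * a x / b x * (y x - S) + ((k x - a x * y x) / b x - 0) * p x"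
   unfolding g_def using x m by (intro DERIV_mult p_deriv DERIV_diff reg_solD(1)[OF sol] DERIV_const) auto
  moreover have "p x * a x / b x * (y x - S) + ((k x - a x * y x) / b x - 0) * p x = p x / b x * (k x - a x * S)"
   using b by (simp add: field_simps)
  moreover have "p x / b x * (k x - a x * S) <= 0" using b le[OF x] by (intro mult_nonneg_nonpos) auto
  ultimately show ?thesis by metis
 qed
 have "((%x. p x * y x - p x * S) ---> 0 - 0 * S) (at_right t0)" by (intro tendsto_intros reg_solD(2)[OF sol] p_tendsto_0)
 hence "(g ---> 0) (at_right t0)" by (simp add: g_def[abs_def] algebra_simps)
 moreover have "g s <= g x" if "t0 < x" "x < s" for x by (rule DERIV_nonpos_imp_nonincreasing) (use that s D in auto)
 ultimately have "g s <= 0" using s by (intro tendsto_le_left_end[of t0 s g 0]) auto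
 thus ?thesis using p_pos[of s] s m by (auto simp: g_def mult_le_0_iff)
qed

lemma reg_sol_ge:
 assumes sol: "reg_sol y k m" and m: "m <= t1"
  and ge: "!!s. t0 < s ==> s < m ==> a s * S <= k s"
  and s: "t0 < s" "s < m"
 shows "S <= y s" using reg_sol_le[OF reg_sol_cmult[OF sol, of "-1"] m, of "- S" s] ge s by auto

text \<open>Constants slightly above and below \<open>k0 / a t0\<close> are barriers near
\<open>t0\<close>.\<close>

lemma reg_sol_tendsto:
 assumes sol: "reg_sol y k m" and m: "t0 < m" "m <= t1" and k: "(k ---> k0) (at_right t0)"
 shows "(y ---> k0 / a t0) (at_right t0)"
proof -
 have a: "(a ---> a t0) (at_right t0)" using cont_a t01 by (simp add: continuous_on_def at_within_Icc_at_right)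
   (metis at_within_Icc_at_right atLeastAtMost_iff order_less_imp_le order_refl)
 have aS: "((%s. k s - a s * S) ---> k0 - a t0 * S) (at_right t0)" for S by (intro tendsto_intros a k)
 show ?thesis
 proof (rule order_tendstoI)
  fix u assume u: "k0 / a t0 < u"
  obtain S where S: "k0 / a t0 < S" "S < u" using dense[OF u] by blast
  have "k0 - a t0 * S < 0" using S(1) a_t0 by (simp add: field_simps)
  hence "\<forall>\<^sub>F s in at_right t0. k s - a s * S < 0" by (rule order_tendstoD(2)[OF aS])
  then obtain d where d: "t0 < d" "!!s. t0 < s ==> s < d ==> k s - a s * S < 0" by (auto simp: eventually_at_right_field)
  have "y s <= S" if "t0 < s" "s < min d m" for s
   by (rule reg_sol_le[OF reg_sol_mono[OF sol, of "min d m"]]) (use that d(2) m in "auto simp: less_imp_le")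
  thus "\<forall>\<^sub>F s in at_right t0. y s < u"
   using d(1) m S(2) by (force simp: eventually_at_right_field intro!: exI[of _ "min d m"])
 next
  fix u assume u: "u < k0 / a t0"
  obtain S where S: "S < k0 / a t0" "u < S" using dense[OF u] by blast
  have "k0 - a t0 * S > 0" using S(1) a_t0 by (simp add: field_simps)
  hence "\<forall>\<^sub>F s in at_right t0. k s - a s * S > 0" by (rule order_tendstoD(1)[OF aS])
  then obtain d where d: "t0 < d" "!!s. t0 < s ==> s < d ==> k s - a s * S > 0" by (auto simp: eventually_at_right_field)
  have "S <= y s" if "t0 < s" "s < min d m" for s
   by (rule reg_sol_ge[OF reg_sol_mono[OF sol, of "min d m"]]) (use that d(2) m in "auto simp: less_imp_le")
  thus "\<forall>\<^sub>F s in at_right t0. u < y s"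
   using d(1) m S(2) by (force simp: eventually_at_right_field intro!: exI[of _ "min d m"])
 qed
qed

text \<open>Near \<open>t0\<close>, where \<open>a\<close> is bounded below, constants are
barriers; on the rest of the interval the equation is regular.\<close>

lemma reg_sol_bound:
 assumes m: "m < t1"
 obtains C where "0 <= C" "!!y k s r eps. reg_sol y k r ==> r <= m ==> t0 < s ==> s < r ==>
   (!!x. t0 < x ==> x <= s ==> \<bar>k x\<bar> <= eps) ==> \<bar>y s\<bar> <= C * eps"
proof -
 obtain s0 \<alpha> where s0: "t0 < s0" "s0 < t1" and \<alpha>: "0 < \<alpha>" "!!s. t0 <= s ==> s <= s0 ==> \<alpha> <= a s"
  using a_pos_near_t0 by metis
 define r1 where "r1 = (t0 + s0) / 2"
 have r1: "t0 < r1" "r1 < s0" "r1 < t1" using s0 by (auto simp: r1_def)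
 have sub: "{r1..max r1 m} <= {t0<..<t1}" using r1 m by auto
 have co: "continuous_on {r1..max r1 m} om" "continuous_on {r1..max r1 m} p"
  by (rule continuous_on_subset[OF om_continuous sub], rule continuous_on_subset[OF p_continuous sub])
 obtain x1 where x1: "x1 \<in> {r1..max r1 m}" "!!x. x \<in> {r1..max r1 m} ==> om x <= om x1"
  using continuous_attains_sup[OF _ _ co(1)] by auto
 obtain x2 where x2: "x2 \<in> {r1..max r1 m}" "!!x. x \<in> {r1..max r1 m} ==> p x2 <= p x"
  using continuous_attains_inf[OF _ _ co(2)] by auto
 have px2: "0 < p x2" and ox1: "0 < om x1" using x1(1) x2(1) sub p_pos om_pos by auto
 define C where "C = 1 / \<alpha> + (p r1 / \<alpha> + om x1 * (t1 - t0)) / p x2"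
 have C1: "1 / \<alpha> <= C" and C0: "0 <= C" using \<alpha> px2 ox1 t01 p_pos[of r1] r1 by (auto simp: C_def)
 have "\<bar>y s\<bar> <= C * eps" if sol: "reg_sol y k r" and r: "r <= m" and s: "t0 < s" "s < r"
  and k: "!!x. t0 < x ==> x <= s ==> \<bar>k x\<bar> <= eps" for y k s r eps
 proof -
  have e0: "0 <= eps" using k[of s] s by auto
  have near: "\<bar>y x\<bar> <= eps / \<alpha>" if x: "t0 < x" "x < s0" "x < s" for x
  proof -
   have k': "\<bar>k z\<bar> <= a z * (eps / \<alpha>)" if "t0 < z" "z < min s s0" for z
   proof -
   have "\<bar>k z\<bar> <= \<alpha> * (eps / \<alpha>)" using k[of z] that \<alpha>(1) by auto
   also have "... <= a z * (eps / \<alpha>)" using \<alpha>(1) \<alpha>(2)[of z] that e0 by (intro mult_right_mono) auto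
   finally show ?thesis .
   qed
   have sol': "reg_sol y k (min s s0)" by (rule reg_sol_mono[OF sol]) (use s in auto)
   have "y x <= eps / \<alpha>" by (rule reg_sol_le[OF sol']) (use x s0 s k' in "auto simp: abs_le_iff")
   moreover have "- (eps / \<alpha>) <= y x" by (rule reg_sol_ge[OF sol']) (use x s0 s k' in "auto simp: abs_le_iff minus_le_iff")
   ultimately show ?thesis by auto
  qed
  have ct: "isCont y s" by (rule DERIV_isCont[OF reg_solD(1)[OF sol s]])
  show ?thesis
  proof (cases "s < s0")
   case True
   have "\<bar>y s\<bar> <= eps / \<alpha>"
   proof (rule tendsto_upperbound)
   show "((%x. \<bar>y x\<bar>) ---> \<bar>y s\<bar>) (at_left s)"
   using ct by (intro tendsto_rabs) (simp add: isCont_def filterlim_at_split)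
   show "\<forall>\<^sub>F x in at_left s. \<bar>y x\<bar> <= eps / \<alpha>"
   using near s True by (auto simp: eventually_at_left_field intro!: exI[of _ t0])
   qed auto
   also have "... <= C * eps" using C1 e0 mult_right_mono[OF C1 e0] by simp
   finally show ?thesis .
  next
   case False
   have s': "r1 < s" using False r1 by auto
   define g where "g x = p x * y x" for x
   have D: "DERIV g x :> om x * k x" if x: "t0 < x" "x <= s" for x
   proof -
   have b: "0 < b x" "0 < p x" using b_pos p_pos x m s r by auto
   have "DERIV g x :> p x * a x / b x * y x + (k x - a x * y x) / b x * p x"
   unfolding g_def using x m s r by (intro DERIV_mult p_deriv reg_solD(1)[OF sol]) auto
   moreover have "p x * a x / b x * y x + (k x - a x * y x) / b x * p x = om x * k x" using b by (simp add: field_simps om_def)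
   ultimately show ?thesis by metis
   qed
   obtain z where z: "r1 < z" "z < s" "g s - g r1 = (s - r1) * (om z * k z)" using MVT2[OF s', of g "%x. om x * k x"] D r1 by auto
   have "\<bar>g s\<bar> <= \<bar>g r1\<bar> + \<bar>(s - r1) * (om z * k z)\<bar>" using z by linarith
   also have "\<bar>g r1\<bar> <= p r1 * (eps / \<alpha>)"
   using mult_left_mono[OF near[of r1], of "p r1"] r1 s' p_pos[of r1] by (simp add: g_def abs_mult)
   also have "\<bar>(s - r1) * (om z * k z)\<bar> <= (t1 - t0) * (om x1 * eps)"
   unfolding abs_mult using k[of z] z r1 s r m x1(2)[of z] om_pos[of z] ox1 by (intro mult_mono) auto
   finally have "\<bar>g s\<bar> <= (p r1 / \<alpha> + om x1 * (t1 - t0)) * eps" by (simp add: algebra_simps)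
   moreover have "p x2 * \<bar>y s\<bar> <= \<bar>g s\<bar>"
   using x2(2)[of s] s s' r px2 by (auto simp: g_def abs_mult intro!: mult_right_mono)
   ultimately have "\<bar>y s\<bar> <= (p r1 / \<alpha> + om x1 * (t1 - t0)) * eps / p x2" using px2 by (simp add: field_simps)
   also have "... <= C * eps" using e0 \<alpha>(1) by (simp add: C_def algebra_simps add_divide_distrib)
   finally show ?thesis .
  qed
 qed
 thus ?thesis using that[of C] C0 by blast
qed

lemma om_mult_integrable:
 assumes "continuous_on {t0..t1} h"
 shows "(%s. om s * h s) absolutely_integrable_on {t0..t1}"
proof -
 have "(%s. h s * om s) absolutely_integrable_on {t0..t1}"
 proof (rule absolutely_integrable_bounded_measurable_product_real[OF _ _ _ om_integrable])
  show "h \<in> borel_measurable (lebesgue_on {t0..t1})" by (rule continuous_imp_measurable_on_sets_lebesgue[OF assms]) auto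
  show "bounded (h ` {t0..t1})" using compact_continuous_image[OF assms] by (simp add: compact_imp_bounded)
 qed auto
 thus ?thesis by (simp add: mult.commute)
qed

lemma om_mult_integrable_left:
 assumes k: "continuous_on {t0..m} k" and m: "t0 <= m" "m <= t1"
 shows "(%s. om s * k s) integrable_on {t0..m}"
proof -
 have "(%s. k s * om s) absolutely_integrable_on {t0..m}"
 proof (rule absolutely_integrable_bounded_measurable_product_real)
  show "k \<in> borel_measurable (lebesgue_on {t0..m})" by (rule continuous_imp_measurable_on_sets_lebesgue[OF k]) auto
  show "bounded (k ` {t0..m})" using compact_continuous_image[OF k] by (simp add: compact_imp_bounded)
  show "om absolutely_integrable_on {t0..m}" by (rule absolutely_integrable_on_subinterval[OF om_integrable]) (use m in auto)
 qed auto
 thus ?thesis by (auto dest: set_lebesgue_integral_eq_integral(1) simp: mult.commute)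
qed

text \<open>The solution is \<open>1 / p\<close> times the integral of \<open>om k\<close> from
\<open>t0\<close>.\<close>

lemma reg_sol_exists:
 assumes k: "continuous_on {t0..m} k" and m: "t0 < m" "m <= t1"
 shows "EX y. reg_sol y k m"
proof -
 define I where "I s = integral {t0..s} (%s. om s * k s)" for s
 have int: "(%s. om s * k s) integrable_on {t0..m}" using om_mult_integrable_left[OF k] m by auto
 have DI: "(I has_real_derivative om s * k s) (at s)" if s: "t0 < s" "s < m" for s
 proof -
  have "isCont (%s. om s * k s) s"
  proof (rule continuous_on_interior[of "{t0<..<m}"])
   show "continuous_on {t0<..<m} (%s. om s * k s)"
   by (intro continuous_intros continuous_on_subset[OF om_continuous] continuous_on_subset[OF k])
   (use m in auto)
   show "s \<in> interior {t0<..<m}" using s by (simp add: interior_open)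
  qed
  hence "((%u. integral {t0..u} (%s. om s * k s)) has_vector_derivative om s * k s) (at s within ({t0..m} - {}))"
   using s by (intro integral_has_vector_derivative_continuous_at[OF int]) (auto intro: continuous_at_imp_continuous_at_within)
  moreover have "at s within {t0..m} = at s" using s by (simp add: at_within_Icc_at)
  ultimately show ?thesis by (simp add: I_def[abs_def] has_real_derivative_iff_has_vector_derivative)
 qed
 have I0: "(I ---> 0) (at_right t0)"
 proof -
  have "continuous_on {t0..m} I" unfolding I_def by (rule indefinite_integral_continuous_1[OF int])
  hence "(I ---> I t0) (at t0 within {t0..m})" using m by (auto simp: continuous_on_def)
  thus ?thesis using m by (simp add: at_within_Icc_at_right I_def)
 qed
 have "reg_sol (%s. I s / p s) k m" unfolding reg_sol_def
 proof (intro conjI allI impI)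
  fix s assume s: "t0 < s" "s < m"
  have b: "0 < b s" "0 < p s" using b_pos p_pos s m by auto
  have "((%s. I s / p s) has_real_derivative (om s * k s * p s - I s * (p s * a s / b s)) / (p s * p s)) (at s)"
   by (rule DERIV_divide[OF DI p_deriv]) (use s m b in auto)
  moreover have "(om s * k s * p s - I s * (p s * a s / b s)) / (p s * p s) = (k s - a s * (I s / p s)) / b s"
   using b by (simp add: om_def field_simps)
  ultimately show "((%s. I s / p s) has_real_derivative (k s - a s * (I s / p s)) / b s) (at s)" by metis
 next
  have "\<forall>\<^sub>F s in at_right t0. I s = p s * (I s / p s)"
   using t01 p_pos by (force simp: eventually_at_right_field intro!: exI[of _ t1])
  thus "((%s. p s * (I s / p s)) ---> 0) (at_right t0)" by (rule Lim_transform_eventually[OF I0])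
 qed
 thus ?thesis by blast
qed

end


section \<open>The initial value problem at a singular end point\<close>

text \<open>Picard iteration in a weighted supremum norm. The predicate \<open>P\<close>,
preserved by the map and by uniform limits, stands for the complete set of functions on which the
map acts.\<close>

lemma weighted_contraction_fixpoint:
 fixes Phi :: "('a => real) => 'a => real"
 assumes P0: "P w0" and PPhi: "!!w. P w ==> P (Phi w)"
  and closed: "!!v w. (!!n::nat. P (v n)) ==> uniform_limit S v w sequentially ==> P w"
  and contr: "!!w w' e s. P w ==> P w' ==> (!!s. s \<in> S ==> \<bar>w s - w' s\<bar> <= e * W s) ==> s \<in> S ==>
   \<bar>Phi w s - Phi w' s\<bar> <= c * e * W s"
  and c: "0 <= c" "c < 1" and W: "!!s. s \<in> S ==> 0 <= W s & W s <= Wm"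
  and e0: "0 <= e0" "!!s. s \<in> S ==> \<bar>Phi w0 s - w0 s\<bar> <= e0 * W s"
 shows "EX w. P w & (\<forall>s\<in>S. Phi w s = w s)"
proof -
 define v where "v n = (Phi ^^ n) w0" for n
 have Pv: "P (v n)" for n by (induction n) (auto simp: v_def P0 PPhi)
 have vS: "v (Suc n) = Phi (v n)" for n by (simp add: v_def)
 have d: "\<forall>s\<in>S. \<bar>v (Suc n) s - v n s\<bar> <= c ^ n * e0 * W s" for n
 proof (induction n)
  case 0 thus ?case using e0 by (simp add: v_def)
 next
  case (Suc n)
  thus ?case using contr[OF Pv Pv, of "Suc n" n "c ^ n * e0"] by (auto simp: vS mult.assoc)
 qed
 have ul: "uniform_limit S (%n s. \<Sum>i<n. v (Suc i) s - v i s) (%s. \<Sum>i. v (Suc i) s - v i s) sequentially"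
 proof (rule Weierstrass_m_test[of _ _ "%n. c ^ n * e0 * Wm"])
  show "norm (v (Suc n) s - v n s) <= c ^ n * e0 * Wm" if "s \<in> S" for n s
   using d[of n] that W[OF that] c e0(1) mult_left_mono[of "W s" Wm "c ^ n * e0"] by fastforce
  show "summable (%n. c ^ n * e0 * Wm)" using c by (intro summable_mult2 summable_geometric) auto
 qed
 define w where "w s = w0 s + (\<Sum>i. v (Suc i) s - v i s)" for s
 have tel: "(\<Sum>i<n. v (Suc i) s - v i s) = v n s - w0 s" for n s by (subst sum_lessThan_telescope) (simp add: v_def)
 have "uniform_limit S (%n s. w0 s + (\<Sum>i<n. v (Suc i) s - v i s)) w sequentially"
  unfolding w_def by (intro uniform_limit_intros ul)
 hence uv: "uniform_limit S v w sequentially" by (simp add: tel)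
 have Pw: "P w" by (rule closed[OF Pv uv])
 have dist: "\<bar>v (n + m) s - v n s\<bar> <= c ^ n * e0 * W s * (1 - c ^ m) / (1 - c)" if "s \<in> S" for n m s
 proof (induction m)
  case (Suc m)
  have "\<bar>v (n + Suc m) s - v n s\<bar> <= \<bar>v (n + m) s - v n s\<bar> + \<bar>v (Suc (n + m)) s - v (n + m) s\<bar>" by simp
  also have "... <= c ^ n * e0 * W s * (1 - c ^ m) / (1 - c) + c ^ (n + m) * e0 * W s"
   using Suc d[of "n + m"] that by (intro add_mono) auto
  also have "... = c ^ n * e0 * W s * (1 - c ^ Suc m) / (1 - c)" using c by (simp add: field_simps power_add)
  finally show ?case .
 qed simp
 define K where "K = e0 / (1 - c)"
 have K0: "0 <= K" using e0 c by (simp add: K_def)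
 have near: "\<bar>w s - v n s\<bar> <= c ^ n * K * W s" if s: "s \<in> S" for n s
 proof (rule tendsto_upperbound)
  have "(%m. v m s) \<longlonglongrightarrow> w s" by (rule tendsto_uniform_limitI[OF uv s])
  hence "(%m. v (n + m) s) \<longlonglongrightarrow> w s" using LIMSEQ_ignore_initial_segment[of "%m. v m s" "w s" n]
   by (simp add: add.commute)
  thus "(%m. \<bar>v (n + m) s - v n s\<bar>) \<longlonglongrightarrow> \<bar>w s - v n s\<bar>" by (intro tendsto_intros)
  have "\<bar>v (n + m) s - v n s\<bar> <= c ^ n * K * W s" for m
  proof -
   have "0 <= c ^ n * e0 * W s" using c e0 W[OF s] by auto
   hence "c ^ n * e0 * W s * (1 - c ^ m) <= c ^ n * e0 * W s * 1" using c by (intro mult_left_mono) auto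
   hence "c ^ n * e0 * W s * (1 - c ^ m) / (1 - c) <= c ^ n * e0 * W s * 1 / (1 - c)" using c by (intro divide_right_mono) auto
   thus ?thesis using dist[OF s, of n m] by (simp add: K_def)
  qed
  thus "\<forall>\<^sub>F m in sequentially. \<bar>v (n + m) s - v n s\<bar> <= c ^ n * K * W s" by simp
 qed simp
 have "Phi w s = w s" if s: "s \<in> S" for s
 proof -
  have le: "\<bar>Phi w s - w s\<bar> <= c ^ n * (2 * K * W s)" for n
  proof -
   have "\<bar>Phi w s - Phi (v n) s\<bar> <= c * (c ^ n * K) * W s" by (rule contr[OF Pw Pv near s])
   hence "\<bar>Phi w s - v (Suc n) s\<bar> <= c ^ Suc n * K * W s" by (simp add: vS mult.assoc)
   hence "\<bar>Phi w s - w s\<bar> <= 2 * (c ^ Suc n * K * W s)" using near[OF s, of "Suc n"] by linarith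
   also have "c ^ Suc n * K * W s <= c ^ n * K * W s"
   using K0 W[OF s] c power_decreasing[of n "Suc n" c] by (intro mult_right_mono) auto
   finally show ?thesis by (simp add: algebra_simps)
  qed
  have "(%n. c ^ n * (2 * K * W s)) \<longlonglongrightarrow> 0 * (2 * K * W s)" by (intro tendsto_intros LIMSEQ_realpow_zero c)
  hence "\<bar>Phi w s - w s\<bar> <= 0" using le by (intro LIMSEQ_le_const[of _ 0]) auto
  thus ?thesis by simp
 qed
 thus ?thesis using Pw by blast
qed

lemma abs_le_of_abs_deriv_le:
 fixes z G :: "real => real"
 assumes ls: "l <= s" and z: "continuous_on {l..s} z" and G: "continuous_on {l..s} G"
  and Dz: "!!x. l < x ==> x < s ==> (z has_real_derivative z' x) (at x)"
  and DG: "!!x. l < x ==> x < s ==> (G has_real_derivative G' x) (at x)"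
  and le: "!!x. l < x ==> x < s ==> \<bar>z' x\<bar> <= G' x"
 shows "\<bar>z s - z l\<bar> <= G s - G l"
proof -
 have "(%x. G x - z x) l <= (%x. G x - z x) s"
 proof (rule DERIV_nonneg_imp_increasing_open[OF ls])
  show "EX y. ((%x. G x - z x) has_real_derivative y) (at x) & 0 <= y" if "l < x" "x < s" for x
   using DERIV_diff[OF DG[OF that] Dz[OF that]] le[OF that] by fastforce
 qed (intro continuous_intros z G)
 moreover have "(%x. G x + z x) l <= (%x. G x + z x) s"
 proof (rule DERIV_nonneg_imp_increasing_open[OF ls])
  show "EX y. ((%x. G x + z x) has_real_derivative y) (at x) & 0 <= y" if "l < x" "x < s" for x
   using DERIV_add[OF DG[OF that] Dz[OF that]] le[OF that] by fastforce
 qed (intro continuous_intros z G)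
 ultimately show ?thesis by auto
qed

context singular_ode
begin

lemma reg_sol_cong:
 assumes "reg_sol y k m" "!!s. t0 < s ==> s < m ==> k s = k' s"
 shows "reg_sol y k' m" using assms unfolding reg_sol_def by metis

text \<open>In terms of \<open>z\<close>, with \<open>y = z'\<close>, the equation is \<open>b z''
+ a z' = k\<close>.\<close>

definition prim_sol :: "(real => real) => (real => real) => (real => real) => real => bool" where
 "prim_sol z y k m \<longleftrightarrow> continuous_on {t0..m} z &
   (ALL s. t0 < s --> s < m --> (z has_real_derivative y s) (at s)) & reg_sol y k m"

lemma prim_solD:
 assumes "prim_sol z y k m"
 shows "continuous_on {t0..m} z"
  "t0 < s ==> s < m ==> (z has_real_derivative y s) (at s)" "reg_sol y k m" using assms by (auto simp: prim_sol_def)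

lemma prim_sol_diff:
 assumes "prim_sol z y k m" "prim_sol z' y' k' m"
 shows "prim_sol (%s. z s - z' s) (%s. y s - y' s) (%s. k s - k' s) m"
 using prim_solD[OF assms(1)] prim_solD[OF assms(2)] unfolding prim_sol_def
 by (auto intro!: continuous_intros derivative_intros reg_sol_diff)

lemma prim_sol_cmult:
 assumes "prim_sol z y k m"
 shows "prim_sol (%s. c * z s) (%s. c * y s) (%s. c * k s) m" using prim_solD[OF assms(1)] unfolding prim_sol_def
 by (auto intro!: continuous_intros DERIV_cmult reg_sol_cmult)

lemma prim_sol_exists:
 assumes k: "continuous_on {t0..m} k" and m: "t0 < m" "m < t1"
 shows "EX z y. prim_sol z y k m & z t0 = 0"
proof -
 define k' where "k' s = k (min s m)" for s
 have k': "continuous_on {t0..t1} k'" unfolding k'_def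
  by (rule continuous_on_compose2[OF k]) (auto intro!: continuous_intros simp: m less_imp_le)
 obtain y where y: "reg_sol y k' t1" using reg_sol_exists[OF k'] t01 by auto
 define Y where "Y s = (if s = t0 then k t0 / a t0 else y s)" for s
 have "(k' ---> k' t0) (at t0 within {t0..t1})" using k' t01 by (auto simp: continuous_on_def)
 hence "(k' ---> k t0) (at_right t0)" using m by (simp add: at_within_Icc_at_right t01 k'_def)
 from reg_sol_tendsto[OF y t01 order_refl this]
 have lim: "(y ---> k t0 / a t0) (at_right t0)" .
 have Ycont: "continuous_on {t0..m} Y" unfolding continuous_on_def
 proof
  fix s assume s: "s \<in> {t0..m}"
  show "(Y ---> Y s) (at s within {t0..m})"
  proof (cases "s = t0")
   case True
   have "(y ---> k t0 / a t0) (at t0 within {t0..m})" using lim m by (simp add: at_within_Icc_at_right)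
   hence "(Y ---> k t0 / a t0) (at t0 within {t0..m})" by (rule Lim_transform_eventually) (auto simp: Y_def eventually_at_filter)
   thus ?thesis using True by (simp add: Y_def)
  next
   case False
   have "isCont y s" using reg_solD(1)[OF y, of s] s False m by (intro DERIV_isCont) auto
   hence "(y ---> Y s) (at s within {t0..m})" using False by (simp add: Y_def isCont_def Lim_at_imp_Lim_at_within)
   moreover have "\<forall>\<^sub>F x in at s within {t0..m}. x ~= t0"
   by (rule eventually_mono[OF order_tendstoD(1)[OF tendsto_ident_at, of t0 s "{t0..m}"]])
   (use s False in auto)
   ultimately show ?thesis by (rule Lim_transform_eventually[OF _ eventually_mono]) (auto simp: Y_def)
  qed
 qed
 define z where "z s = integral {t0..s} Y" for s
 have Dz: "(z has_real_derivative Y s) (at s within {t0..m})" if "s \<in> {t0..m}" for s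
  unfolding z_def by (rule integral_has_real_derivative[OF Ycont that])
 have "prim_sol z y k m" unfolding prim_sol_def
 proof (intro conjI allI impI)
  show "continuous_on {t0..m} z" using Dz by (meson DERIV_continuous_on)
  show "(z has_real_derivative y s) (at s)" if "t0 < s" "s < m" for s using Dz[of s] that by (simp add: at_within_Icc_at Y_def)
  show "reg_sol y k m" by (rule reg_sol_cong[OF reg_sol_mono[OF y]]) (use m in "auto simp: k'_def")
 qed
 thus ?thesis by (auto simp: z_def)
qed

text \<open>The weight \<open>exp (M (s - t0))\<close> is that of Bielecki's norm: its integral is
smaller than the weight by the factor \<open>1 / M\<close>.\<close>

lemma prim_sol_step_bound:
 assumes m: "m < t1"
 obtains C where "0 <= C" "!!z y k s eps kap M. prim_sol z y k m ==> z t0 = 0 ==> 0 < M ==> 0 <= kap ==>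
   (!!x. t0 < x ==> x < m ==> \<bar>k x\<bar> <= eps + kap * exp (M * (x - t0))) ==> s \<in> {t0..m} ==>
   \<bar>z s\<bar> <= C * eps * (s - t0) + C * kap / M * exp (M * (s - t0))"
proof -
 obtain C where C: "0 <= C" "!!y k s r eps. reg_sol y k r ==> r <= m ==> t0 < s ==> s < r ==>
   (!!x. t0 < x ==> x <= s ==> \<bar>k x\<bar> <= eps) ==> \<bar>y s\<bar> <= C * eps" using reg_sol_bound[OF m] by metis
 have "\<bar>z s\<bar> <= C * eps * (s - t0) + C * kap / M * exp (M * (s - t0))"
  if sol: "prim_sol z y k m" "z t0 = 0" and M: "0 < M" "0 <= kap"
  and k: "!!x. t0 < x ==> x < m ==> \<bar>k x\<bar> <= eps + kap * exp (M * (x - t0))" and s: "s \<in> {t0..m}"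
  for z y k s eps kap M
 proof -
  define G where "G x = C * eps * (x - t0) + C * kap / M * exp (M * (x - t0))" for x
  have "\<bar>z s - z t0\<bar> <= G s - G t0"
  proof (rule abs_le_of_abs_deriv_le[where z' = y and G' = "%x. C * (eps + kap * exp (M * (x - t0)))"])
   show "continuous_on {t0..s} z" by (rule continuous_on_subset[OF prim_solD(1)[OF sol(1)]]) (use s in auto)
   show "continuous_on {t0..s} G" unfolding G_def by (intro continuous_intros)
   show "(z has_real_derivative y x) (at x)" if "t0 < x" "x < s" for x using prim_solD(2)[OF sol(1)] that s by auto
   show "(G has_real_derivative C * (eps + kap * exp (M * (x - t0)))) (at x)" for x
   unfolding G_def using M by (auto intro!: derivative_eq_intros simp: algebra_simps)
   show "\<bar>y x\<bar> <= C * (eps + kap * exp (M * (x - t0)))" if x: "t0 < x" "x < s" for x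
   proof (rule C(2)[OF prim_solD(3)[OF sol(1)] order_refl])
   show "\<bar>k z\<bar> <= eps + kap * exp (M * (x - t0))" if "t0 < z" "z <= x" for z
   proof -
   have "kap * exp (M * (z - t0)) <= kap * exp (M * (x - t0))" using M that by (intro mult_left_mono) auto
   thus ?thesis using k[of z] that x s by auto
   qed
   qed (use x s in auto)
  qed (use s in auto)
  moreover have "0 <= G t0" using C(1) M by (simp add: G_def)
  ultimately show ?thesis using sol(2) by (simp add: G_def)
 qed
 thus ?thesis using that[of C] C(1) by blast
qed

lemma prim_sol_stable:
 assumes m: "t0 < m" "m < t1" and \<mu>: "0 <= \<mu>"
 obtains C where "0 <= C" "!!z y k s eps. prim_sol z y k m ==> z t0 = 0 ==>
   (!!x. t0 < x ==> x < m ==> \<bar>k x\<bar> <= eps + \<mu> * \<bar>z x\<bar>) ==> s \<in> {t0..m} ==> \<bar>z s\<bar> <= C * eps"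
proof -
 obtain C where C: "0 <= C" "!!z y k s eps kap M. prim_sol z y k m ==> z t0 = 0 ==> 0 < M ==> 0 <= kap ==>
   (!!x. t0 < x ==> x < m ==> \<bar>k x\<bar> <= eps + kap * exp (M * (x - t0))) ==> s \<in> {t0..m} ==>
   \<bar>z s\<bar> <= C * eps * (s - t0) + C * kap / M * exp (M * (s - t0))" using prim_sol_step_bound[OF m(2)] by metis
 define M where "M = 2 * C * \<mu> + 1"
 have M: "0 < M" using C \<mu> by (simp add: M_def add_nonneg_pos)
 have half: "C * \<mu> / M <= 1 / 2" using M C \<mu> by (simp add: M_def field_simps)
 define K where "K = 2 * C * (t1 - t0) * exp (M * (t1 - t0))"
 have "\<bar>z s\<bar> <= K * eps" if sol: "prim_sol z y k m" "z t0 = 0"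
  and k: "!!x. t0 < x ==> x < m ==> \<bar>k x\<bar> <= eps + \<mu> * \<bar>z x\<bar>" and s: "s \<in> {t0..m}" for z y k s eps
 proof -
  have "continuous_on {t0..m} (%s. \<bar>z s\<bar> * exp (- M * (s - t0)))" by (intro continuous_intros prim_solD(1)[OF sol(1)])
  then obtain x0 where x0: "x0 \<in> {t0..m}"
   "!!x. x \<in> {t0..m} ==> \<bar>z x\<bar> * exp (- M * (x - t0)) <= \<bar>z x0\<bar> * exp (- M * (x0 - t0))"
   using continuous_attains_sup[of "{t0..m}" "%s. \<bar>z s\<bar> * exp (- M * (s - t0))"] m by auto
  define eta where "eta = \<bar>z x0\<bar> * exp (- M * (x0 - t0))"
  have zeta: "\<bar>z x\<bar> <= eta * exp (M * (x - t0))" if "x \<in> {t0..m}" for x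
  proof -
   have "\<bar>z x\<bar> = \<bar>z x\<bar> * exp (- M * (x - t0)) * exp (M * (x - t0))" by (simp add: mult.assoc flip: exp_add)
   also have "... <= eta * exp (M * (x - t0))" unfolding eta_def using x0(2)[OF that] by (intro mult_right_mono) auto
   finally show ?thesis .
  qed
  have eta0: "0 <= eta" by (simp add: eta_def)
  have z0: "\<bar>z x0\<bar> = eta * exp (M * (x0 - t0))" by (simp add: eta_def mult.assoc flip: exp_add)
  have k': "\<bar>k x\<bar> <= eps + (\<mu> * eta) * exp (M * (x - t0))" if "t0 < x" "x < m" for x
   using k[OF that] mult_left_mono[OF zeta[of x] \<mu>] that by (simp add: mult.assoc)
  have "\<bar>z x0\<bar> <= C * eps * (x0 - t0) + C * (\<mu> * eta) / M * exp (M * (x0 - t0))"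
   by (rule C(2)[OF sol M _ k' x0(1)]) (use \<mu> eta0 in auto)
  moreover have "C * (\<mu> * eta) / M * exp (M * (x0 - t0)) <= 1 / 2 * (eta * exp (M * (x0 - t0)))"
   using mult_right_mono[OF half, of "eta * exp (M * (x0 - t0))"] eta0 by (simp add: mult_ac)
  ultimately have 1: "\<bar>z x0\<bar> <= 2 * (C * eps * (x0 - t0))" using z0 by linarith
  have eps0: "0 <= C * eps"
  proof (cases "x0 = t0")
   case True
   hence "eta = 0" using sol(2) by (simp add: eta_def)
   hence "0 <= eps" using k'[of "(t0 + m) / 2"] m by auto
   thus ?thesis using C(1) by simp
  next
   case False
   hence "0 < x0 - t0" using x0(1) by auto
   moreover have "0 <= C * eps * (x0 - t0)" using 1 by linarith
   ultimately show ?thesis by (simp add: zero_le_mult_iff)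
  qed
  have "eta <= \<bar>z x0\<bar> * 1" unfolding eta_def using M x0(1) by (intro mult_left_mono) auto
  also have "... <= 2 * (C * eps * (t1 - t0))" using 1 mult_left_mono[of "x0 - t0" "t1 - t0" "C * eps"] eps0 x0(1) m by simp
  finally have eta': "eta <= 2 * (C * eps * (t1 - t0))" .
  have "\<bar>z s\<bar> <= eta * exp (M * (s - t0))" by (rule zeta[OF s])
  also have "... <= 2 * (C * eps * (t1 - t0)) * exp (M * (t1 - t0))" using eta' eta0 s m M eps0 t01 by (intro mult_mono) auto
  finally show ?thesis by (simp add: K_def mult_ac)
 qed
 moreover have "0 <= K" using C(1) t01 by (simp add: K_def)
 ultimately show ?thesis using that[of K] by blast
qed

text \<open>For a large weight parameter the Volterra operator is a contraction in Bielecki's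
norm.\<close>

lemma ivp_exists:
 assumes h: "continuous_on {t0..m} h" and m: "t0 < m" "m < t1" and \<mu>: "0 <= \<mu>"
 shows "EX z y. prim_sol z y (%s. h s - \<mu> * z s) m & z t0 = 0"
proof -
 obtain C where C: "0 <= C" "!!z y k s eps kap M. prim_sol z y k m ==> z t0 = 0 ==> 0 < M ==> 0 <= kap ==>
   (!!x. t0 < x ==> x < m ==> \<bar>k x\<bar> <= eps + kap * exp (M * (x - t0))) ==> s \<in> {t0..m} ==>
   \<bar>z s\<bar> <= C * eps * (s - t0) + C * kap / M * exp (M * (s - t0))" using prim_sol_step_bound[OF m(2)] by metis
 define M where "M = 2 * C * \<mu> + 1"
 have M: "0 < M" using C \<mu> by (simp add: M_def add_nonneg_pos)
 have half: "C * \<mu> / M <= 1 / 2" using M C \<mu> by (simp add: M_def field_simps)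
 have ex: "EX z. continuous_on {t0..m} w --> (EX y. prim_sol z y (%s. h s - \<mu> * w s) m) & z t0 = 0" for w
  using prim_sol_exists[of m "%s. h s - \<mu> * w s"] m h by (fastforce intro!: continuous_intros)
 obtain Phi where Phi: "!!w. continuous_on {t0..m} w ==> (EX y. prim_sol (Phi w) y (%s. h s - \<mu> * w s) m) & Phi w t0 = 0"
  using ex by metis
 define W where "W s = exp (M * (s - t0))" for s
 have Phic: "continuous_on {t0..m} (Phi w)" if "continuous_on {t0..m} w" for w using Phi[OF that] prim_solD(1) by blast
 have "compact (Phi (%s. 0) ` {t0..m})" by (intro compact_continuous_image Phic continuous_intros) auto
 then obtain B where B: "!!s. s \<in> {t0..m} ==> \<bar>Phi (%s. 0) s\<bar> <= B"
  using compact_imp_bounded[THEN bounded_iff[THEN iffD1]] by (metis imageI real_norm_def)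
 have "EX w. continuous_on {t0..m} w & (\<forall>s\<in>{t0..m}. Phi w s = w s)"
 proof (rule weighted_contraction_fixpoint[where c = "1/2" and W = W and ?w0.0 = "%s. 0" and Wm = "W m"])
  show "continuous_on {t0..m} w" if "!!n::nat. continuous_on {t0..m} (v n)" "uniform_limit {t0..m} v w sequentially" for v w
   by (rule uniform_limit_theorem[OF _ that(2)]) (use that(1) in auto)
  show "\<bar>Phi w s - Phi w' s\<bar> <= 1 / 2 * e * W s"
   if w: "continuous_on {t0..m} w" "continuous_on {t0..m} w'" and e: "!!s. s \<in> {t0..m} ==> \<bar>w s - w' s\<bar> <= e * W s"
   and s: "s \<in> {t0..m}" for w w' e s
  proof -
   have e0: "0 <= e" using e[of t0] m by (simp add: W_def)
   obtain y y' where "prim_sol (Phi w) y (%s. h s - \<mu> * w s) m" "prim_sol (Phi w') y' (%s. h s - \<mu> * w' s) m"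
   "Phi w t0 = 0" "Phi w' t0 = 0" using Phi w by metis
   note sol = prim_sol_diff[OF this(1,2)] and z = this(3,4)
   have "\<bar>Phi w s - Phi w' s\<bar> <= C * 0 * (s - t0) + C * (\<mu> * e) / M * exp (M * (s - t0))"
   proof (rule C(2)[OF sol _ M])
   show "\<bar>h x - \<mu> * w x - (h x - \<mu> * w' x)\<bar> <= 0 + \<mu> * e * exp (M * (x - t0))" if "t0 < x" "x < m" for x
   proof -
   have "\<mu> * \<bar>w x - w' x\<bar> <= \<mu> * (e * W x)" using e[of x] that \<mu> by (intro mult_left_mono) auto
   moreover have "h x - \<mu> * w x - (h x - \<mu> * w' x) = - \<mu> * (w x - w' x)" by (simp add: algebra_simps)
   ultimately show ?thesis using \<mu> by (simp add: abs_mult W_def mult.assoc)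
   qed
   qed (use z \<mu> e0 s in auto)
   also have "... = C * \<mu> / M * (e * W s)" by (simp add: W_def)
   also have "... <= 1 / 2 * (e * W s)" using half e0 by (intro mult_right_mono) (auto simp: W_def)
   finally show ?thesis by simp
  qed
  show "0 <= W s & W s <= W m" if "s \<in> {t0..m}" for s using that M by (auto simp: W_def)
  show "0 <= \<bar>B\<bar>" by simp
  show "\<bar>Phi (%s. 0) s - 0\<bar> <= \<bar>B\<bar> * W s" if "s \<in> {t0..m}" for s
  proof -
   have "\<bar>Phi (%s. 0) s\<bar> <= \<bar>B\<bar> * 1" using B[OF that] by linarith
   also have "... <= \<bar>B\<bar> * W s" using that M by (intro mult_left_mono) (auto simp: W_def)
   finally show ?thesis by simp
  qed
 qed (auto simp: Phic)
 then obtain w where w: "continuous_on {t0..m} w" "!!s. s \<in> {t0..m} ==> Phi w s = w s" by blast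
 obtain y where y: "prim_sol (Phi w) y (%s. h s - \<mu> * w s) m" "Phi w t0 = 0" using Phi[OF w(1)] by blast
 have "prim_sol (Phi w) y (%s. h s - \<mu> * Phi w s) m" using prim_solD[OF y(1)] unfolding prim_sol_def
  by (auto intro: reg_sol_cong simp: w(2))
 thus ?thesis using y(2) by blast
qed

end


section \<open>Green's identity and the boundary value problem\<close>

lemma DERIV_glue:
 fixes f g :: "real => real"
 assumes f: "(f has_real_derivative d) (at m)" and g: "(g has_real_derivative d) (at m)" and eq: "f m = g m"
 shows "((%s. if s <= m then f s else g s) has_real_derivative d) (at m)"
proof -
 let ?F = "%s. if s <= m then f s else g s"
 have "((%s. (?F s - ?F m) / (s - m)) ---> d) (at m)"
 proof (rule filterlim_split_at)
  have "((%s. (f s - f m) / (s - m)) ---> d) (at_left m)"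
   using f unfolding has_field_derivative_iff by (rule Lim_at_imp_Lim_at_within)
  thus "((%s. (?F s - ?F m) / (s - m)) ---> d) (at_left m)" by (rule Lim_transform_eventually) (auto simp: eventually_at_filter)
  have "((%s. (g s - g m) / (s - m)) ---> d) (at_right m)"
   using g unfolding has_field_derivative_iff by (rule Lim_at_imp_Lim_at_within)
  thus "((%s. (?F s - ?F m) / (s - m)) ---> d) (at_right m)" by (rule Lim_transform_eventually) (auto simp: eventually_at_filter eq)
 qed
 thus ?thesis by (simp add: has_field_derivative_iff)
qed

lemma DERIV_reflect:
 fixes f :: "real => real"
 shows "((%s. f (- s)) has_real_derivative d) (at s) \<longleftrightarrow> (f has_real_derivative - d) (at (- s))"
 using DERIV_mirror[of f "- d" s] by simp

lemma continuous_on_mirror: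
 fixes f :: "real => real"
 shows "continuous_on {- u..- l} (%s. f (- s)) \<longleftrightarrow> continuous_on {l..u} f"
proof
 assume "continuous_on {l..u} f"
 thus "continuous_on {- u..- l} (%s. f (- s))" by (rule continuous_on_compose2) (auto intro!: continuous_intros)
next
 assume c: "continuous_on {- u..- l} (%s. f (- s))"
 have "continuous_on {l..u} (%s. f (- (- s)))" by (rule continuous_on_compose2[OF c]) (auto intro!: continuous_intros)
 thus "continuous_on {l..u} f" by simp
qed

context singular_ode
begin

lemma prim_sol_mono: "prim_sol z y k m ==> m' <= m ==> prim_sol z y k m'"
 unfolding prim_sol_def by (auto intro: reg_sol_mono elim!: continuous_on_subset)

text \<open>The notion for the right end point, stated without reflection so that left and right
solutions can be glued.\<close>

definition rprim_sol :: "(real => real) => (real => real) => (real => real) => real => bool" where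
 "rprim_sol z y k m \<longleftrightarrow> continuous_on {m..t1} z &
   (ALL s. m < s --> s < t1 --> (z has_real_derivative y s) (at s) &
   (y has_real_derivative (k s - a s * y s) / b s) (at s)) &
   ((%s. p s * y s) ---> 0) (at_left t1)"

lemma rprim_sol_iff_mirror:
 "rprim_sol z y k m \<longleftrightarrow> singular_ode.prim_sol (%s. - a (- s)) (%s. b (- s)) (%s. p (- s)) (- t1)
   (%s. z (- s)) (%s. - y (- s)) (%s. k (- s)) (- m)"
proof -
 interpret m: singular_ode "%s. - a (- s)" "%s. b (- s)" "%s. p (- s)" "- t1" "- t0" b1 b0 by (rule mirror)
 have lim: "((%s. p (- s) * - y (- s)) ---> 0) (at_right (- t1)) \<longleftrightarrow> ((%s. p s * y s) ---> 0) (at_left t1)"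
 proof -
  have "((%s. p (- s) * - y (- s)) ---> 0) (at_right (- t1)) \<longleftrightarrow> ((%s. - (p (- s) * y (- s))) ---> - 0) (at_right (- t1))"
   by simp
  also have "... \<longleftrightarrow> ((%s. p (- s) * y (- s)) ---> 0) (at_right (- t1))"
   using tendsto_minus_cancel_left[of "%s. p (- s) * y (- s)" "- 0" "at_right (- t1)"] by simp
  also have "... \<longleftrightarrow> ((%s. p s * y s) ---> 0) (at_left t1)" by (simp add: at_right_minus filterlim_filtermap)
  finally show ?thesis .
 qed
 have D: "((%s. z (- s)) has_real_derivative - y (- s)) (at s) \<longleftrightarrow> (z has_real_derivative y (- s)) (at (- s))" for s
  using DERIV_reflect[of z "- y (- s)" s] by simp
 have D2: "((%s. - y (- s)) has_real_derivative (k (- s) - - a (- s) * - y (- s)) / b (- s)) (at s) \<longleftrightarrow>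
   (y has_real_derivative (k (- s) - a (- s) * y (- s)) / b (- s)) (at (- s))" for s
 proof -
  have "((%s. - y (- s)) has_real_derivative (k (- s) - - a (- s) * - y (- s)) / b (- s)) (at s) \<longleftrightarrow>
   ((%s. y (- s)) has_real_derivative - ((k (- s) - a (- s) * y (- s)) / b (- s))) (at s)"
   using DERIV_minus[of "%s. - y (- s)" "(k (- s) - a (- s) * y (- s)) / b (- s)" s UNIV]
   DERIV_minus[of "%s. y (- s)" "- ((k (- s) - a (- s) * y (- s)) / b (- s))" s UNIV] by auto
  thus ?thesis using DERIV_reflect[of y "- ((k (- s) - a (- s) * y (- s)) / b (- s))" s] by simp
 qed
 have all: "(ALL s. - t1 < s --> s < - m --> P (- s)) \<longleftrightarrow> (ALL s. m < s --> s < t1 --> P s)" for P :: "real => bool"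
  by (metis minus_less_iff minus_minus)
 show ?thesis unfolding rprim_sol_def m.prim_sol_def m.reg_sol_def lim continuous_on_mirror D D2
  using all[of "%s. (z has_real_derivative y s) (at s)"]
   all[of "%s. (y has_real_derivative (k s - a s * y s) / b s) (at s)"] by blast
qed

text \<open>Green's identity. The boundary term at \<open>t0\<close> is absent because \<open>p
y\<close> and \<open>p v\<close> tend to zero there.\<close>

lemma prim_sol_green:
 assumes z: "prim_sol z y k m'" and w: "prim_sol w v l m'" and m: "t0 < m" "m < m'" "m' <= t1"
 shows "((%s. om s * (k s * w s - l s * z s)) has_integral p m * (y m * w m - z m * v m)) {t0..m}"
proof -
 define g where "g s = (if s = t0 then 0 else p s * (y s * w s - z s * v s))" for s
 have D: "((%s. p s * (y s * w s - z s * v s)) has_real_derivative om s * (k s * w s - l s * z s)) (at s)"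
  if s: "t0 < s" "s < m'" for s
 proof -
  have b: "0 < b s" using b_pos s m by auto
  have "((%s. p s * (y s * w s - z s * v s)) has_real_derivative
   p s * a s / b s * (y s * w s - z s * v s) +
   ((k s - a s * y s) / b s * w s + v s * y s - (y s * v s + (l s - a s * v s) / b s * z s)) * p s) (at s)"
   by (intro DERIV_mult DERIV_diff p_deriv prim_solD(2)[OF z] prim_solD(2)[OF w]
   reg_solD(1)[OF prim_solD(3)[OF z]] reg_solD(1)[OF prim_solD(3)[OF w]]) (use s m in auto)
  moreover have "p s * a s / b s * (y s * w s - z s * v s) +
   ((k s - a s * y s) / b s * w s + v s * y s - (y s * v s + (l s - a s * v s) / b s * z s)) * p s
   = om s * (k s * w s - l s * z s)" using b by (simp add: om_def field_simps)
  ultimately show ?thesis by metis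
 qed
 have "((%s. om s * (k s * w s - l s * z s)) has_integral g m - g t0) {t0..m}"
 proof (rule fundamental_theorem_of_calculus_interior)
  show "t0 <= m" using m by auto
  show "continuous_on {t0..m} g" unfolding continuous_on_def
  proof
   fix s assume s: "s \<in> {t0..m}"
   show "(g ---> g s) (at s within {t0..m})"
   proof (cases "s = t0")
   case True
   have "(z ---> z t0) (at t0 within {t0..m'})" "(w ---> w t0) (at t0 within {t0..m'})"
   using prim_solD(1)[OF z] prim_solD(1)[OF w] m by (auto simp: continuous_on_def)
   hence lim: "(z ---> z t0) (at_right t0)" "(w ---> w t0) (at_right t0)" using m by (simp_all add: at_within_Icc_at_right)
   have "((%s. p s * y s * w s - z s * (p s * v s)) ---> 0 * w t0 - z t0 * 0) (at_right t0)"
   by (intro tendsto_intros lim reg_solD(2)[OF prim_solD(3)[OF z]] reg_solD(2)[OF prim_solD(3)[OF w]])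
   hence "((%s. p s * (y s * w s - z s * v s)) ---> 0) (at t0 within {t0..m})"
   using m by (simp add: at_within_Icc_at_right algebra_simps)
   hence "(g ---> 0) (at t0 within {t0..m})" by (rule Lim_transform_eventually) (auto simp: g_def eventually_at_filter)
   thus ?thesis using True by (simp add: g_def)
   next
   case False
   have "isCont (%s. p s * (y s * w s - z s * v s)) s" by (rule DERIV_isCont[OF D]) (use s m False in auto)
   hence "((%s. p s * (y s * w s - z s * v s)) ---> g s) (at s within {t0..m})"
   using False by (simp add: g_def isCont_def Lim_at_imp_Lim_at_within)
   moreover have "\<forall>\<^sub>F x in at s within {t0..m}. x ~= t0"
   by (rule eventually_mono[OF order_tendstoD(1)[OF tendsto_ident_at, of t0 s "{t0..m}"]])
   (use s False in auto)
   ultimately show ?thesis by (rule Lim_transform_eventually[OF _ eventually_mono]) (auto simp: g_def)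
   qed
  qed
  show "(g has_vector_derivative om s * (k s * w s - l s * z s)) (at s)" if s: "s \<in> {t0<..<m}" for s
   unfolding has_real_derivative_iff_has_vector_derivative[symmetric]
   by (rule has_field_derivative_transform_within_open[OF D, of _ "{t0<..<m}"])
   (use s m in "auto simp: g_def")
 qed
 thus ?thesis using m by (simp add: g_def)
qed

lemma rprim_sol_green:
 assumes z: "rprim_sol z y k m'" and w: "rprim_sol w v l m'" and m: "t0 <= m'" "m' < m" "m < t1"
 shows "((%s. om s * (k s * w s - l s * z s)) has_integral - (p m * (y m * w m - z m * v m))) {m..t1}"
proof -
 interpret m: singular_ode "%s. - a (- s)" "%s. b (- s)" "%s. p (- s)" "- t1" "- t0" b1 b0 by (rule mirror)
 have mom: "m.om s = om (- s)" for s by (simp add: m.om_def om_def)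
 have "((%s. m.om s * (k (- s) * w (- s) - l (- s) * z (- s))) has_integral
   p (- (- m)) * (- y (- (- m)) * w (- (- m)) - z (- (- m)) * - v (- (- m)))) {- t1..- m}"
  by (rule m.prim_sol_green[OF z[unfolded rprim_sol_iff_mirror] w[unfolded rprim_sol_iff_mirror]]) (use m in auto)
 hence "((%s. (%s. om s * (k s * w s - l s * z s)) (- s)) has_integral
   - (p m * (y m * w m - z m * v m))) {- t1..- m}" by (simp add: mom algebra_simps)
 thus ?thesis by (subst (asm) has_integral_reflect_real) simp
qed

definition bvp_sol :: "(real => real) => (real => real) => (real => real) => bool" where
 "bvp_sol z y k \<longleftrightarrow> prim_sol z y k t1 & ((%s. p s * y s) ---> 0) (at_left t1)"

lemma bvp_sol_prim: "bvp_sol z y k ==> m <= t1 ==> prim_sol z y k m"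
 by (auto simp: bvp_sol_def intro: prim_sol_mono)

lemma bvp_sol_rprim:
 assumes "bvp_sol z y k" "t0 <= m"
 shows "rprim_sol z y k m" using assms(2) prim_solD(2)[OF bvp_sol_prim[OF assms(1) order_refl]]
  reg_solD(1)[OF prim_solD(3)[OF bvp_sol_prim[OF assms(1) order_refl]]]
  continuous_on_subset[OF prim_solD(1)[OF bvp_sol_prim[OF assms(1) order_refl]], of "{m..t1}"] assms(1)
 unfolding rprim_sol_def bvp_sol_def by auto

lemma bvp_solD:
 assumes "bvp_sol z y k"
 shows "continuous_on {t0..t1} z"
  "t0 < s ==> s < t1 ==> (z has_real_derivative y s) (at s)"
  "t0 < s ==> s < t1 ==> (y has_real_derivative (k s - a s * y s) / b s) (at s)"
  "((%s. p s * y s) ---> 0) (at_right t0)" "((%s. p s * y s) ---> 0) (at_left t1)"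
 using assms unfolding bvp_sol_def prim_sol_def reg_sol_def by blast+

lemma bvp_sol_diff:
 assumes "bvp_sol z y k" "bvp_sol z' y' k'"
 shows "bvp_sol (%s. z s - z' s) (%s. y s - y' s) (%s. k s - k' s)"
 using assms tendsto_diff[OF bvp_solD(5)[OF assms(1)] bvp_solD(5)[OF assms(2)]]
 by (auto simp: bvp_sol_def algebra_simps intro!: prim_sol_diff)

lemma bvp_sol_cmult:
 assumes "bvp_sol z y k"
 shows "bvp_sol (%s. c * z s) (%s. c * y s) (%s. c * k s)" using assms tendsto_mult_left[OF bvp_solD(5)[OF assms(1)], of c]
 by (auto simp: bvp_sol_def algebra_simps intro!: prim_sol_cmult)

lemma bvp_sol_cong:
 assumes "bvp_sol z y k" "!!s. t0 < s ==> s < t1 ==> k s = k' s"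
 shows "bvp_sol z y k'" using assms unfolding bvp_sol_def prim_sol_def by (auto intro: reg_sol_cong)

end


section \<open>The Fredholm alternative at an eigenvalue\<close>

context singular_ode
begin

lemma om_integral_abs_le:
 assumes h: "continuous_on {t0..t1} h" and w: "continuous_on {t0..t1} w"
  and le: "!!s. s \<in> {t0..t1} ==> \<bar>h s\<bar> <= eps"
 shows "\<bar>integral {t0..t1} (%s. om s * (h s * w s))\<bar> <= eps * integral {t0..t1} (%s. om s * \<bar>w s\<bar>)"
proof -
 have i: "(%s. om s * f s) integrable_on {t0..t1}" if "continuous_on {t0..t1} f" for f
  using om_mult_integrable[OF that] by (auto dest: set_lebesgue_integral_eq_integral(1))
 have "\<bar>integral {t0..t1} (%s. om s * (h s * w s))\<bar> <= integral {t0..t1} (%s. eps * (om s * \<bar>w s\<bar>))"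
  unfolding real_norm_def[symmetric]
 proof (rule integral_norm_bound_integral)
  show "(%s. om s * (h s * w s)) integrable_on {t0..t1}" by (intro i continuous_intros h w)
  show "(%s. eps * (om s * norm (w s))) integrable_on {t0..t1}" by (intro integrable_on_mult_right i continuous_intros w)
  show "norm (om s * (h s * w s)) <= eps * (om s * norm (w s))" if "s \<in> {t0..t1}" for s
  proof -
   have "om s * (\<bar>h s\<bar> * \<bar>w s\<bar>) <= om s * (eps * \<bar>w s\<bar>)"
   using le[OF that] om_nonneg[of s] that by (intro mult_left_mono mult_right_mono) auto
   thus ?thesis using om_nonneg[of s] that by (simp add: abs_mult mult_ac)
  qed
 qed
 thus ?thesis by simp
qed

lemma om_integrable_on:
 assumes "continuous_on {t0..t1} f"
 shows "(%s. om s * f s) integrable_on {t0..t1}"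
 using om_mult_integrable[OF assms] by (auto dest: set_lebesgue_integral_eq_integral(1))

lemma om_integral_pos:
 assumes f: "continuous_on {t0..t1} f" "!!s. s \<in> {t0..t1} ==> 0 <= f s" and m: "t0 < m" "m < t1" "0 < f m"
 shows "0 < integral {t0..t1} (%s. om s * f s)"
proof -
 have "continuous_on {t0<..<t1} f" by (rule continuous_on_subset[OF f(1)]) auto
 hence "isCont f m" using m by (simp add: continuous_on_eq_continuous_at)
 hence "\<forall>\<^sub>F s in at m. 0 < f s" using m(3) by (simp add: isCont_def order_tendstoD(1))
 then obtain d where d: "d > 0" "!!s. s ~= m ==> dist s m < d ==> 0 < f s" by (auto simp: eventually_at)
 define r where "r = min (d / 2) ((t1 - m) / 2)"
 have r: "0 < r" "r < d" "m + r < t1" using d m by (auto simp: r_def min_def field_simps)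
 have fp: "0 < f s" if "s \<in> {m..m+r}" for s using d(2)[of s] that r m(3) by (cases "s = m") (auto simp: dist_real_def)
 have co: "continuous_on {m..m+r} (%s. om s * f s)"
  by (intro continuous_intros continuous_on_subset[OF om_continuous] continuous_on_subset[OF f(1)]) (use m r in auto)
 have "integral {m..m+r} (%s. 0) < integral {m..m+r} (%s. om s * f s)"
 proof (rule integral_less_real)
  show "{m<..<m + r} ~= {}" using r by auto
  show "0 < om s * f s" if "s \<in> {m<..<m + r}" for s using fp[of s] om_pos[of s] that m r by auto
 qed (auto intro: co)
 hence "0 < integral {m..m+r} (%s. om s * f s)" by simp
 also have "... <= integral {t0..t1} (%s. om s * f s)"
 proof (rule integral_subset_le)
  show "{m..m+r} <= {t0..t1}" using m r by auto
  show "(%s. om s * f s) integrable_on {m..m + r}" by (rule integrable_continuous_real[OF co])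
  show "\<forall>s\<in>{t0..t1}. 0 <= om s * f s" using om_nonneg f(2) by auto
 qed (rule om_integrable_on[OF f(1)])
 finally show ?thesis .
qed

end

locale singular_eigen = singular_ode +
 fixes \<mu> :: real and w0 y0 :: "real => real"
 assumes \<mu>: "0 < \<mu>" and eigen: "bvp_sol w0 y0 (%s. - \<mu> * w0 s)"
  and w0_nonzero: "EX m. t0 < m & m < t1 & w0 m ~= 0"
begin

abbreviation ip :: "(real => real) => real" where
 "ip h \<equiv> integral {t0..t1} (%s. om s * (h s * w0 s))"

lemma w0_cont: "continuous_on {t0..t1} w0" by (rule bvp_solD(1)[OF eigen])

lemma w0_bounded:
 obtains B where "0 <= B" "!!s. s \<in> {t0..t1} ==> \<bar>w0 s\<bar> <= B"
proof -
 have "bounded (w0 ` {t0..t1})" by (intro compact_imp_bounded compact_continuous_image w0_cont) auto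
 then obtain B where B: "\<forall>x\<in>{t0..t1}. \<bar>w0 x\<bar> <= B" by (auto simp: bounded_iff)
 moreover have "0 <= B" using B t01 abs_ge_zero[of "w0 t0"] by fastforce
 ultimately show ?thesis using that by blast
qed

lemma bvp_sol_stable_left:
 assumes m: "t0 < m" "m < t1"
 obtains C where "0 <= C" "!!z y h s eps. prim_sol z y (%s. h s - \<mu> * z s) m ==> z t0 = 0 ==>
   (!!x. x \<in> {t0..t1} ==> \<bar>h x\<bar> <= eps) ==> s \<in> {t0..m} ==> \<bar>z s\<bar> <= C * eps"
proof -
 obtain C where C: "0 <= C" "!!z y k s eps. prim_sol z y k m ==> z t0 = 0 ==>
   (!!x. t0 < x ==> x < m ==> \<bar>k x\<bar> <= eps + \<mu> * \<bar>z x\<bar>) ==> s \<in> {t0..m} ==> \<bar>z s\<bar> <= C * eps"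
  by (rule prim_sol_stable[OF m less_imp_le[OF \<mu>]]) (blast intro: that)
 show ?thesis
 proof (rule that[OF C(1)])
  fix z y h :: "real => real" and s eps
  assume z: "prim_sol z y (%s. h s - \<mu> * z s) m" "z t0 = 0"
   and h: "!!x. x \<in> {t0..t1} ==> \<bar>h x\<bar> <= eps" and s: "s \<in> {t0..m}"
  show "\<bar>z s\<bar> <= C * eps"
  proof (rule C(2)[OF z _ s])
   show "\<bar>h x - \<mu> * z x\<bar> <= eps + \<mu> * \<bar>z x\<bar>" if "t0 < x" "x < m" for x
   proof -
   have "\<bar>h x - \<mu> * z x\<bar> <= \<bar>h x\<bar> + \<bar>\<mu> * z x\<bar>" by linarith
   thus ?thesis using h[of x] that m \<mu> by (simp add: abs_mult)
   qed
  qed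
 qed
qed

lemma mirror_eigen:
 "singular_eigen (%s. - a (- s)) (%s. b (- s)) (%s. p (- s)) (- t1) (- t0) b1 b0 \<mu> (%s. w0 (- s)) (%s. - y0 (- s))"
proof -
 interpret m: singular_ode "%s. - a (- s)" "%s. b (- s)" "%s. p (- s)" "- t1" "- t0" b1 b0 by (rule mirror)
 show ?thesis
 proof
  show "0 < \<mu>" by (rule \<mu>)
  have "m.prim_sol (%s. w0 (- s)) (%s. - y0 (- s)) (%s. - \<mu> * w0 (- s)) (- t0)"
   using bvp_sol_rprim[OF eigen order_refl] rprim_sol_iff_mirror[of w0 y0 "%s. - \<mu> * w0 s" t0] by simp
  moreover have "((%s. p (- s) * - y0 (- s)) ---> 0) (at_left (- t0))"
   using tendsto_minus[OF bvp_solD(4)[OF eigen]] by (simp add: at_left_minus filterlim_filtermap)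
  ultimately show "m.bvp_sol (%s. w0 (- s)) (%s. - y0 (- s)) (%s. - \<mu> * w0 (- s))" by (simp add: m.bvp_sol_def)
  obtain m where "t0 < m" "m < t1" "w0 m ~= 0" using w0_nonzero by blast
  thus "EX m. - t1 < m & m < - t0 & w0 (- m) ~= 0" by (intro exI[of _ "- m"]) auto
 qed
qed

lemma rprim_sol_stable:
 assumes m: "t0 < m" "m < t1"
 obtains C where "0 <= C" "!!z y h s eps. rprim_sol z y (%s. h s - \<mu> * z s) m ==> z t1 = 0 ==>
   (!!x. x \<in> {t0..t1} ==> \<bar>h x\<bar> <= eps) ==> s \<in> {m..t1} ==> \<bar>z s\<bar> <= C * eps"
proof -
 interpret m: singular_eigen "%s. - a (- s)" "%s. b (- s)" "%s. p (- s)" "- t1" "- t0" b1 b0 \<mu>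
  "%s. w0 (- s)" "%s. - y0 (- s)" by (rule mirror_eigen)
 have mm: "- t1 < - m" "- m < - t0" using m by auto
 obtain C where C: "0 <= C" "!!z y h s eps. m.prim_sol z y (%s. h s - \<mu> * z s) (- m) ==> z (- t1) = 0 ==>
   (!!x. x \<in> {- t1..- t0} ==> \<bar>h x\<bar> <= eps) ==> s \<in> {- t1..- m} ==> \<bar>z s\<bar> <= C * eps"
  by (rule m.bvp_sol_stable_left[OF mm]) (blast intro: that)
 show ?thesis
 proof (rule that[OF C(1)])
  fix z y h :: "real => real" and s eps
  assume z: "rprim_sol z y (%s. h s - \<mu> * z s) m" "z t1 = 0"
   and h: "!!x. x \<in> {t0..t1} ==> \<bar>h x\<bar> <= eps" and s: "s \<in> {m..t1}"
  have "\<bar>z (- (- s))\<bar> <= C * eps" by (rule C(2)[OF z(1)[unfolded rprim_sol_iff_mirror]]) (use z h s in auto)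
  thus "\<bar>z s\<bar> <= C * eps" by simp
 qed
qed

lemma rprim_sol_exists:
 assumes h: "continuous_on {t0..t1} h" and m: "t0 < m" "m < t1"
 shows "EX z y. rprim_sol z y (%s. h s - \<mu> * z s) m & z t1 = 0"
proof -
 interpret m: singular_ode "%s. - a (- s)" "%s. b (- s)" "%s. p (- s)" "- t1" "- t0" b1 b0 by (rule mirror)
 have "continuous_on {- t1..- m} (%s. h (- s))" unfolding continuous_on_mirror by (rule continuous_on_subset[OF h]) (use m in auto)
 then obtain z y where zy: "m.prim_sol z y (%s. h (- s) - \<mu> * z s) (- m)" "z (- t1) = 0"
  using m.ivp_exists[of "- m" "%s. h (- s)" \<mu>] m \<mu> by auto
 have "rprim_sol (%s. z (- s)) (%s. - y (- s)) (%s. h s - \<mu> * z (- s)) m" unfolding rprim_sol_iff_mirror using zy(1) by simp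
 thus ?thesis using zy(2) by (intro exI[of _ "%s. z (- s)"] exI[of _ "%s. - y (- s)"]) simp
qed

text \<open>By uniqueness, a solution of the homogeneous equation that vanishes at
\<open>t0\<close> vanishes identically.\<close>

lemma w0_t0: "w0 t0 ~= 0"
proof
 assume 0: "w0 t0 = 0"
 obtain m where m: "t0 < m" "m < t1" "w0 m ~= 0" using w0_nonzero by blast
 obtain C where C: "0 <= C" "!!z y h s eps. prim_sol z y (%s. h s - \<mu> * z s) m ==> z t0 = 0 ==>
   (!!x. x \<in> {t0..t1} ==> \<bar>h x\<bar> <= eps) ==> s \<in> {t0..m} ==> \<bar>z s\<bar> <= C * eps"
  by (rule bvp_sol_stable_left[OF m(1,2)]) (blast intro: that)
 have "\<bar>w0 m\<bar> <= C * 0" by (rule C(2)[of w0 y0 "%s. 0"]) (use 0 m bvp_sol_prim[OF eigen, of m] in auto)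
 thus False using m by simp
qed

lemma w0_t1: "w0 t1 ~= 0"
proof -
 interpret m: singular_eigen "%s. - a (- s)" "%s. b (- s)" "%s. p (- s)" "- t1" "- t0" b1 b0 \<mu>
  "%s. w0 (- s)" "%s. - y0 (- s)" by (rule mirror_eigen)
 show ?thesis using m.w0_t0 by simp
qed

lemma bvp_sol_stable_aux:
 obtains C where "0 <= C" "!!z y h s eps. bvp_sol z y (%s. h s - \<mu> * z s) ==> z t0 = 0 ==>
   (!!x. x \<in> {t0..t1} ==> \<bar>h x\<bar> <= eps) ==> s \<in> {t0..t1} ==> \<bar>z s\<bar> <= C * eps"
proof -
 obtain m where m: "t0 < m" "m < t1" "w0 m ~= 0" using w0_nonzero by blast
 obtain C1 where C1: "0 <= C1" "!!z y h s eps. prim_sol z y (%s. h s - \<mu> * z s) m ==> z t0 = 0 ==>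
   (!!x. x \<in> {t0..t1} ==> \<bar>h x\<bar> <= eps) ==> s \<in> {t0..m} ==> \<bar>z s\<bar> <= C1 * eps"
  by (rule bvp_sol_stable_left[OF m(1,2)]) (blast intro: that)
 obtain C2 where C2: "0 <= C2" "!!z y h s eps. rprim_sol z y (%s. h s - \<mu> * z s) m ==> z t1 = 0 ==>
   (!!x. x \<in> {t0..t1} ==> \<bar>h x\<bar> <= eps) ==> s \<in> {m..t1} ==> \<bar>z s\<bar> <= C2 * eps"
  by (rule rprim_sol_stable[OF m(1,2)]) (blast intro: that)
 obtain B where B0: "0 <= B" and B: "!!s. s \<in> {t0..t1} ==> \<bar>w0 s\<bar> <= B" using w0_bounded by blast
 define C where "C = C1 + C2 + (C1 + C2) / \<bar>w0 m\<bar> * B"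
 have C0: "0 <= C" using C1(1) C2(1) B0 by (simp add: C_def)
 show ?thesis
 proof (rule that[OF C0])
  fix z y h :: "real => real" and s eps
  assume z: "bvp_sol z y (%s. h s - \<mu> * z s)" "z t0 = 0"
   and h: "!!x. x \<in> {t0..t1} ==> \<bar>h x\<bar> <= eps" and s: "s \<in> {t0..t1}"
  have e0: "0 <= eps" using h[of t0] t01 by auto
  have left: "\<bar>z x\<bar> <= C1 * eps" if "x \<in> {t0..m}" for x
   by (rule C1(2)[OF bvp_sol_prim[OF z(1)] z(2) h that]) (use m in auto)
  define gam where "gam = z t1 / w0 t1"
  have sol: "bvp_sol (%s. z s - gam * w0 s) (%s. y s - gam * y0 s) (%s. h s - \<mu> * (z s - gam * w0 s))"
   by (rule bvp_sol_cong[OF bvp_sol_diff[OF z(1) bvp_sol_cmult[OF eigen]]]) (simp add: algebra_simps)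
  have right: "\<bar>z x - gam * w0 x\<bar> <= C2 * eps" if "x \<in> {m..t1}" for x
   by (rule C2(2)[OF bvp_sol_rprim[OF sol] _ h that]) (use m w0_t1 in "auto simp: gam_def")
  have "\<bar>gam\<bar> * \<bar>w0 m\<bar> <= (C1 + C2) * eps"
   using left[of m] right[of m] m by (simp add: abs_mult[symmetric] algebra_simps)
  hence gam: "\<bar>gam\<bar> <= (C1 + C2) / \<bar>w0 m\<bar> * eps" using m by (simp add: field_simps)
  have "\<bar>gam * w0 s\<bar> <= (C1 + C2) / \<bar>w0 m\<bar> * eps * B"
   unfolding abs_mult using gam B[OF s] C1(1) C2(1) e0 by (intro mult_mono) auto
  moreover have "\<bar>z s\<bar> <= (C1 + C2) * eps + \<bar>gam * w0 s\<bar>"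
  proof (cases "s <= m")
   case True
   hence "\<bar>z s\<bar> <= C1 * eps" using left s by auto
   thus ?thesis using C2(1) e0 by (simp add: algebra_simps add_increasing2)
  next
   case False
   hence "\<bar>z s - gam * w0 s\<bar> <= C2 * eps" using right s by auto
   moreover have "0 <= C1 * eps" using C1(1) e0 by simp
   ultimately show ?thesis unfolding distrib_right by linarith
  qed
  ultimately show "\<bar>z s\<bar> <= C * eps" by (simp add: C_def algebra_simps)
 qed
qed

lemma ip_w0_pos: "0 < ip w0"
proof -
 obtain m where m: "t0 < m" "m < t1" "w0 m ~= 0" using w0_nonzero by blast
 have "0 < w0 m * w0 m" using m by (simp add: zero_less_mult_iff linorder_neq_iff[symmetric])
 thus ?thesis using m by (intro om_integral_pos[of _ m]) (auto intro!: continuous_intros w0_cont)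
qed

lemma ip_diff_cmult:
 assumes "continuous_on {t0..t1} z"
 shows "ip (%s. z s - gam * w0 s) = ip z - gam * ip w0"
proof -
 have "ip (%s. z s - gam * w0 s) = integral {t0..t1} (%s. om s * (z s * w0 s) - gam * (om s * (w0 s * w0 s)))"
  by (rule integral_cong) (simp add: algebra_simps)
 also have "... = ip z - integral {t0..t1} (%s. gam * (om s * (w0 s * w0 s)))"
  by (intro Henstock_Kurzweil_Integration.integral_diff integrable_on_mult_right om_integrable_on continuous_intros assms w0_cont)
 finally show ?thesis by simp
qed

text \<open>A solution is determined by its value at \<open>t0\<close>, so the kernel is spanned
by \<open>w0\<close>; fixing the component along \<open>w0\<close> makes the inverse
bounded.\<close>

lemma bvp_sol_stable:
 obtains C where "0 <= C" "!!z y h s eps. bvp_sol z y (%s. h s - \<mu> * z s) ==> ip z = 0 ==>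
   (!!x. x \<in> {t0..t1} ==> \<bar>h x\<bar> <= eps) ==> s \<in> {t0..t1} ==> \<bar>z s\<bar> <= C * eps"
proof -
 obtain C1 where C1: "0 <= C1" "!!z y h s eps. bvp_sol z y (%s. h s - \<mu> * z s) ==> z t0 = 0 ==>
   (!!x. x \<in> {t0..t1} ==> \<bar>h x\<bar> <= eps) ==> s \<in> {t0..t1} ==> \<bar>z s\<bar> <= C1 * eps"
  by (rule bvp_sol_stable_aux) (blast intro: that)
 obtain B where B0: "0 <= B" and B: "!!s. s \<in> {t0..t1} ==> \<bar>w0 s\<bar> <= B" using w0_bounded by blast
 define W where "W = integral {t0..t1} (%s. om s * \<bar>w0 s\<bar>)"
 have W0: "0 <= W" unfolding W_def
  by (rule integral_nonneg) (auto intro!: om_integrable_on continuous_intros w0_cont mult_nonneg_nonneg om_nonneg)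
 define C where "C = C1 + C1 * W / ip w0 * B"
 have C0: "0 <= C" using C1(1) W0 B0 ip_w0_pos by (simp add: C_def)
 show ?thesis
 proof (rule that[OF C0])
  fix z y h :: "real => real" and s eps
  assume z: "bvp_sol z y (%s. h s - \<mu> * z s)" "ip z = 0"
   and h: "!!x. x \<in> {t0..t1} ==> \<bar>h x\<bar> <= eps" and s: "s \<in> {t0..t1}"
  have e0: "0 <= eps" using h[of t0] t01 by auto
  define gam where "gam = z t0 / w0 t0"
  have sol: "bvp_sol (%s. z s - gam * w0 s) (%s. y s - gam * y0 s) (%s. h s - \<mu> * (z s - gam * w0 s))"
   by (rule bvp_sol_cong[OF bvp_sol_diff[OF z(1) bvp_sol_cmult[OF eigen]]]) (simp add: algebra_simps)
  have le: "\<bar>z x - gam * w0 x\<bar> <= C1 * eps" if "x \<in> {t0..t1}" for x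
   by (rule C1(2)[OF sol _ h that]) (use w0_t0 in "auto simp: gam_def")
  have "\<bar>ip (%s. z s - gam * w0 s)\<bar> <= C1 * eps * W"
   unfolding W_def by (rule om_integral_abs_le[OF _ w0_cont le]) (auto intro: bvp_solD(1)[OF sol])
  hence "\<bar>gam\<bar> * ip w0 <= C1 * eps * W" using ip_w0_pos z(2) by (simp add: ip_diff_cmult bvp_solD(1)[OF z(1)] abs_mult)
  hence gam: "\<bar>gam\<bar> <= C1 * W / ip w0 * eps" using ip_w0_pos by (simp add: field_simps)
  have "\<bar>gam * w0 s\<bar> <= C1 * W / ip w0 * eps * B"
   unfolding abs_mult using gam B[OF s] C1(1) W0 ip_w0_pos e0 by (intro mult_mono) auto
  moreover have "\<bar>z s\<bar> <= C1 * eps + \<bar>gam * w0 s\<bar>" using le[OF s] by linarith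
  ultimately show "\<bar>z s\<bar> <= C * eps" by (simp add: C_def algebra_simps)
 qed
qed

text \<open>The Fredholm alternative. Solutions that are regular at one of the end points exist
for every \<open>h\<close>. Adding a multiple of \<open>w0\<close> makes the left and the right
one agree at a point \<open>m\<close> with \<open>w0 m \<noteq> 0\<close>, and then Green's
identity turns orthogonality into the equality of their derivatives at \<open>m\<close>.\<close>

lemma bvp_sol_exists:
 assumes h: "continuous_on {t0..t1} h" and orth: "ip h = 0"
 shows "EX z y. bvp_sol z y (%s. h s - \<mu> * z s) & ip z = 0"
proof -
 obtain m where m: "t0 < m" "m < t1" "w0 m ~= 0" using w0_nonzero by blast
 define m1 where "m1 = (m + t1) / 2" define m2 where "m2 = (t0 + m) / 2"
 have m1: "m < m1" "m1 < t1" and m2: "t0 < m2" "m2 < m" using m by (auto simp: m1_def m2_def)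
 have "continuous_on {t0..m1} h" by (rule continuous_on_subset[OF h]) (use m1 in auto)
 then obtain z1 y1 where zy1: "prim_sol z1 y1 (%s. h s - \<mu> * z1 s) m1" using ivp_exists[of m1 h \<mu>] m m1 \<mu> by auto
 obtain z2 y2 where zy2: "rprim_sol z2 y2 (%s. h s - \<mu> * z2 s) m2" using rprim_sol_exists[OF h, of m2] m m2 by auto
 define kap where "kap = (z1 m - z2 m) / w0 m"
 define z3 where "z3 s = z2 s + kap * w0 s" for s
 define y3 where "y3 s = y2 s + kap * y0 s" for s
 have zy3: "rprim_sol z3 y3 (%s. h s - \<mu> * z3 s) m2" unfolding rprim_sol_def
 proof (intro conjI allI impI)
  show "continuous_on {m2..t1} z3" unfolding z3_def
   by (intro continuous_intros continuous_on_subset[OF w0_cont]) (use zy2 m2 in "auto simp: rprim_sol_def")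
  fix s assume s: "m2 < s" "s < t1"
  have d2: "(z2 has_real_derivative y2 s) (at s)"
   "(y2 has_real_derivative (h s - \<mu> * z2 s - a s * y2 s) / b s) (at s)" using zy2 s by (auto simp: rprim_sol_def)
  have d0: "(w0 has_real_derivative y0 s) (at s)"
   "(y0 has_real_derivative (- \<mu> * w0 s - a s * y0 s) / b s) (at s)" using bvp_solD(2,3)[OF eigen, of s] s m2 by auto
  show "(z3 has_real_derivative y3 s) (at s)" unfolding z3_def y3_def by (intro DERIV_add DERIV_cmult d2 d0)
  have "(y3 has_real_derivative (h s - \<mu> * z2 s - a s * y2 s) / b s + kap * ((- \<mu> * w0 s - a s * y0 s) / b s)) (at s)"
   unfolding y3_def by (intro DERIV_add DERIV_cmult d2 d0)
  moreover have "(h s - \<mu> * z2 s - a s * y2 s) / b s + kap * ((- \<mu> * w0 s - a s * y0 s) / b s)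
   = (h s - \<mu> * z3 s - a s * y3 s) / b s"
   unfolding z3_def y3_def times_divide_eq_right add_divide_distrib[symmetric] by (simp add: algebra_simps)
  ultimately show "(y3 has_real_derivative (h s - \<mu> * z3 s - a s * y3 s) / b s) (at s)" by metis
 next
  have "((%s. p s * y2 s + kap * (p s * y0 s)) ---> 0 + kap * 0) (at_left t1)"
   by (intro tendsto_intros bvp_solD(5)[OF eigen]) (use zy2 in "auto simp: rprim_sol_def")
  thus "((%s. p s * y3 s) ---> 0) (at_left t1)" by (simp add: y3_def algebra_simps)
 qed
 have zm: "z1 m = z3 m" using m by (simp add: z3_def kap_def)
 have gl: "((%s. om s * (h s * w0 s)) has_integral p m * (y1 m * w0 m - z1 m * y0 m)) {t0..m}"
  using prim_sol_green[OF zy1 bvp_sol_prim[OF eigen]] m m1 by (simp add: algebra_simps)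
 have gr: "((%s. om s * (h s * w0 s)) has_integral - (p m * (y3 m * w0 m - z3 m * y0 m))) {m..t1}"
  using rprim_sol_green[OF zy3 bvp_sol_rprim[OF eigen]] m m2 by (simp add: algebra_simps)
 have "((%s. om s * (h s * w0 s)) has_integral
   p m * (y1 m * w0 m - z1 m * y0 m) + - (p m * (y3 m * w0 m - z3 m * y0 m))) {t0..t1}"
  by (rule has_integral_combine[OF _ _ gl gr]) (use m in auto)
 hence "p m * (y1 m * w0 m - z1 m * y0 m) - p m * (y3 m * w0 m - z3 m * y0 m) = 0" using orth by (simp add: integral_unique)
 hence "p m * w0 m * (y1 m - y3 m) = 0" using zm by (simp add: algebra_simps)
 hence ym: "y1 m = y3 m" using m p_pos[of m] by simp
 define z where "z s = (if s <= m then z1 s else z3 s)" for s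
 define y where "y s = (if s <= m then y1 s else y3 s)" for s
 define k where "k s = h s - \<mu> * z s" for s
 have D1: "(z1 has_real_derivative y1 s) (at s)"
   "(y1 has_real_derivative (h s - \<mu> * z1 s - a s * y1 s) / b s) (at s)" if "t0 < s" "s < m1" for s
  using prim_solD(2)[OF zy1 that] reg_solD(1)[OF prim_solD(3)[OF zy1] that] by auto
 have D3: "(z3 has_real_derivative y3 s) (at s)"
   "(y3 has_real_derivative (h s - \<mu> * z3 s - a s * y3 s) / b s) (at s)" if "m2 < s" "s < t1" for s
  using zy3 that by (auto simp: rprim_sol_def)
 have D: "(z has_real_derivative y s) (at s) & (y has_real_derivative (k s - a s * y s) / b s) (at s)"
  if s: "t0 < s" "s < t1" for s
 proof -
  consider "s < m" | "s = m" | "m < s" by linarith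
  thus ?thesis
  proof cases
   case 1
   have "(z has_real_derivative y1 s) (at s)"
   by (rule has_field_derivative_transform_within_open[OF D1(1), of _ "{..<m}"]) (use 1 s m1 in "auto simp: z_def")
   moreover have "(y has_real_derivative (h s - \<mu> * z1 s - a s * y1 s) / b s) (at s)"
   by (rule has_field_derivative_transform_within_open[OF D1(2), of _ "{..<m}"]) (use 1 s m1 in "auto simp: y_def")
   ultimately show ?thesis using 1 by (simp add: y_def k_def z_def)
  next
   case 2
   have "(z has_real_derivative y1 m) (at m)"
   unfolding z_def by (rule DERIV_glue) (use D1(1)[of m] D3(1)[of m] m m1 m2 zm ym in auto)
   moreover have "(y has_real_derivative (h m - \<mu> * z1 m - a m * y1 m) / b m) (at m)"
   unfolding y_def by (rule DERIV_glue) (use D1(2)[of m] D3(2)[of m] m m1 m2 zm ym in auto)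
   ultimately show ?thesis using 2 by (simp add: y_def k_def z_def)
  next
   case 3
   have "(z has_real_derivative y3 s) (at s)"
   by (rule has_field_derivative_transform_within_open[OF D3(1), of _ "{m<..}"]) (use 3 s m2 in "auto simp: z_def")
   moreover have "(y has_real_derivative (h s - \<mu> * z3 s - a s * y3 s) / b s) (at s)"
   by (rule has_field_derivative_transform_within_open[OF D3(2), of _ "{m<..}"]) (use 3 s m2 in "auto simp: y_def")
   ultimately show ?thesis using 3 by (simp add: y_def k_def z_def)
  qed
 qed
 have sol: "bvp_sol z y k" unfolding bvp_sol_def prim_sol_def reg_sol_def
 proof (intro conjI allI impI)
  have "continuous_on ({t0..m} \<union> {m..t1}) z"
  proof (rule continuous_on_closed_Un)
   have "continuous_on {t0..m} z1" by (rule continuous_on_subset[OF prim_solD(1)[OF zy1]]) (use m1 in auto)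
   thus "continuous_on {t0..m} z" by (rule continuous_on_eq) (auto simp: z_def)
   have "continuous_on {m..t1} z3" by (rule continuous_on_subset[of "{m2..t1}"]) (use m2 zy3 in "auto simp: rprim_sol_def")
   thus "continuous_on {m..t1} z" by (rule continuous_on_eq) (use zm in "auto simp: z_def")
  qed auto
  moreover have "{t0..m} \<union> {m..t1} = {t0..t1}" using m by auto
  ultimately show "continuous_on {t0..t1} z" by simp
  have "\<forall>\<^sub>F s in at_right t0. p s * y1 s = p s * y s"
   using m by (auto simp: eventually_at_right_field y_def intro!: exI[of _ m])
  thus "((%s. p s * y s) ---> 0) (at_right t0)" by (rule Lim_transform_eventually[OF reg_solD(2)[OF prim_solD(3)[OF zy1]]])
  have "\<forall>\<^sub>F s in at_left t1. p s * y3 s = p s * y s"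
   using m by (auto simp: eventually_at_left_field y_def intro!: exI[of _ m])
  thus "((%s. p s * y s) ---> 0) (at_left t1)" by (rule Lim_transform_eventually[rotated]) (use zy3 in "auto simp: rprim_sol_def")
 qed (use D in auto)
 define gam where "gam = ip z / ip w0"
 have "bvp_sol (%s. z s - gam * w0 s) (%s. y s - gam * y0 s) (%s. h s - \<mu> * (z s - gam * w0 s))"
  by (rule bvp_sol_cong[OF bvp_sol_diff[OF sol bvp_sol_cmult[OF eigen]]]) (simp add: k_def algebra_simps)
 moreover have "ip (%s. z s - gam * w0 s) = 0" unfolding ip_diff_cmult[OF bvp_solD(1)[OF sol]] gam_def using ip_w0_pos by simp
 ultimately show ?thesis by blast
qed

end


section \<open>Regularity up to the end points\<close>

lemma has_real_derivative_extend_Icc: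
 fixes z Z :: "real => real"
 assumes lu: "l < u" and z: "continuous_on {l..u} z" and Z: "continuous_on {l..u} Z"
  and D: "!!s. l < s ==> s < u ==> (z has_real_derivative Z s) (at s)" and s: "s \<in> {l..u}"
 shows "(z has_real_derivative Z s) (at s within {l..u})"
proof -
 have eq: "z x = z l + integral {l..x} Z" if x: "x \<in> {l..u}" for x
 proof -
  have "(Z has_integral z x - z l) {l..x}"
  proof (rule fundamental_theorem_of_calculus_interior)
   show "continuous_on {l..x} z" by (rule continuous_on_subset[OF z]) (use x in auto)
   show "(z has_vector_derivative Z y) (at y)" if "y \<in> {l<..<x}" for y
   using D[of y] that x by (simp add: has_real_derivative_iff_has_vector_derivative)
  qed (use x in auto)
  thus ?thesis by (simp add: integral_unique)
 qed
 have "((%x. z l + integral {l..x} Z) has_real_derivative 0 + Z s) (at s within {l..u})"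
  by (intro DERIV_add DERIV_const integral_has_real_derivative Z s)
 hence d: "((%x. z l + integral {l..x} Z) has_derivative (*) (Z s)) (at s within {l..u})" by (simp add: has_field_derivative_def)
 have "(z has_derivative (*) (Z s)) (at s within {l..u})" by (rule has_derivative_transform[OF s eq d])
 thus ?thesis by (simp add: has_field_derivative_def)
qed

context singular_ode
begin

definition reg2 :: "(real => real) => (real => real) => bool" where
 "reg2 y k \<longleftrightarrow> (ALL s. t0 < s --> s < t1 --> (y has_real_derivative (k s - a s * y s) / b s) (at s)) &
   ((%s. p s * y s) ---> 0) (at_right t0) & ((%s. p s * y s) ---> 0) (at_left t1)"

lemma reg2_reg_sol: "reg2 y k ==> reg_sol y k t1"
 by (auto simp: reg2_def reg_sol_def)

lemma bvp_sol_reg2: "bvp_sol z y k ==> reg2 y k"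
 by (auto simp: reg2_def bvp_sol_def prim_sol_def reg_sol_def)

lemma reg2_diff:
 assumes "reg2 y k" "reg2 y' k'"
 shows "reg2 (%s. y s - y' s) (%s. k s - k' s)"
proof -
 have "((%s. p s * y s - p s * y' s) ---> 0 - 0) (at_left t1)" by (rule tendsto_diff) (use assms in "simp_all add: reg2_def")
 hence "((%s. p s * (y s - y' s)) ---> 0) (at_left t1)" by (simp add: right_diff_distrib)
 thus ?thesis using reg_sol_diff[OF assms[THEN reg2_reg_sol]] unfolding reg2_def reg_sol_def by blast
qed

lemma reg2_mirror:
 assumes "reg2 y k"
 shows "singular_ode.reg2 (%s. - a (- s)) (%s. b (- s)) (%s. p (- s)) (- t1) (- t0) (%s. - y (- s)) (%s. k (- s))"
proof -
 interpret m: singular_ode "%s. - a (- s)" "%s. b (- s)" "%s. p (- s)" "- t1" "- t0" b1 b0 by (rule mirror)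
 show ?thesis unfolding m.reg2_def
 proof (intro conjI allI impI)
  fix s assume s: "- t1 < s" "s < - t0"
  hence "(y has_real_derivative (k (- s) - a (- s) * y (- s)) / b (- s)) (at (- s))" using assms by (auto simp: reg2_def)
  hence "((%s. y (- s)) has_real_derivative - ((k (- s) - a (- s) * y (- s)) / b (- s))) (at s)"
   using DERIV_reflect[of y "- ((k (- s) - a (- s) * y (- s)) / b (- s))" s] by simp
  from DERIV_minus[OF this]
  show "((%s. - y (- s)) has_real_derivative (k (- s) - - a (- s) * - y (- s)) / b (- s)) (at s)" by simp
 next
  have "((%s. p s * y s) ---> 0) (at_left t1)" using assms by (simp add: reg2_def)
  hence "((%s. p (- s) * y (- s)) ---> 0) (at_right (- t1))" by (simp add: at_right_minus filterlim_filtermap)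
  from tendsto_minus[OF this] show "((%s. p (- s) * - y (- s)) ---> 0) (at_right (- t1))" by simp
 next
  have "((%s. p s * y s) ---> 0) (at_right t0)" using assms by (simp add: reg2_def)
  hence "((%s. p (- s) * y (- s)) ---> 0) (at_left (- t0))" by (simp add: at_left_minus filterlim_filtermap)
  from tendsto_minus[OF this] show "((%s. p (- s) * - y (- s)) ---> 0) (at_left (- t0))" by simp
 qed
qed

text \<open>The solution that is regular at both ends has the limits \<open>k / a\<close>
there.\<close>

definition ext :: "(real => real) => (real => real) => real => real" where
 "ext y k s = (if s = t0 then k t0 / a t0 else if s = t1 then k t1 / a t1 else y s)"

lemma ext_inside: "t0 < s ==> s < t1 ==> ext y k s = y s"
 by (simp add: ext_def)

lemma ext_continuous:
 assumes y: "reg2 y k" and k: "continuous_on {t0..t1} k"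
 shows "continuous_on {t0..t1} (ext y k)"
proof -
 interpret m: singular_ode "%s. - a (- s)" "%s. b (- s)" "%s. p (- s)" "- t1" "- t0" b1 b0 by (rule mirror)
 have k0: "(k ---> k t0) (at_right t0)"
 proof -
  have "(k ---> k t0) (at t0 within {t0..t1})" using k t01 by (auto simp: continuous_on_def)
  thus ?thesis using t01 by (simp add: at_within_Icc_at_right)
 qed
 have k1: "(k ---> k t1) (at_left t1)"
 proof -
  have "(k ---> k t1) (at t1 within {t0..t1})" using k t01 by (auto simp: continuous_on_def)
  thus ?thesis using t01 by (simp add: at_within_Icc_at_left)
 qed
 have y0: "(y ---> k t0 / a t0) (at_right t0)" by (rule reg_sol_tendsto[OF reg2_reg_sol[OF y] t01 order_refl k0])
 have k1': "((%s. k (- s)) ---> k t1) (at_right (- t1))" using k1 by (simp add: at_right_minus filterlim_filtermap)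
 have "((%s. - y (- s)) ---> k t1 / - a (- (- t1))) (at_right (- t1))"
  by (rule m.reg_sol_tendsto[OF m.reg2_reg_sol[OF reg2_mirror[OF y]] _ order_refl k1']) (use t01 in auto)
 hence "((%s. - y s) ---> - (k t1 / a t1)) (at_left t1)" by (simp add: at_right_minus filterlim_filtermap)
 hence y1: "(y ---> k t1 / a t1) (at_left t1)"
  using tendsto_minus_cancel_left[of y "k t1 / a t1" "at_left t1"] tendsto_minus_cancel by blast
 show ?thesis unfolding continuous_on_def
 proof
  fix s assume s: "s \<in> {t0..t1}"
  consider "s = t0" | "s = t1" | "t0 < s" "s < t1" using s by force
  thus "(ext y k ---> ext y k s) (at s within {t0..t1})"
  proof cases
   case 1
   have "\<forall>\<^sub>F x in at_right t0. y x = ext y k x"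
   using t01 by (auto simp: eventually_at_right_field ext_def intro!: exI[of _ t1])
   hence "(ext y k ---> k t0 / a t0) (at_right t0)" by (rule Lim_transform_eventually[OF y0])
   thus ?thesis using 1 t01 by (simp add: at_within_Icc_at_right ext_def)
  next
   case 2
   have "\<forall>\<^sub>F x in at_left t1. y x = ext y k x"
   using t01 by (auto simp: eventually_at_left_field ext_def intro!: exI[of _ t0])
   hence "(ext y k ---> k t1 / a t1) (at_left t1)" by (rule Lim_transform_eventually[OF y1])
   thus ?thesis using 2 t01 by (simp add: at_within_Icc_at_left ext_def)
  next
   case 3
   have "(y has_real_derivative (k s - a s * y s) / b s) (at s)" using y 3 by (auto simp: reg2_def)
   hence "(ext y k has_real_derivative (k s - a s * y s) / b s) (at s)"
   by (rule has_field_derivative_transform_within_open[of _ _ _ "{t0<..<t1}"]) (use 3 in "auto simp: ext_def")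
   hence "isCont (ext y k) s" by (rule DERIV_isCont)
   thus ?thesis by (simp add: isCont_def Lim_at_imp_Lim_at_within)
  qed
 qed
qed

lemma ext_bound:
 obtains C where "0 <= C" "!!y k s eps. reg2 y k ==> (!!x. x \<in> {t0..t1} ==> \<bar>k x\<bar> <= eps) ==>
   s \<in> {t0..t1} ==> \<bar>ext y k s\<bar> <= C * eps"
proof -
 interpret m: singular_ode "%s. - a (- s)" "%s. b (- s)" "%s. p (- s)" "- t1" "- t0" b1 b0 by (rule mirror)
 define r1 where "r1 = (2 * t1 + t0) / 3" define r2 where "r2 = (t1 + 2 * t0) / 3"
 have r: "r1 < t1" "t0 < r2" "r2 < r1" using t01 by (auto simp: r1_def r2_def field_simps)
 have r2': "- r2 < - t0" using r by simp
 obtain C1 where C1: "0 <= C1" "!!y k s r eps. reg_sol y k r ==> r <= r1 ==> t0 < s ==> s < r ==>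
   (!!x. t0 < x ==> x <= s ==> \<bar>k x\<bar> <= eps) ==> \<bar>y s\<bar> <= C1 * eps"
  by (rule reg_sol_bound[OF r(1)]) (blast intro: that)
 obtain C2 where C2: "0 <= C2" "!!y k s r eps. m.reg_sol y k r ==> r <= - r2 ==> - t1 < s ==> s < r ==>
   (!!x. - t1 < x ==> x <= s ==> \<bar>k x\<bar> <= eps) ==> \<bar>y s\<bar> <= C2 * eps"
  by (rule m.reg_sol_bound[OF r2']) (blast intro: that)
 define C where "C = C1 + C2 + 1 / \<bar>a t0\<bar> + 1 / \<bar>a t1\<bar>"
 have le: "C1 <= C" "C2 <= C" "1 / \<bar>a t0\<bar> <= C" "1 / \<bar>a t1\<bar> <= C" using C1 C2 by (auto simp: C_def)
 have C0: "0 <= C" using le C1 by linarith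
 show ?thesis
 proof (rule that[OF C0])
  fix y k :: "real => real" and s eps
  assume y: "reg2 y k" and k: "!!x. x \<in> {t0..t1} ==> \<bar>k x\<bar> <= eps" and s: "s \<in> {t0..t1}"
  have e0: "0 <= eps" using k[OF s] by linarith
  consider "s = t0" | "s = t1" | "t0 < s" "s < r1" | "r2 < s" "s < t1" using s r by force
  thus "\<bar>ext y k s\<bar> <= C * eps"
  proof cases
   case 1
   have "\<bar>ext y k s\<bar> = 1 / \<bar>a t0\<bar> * \<bar>k t0\<bar>" using 1 by (simp add: ext_def)
   also have "... <= C * eps" using le(3) k[of t0] t01 C0 by (intro mult_mono) auto
   finally show ?thesis .
  next
   case 2
   have "\<bar>ext y k s\<bar> = 1 / \<bar>a t1\<bar> * \<bar>k t1\<bar>" using 2 t01 by (simp add: ext_def)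
   also have "... <= C * eps" using le(4) k[of t1] t01 C0 by (intro mult_mono) auto
   finally show ?thesis .
  next
   case 3
   have "\<bar>y s\<bar> <= C1 * eps" by (rule C1(2)[OF reg_sol_mono[OF reg2_reg_sol[OF y], of r1]]) (use 3 r k in auto)
   also have "... <= C * eps" using le e0 by (intro mult_right_mono)
   finally show ?thesis using 3 r by (simp add: ext_def)
  next
   case 4
   have "\<bar>- y (- (- s))\<bar> <= C2 * eps"
   by (rule C2(2)[OF m.reg_sol_mono[OF m.reg2_reg_sol[OF reg2_mirror[OF y]], of "- r2"]]) (use 4 r k in auto)
   also have "... <= C * eps" using le e0 by (intro mult_right_mono)
   finally show ?thesis using 4 r by (simp add: ext_def)
  qed
 qed
qed

lemma ext_diff: "ext y k s - ext y' k' s = ext (%s. y s - y' s) (%s. k s - k' s) s"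
 by (simp add: ext_def diff_divide_distrib)

lemma ext_uniform_limit:
 assumes y: "!!t. t \<in> T ==> reg2 (y t) (k t)" and s: "s \<in> T"
  and ul: "uniform_limit {t0..t1} k (k s) (at s within T)"
 shows "uniform_limit {t0..t1} (%t. ext (y t) (k t)) (ext (y s) (k s)) (at s within T)"
proof (rule uniform_limitI)
 fix e :: real assume e: "0 < e"
 obtain C where C: "0 <= C" "!!y k s eps. reg2 y k ==> (!!x. x \<in> {t0..t1} ==> \<bar>k x\<bar> <= eps) ==>
   s \<in> {t0..t1} ==> \<bar>ext y k s\<bar> <= C * eps" by (rule ext_bound) (blast intro: that)
 have "\<forall>\<^sub>F t in at s within T. \<forall>x\<in>{t0..t1}. dist (k t x) (k s x) < e / (C + 1)"
  using uniform_limitD[OF ul, of "e / (C + 1)"] e C by simp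
 moreover have "\<forall>\<^sub>F t in at s within T. t \<in> T" by (auto simp: eventually_at_filter)
 ultimately show "\<forall>\<^sub>F t in at s within T. \<forall>x\<in>{t0..t1}. dist (ext (y t) (k t) x) (ext (y s) (k s) x) < e"
 proof eventually_elim
  case (elim t)
  show ?case
  proof
   fix x assume x: "x \<in> {t0..t1}"
   have "\<bar>ext (y t) (k t) x - ext (y s) (k s) x\<bar> <= C * (e / (C + 1))" unfolding ext_diff
   by (rule C(2)[OF reg2_diff[OF y[OF elim(2)] y[OF s]]]) (use elim x in "auto simp: dist_real_def less_imp_le")
   also have "... < e" using C e by (simp add: field_simps)
   finally show "dist (ext (y t) (k t) x) (ext (y s) (k s) x) < e" by (simp add: dist_real_def)
  qed
 qed
qed

end

locale smooth_singular_ode = singular_ode +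
 fixes a1 bb1 bb2 :: "real => real"
 assumes a_deriv: "!!s. s \<in> {t0..t1} ==> (a has_real_derivative a1 s) (at s within {t0..t1})"
  and a1_cont: "continuous_on {t0..t1} a1"
  and b_deriv: "!!s. s \<in> {t0..t1} ==> (b has_real_derivative bb1 s) (at s within {t0..t1})"
  and bb1_deriv: "!!s. s \<in> {t0..t1} ==> (bb1 has_real_derivative bb2 s) (at s within {t0..t1})"
  and bb2_cont: "continuous_on {t0..t1} bb2"
  and bb1_t0: "bb1 t0 = b0" and bb1_t1: "bb1 t1 = - b1"
begin

lemma inside:
 assumes "t0 < s" "s < t1"
 shows "(a has_real_derivative a1 s) (at s)"
  "(b has_real_derivative bb1 s) (at s)" "(bb1 has_real_derivative bb2 s) (at s)"
 using a_deriv[of s] b_deriv[of s] bb1_deriv[of s] assms by (auto simp: at_within_Icc_at)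

lemma bb1_cont: "continuous_on {t0..t1} bb1"
 using bb1_deriv by (meson DERIV_continuous_on)

text \<open>Differentiating \<open>b y' + a y = k\<close> gives an equation of the same kind for
\<open>y'\<close>, with \<open>a + b'\<close> in place of \<open>a\<close> and \<open>p b\<close>
in place of \<open>p\<close>.\<close>

lemma shift: "singular_ode (%s. a s + bb1 s) b (%s. p s * b s) t0 t1 b0 b1"
proof
 show "continuous_on {t0..t1} (%s. a s + bb1 s)" by (intro continuous_intros cont_a bb1_cont)
 show "((%s. p s * b s) has_real_derivative p s * b s * (a s + bb1 s) / b s) (at s)" if s: "t0 < s" "s < t1" for s
 proof -
  have "((%s. p s * b s) has_real_derivative p s * a s / b s * b s + bb1 s * p s) (at s)" by (intro DERIV_mult p_deriv inside s)
  moreover have "p s * a s / b s * b s + bb1 s * p s = p s * b s * (a s + bb1 s) / b s" using b_pos[OF s] by (simp add: field_simps)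
  ultimately show ?thesis by metis
 qed
qed (use t01 cont_b b_pos b_t0 b_t1 b_deriv0 b0 b_deriv1 b1 a_t0 a_t1 bb1_t0 bb1_t1 p_pos in auto)

lemma shift_smooth: "smooth_singular_ode (%s. a s + bb1 s) b (%s. p s * b s) t0 t1 b0 b1 (%s. a1 s + bb2 s) bb1 bb2"
 unfolding smooth_singular_ode_def smooth_singular_ode_axioms_def
 using shift by (auto intro!: DERIV_add a_deriv bb1_deriv b_deriv continuous_intros a1_cont bb2_cont bb1_t0 bb1_t1)

lemma shift_reg2:
 assumes y: "reg2 y k" and k: "continuous_on {t0..t1} k"
  and dk: "!!s. t0 < s ==> s < t1 ==> (k has_real_derivative k' s) (at s)"
  and l: "!!s. t0 < s ==> s < t1 ==> l s = k' s - a1 s * y s"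
 shows "singular_ode.reg2 (%s. a s + bb1 s) b (%s. p s * b s) t0 t1 (%s. (k s - a s * y s) / b s) l"
proof -
 interpret sh: singular_ode "%s. a s + bb1 s" b "%s. p s * b s" t0 t1 b0 b1 by (rule shift)
 have lim: "((%s. p s * b s * ((k s - a s * y s) / b s)) ---> 0) (at x within S)"
  if x: "x \<in> {t0..t1}" "!!f :: real => real. continuous_on {t0..t1} f ==> (f ---> f x) (at x within S)"
  and py: "((%s. p s * y s) ---> 0) (at x within S)" and p0: "(p ---> 0) (at x within S)"
  and ev: "\<forall>\<^sub>F s in at x within S. t0 < s & s < t1" for x S
 proof -
  have "((%s. p s * k s - a s * (p s * y s)) ---> 0 * k x - a x * 0) (at x within S)"
   by (intro tendsto_intros x(2)[OF k] x(2)[OF cont_a] py p0)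
  hence "((%s. p s * k s - a s * (p s * y s)) ---> 0) (at x within S)" by simp
  thus ?thesis
  proof (rule Lim_transform_eventually)
   show "\<forall>\<^sub>F s in at x within S. p s * k s - a s * (p s * y s) = p s * b s * ((k s - a s * y s) / b s)"
   using ev by eventually_elim (use b_pos in "force simp: field_simps")
  qed
 qed
 interpret m: singular_ode "%s. - a (- s)" "%s. b (- s)" "%s. p (- s)" "- t1" "- t0" b1 b0 by (rule mirror)
 have pl: "(p ---> 0) (at_left t1)" using m.p_tendsto_0 by (simp add: at_right_minus filterlim_filtermap)
 have c0: "(f ---> f t0) (at_right t0)" and c1: "(f ---> f t1) (at_left t1)" if f: "continuous_on {t0..t1} f" for f :: "real => real"
 proof -
  have "(f ---> f t0) (at t0 within {t0..t1})" "(f ---> f t1) (at t1 within {t0..t1})" using f t01 by (auto simp: continuous_on_def)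
  thus "(f ---> f t0) (at_right t0)" "(f ---> f t1) (at_left t1)"
   using t01 by (simp_all add: at_within_Icc_at_right at_within_Icc_at_left)
 qed
 show ?thesis unfolding sh.reg2_def
 proof (intro conjI allI impI)
  fix s assume s: "t0 < s" "s < t1"
  have b: "0 < b s" by (rule b_pos[OF s])
  have dy: "(y has_real_derivative (k s - a s * y s) / b s) (at s)" using y s by (auto simp: reg2_def)
  define v where "v = (k s - a s * y s) / b s"
  have "((%s. (k s - a s * y s) / b s) has_real_derivative
   ((k' s - (a1 s * y s + v * a s)) * b s - (k s - a s * y s) * bb1 s) / (b s * b s)) (at s)"
   using b unfolding v_def by (intro DERIV_divide DERIV_diff DERIV_mult dk inside dy s) auto
  moreover have "((k' s - (a1 s * y s + v * a s)) * b s - (k s - a s * y s) * bb1 s) / (b s * b s)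
   = (l s - (a s + bb1 s) * v) / b s"
  proof -
   have "k s - a s * y s = v * b s" using b by (simp add: v_def)
   thus ?thesis using b by (simp add: l[OF s] field_simps)
  qed
  ultimately show "((%s. (k s - a s * y s) / b s) has_real_derivative
   (l s - (a s + bb1 s) * ((k s - a s * y s) / b s)) / b s) (at s)" unfolding v_def by metis
 next
  show "((%s. p s * b s * ((k s - a s * y s) / b s)) ---> 0) (at_right t0)"
   by (rule lim) (use t01 c0 p_tendsto_0 y in "auto simp: reg2_def eventually_at_right_field intro!: exI[of _ t1]")
  show "((%s. p s * b s * ((k s - a s * y s) / b s)) ---> 0) (at_left t1)"
   by (rule lim) (use t01 c1 pl y in "auto simp: reg2_def eventually_at_left_field intro!: exI[of _ t0]")
 qed
qed

end


section \<open>The bifurcation branch of the singular equation\<close>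

text \<open>The nonlinearity \<open>u - u powr q\<close> at \<open>u = 1 + x\<close>, divided by
\<open>x\<close>. The remainder \<open>kap\<close> is an average of a smooth function over the
segment from \<open>0\<close> to \<open>x\<close>, hence Lipschitz.\<close>

lemma power_nonlinearity_quotient:
 fixes q :: real
 assumes q: "1 < q"
 obtains kap Lam where "0 <= Lam" "kap 0 = 0" "continuous_on {- 1 / 2..1 / 2} kap"
  "!!x. \<bar>x\<bar> <= 1 / 2 ==> (1 + x) - (1 + x) powr q = x * (kap x - (q - 1))"
  "!!x y. \<bar>x\<bar> <= 1 / 2 ==> \<bar>y\<bar> <= 1 / 2 ==> \<bar>kap x - kap y\<bar> <= Lam * \<bar>x - y\<bar>"
proof -
 define m where "m y = q - q * (1 + y) powr (q - 1)" for y :: real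
 have "continuous_on {- 1 / 2..1 / 2 :: real} (%y. - (q * (q - 1) * (1 + y) powr (q - 2)))" by (intro continuous_intros) auto
 from compact_imp_bounded[OF compact_continuous_image[OF this]]
 obtain Lam where "\<forall>y\<in>{- 1 / 2..1 / 2}. norm (- (q * (q - 1) * (1 + y) powr (q - 2))) <= Lam"
  unfolding bounded_iff by (auto simp del: norm_minus_cancel)
 hence Lam: "!!y. y \<in> {- 1 / 2..1 / 2} ==> norm (- (q * (q - 1) * (1 + y) powr (q - 2))) <= Lam" by blast
 have Lam0: "0 <= Lam" using order_trans[OF norm_ge_zero Lam[of 0]] by simp
 have Dm: "(m has_real_derivative - (q * (q - 1) * (1 + y) powr (q - 2))) (at y)" if "y \<in> {- 1 / 2..1 / 2}" for y
  unfolding m_def using that by (auto intro!: derivative_eq_intros)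
 have mlip: "\<bar>m x - m y\<bar> <= Lam * \<bar>x - y\<bar>" if "\<bar>x\<bar> <= 1 / 2" "\<bar>y\<bar> <= 1 / 2" for x y
 proof -
  have "norm (m x - m y) <= Lam * norm (x - y)"
  proof (rule field_differentiable_bound[where S = "{- 1 / 2..1 / 2}" and f' = "%y. - (q * (q - 1) * (1 + y) powr (q - 2))"])
   show "(m has_real_derivative - (q * (q - 1) * (1 + z) powr (q - 2))) (at z within {- 1 / 2..1 / 2})"
   if "z \<in> {- 1 / 2..1 / 2}" for z by (rule has_field_derivative_at_within[OF Dm[OF that]])
  qed (use Lam that in "auto simp: abs_le_iff")
  thus ?thesis by simp
 qed
 have mcont: "continuous_on {- 1 / 2..1 / 2} m"
  using Dm by (intro DERIV_continuous_on[of _ _ "%y. - (q * (q - 1) * (1 + y) powr (q - 2))"]) (auto intro: has_field_derivative_at_within)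
 define kap where "kap x = integral {0..1} (%sgm. m (sgm * x))" for x
 have small: "\<bar>sgm * x\<bar> <= 1 / 2" if "\<bar>x\<bar> <= 1 / 2" "sgm \<in> {0..1}" for sgm x :: real
  using that mult_mono[of "\<bar>sgm\<bar>" 1 "\<bar>x\<bar>" "1 / 2"] by (auto simp: abs_mult)
 have int: "(%sgm. m (sgm * x)) integrable_on {0..1}" if "\<bar>x\<bar> <= 1 / 2" for x
 proof -
  have "sgm * x \<in> {- 1 / 2..1 / 2}" if "sgm \<in> {0..1}" for sgm
   using small[OF \<open>\<bar>x\<bar> <= 1 / 2\<close> that] unfolding abs_le_iff by simp
  thus ?thesis by (intro integrable_continuous_real continuous_on_compose2[OF mcont] continuous_intros) auto
 qed
 have lip: "\<bar>kap x - kap y\<bar> <= Lam * \<bar>x - y\<bar>" if x: "\<bar>x\<bar> <= 1 / 2" and y: "\<bar>y\<bar> <= 1 / 2" for x y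
 proof -
  have "norm (integral {0..1} (%sgm. m (sgm * x) - m (sgm * y))) <= integral {0..1} (%sgm::real. Lam * \<bar>x - y\<bar>)"
  proof (rule integral_norm_bound_integral)
   fix sgm :: real assume sgm: "sgm \<in> {0..1}"
   have "\<bar>m (sgm * x) - m (sgm * y)\<bar> <= Lam * \<bar>sgm * x - sgm * y\<bar>" by (intro mlip small x y sgm)
   also have "\<bar>sgm * x - sgm * y\<bar> = \<bar>sgm\<bar> * \<bar>x - y\<bar>" by (simp flip: abs_mult add: right_diff_distrib)
   also have "Lam * (\<bar>sgm\<bar> * \<bar>x - y\<bar>) <= Lam * (1 * \<bar>x - y\<bar>)"
   using sgm Lam0 by (intro mult_left_mono mult_right_mono) auto
   finally show "norm (m (sgm * x) - m (sgm * y)) <= Lam * \<bar>x - y\<bar>" by simp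
  qed (auto intro!: integrable_diff int x y)
  thus ?thesis using int[OF x] int[OF y] by (simp add: kap_def integral_diff)
 qed
 have eq: "(1 + x) - (1 + x) powr q = x * (kap x - (q - 1))" if x: "\<bar>x\<bar> <= 1 / 2" for x
 proof -
  define e where "e y = q * y - (1 + y) powr q" for y :: real
  have "((%sgm. m (sgm * x) * x) has_integral e (1 * x) - e (0 * x)) {0..1}"
  proof (rule fundamental_theorem_of_calculus)
   fix sgm :: real assume sgm: "sgm \<in> {0..1}"
   have "0 < 1 + sgm * x" using small[OF x sgm] by (auto simp: abs_le_iff)
   hence "(e has_real_derivative m (sgm * x)) (at (sgm * x))" unfolding e_def m_def by (auto intro!: derivative_eq_intros)
   hence "((%sgm. e (sgm * x)) has_real_derivative m (sgm * x) * x) (at sgm)"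
   by (rule DERIV_chain2) (auto intro!: derivative_eq_intros)
   thus "((%sgm. e (sgm * x)) has_vector_derivative m (sgm * x) * x) (at sgm within {0..1})"
   by (simp add: has_real_derivative_iff_has_vector_derivative has_vector_derivative_at_within)
  qed simp
  from integral_unique[OF this] have "kap x * x = e x - e 0" by (simp add: kap_def)
  thus ?thesis by (simp add: e_def algebra_simps)
 qed
 have "continuous_on {- 1 / 2..1 / 2} kap" by (rule lipschitz_on_continuous_on[of Lam])
   (use lip Lam0 in "auto simp: lipschitz_on_def dist_real_def abs_le_iff")
 moreover have "kap 0 = 0" by (simp add: kap_def m_def)
 ultimately show ?thesis using that[OF Lam0 _ _ eq lip] by blast
qed

context singular_eigen
begin

lemma ip_diff:
 assumes "continuous_on {t0..t1} z" "continuous_on {t0..t1} z'"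
 shows "ip (%s. z s - z' s) = ip z - ip z'"
proof -
 have "ip (%s. z s - z' s) = integral {t0..t1} (%s. om s * (z s * w0 s) - om s * (z' s * w0 s))"
  by (rule integral_cong) (simp add: algebra_simps)
 also have "... = ip z - ip z'"
  by (intro Henstock_Kurzweil_Integration.integral_diff om_integrable_on continuous_intros assms w0_cont)
 finally show ?thesis .
qed

lemma ip_cmult: "ip (%s. c * z s) = c * ip z"
proof -
 have "ip (%s. c * z s) = integral {t0..t1} (%s. c * (om s * (z s * w0 s)))" by (rule integral_cong) (simp add: algebra_simps)
 thus ?thesis by simp
qed

lemma abs_ip_le:
 obtains W where "0 <= W" "!!h eps. continuous_on {t0..t1} h ==> (!!s. s \<in> {t0..t1} ==> \<bar>h s\<bar> <= eps) ==>
  \<bar>ip h / ip w0\<bar> <= W * eps"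
proof -
 define W where "W = integral {t0..t1} (%s. om s * \<bar>w0 s\<bar>)"
 have W0: "0 <= W" unfolding W_def
  by (rule integral_nonneg) (auto intro!: om_integrable_on continuous_intros w0_cont mult_nonneg_nonneg om_nonneg)
 have "\<bar>ip h / ip w0\<bar> <= W / ip w0 * eps"
  if "continuous_on {t0..t1} h" "!!s. s \<in> {t0..t1} ==> \<bar>h s\<bar> <= eps" for h eps
  using om_integral_abs_le[OF that(1) w0_cont that(2)] ip_w0_pos by (simp add: W_def field_simps)
 moreover have "0 <= W / ip w0" using W0 ip_w0_pos by simp
 ultimately show ?thesis using that by blast
qed

text \<open>Here \<open>u = 1 + t w\<close>. The multiplier \<open>lam\<close> is chosen so that
the right hand side is orthogonal to \<open>w0\<close>, and the normalisation \<open>ip w = ip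
w0\<close> fixes the component of \<open>w\<close> along \<open>w0\<close>. The right hand side is
of order \<open>t\<close> together with its Lipschitz constant in \<open>w\<close>, so for small
\<open>t\<close> the solution operator of the linear problem yields a contraction.\<close>

theorem bifurcation_branch:
 fixes q :: real
 assumes q: "1 < q" and kap: "0 <= Lam" "kap 0 = 0" "continuous_on {- 1 / 2..1 / 2} kap"
  and lip: "!!x y. \<bar>x\<bar> <= 1 / 2 ==> \<bar>y\<bar> <= 1 / 2 ==> \<bar>kap x - kap y\<bar> <= Lam * \<bar>x - y\<bar>"
 obtains eps W Y lam L where "0 < eps" "lam 0 = \<mu> / (q - 1)"
  "!!t. \<bar>t\<bar> <= eps ==> 0 < lam t & bvp_sol (W t) (Y t) (%s. lam t * (W t s * (kap (t * W t s) - (q - 1))))"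
  "!!t s. \<bar>t\<bar> <= eps ==> s \<in> {t0..t1} ==> \<bar>t * W t s\<bar> <= 1 / 2"
  "!!t. \<bar>t\<bar> <= eps ==> \<exists>s\<in>{t0..t1}. W t s ~= 0"
  "!!t t' s. \<bar>t\<bar> <= eps ==> \<bar>t'\<bar> <= eps ==> s \<in> {t0..t1} ==> \<bar>W t s - W t' s\<bar> <= L * \<bar>t - t'\<bar>"
  "!!t t'. \<bar>t\<bar> <= eps ==> \<bar>t'\<bar> <= eps ==> \<bar>lam t - lam t'\<bar> <= L * \<bar>t - t'\<bar>"
proof -
 let ?I = "{t0..t1}"
 obtain B where B: "0 <= B" "!!s. s \<in> ?I ==> \<bar>w0 s\<bar> <= B" using w0_bounded by blast
 obtain V where V: "0 <= V" "!!h eps. continuous_on ?I h ==> (!!s. s \<in> ?I ==> \<bar>h s\<bar> <= eps) ==>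
  \<bar>ip h / ip w0\<bar> <= V * eps" using abs_ip_le by blast
 obtain C where C: "0 <= C" "!!z y h s eps. bvp_sol z y (%s. h s - \<mu> * z s) ==> ip z = 0 ==>
   (!!x. x \<in> ?I ==> \<bar>h x\<bar> <= eps) ==> s \<in> ?I ==> \<bar>z s\<bar> <= C * eps"
  by (rule bvp_sol_stable) (blast intro: that)
 define R where "R = B + 1"
 define Aa where "Aa = 2 * Lam * R + Lam * R\<^sup>2"
 define M where "M = 2 * \<mu> / (q - 1)"
 define A1 where "A1 = Aa * (1 + V * R + V)"
 define A2 where "A2 = M * A1 + 4 * \<mu> / (q - 1)\<^sup>2 * (V * Aa) * A1"
 define A3 where "A3 = M * A1"
 have R: "1 <= R" using B by (simp add: R_def)
 have Aa0: "0 <= Aa" using kap R by (simp add: Aa_def)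
 have M0: "0 < M" using \<mu> q by (simp add: M_def)
 have A10: "0 <= A1" using Aa0 V R by (simp add: A1_def)
 have A20: "0 <= A2" using A10 M0 \<mu> q V Aa0 by (simp add: A2_def)
 have A30: "0 <= A3" using A10 M0 by (simp add: A3_def)
 define S where "S = 1 + 2 * R + 2 * (V * Aa) / (q - 1) + C * A3 + 2 * (C * A2)"
 define tau where "tau = 1 / S"
 have pos: "0 <= 2 * (V * Aa) / (q - 1)" "0 <= C * A3" "0 <= C * A2" using V Aa0 q C A30 A20 by auto
 have S: "1 <= S" "2 * R <= S" "2 * (V * Aa) / (q - 1) <= S" "C * A3 <= S" "2 * (C * A2) <= S" using pos R by (auto simp: S_def)
 have tau0: "0 < tau" using S by (simp add: tau_def)
 have tauS: "x * tau <= 1" if "x <= S" for x using that S by (simp add: tau_def)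
 have tau: "tau <= 1" "tau * R <= 1 / 2" "V * (Aa * tau) <= (q - 1) / 2" "C * (A3 * tau) <= 1" "C * A2 * tau <= 1 / 2"
  using tauS[OF S(1)] tauS[OF S(2)] tauS[OF S(3)] tauS[OF S(4)] tauS[OF S(5)] q by (simp_all add: field_simps)
 define E where "E t w s = w s * kap (t * w s)" for t and w :: "real => real" and s
 \<comment> \<open>With this value of \<open>c\<close> the function \<open>H t w\<close> below is orthogonal to \<open>w0\<close>.\<close>
 define c where "c t w = ip (E t w) / ip w0" for t w
 define l where "l t w = \<mu> / ((q - 1) - c t w)" for t w
 define H where "H t w s = l t w * (E t w s - c t w * w s)" for t w s
 define P where "P w \<longleftrightarrow> continuous_on ?I w & (\<forall>s\<in>?I. \<bar>w s - w0 s\<bar> <= 1) & ip w = ip w0" for w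
 have wR: "\<bar>w s\<bar> <= R" if "P w" "s \<in> ?I" for w s
 proof -
  have "\<bar>w s - w0 s\<bar> <= 1" using that by (auto simp: P_def)
  thus ?thesis using B(2)[OF that(2)] by (simp add: R_def)
 qed
 have small: "\<bar>t * w s\<bar> <= 1 / 2" if "P w" "s \<in> ?I" "\<bar>t\<bar> <= tau" for t w s
  using mult_mono[OF that(3) wR[OF that(1,2)]] tau0 tau(2) by (simp add: abs_mult)
 have Econt: "continuous_on ?I (E t w)" if "P w" "\<bar>t\<bar> <= tau" for t w
 proof -
  have wc: "continuous_on ?I w" using that by (simp add: P_def)
  have "t * w s \<in> {- 1 / 2..1 / 2}" if "s \<in> ?I" for s
   using small[OF \<open>P w\<close> that \<open>\<bar>t\<bar> <= tau\<close>] unfolding abs_le_iff by simp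
  thus ?thesis unfolding E_def by (intro continuous_intros continuous_on_compose2[OF kap(3)] wc) auto
 qed
 have Ebd: "\<bar>E t w s\<bar> <= Aa * tau" if w: "P w" "s \<in> ?I" "\<bar>t\<bar> <= tau" for t w s
 proof -
  have "\<bar>kap (t * w s)\<bar> <= Lam * \<bar>t * w s\<bar>" using lip[OF small[OF w], of 0] kap(2) by simp
  also have "... <= Lam * (tau * R)" unfolding abs_mult using w wR[OF w(1,2)] kap(1) tau0 by (intro mult_left_mono mult_mono) auto
  finally have "\<bar>E t w s\<bar> <= R * (Lam * (tau * R))" unfolding E_def abs_mult using wR[OF w(1,2)] by (intro mult_mono) auto
  also have "... <= Aa * tau" using kap(1) R tau0 by (simp add: Aa_def power2_eq_square algebra_simps)
  finally show ?thesis .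
 qed
 have Elip: "\<bar>E t w s - E t' w' s\<bar> <= Aa * (tau * e + \<bar>t - t'\<bar>)"
  if w: "P w" "P w'" "s \<in> ?I" "\<bar>t\<bar> <= tau" "\<bar>t'\<bar> <= tau" "\<bar>w s - w' s\<bar> <= e" for t t' w w' s e
 proof -
  have e0: "0 <= e" using w(6) by linarith
  have k1: "\<bar>kap (t * w s)\<bar> <= Lam * (tau * R)"
  proof -
   have "\<bar>kap (t * w s)\<bar> <= Lam * \<bar>t * w s\<bar>" using lip[OF small[OF w(1,3,4)], of 0] kap(2) by simp
   also have "... <= Lam * (tau * R)" unfolding abs_mult using w wR[OF w(1,3)] kap(1) tau0 by (intro mult_left_mono mult_mono) auto
   finally show ?thesis .
  qed
  have "t * w s - t' * w' s = t * (w s - w' s) + (t - t') * w' s" by (simp add: algebra_simps)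
  hence "\<bar>t * w s - t' * w' s\<bar> <= \<bar>t\<bar> * \<bar>w s - w' s\<bar> + \<bar>t - t'\<bar> * \<bar>w' s\<bar>"
   by (metis abs_mult abs_triangle_ineq)
  also have "... <= tau * e + \<bar>t - t'\<bar> * R" using w wR[OF w(2,3)] tau0 by (intro add_mono mult_mono) auto
  finally have tw: "\<bar>t * w s - t' * w' s\<bar> <= tau * e + \<bar>t - t'\<bar> * R" .
  have k2: "\<bar>kap (t * w s) - kap (t' * w' s)\<bar> <= Lam * (tau * e + \<bar>t - t'\<bar> * R)"
   using lip[OF small[OF w(1,3,4)] small[OF w(2,3,5)]] mult_left_mono[OF tw kap(1)] by linarith
  have "E t w s - E t' w' s = (w s - w' s) * kap (t * w s) + w' s * (kap (t * w s) - kap (t' * w' s))"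
   by (simp add: E_def algebra_simps)
  hence "\<bar>E t w s - E t' w' s\<bar> <= \<bar>w s - w' s\<bar> * \<bar>kap (t * w s)\<bar> + \<bar>w' s\<bar> * \<bar>kap (t * w s) - kap (t' * w' s)\<bar>"
   by (metis abs_mult abs_triangle_ineq)
  also have "... <= e * (Lam * (tau * R)) + R * (Lam * (tau * e + \<bar>t - t'\<bar> * R))"
   using w k1 k2 wR[OF w(2,3)] R e0 by (intro add_mono mult_mono) auto
  also have "... = 2 * Lam * R * (tau * e) + Lam * R\<^sup>2 * \<bar>t - t'\<bar>" by (simp add: algebra_simps power2_eq_square)
  also have "... <= Aa * (tau * e) + Aa * \<bar>t - t'\<bar>"
   using kap(1) R tau0 e0 by (intro add_mono mult_right_mono) (auto simp: Aa_def)
  finally show ?thesis by (simp add: algebra_simps)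
 qed
 have cbd: "\<bar>c t w\<bar> <= V * (Aa * tau)" if "P w" "\<bar>t\<bar> <= tau" for t w
  unfolding c_def by (rule V(2)[OF Econt[OF that] Ebd[OF that(1) _ that(2)]])
 have clip: "\<bar>c t w - c t' w'\<bar> <= V * (Aa * (tau * e + \<bar>t - t'\<bar>))"
  if w: "P w" "P w'" "\<bar>t\<bar> <= tau" "\<bar>t'\<bar> <= tau" "!!s. s \<in> ?I ==> \<bar>w s - w' s\<bar> <= e" for t t' w w' e
 proof -
  have "c t w - c t' w' = ip (%s. E t w s - E t' w' s) / ip w0" by (simp add: c_def ip_diff Econt w diff_divide_distrib)
  also have "\<bar>...\<bar> <= V * (Aa * (tau * e + \<bar>t - t'\<bar>))"
   by (rule V(2)) (intro continuous_intros Econt w, rule Elip[OF w(1,2) _ w(3,4) w(5)])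
  finally show ?thesis .
 qed
 have den: "(q - 1) / 2 <= (q - 1) - c t w" if "P w" "\<bar>t\<bar> <= tau" for t w
  using cbd[OF that] tau(3) by (simp add: abs_le_iff)
 have lpos: "0 < l t w" and lbd: "l t w <= M" if "P w" "\<bar>t\<bar> <= tau" for t w
 proof -
  have d: "0 < (q - 1) / 2" "(q - 1) / 2 <= (q - 1) - c t w" using q den[OF that] by auto
  hence d': "0 < (q - 1) - c t w" by linarith
  show "0 < l t w" unfolding l_def using \<mu> d' by simp
  have "\<mu> / ((q - 1) - c t w) <= \<mu> / ((q - 1) / 2)" using d d' \<mu> by (intro divide_left_mono) auto
  thus "l t w <= M" by (simp add: l_def M_def mult.commute)
 qed
 have llip: "\<bar>l t w - l t' w'\<bar> <= 4 * \<mu> / (q - 1)\<^sup>2 * (V * Aa) * (tau * e + \<bar>t - t'\<bar>)"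
  if w: "P w" "P w'" "\<bar>t\<bar> <= tau" "\<bar>t'\<bar> <= tau" "!!s. s \<in> ?I ==> \<bar>w s - w' s\<bar> <= e" for t t' w w' e
 proof -
  define x where "x = (q - 1) - c t w" define y where "y = (q - 1) - c t' w'"
  have xy: "(q - 1) / 2 <= x" "(q - 1) / 2 <= y" using den w by (auto simp: x_def y_def)
  have h: "0 < (q - 1) / 2" using q by simp
  have xy0: "0 < x" "0 < y" using xy h by linarith+
  have "l t w - l t' w' = \<mu> * (y - x) / (x * y)"
   unfolding l_def x_def[symmetric] y_def[symmetric] using xy0 by (simp add: field_simps)
  also have "\<bar>...\<bar> = \<mu> * \<bar>y - x\<bar> / (x * y)" using \<mu> xy0 by (simp add: abs_mult)
  also have "... <= \<mu> * \<bar>y - x\<bar> / ((q - 1) / 2 * ((q - 1) / 2))"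
   using xy xy0 h \<mu> by (intro divide_left_mono mult_mono) auto
  also have "... = 4 * \<mu> / (q - 1)\<^sup>2 * \<bar>c t w - c t' w'\<bar>" by (simp add: x_def y_def power2_eq_square)
  also have "... <= 4 * \<mu> / (q - 1)\<^sup>2 * (V * (Aa * (tau * e + \<bar>t - t'\<bar>)))"
   using clip[OF w] \<mu> by (intro mult_left_mono) auto
  finally show ?thesis by (simp add: mult.assoc)
 qed
 define F where "F t w s = E t w s - c t w * w s" for t w s
 have Fbd: "\<bar>F t w s\<bar> <= A1 * tau" if w: "P w" "s \<in> ?I" "\<bar>t\<bar> <= tau" for t w s
 proof -
  have "\<bar>F t w s\<bar> <= \<bar>E t w s\<bar> + \<bar>c t w\<bar> * \<bar>w s\<bar>"
   unfolding F_def by (metis abs_mult abs_triangle_ineq4)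
  also have "... <= Aa * tau + V * (Aa * tau) * R"
   using Ebd[OF w] cbd[OF w(1,3)] wR[OF w(1,2)] V Aa0 tau0 by (intro add_mono mult_mono) auto
  also have "... <= A1 * tau" using V Aa0 tau0 by (simp add: A1_def algebra_simps)
  finally show ?thesis .
 qed
 have Flip: "\<bar>F t w s - F t' w' s\<bar> <= A1 * (tau * e + \<bar>t - t'\<bar>)"
  if w: "P w" "P w'" "\<bar>t\<bar> <= tau" "\<bar>t'\<bar> <= tau" "!!s. s \<in> ?I ==> \<bar>w s - w' s\<bar> <= e" and s: "s \<in> ?I" for t t' w w' e s
 proof -
  define dlt where "dlt = tau * e + \<bar>t - t'\<bar>"
  have e0: "0 <= e" using order_trans[OF abs_ge_zero w(5)[OF s]] .
  have dlte: "tau * e <= dlt" by (simp add: dlt_def)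
  have d0: "0 <= dlt" using tau0 e0 by (simp add: dlt_def)
  have eq: "F t w s - F t' w' s = (E t w s - E t' w' s) - ((c t w - c t' w') * w s + c t' w' * (w s - w' s))"
   by (simp add: F_def algebra_simps)
  have tri: "\<bar>x - (y + z)\<bar> <= \<bar>x\<bar> + (\<bar>y\<bar> + \<bar>z\<bar>)" for x y z :: real by linarith
  have "\<bar>F t w s - F t' w' s\<bar> <= \<bar>E t w s - E t' w' s\<bar> + (\<bar>c t w - c t' w'\<bar> * \<bar>w s\<bar> + \<bar>c t' w'\<bar> * \<bar>w s - w' s\<bar>)"
   unfolding eq abs_mult[symmetric] by (rule tri)
  also have "... <= Aa * dlt + (V * (Aa * dlt) * R + V * (Aa * tau) * e)"
   using Elip[OF w(1,2) s w(3,4) w(5)[OF s]] clip[OF w] cbd[OF w(2,4)] wR[OF w(1) s] w(5)[OF s] V Aa0 tau0 d0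
   unfolding dlt_def[symmetric] by (intro add_mono mult_mono) auto
  also have "V * (Aa * tau) * e <= V * Aa * dlt" using mult_left_mono[OF dlte, of "V * Aa"] V Aa0 by (simp add: mult.assoc)
  finally show ?thesis unfolding dlt_def[symmetric] by (simp add: A1_def algebra_simps)
 qed
 have Heq: "H t w s = l t w * F t w s" for t w s by (simp add: H_def F_def)
 have Hbd: "\<bar>H t w s\<bar> <= A3 * tau" if w: "P w" "s \<in> ?I" "\<bar>t\<bar> <= tau" for t w s
 proof -
  have "\<bar>H t w s\<bar> <= M * (A1 * tau)"
   unfolding Heq abs_mult using lpos[OF w(1,3)] lbd[OF w(1,3)] Fbd[OF w] M0 by (intro mult_mono) auto
  thus ?thesis by (simp add: A3_def mult.assoc)
 qed
 have Hlip: "\<bar>H t w s - H t' w' s\<bar> <= A2 * (tau * e + \<bar>t - t'\<bar>)"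
  if w: "P w" "P w'" "\<bar>t\<bar> <= tau" "\<bar>t'\<bar> <= tau" "!!s. s \<in> ?I ==> \<bar>w s - w' s\<bar> <= e" and s: "s \<in> ?I" for t t' w w' e s
 proof -
  define dlt where "dlt = tau * e + \<bar>t - t'\<bar>"
  have e0: "0 <= e" using order_trans[OF abs_ge_zero w(5)[OF s]] .
  have d0: "0 <= dlt" using tau0 e0 by (simp add: dlt_def)
  define G where "G = 4 * \<mu> / (q - 1)\<^sup>2 * (V * Aa)"
  have G0: "0 <= G" using \<mu> V Aa0 by (simp add: G_def)
  have "H t w s - H t' w' s = l t w * (F t w s - F t' w' s) + (l t w - l t' w') * F t' w' s" by (simp add: Heq algebra_simps)
  hence "\<bar>H t w s - H t' w' s\<bar> <= \<bar>l t w\<bar> * \<bar>F t w s - F t' w' s\<bar> + \<bar>l t w - l t' w'\<bar> * \<bar>F t' w' s\<bar>"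
   by (metis abs_mult abs_triangle_ineq)
  also have "... <= M * (A1 * dlt) + G * dlt * (A1 * tau)"
   using lpos[OF w(1,3)] lbd[OF w(1,3)] Flip[OF w s] llip[OF w] Fbd[OF w(2) s w(4)] M0 G0 d0
   unfolding dlt_def[symmetric] G_def[symmetric] by (intro add_mono mult_mono) auto
  also have "G * dlt * (A1 * tau) <= G * dlt * (A1 * 1)" using G0 d0 A10 tau(1) by (intro mult_left_mono) auto
  finally show ?thesis unfolding dlt_def[symmetric] A2_def G_def[symmetric] by (simp add: algebra_simps)
 qed
 have Hcont: "continuous_on ?I (H t w)" if "P w" "\<bar>t\<bar> <= tau" for t w
  unfolding H_def by (intro continuous_intros Econt that) (use that in "simp add: P_def")
 have Horth: "ip (H t w) = 0" if "P w" "\<bar>t\<bar> <= tau" for t w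
 proof -
  have "ip (H t w) = l t w * ip (%s. E t w s - c t w * w s)" unfolding H_def by (rule ip_cmult)
  also have "ip (%s. E t w s - c t w * w s) = ip (E t w) - ip (%s. c t w * w s)"
   by (rule ip_diff) (use that Econt in "auto intro!: continuous_intros simp: P_def")
  also have "... = 0" using that ip_w0_pos unfolding ip_cmult by (simp add: P_def c_def)
  finally show ?thesis by simp
 qed
 have "EX K. ALL h. continuous_on ?I h & ip h = 0 --> (EX y. bvp_sol (K h) y (%s. h s - \<mu> * K h s)) & ip (K h) = 0"
  using bvp_sol_exists by (intro choice) blast
 then obtain K where K: "!!h. continuous_on ?I h ==> ip h = 0 ==> (EX y. bvp_sol (K h) y (%s. h s - \<mu> * K h s)) & ip (K h) = 0"
  by blast
 have Kdiff: "\<bar>K h s - K h' s\<bar> <= C * e" if h: "continuous_on ?I h" "ip h = 0" "continuous_on ?I h'" "ip h' = 0"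
  "!!x. x \<in> ?I ==> \<bar>h x - h' x\<bar> <= e" and s: "s \<in> ?I" for h h' e s
 proof -
  obtain y y' where y: "bvp_sol (K h) y (%s. h s - \<mu> * K h s)" "bvp_sol (K h') y' (%s. h' s - \<mu> * K h' s)"
   using K[OF h(1,2)] K[OF h(3,4)] by blast
  have sol: "bvp_sol (%s. K h s - K h' s) (%s. y s - y' s) (%s. (h s - h' s) - \<mu> * (K h s - K h' s))"
   by (rule bvp_sol_cong[OF bvp_sol_diff[OF y]]) (simp add: algebra_simps)
  have ip0: "ip (%s. K h s - K h' s) = 0"
   using ip_diff[OF bvp_solD(1)[OF y(1)] bvp_solD(1)[OF y(2)]] K[OF h(1,2)] K[OF h(3,4)] by simp
  show ?thesis by (rule C(2)[OF sol ip0 h(5) s])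
 qed
 define Phi where "Phi t w s = w0 s + K (H t w) s" for t w s
 have Pw0: "P w0" using w0_cont by (simp add: P_def)
 have PPhi: "P (Phi t w)" if w: "P w" "\<bar>t\<bar> <= tau" for t w
 proof -
  obtain y where y: "bvp_sol (K (H t w)) y (%s. H t w s - \<mu> * K (H t w) s)" and 0: "ip (K (H t w)) = 0"
   using K[OF Hcont[OF w] Horth[OF w]] by blast
  have "continuous_on ?I (Phi t w)" unfolding Phi_def by (intro continuous_intros w0_cont bvp_solD(1)[OF y])
  moreover have "\<bar>Phi t w s - w0 s\<bar> <= 1" if s: "s \<in> ?I" for s
   using C(2)[OF y 0 Hbd[OF w(1) _ w(2)] s] tau(4) by (simp add: Phi_def)
  moreover have "ip (Phi t w) = ip w0" using ip_diff[OF calculation(1) bvp_solD(1)[OF y]] 0 by (simp add: Phi_def)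
  ultimately show ?thesis by (auto simp: P_def)
 qed
 have Pclosed: "P w" if v: "!!n::nat. P (v n)" and ul: "uniform_limit ?I v w sequentially" for v w
 proof -
  have wc: "continuous_on ?I w" by (rule uniform_limit_theorem[OF _ ul]) (use v in "auto simp: P_def")
  have "\<bar>w s - w0 s\<bar> <= 1" if s: "s \<in> ?I" for s
  proof (rule tendsto_upperbound)
   show "(%n. \<bar>v n s - w0 s\<bar>) \<longlonglongrightarrow> \<bar>w s - w0 s\<bar>" by (intro tendsto_intros tendsto_uniform_limitI[OF ul s])
   show "\<forall>\<^sub>F n in sequentially. \<bar>v n s - w0 s\<bar> <= 1" using v s by (simp add: P_def)
  qed simp
  moreover have "ip w = ip w0"
  proof -
   have "\<bar>(ip w - ip w0) / ip w0\<bar> <= V * e" if e: "0 < e" for e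
   proof -
   obtain n where "\<forall>m\<ge>n. \<forall>s\<in>?I. dist (v m s) (w s) < e"
   using uniform_limitD[OF ul e] by (auto simp: eventually_sequentially)
   hence n: "!!s. s \<in> ?I ==> dist (v n s) (w s) < e" by blast
   have "\<bar>ip (%s. w s - v n s) / ip w0\<bar> <= V * e"
   by (rule V(2)) (use wc v n in "auto intro!: continuous_intros less_imp_le simp: P_def dist_real_def abs_minus_commute")
   moreover have "ip (%s. w s - v n s) = ip w - ip w0" using ip_diff[OF wc, of "v n"] v[of n] by (simp add: P_def)
   ultimately show ?thesis by simp
   qed
   hence "\<bar>(ip w - ip w0) / ip w0\<bar> <= e" if "0 < e" for e
   proof -
   have "\<bar>(ip w - ip w0) / ip w0\<bar> <= V * (e / (V + 1))"
   using \<open>!!e. 0 < e ==> \<bar>(ip w - ip w0) / ip w0\<bar> <= V * e\<close>[of "e / (V + 1)"] that V(1) by simp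
   also have "... <= e" using that V(1) by (simp add: field_simps)
   finally show ?thesis .
   qed
   hence "\<bar>(ip w - ip w0) / ip w0\<bar> <= 0" by (rule field_le_epsilon[of _ 0, simplified])
   hence "(ip w - ip w0) / ip w0 = 0" by linarith
   thus ?thesis using ip_w0_pos by (simp only: divide_eq_0_iff) auto
  qed
  ultimately show ?thesis using wc by (auto simp: P_def)
 qed
 have fixp: "EX w. P w & (\<forall>s\<in>?I. Phi t w s = w s)" if t: "\<bar>t\<bar> <= tau" for t
 proof (rule weighted_contraction_fixpoint[of P w0 "Phi t" ?I "%s. 1" "1 / 2" 1 1])
  show "P w0" by (rule Pw0)
  show "P (Phi t w)" if "P w" for w by (rule PPhi[OF that t])
  show "P w" if "!!n::nat. P (v n)" "uniform_limit ?I v w sequentially" for v w by (rule Pclosed[OF that])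
  show "\<bar>Phi t w s - Phi t w' s\<bar> <= 1 / 2 * e * 1"
   if w: "P w" "P w'" and e: "!!s. s \<in> ?I ==> \<bar>w s - w' s\<bar> <= e * 1" and s: "s \<in> ?I" for w w' e s
  proof -
   have e': "!!s. s \<in> ?I ==> \<bar>w s - w' s\<bar> <= e" using e by simp
   have e0: "0 <= e" using order_trans[OF abs_ge_zero e'[OF s]] .
   have "\<bar>K (H t w) s - K (H t w') s\<bar> <= C * (A2 * (tau * e + \<bar>t - t\<bar>))"
   by (rule Kdiff[OF Hcont[OF w(1) t] Horth[OF w(1) t] Hcont[OF w(2) t] Horth[OF w(2) t] Hlip[OF w t t e'] s])
   also have "... = C * A2 * tau * e" by simp
   also have "... <= 1 / 2 * e" using tau(5) e0 by (intro mult_right_mono) auto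
   finally show ?thesis by (simp add: Phi_def)
  qed
  show "\<bar>Phi t w0 s - w0 s\<bar> <= 1 * 1" if "s \<in> ?I" for s using PPhi[OF Pw0 t] that by (simp add: P_def)
 qed auto
 have "EX w. ALL t. \<bar>t\<bar> <= tau --> P (w t) & (\<forall>s\<in>?I. Phi t (w t) s = w t s)"
  using fixp by (intro choice) blast
 then obtain w where w: "!!t. \<bar>t\<bar> <= tau ==> P (w t)" "!!t s. \<bar>t\<bar> <= tau ==> s \<in> ?I ==> Phi t (w t) s = w t s"
  by blast
 define lam where "lam t = l t (w t)" for t
 have sol: "EX y. bvp_sol (w t) y (%s. lam t * (w t s * (kap (t * w t s) - (q - 1))))" if t: "\<bar>t\<bar> <= tau" for t
 proof -
  let ?h = "H t (w t)"
  obtain y where y: "bvp_sol (K ?h) y (%s. ?h s - \<mu> * K ?h s)"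
   using K[OF Hcont[OF w(1)[OF t] t] Horth[OF w(1)[OF t] t]] by blast
  have "bvp_sol (%s. w0 s - -1 * K ?h s) (%s. y0 s - -1 * y s) (%s. - \<mu> * w0 s - -1 * (?h s - \<mu> * K ?h s))"
   by (rule bvp_sol_diff[OF eigen bvp_sol_cmult[OF y]])
  hence "bvp_sol (Phi t (w t)) (%s. y0 s - -1 * y s) (%s. ?h s - \<mu> * Phi t (w t) s)"
   by (simp add: Phi_def[abs_def] algebra_simps)
  hence 1: "bvp_sol (w t) (%s. y0 s - -1 * y s) (%s. ?h s - \<mu> * Phi t (w t) s)"
  proof -
   assume b: "bvp_sol (Phi t (w t)) (%s. y0 s - -1 * y s) (%s. ?h s - \<mu> * Phi t (w t) s)"
   have c: "continuous_on ?I (w t)" using w(1)[OF t] by (simp add: P_def)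
   have "(w t has_real_derivative y0 s - -1 * y s) (at s)" if s: "t0 < s" "s < t1" for s
   by (rule has_field_derivative_transform_within_open[OF bvp_solD(2)[OF b s], of "{t0<..<t1}"])
   (use s w(2)[OF t] in auto)
   thus ?thesis using b c unfolding bvp_sol_def prim_sol_def by auto
  qed
  have eq: "?h s - \<mu> * Phi t (w t) s = lam t * (w t s * (kap (t * w t s) - (q - 1)))" if s: "t0 < s" "s < t1" for s
  proof -
   have "\<mu> = lam t * ((q - 1) - c t (w t))" unfolding lam_def l_def using den[OF w(1)[OF t] t] q by simp
   moreover have "Phi t (w t) s = w t s" using w(2)[OF t] s by auto
   ultimately have "?h s - \<mu> * Phi t (w t) s = lam t * (E t (w t) s - c t (w t) * w t s) - lam t * ((q - 1) - c t (w t)) * w t s"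
   by (simp add: H_def lam_def)
   thus ?thesis by (simp add: E_def algebra_simps)
  qed
  show ?thesis by (rule exI, rule bvp_sol_cong[OF 1 eq])
 qed
 hence "EX Y. ALL t. \<bar>t\<bar> <= tau --> bvp_sol (w t) (Y t) (%s. lam t * (w t s * (kap (t * w t s) - (q - 1))))"
  by (intro choice) blast
 then obtain Y where Y: "!!t. \<bar>t\<bar> <= tau ==> bvp_sol (w t) (Y t) (%s. lam t * (w t s * (kap (t * w t s) - (q - 1))))"
  by blast
 have wdep: "\<bar>w t s - w t' s\<bar> <= 2 * (C * A2) * \<bar>t - t'\<bar>" if t: "\<bar>t\<bar> <= tau" "\<bar>t'\<bar> <= tau" and s: "s \<in> ?I" for t t' s
 proof -
  have "continuous_on ?I (%s. \<bar>w t s - w t' s\<bar>)"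
   using w(1)[OF t(1)] w(1)[OF t(2)] by (auto intro!: continuous_intros simp: P_def)
  then obtain x where x: "x \<in> ?I" "!!s. s \<in> ?I ==> \<bar>w t s - w t' s\<bar> <= \<bar>w t x - w t' x\<bar>"
   using continuous_attains_sup[of ?I "%s. \<bar>w t s - w t' s\<bar>"] t01 by auto
  define e where "e = \<bar>w t x - w t' x\<bar>"
  have e: "!!s. s \<in> ?I ==> \<bar>w t s - w t' s\<bar> <= e" using x(2) by (simp add: e_def)
  have "\<bar>K (H t (w t)) x - K (H t' (w t')) x\<bar> <= C * (A2 * (tau * e + \<bar>t - t'\<bar>))"
   by (rule Kdiff[OF Hcont[OF w(1)[OF t(1)] t(1)] Horth[OF w(1)[OF t(1)] t(1)] Hcont[OF w(1)[OF t(2)] t(2)]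
   Horth[OF w(1)[OF t(2)] t(2)] Hlip[OF w(1)[OF t(1)] w(1)[OF t(2)] t e] x(1)])
  moreover have "K (H t (w t)) x - K (H t' (w t')) x = w t x - w t' x"
   using w(2)[OF t(1) x(1)] w(2)[OF t(2) x(1)] by (simp add: Phi_def)
  ultimately have "e <= C * A2 * tau * e + C * A2 * \<bar>t - t'\<bar>" by (simp add: e_def algebra_simps)
  moreover have "C * A2 * tau * e <= 1 / 2 * e" using tau(5) by (intro mult_right_mono) (auto simp: e_def)
  ultimately have "e <= 2 * (C * A2) * \<bar>t - t'\<bar>" by linarith
  thus ?thesis using e[OF s] by linarith
 qed
 define L where "L = 2 * (C * A2) + 4 * \<mu> / (q - 1)\<^sup>2 * (V * Aa) * (tau * (2 * (C * A2)) + 1)"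
 have L1: "2 * (C * A2) <= L" using \<mu> V Aa0 tau0 C A20 by (simp add: L_def)
 have ldep: "\<bar>lam t - lam t'\<bar> <= L * \<bar>t - t'\<bar>" if t: "\<bar>t\<bar> <= tau" "\<bar>t'\<bar> <= tau" for t t'
 proof -
  have "\<bar>lam t - lam t'\<bar> <= 4 * \<mu> / (q - 1)\<^sup>2 * (V * Aa) * (tau * (2 * (C * A2) * \<bar>t - t'\<bar>) + \<bar>t - t'\<bar>)"
   unfolding lam_def by (rule llip[OF w(1)[OF t(1)] w(1)[OF t(2)] t wdep[OF t]])
  also have "... = 4 * \<mu> / (q - 1)\<^sup>2 * (V * Aa) * (tau * (2 * (C * A2)) + 1) * \<bar>t - t'\<bar>"
   by (simp only: distrib_right distrib_left mult.assoc mult_1)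
  also have "... <= L * \<bar>t - t'\<bar>" using C A20 by (intro mult_right_mono) (auto simp: L_def)
  finally show ?thesis .
 qed
 show ?thesis
 proof (rule that[of tau lam w Y L])
  show "lam 0 = \<mu> / (q - 1)"
  proof -
   have "E 0 (w 0) s = 0" for s by (simp add: E_def kap(2))
   hence "c 0 (w 0) = 0" by (simp add: c_def)
   thus ?thesis by (simp add: lam_def l_def)
  qed
  show "\<exists>s\<in>?I. w t s ~= 0" if t: "\<bar>t\<bar> <= tau" for t
  proof (rule ccontr)
   assume "~ ?thesis"
   hence "ip (w t) = integral ?I (%s. 0)" by (intro integral_cong) auto
   thus False using w(1)[OF t] ip_w0_pos by (simp add: P_def)
  qed
  show "\<bar>w t s - w t' s\<bar> <= L * \<bar>t - t'\<bar>" if "\<bar>t\<bar> <= tau" "\<bar>t'\<bar> <= tau" "s \<in> ?I" for t t' s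
   using wdep[OF that] mult_right_mono[OF L1, of "\<bar>t - t'\<bar>"] by simp
 qed (use tau0 Y ldep lpos[OF w(1)] small[OF w(1)] in "auto simp: lam_def")
qed

end


section \<open>Smoothness of the branch, and the flux of an eigenfunction\<close>

lemma uniform_limit_mult_continuous:
 fixes f g :: "'t => real => real"
 assumes "compact S" "uniform_limit S f f0 F" "uniform_limit S g g0 F" "continuous_on S f0" "continuous_on S g0"
 shows "uniform_limit S (%t x. f t x * g t x) (%x. f0 x * g0 x) F"
 using assms by (intro uniform_lim_mult compact_imp_bounded compact_continuous_image)

lemma uniform_limit_of_tendsto:
 fixes c :: "'t => real"
 assumes "(c ---> l) F"
 shows "uniform_limit S (%t x. c t) (%x. l) F" using assms by (auto simp: uniform_limit_iff tendsto_iff elim: eventually_mono)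

locale smooth2_singular_ode = smooth_singular_ode +
 fixes a2 :: "real => real"
 assumes a1_deriv: "!!s. s \<in> {t0..t1} ==> (a1 has_real_derivative a2 s) (at s within {t0..t1})"
  and a2_cont: "continuous_on {t0..t1} a2"
begin

text \<open>The equation is differentiated twice. Each derivative solves an equation of the same
kind, so it extends continuously to the end points and depends continuously on the right hand
side.\<close>

theorem regularity:
 fixes U Y :: "real => real => real" and lam G G1 G2 :: "real => real" and J T :: "real set"
 assumes sol: "!!t. t \<in> T ==> bvp_sol (U t) (Y t) (%s. lam t * G (U t s))"
  and J: "!!t s. t \<in> T ==> s \<in> {t0..t1} ==> U t s \<in> J" "compact J"
  and G: "!!x. x \<in> J ==> (G has_real_derivative G1 x) (at x)"
   "!!x. x \<in> J ==> (G1 has_real_derivative G2 x) (at x)" "continuous_on J G2"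
  and ul: "!!s. s \<in> T ==> uniform_limit {t0..t1} U (U s) (at s within T)"
  and lam: "continuous_on T lam"
 obtains U1 U2 U3 where
  "!!t s. t \<in> T ==> s \<in> {t0..t1} ==> (U t has_real_derivative U1 t s) (at s within {t0..t1})"
  "!!t s. t \<in> T ==> s \<in> {t0..t1} ==> (U1 t has_real_derivative U2 t s) (at s within {t0..t1})"
  "!!t s. t \<in> T ==> s \<in> {t0..t1} ==> (U2 t has_real_derivative U3 t s) (at s within {t0..t1})"
  "!!t s. t \<in> T ==> s \<in> {t0..t1} ==> b s * U2 t s + a s * U1 t s = lam t * G (U t s)"
  "!!t. t \<in> T ==> continuous_on {t0..t1} (U3 t)"
  "!!s. s \<in> T ==> uniform_limit {t0..t1} U1 (U1 s) (at s within T)"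
  "!!s. s \<in> T ==> uniform_limit {t0..t1} U2 (U2 s) (at s within T)"
  "!!s. s \<in> T ==> uniform_limit {t0..t1} U3 (U3 s) (at s within T)"
proof -
 let ?I = "{t0..t1}"
 interpret A: smooth_singular_ode "%s. a s + bb1 s" b "%s. p s * b s" t0 t1 b0 b1 "%s. a1 s + bb2 s" bb1 bb2 by (rule shift_smooth)
 interpret B: singular_ode "%s. a s + bb1 s + bb1 s" b "%s. p s * b s * b s" t0 t1 b0 b1 by (rule A.shift)
 have Gc: "continuous_on J G" "continuous_on J G1" using G by (meson DERIV_isCont continuous_at_imp_continuous_on)+
 define k0 where "k0 t s = lam t * G (U t s)" for t s
 define U1 where "U1 t = ext (Y t) (k0 t)" for t
 define k1 where "k1 t s = lam t * (G1 (U t s) * U1 t s) - a1 s * U1 t s" for t s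
 define y1 where "y1 t s = (k0 t s - a s * Y t s) / b s" for t s
 define U2 where "U2 t = A.ext (y1 t) (k1 t)" for t
 define dk1 where "dk1 t s = lam t * (G2 (U t s) * U1 t s * U1 t s + G1 (U t s) * U2 t s) - (a2 s * U1 t s + a1 s * U2 t s)" for t s
 define k2 where "k2 t s = dk1 t s - (a1 s + bb2 s) * U2 t s" for t s
 define y2 where "y2 t s = (k1 t s - (a s + bb1 s) * y1 t s) / b s" for t s
 define U3 where "U3 t = B.ext (y2 t) (k2 t)" for t
 have Uc: "continuous_on ?I (U t)" if "t \<in> T" for t by (rule bvp_solD(1)[OF sol[OF that]])
 have comp: "continuous_on ?I (%s. H (U t s))" if "continuous_on J H" "t \<in> T" for H t
  by (rule continuous_on_compose2[OF that(1) Uc[OF that(2)]]) (use J that in auto)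
 have k0c: "continuous_on ?I (k0 t)" if "t \<in> T" for t unfolding k0_def by (intro continuous_intros comp Gc that)
 have r0: "reg2 (Y t) (k0 t)" if "t \<in> T" for t using bvp_sol_reg2[OF sol[OF that]] by (simp add: k0_def[abs_def])
 have U1c: "continuous_on ?I (U1 t)" if "t \<in> T" for t unfolding U1_def by (rule ext_continuous[OF r0[OF that] k0c[OF that]])
 have U1i: "U1 t s = Y t s" if "t0 < s" "s < t1" for t s unfolding U1_def by (rule ext_inside[OF that])
 have dU: "(U t has_real_derivative U1 t s) (at s)" if "t \<in> T" "t0 < s" "s < t1" for t s
  using bvp_solD(2)[OF sol[OF that(1)] that(2,3)] by (simp add: U1i that)
 have DU: "(U t has_real_derivative U1 t s) (at s within ?I)" if "t \<in> T" "s \<in> ?I" for t s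
  by (rule has_real_derivative_extend_Icc[OF t01 Uc U1c dU]) (use that in auto)
 have dG: "((%s. H (U t s)) has_real_derivative H' (U t s) * U1 t s) (at s)"
  if "!!x. x \<in> J ==> (H has_real_derivative H' x) (at x)" "t \<in> T" "t0 < s" "s < t1" for H H' t s
  by (rule DERIV_chain2[OF that(1)[OF J(1)] dU]) (use that in auto)
 have dk0: "(k0 t has_real_derivative lam t * (G1 (U t s) * U1 t s)) (at s)" if "t \<in> T" "t0 < s" "s < t1" for t s
  unfolding k0_def by (intro DERIV_cmult dG that G)
 have k1c: "continuous_on ?I (k1 t)" if "t \<in> T" for t unfolding k1_def by (intro continuous_intros comp Gc U1c a1_cont that)
 have r1: "A.reg2 (y1 t) (k1 t)" if "t \<in> T" for t
  unfolding y1_def by (rule shift_reg2[OF r0[OF that] k0c[OF that] dk0[OF that]]) (auto simp: k1_def U1i)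
 have U2c: "continuous_on ?I (U2 t)" if "t \<in> T" for t unfolding U2_def by (rule A.ext_continuous[OF r1[OF that] k1c[OF that]])
 have U2i: "U2 t s = y1 t s" if "t0 < s" "s < t1" for t s unfolding U2_def by (rule A.ext_inside[OF that])
 have dU1: "(U1 t has_real_derivative U2 t s) (at s)" if "t \<in> T" "t0 < s" "s < t1" for t s
 proof -
  have "(Y t has_real_derivative U2 t s) (at s)" using r0[OF that(1)] that by (auto simp: reg2_def U2i y1_def)
  thus ?thesis by (rule has_field_derivative_transform_within_open[of _ _ _ "{t0<..<t1}"]) (use that in "auto simp: U1i")
 qed
 have DU1: "(U1 t has_real_derivative U2 t s) (at s within ?I)" if "t \<in> T" "s \<in> ?I" for t s
  by (rule has_real_derivative_extend_Icc[OF t01 U1c U2c dU1]) (use that in auto)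
 have da1: "(a1 has_real_derivative a2 s) (at s)" if "t0 < s" "s < t1" for s
  using a1_deriv[of s] that by (simp add: at_within_Icc_at)
 have dk1: "(k1 t has_real_derivative dk1 t s) (at s)" if t: "t \<in> T" "t0 < s" "s < t1" for t s
 proof -
  have "(k1 t has_real_derivative lam t * (G2 (U t s) * U1 t s * U1 t s + U2 t s * G1 (U t s)) - (a2 s * U1 t s + U2 t s * a1 s)) (at s)"
   unfolding k1_def by (intro DERIV_diff DERIV_cmult DERIV_mult dG G t dU1 da1)
  thus ?thesis by (simp add: dk1_def mult.commute)
 qed
 have k2c: "continuous_on ?I (k2 t)" if "t \<in> T" for t
  unfolding k2_def dk1_def by (intro continuous_intros comp Gc G(3) U1c U2c a1_cont a2_cont bb2_cont that)
 have r2: "B.reg2 (y2 t) (k2 t)" if "t \<in> T" for t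
  unfolding y2_def by (rule A.shift_reg2[OF r1[OF that] k1c[OF that] dk1[OF that]]) (auto simp: k2_def U2i)
 have U3c: "continuous_on ?I (U3 t)" if "t \<in> T" for t unfolding U3_def by (rule B.ext_continuous[OF r2[OF that] k2c[OF that]])
 have U3i: "U3 t s = y2 t s" if "t0 < s" "s < t1" for t s unfolding U3_def by (rule B.ext_inside[OF that])
 have dU2: "(U2 t has_real_derivative U3 t s) (at s)" if "t \<in> T" "t0 < s" "s < t1" for t s
 proof -
  have "(y1 t has_real_derivative U3 t s) (at s)" using r1[OF that(1)] that by (auto simp: A.reg2_def U3i y2_def)
  thus ?thesis by (rule has_field_derivative_transform_within_open[of _ _ _ "{t0<..<t1}"]) (use that in "auto simp: U2i")
 qed
 have DU2: "(U2 t has_real_derivative U3 t s) (at s within ?I)" if "t \<in> T" "s \<in> ?I" for t s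
  by (rule has_real_derivative_extend_Icc[OF t01 U2c U3c dU2]) (use that in auto)
 have ode: "b s * U2 t s + a s * U1 t s = lam t * G (U t s)" if ts: "t \<in> T" "s \<in> ?I" for t s
 proof -
  consider "s = t0" | "s = t1" | "t0 < s" "s < t1" using ts by force
  thus ?thesis
  proof cases
   case 1 thus ?thesis using a_t0 by (simp add: b_t0 U1_def ext_def k0_def)
  next
   case 2 thus ?thesis using a_t1 t01 by (simp add: b_t1 U1_def ext_def k0_def)
  next
   case 3 thus ?thesis using b_pos[OF 3] by (simp add: U1i U2i y1_def k0_def)
  qed
 qed
 note mul = uniform_limit_mult_continuous[OF compact_Icc]
 have lamu: "uniform_limit ?I (%t x. lam t) (%x. lam s) (at s within T)" if "s \<in> T" for s
  using lam that by (intro uniform_limit_of_tendsto) (simp add: continuous_on_def)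
 have compu: "uniform_limit ?I (%t x. H (U t x)) (%x. H (U s x)) (at s within T)" if H: "continuous_on J H" and s: "s \<in> T" for H s
 proof (rule uniform_limit_compose_uniformly_continuous_on[OF ul[OF s]])
  show "uniformly_continuous_on J H" by (rule compact_uniformly_continuous[OF H J(2)])
  show "\<forall>\<^sub>F t in at s within T. \<forall>y\<in>?I. U t y \<in> J" using J(1) by (auto simp: eventually_at_filter)
  show "closed J" by (rule compact_imp_closed[OF J(2)])
 qed
 have cu: "uniform_limit ?I (%t x. h x) (%x. h x) F" for h :: "real => real" and F :: "real filter" by (rule uniform_limit_const)
 have k0u: "uniform_limit ?I k0 (k0 s) (at s within T)" if s: "s \<in> T" for s
  unfolding k0_def by (intro mul lamu compu Gc s continuous_intros comp)
 have U1u: "uniform_limit ?I U1 (U1 s) (at s within T)" if s: "s \<in> T" for s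
  unfolding U1_def by (rule ext_uniform_limit[OF r0 s k0u[OF s]])
 have k1u: "uniform_limit ?I k1 (k1 s) (at s within T)" if s: "s \<in> T" for s
  unfolding k1_def by (intro uniform_limit_minus mul lamu compu Gc s continuous_intros comp U1u U1c cu a1_cont)
 have U2u: "uniform_limit ?I U2 (U2 s) (at s within T)" if s: "s \<in> T" for s
  unfolding U2_def by (rule A.ext_uniform_limit[OF r1 s k1u[OF s]])
 have k2u: "uniform_limit ?I k2 (k2 s) (at s within T)" if s: "s \<in> T" for s unfolding k2_def dk1_def
  by (intro uniform_limit_minus uniform_limit_add mul lamu compu Gc G(3) s continuous_intros comp U1u U1c U2u U2c
   cu a1_cont a2_cont bb2_cont)
 have U3u: "uniform_limit ?I U3 (U3 s) (at s within T)" if s: "s \<in> T" for s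
  unfolding U3_def by (rule B.ext_uniform_limit[OF r2 s k2u[OF s]])
 show ?thesis by (rule that[OF DU DU1 DU2 ode U3c U1u U2u U3u])
qed

text \<open>The logarithmic derivative \<open>a / b\<close> of \<open>p\<close> is at least
\<open>1 / (2 (s - t0))\<close> up to a bounded error.\<close>

lemma p_le_sqrt:
 assumes ab: "b0 <= 2 * a t0"
 obtains C m where "0 < C" "t0 < m" "m < t1" "!!s. t0 < s ==> s <= m ==> p s <= C * sqrt (s - t0)"
proof -
 \<comment> \<open>The numerator of \<open>a / b - 1 / (2 (s - t0))\<close>; it vanishes at \<open>t0\<close>, where its derivative is nonnegative.\<close>
 define N where "N s = 2 * (s - t0) * a s - b s" for s
 define N1 where "N1 s = 2 * a s + 2 * (s - t0) * a1 s - bb1 s" for s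
 define N2 where "N2 s = 4 * a1 s + 2 * (s - t0) * a2 s - bb2 s" for s
 have "continuous_on {t0..t1} N2" unfolding N2_def by (intro continuous_intros a1_cont a2_cont bb2_cont)
 from compact_imp_bounded[OF compact_continuous_image[OF this compact_Icc]]
 obtain M0 where "\<forall>s\<in>{t0..t1}. \<bar>N2 s\<bar> <= M0" by (auto simp: bounded_iff)
 hence M0: "\<bar>N2 s\<bar> <= M0" if "s \<in> {t0..t1}" for s using that by blast
 define M where "M = M0 + 1"
 have M: "\<bar>N2 s\<bar> <= M" if "s \<in> {t0..t1}" for s using M0[OF that] by (simp add: M_def)
 have Mp: "0 < M" using M0[of t0] t01 by (simp add: M_def)
 have dN: "(N has_real_derivative N1 s) (at s)" "(N1 has_real_derivative N2 s) (at s)" if s: "t0 < s" "s < t1" for s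
 proof -
  have da1: "(a1 has_real_derivative a2 s) (at s)" using a1_deriv[of s] s by (simp add: at_within_Icc_at)
  show "(N has_real_derivative N1 s) (at s)" unfolding N_def N1_def by (rule derivative_eq_intros inside s refl | simp)+
  show "(N1 has_real_derivative N2 s) (at s)" unfolding N1_def N2_def by (rule derivative_eq_intros inside s da1 refl | simp)+
 qed
 have Nc: "continuous_on {t0..t1} N" "continuous_on {t0..t1} N1"
  unfolding N_def N1_def by (intro continuous_intros cont_a cont_b a1_cont bb1_cont)+
 have N1: "- (M * (s - t0)) <= N1 s" if s: "t0 <= s" "s <= t1" for s
 proof -
  have "N1 t0 + M * (t0 - t0) <= N1 s + M * (s - t0)"
  proof (rule DERIV_nonneg_imp_increasing_open[OF s(1), of "%s. N1 s + M * (s - t0)"])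
   fix x assume x: "t0 < x" "x < s"
   have "((%s. N1 s + M * (s - t0)) has_real_derivative N2 x + M * (1 - 0)) (at x)"
   by (rule derivative_eq_intros dN refl | use x s in simp)+
   moreover have "0 <= N2 x + M * (1 - 0)" using M[of x] x s by auto
   ultimately show "EX y. ((%s. N1 s + M * (s - t0)) has_real_derivative y) (at x) & 0 <= y" by blast
  qed (intro continuous_intros continuous_on_subset[OF Nc(2)], use s in auto)
  moreover have "0 <= N1 t0" using ab by (simp add: N1_def bb1_t0)
  ultimately show ?thesis by simp
 qed
 have N: "- (M * (s - t0)\<^sup>2) <= N s" if s: "t0 <= s" "s <= t1" for s
 proof -
  have "N t0 + M * (t0 - t0)\<^sup>2 <= N s + M * (s - t0)\<^sup>2"
  proof (rule DERIV_nonneg_imp_increasing_open[OF s(1), of "%s. N s + M * (s - t0)\<^sup>2"])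
   fix x assume x: "t0 < x" "x < s"
   have "((%s. N s + M * (s - t0)\<^sup>2) has_real_derivative N1 x + M * (2 * (x - t0))) (at x)"
   by (rule derivative_eq_intros dN refl | use x s in simp)+
   moreover have "0 <= N1 x + M * (2 * (x - t0))"
   proof -
   have "0 <= M * (x - t0)" using Mp x by simp
   thus ?thesis using N1[of x] x s by (simp add: algebra_simps)
   qed
   ultimately show "EX y. ((%s. N s + M * (s - t0)\<^sup>2) has_real_derivative y) (at x) & 0 <= y" by blast
  qed (intro continuous_intros continuous_on_subset[OF Nc(1)], use s in auto)
  moreover have "N t0 = 0" by (simp add: N_def b_t0)
  ultimately show ?thesis by simp
 qed
 obtain c where c: "0 < c" and cb: "!!s. s \<in> {t0..t1} ==> c * ((s - t0) * (t1 - s)) <= b s" using b_quotient_bounds by metis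
 define m where "m = (t0 + t1) / 2"
 have m: "t0 < m" "m < t1" using t01 by (auto simp: m_def)
 define c2 where "c2 = c * (t1 - m)"
 have c2: "0 < c2" using c m by (simp add: c2_def)
 define c3 where "c3 = M / (2 * c2)"
 have c30: "0 < c3" using Mp c2 by (simp add: c3_def)
 define Q where "Q s = p s * (exp (c3 * (s - t0)) / sqrt (s - t0))" for s
 have key: "0 <= a s / b s + c3 - 1 / (2 * (s - t0))" if s: "t0 < s" "s <= m" for s
 proof -
  have bp: "0 < b s" using b_pos s m by auto
  have "c2 * (s - t0) <= c * ((s - t0) * (t1 - s))"
   unfolding c2_def using c s m by (simp add: mult.assoc mult.left_commute mult_left_mono)
  also have "... <= b s" by (rule cb) (use s m in auto)
  finally have b2: "c2 * (s - t0) <= b s" .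
  have "M * (s - t0)\<^sup>2 = 2 * c3 * (s - t0) * (c2 * (s - t0))" using c2 by (simp add: c3_def power2_eq_square)
  also have "... <= 2 * c3 * (s - t0) * b s" using b2 c30 s by (intro mult_left_mono) auto
  finally have "0 <= N s + 2 * c3 * (s - t0) * b s" using N[of s] s m by simp
  hence "0 <= (N s + 2 * c3 * (s - t0) * b s) / (2 * (s - t0) * b s)" using s bp by simp
  also have "... = a s / b s + c3 - 1 / (2 * (s - t0))" using s bp by (simp add: N_def field_simps)
  finally show ?thesis .
 qed
 have Qle: "Q s <= Q m" if s: "t0 < s" "s <= m" for s
 proof (rule DERIV_nonneg_imp_nondecreasing[OF s(2)])
  fix x assume x: "s <= x" "x <= m"
  have xt: "0 < x - t0" using x s by auto
  define e where "e = exp (c3 * (x - t0)) / sqrt (x - t0)"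
  have e0: "0 < e" using xt by (simp add: e_def)
  have De: "((%s. exp (c3 * (s - t0)) / sqrt (s - t0)) has_real_derivative e * (c3 - 1 / (2 * (x - t0)))) (at x)"
  proof -
   have "((%s. exp (c3 * (s - t0)) / sqrt (s - t0)) has_real_derivative
   ((exp (c3 * (x - t0)) * c3) * sqrt (x - t0) - exp (c3 * (x - t0)) * (inverse (sqrt (x - t0)) / 2)) / (sqrt (x - t0) * sqrt (x - t0))) (at x)"
   using xt by (auto intro!: derivative_eq_intros simp: DERIV_real_sqrt)
   moreover have "((exp (c3 * (x - t0)) * c3) * sqrt (x - t0) - exp (c3 * (x - t0)) * (inverse (sqrt (x - t0)) / 2)) / (sqrt (x - t0) * sqrt (x - t0))
   = e * (c3 - 1 / (2 * (x - t0)))"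
   proof -
   define r where "r = sqrt (x - t0)"
   have r: "0 < r" "x - t0 = r * r" using xt by (auto simp: r_def)
   show ?thesis unfolding e_def r_def[symmetric] r(2) using r(1) by (simp add: field_simps)
   qed
   ultimately show ?thesis by metis
  qed
  have "(Q has_real_derivative p x * a x / b x * e + e * (c3 - 1 / (2 * (x - t0))) * p x) (at x)"
   unfolding Q_def by (rule DERIV_cong[OF DERIV_mult[OF p_deriv De]]) (use xt x m in "auto simp: e_def")
  moreover have "p x * a x / b x * e + e * (c3 - 1 / (2 * (x - t0))) * p x = p x * e * (a x / b x + c3 - 1 / (2 * (x - t0)))"
   by (simp add: algebra_simps)
  moreover have "0 <= ..." using p_pos[of x] e0 key[of x] x s m by (intro mult_nonneg_nonneg) auto
  ultimately show "EX y. DERIV Q x :> y & 0 <= y" by metis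
 qed
 have "p s <= Q m * sqrt (s - t0)" if s: "t0 < s" "s <= m" for s
 proof -
  have "p s * 1 <= p s * exp (c3 * (s - t0))" using p_pos[of s] s m c30 by (intro mult_left_mono) auto
  also have "... = Q s * sqrt (s - t0)" using s by (simp add: Q_def)
  also have "... <= Q m * sqrt (s - t0)" using Qle[OF s] s by (intro mult_right_mono) auto
  finally show ?thesis by simp
 qed
 moreover have "0 < Q m" using p_pos[OF m] m by (simp add: Q_def)
 ultimately show ?thesis using that m by blast
qed

text \<open>The flux \<open>p y\<close> always has a limit. If it were not zero, \<open>y\<close>
would be at least a multiple of \<open>1 / sqrt (s - t0)\<close>, and integration would contradict
the smallness of \<open>z - z t0\<close>.\<close>

lemma flux_vanishes:
 assumes ab: "b0 <= 2 * a t0"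
  and z: "!!s. t0 < s ==> s < t1 ==> (z has_real_derivative y s) (at s)"
  and y: "!!s. t0 < s ==> s < t1 ==> (y has_real_derivative (k s - a s * y s) / b s) (at s)"
  and k: "continuous_on {t0..t1} k"
  and small: "!!e. 0 < e ==> \<exists>d>0. ALL s. t0 < s --> s < t0 + d --> \<bar>z s - z t0\<bar> <= e * sqrt (s - t0)"
 shows "((%s. p s * y s) ---> 0) (at_right t0)"
proof -
 obtain v where v: "reg_sol v k t1" using reg_sol_exists[OF k t01] by auto
 obtain C m where C: "0 < C" and m: "t0 < m" "m < t1" and pC: "!!s. t0 < s ==> s <= m ==> p s <= C * sqrt (s - t0)"
  using p_le_sqrt[OF ab] by metis
 have D0: "((%s. p s * (y s - v s)) has_real_derivative 0) (at s)" if s: "t0 < s" "s < t1" for s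
 proof -
  have "((%s. p s * (y s - v s)) has_real_derivative
   p s * a s / b s * (y s - v s) + ((k s - a s * y s) / b s - (k s - a s * v s) / b s) * p s) (at s)"
   by (intro DERIV_mult DERIV_diff p_deriv y reg_solD(1)[OF v] s)
  moreover have "p s * a s / b s * (y s - v s) + ((k s - a s * y s) / b s - (k s - a s * v s) / b s) * p s = 0"
   using b_pos[OF s] by (simp add: field_simps)
  ultimately show ?thesis by metis
 qed
 have const: "p s * (y s - v s) = p m * (y m - v m)" if s: "t0 < s" "s < t1" for s
  by (rule has_field_derivative_zero_constant[of "{t0<..<t1}" "%s. p s * (y s - v s)", THEN exE])
   (use D0 s m in "auto intro: has_field_derivative_at_within")
 define l where "l = p m * (y m - v m)"
 have "((%s. p s * v s + l) ---> 0 + l) (at_right t0)" by (intro tendsto_intros reg_solD(2)[OF v])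
 moreover have "\<forall>\<^sub>F s in at_right t0. p s * v s + l = p s * y s"
  using t01 const by (auto simp: eventually_at_right_field l_def algebra_simps intro!: exI[of _ t1])
 ultimately have lim: "((%s. p s * y s) ---> l) (at_right t0)" by (auto intro: Lim_transform_eventually)
 have "l = 0"
 proof (rule ccontr)
  assume l0: "l ~= 0"
  define sgm where "sgm = sgn l"
  have sl: "sgm * l = \<bar>l\<bar>" "\<bar>sgm\<bar> = 1" using l0 by (auto simp: sgm_def sgn_if)
  have "((%s. sgm * (p s * y s)) ---> \<bar>l\<bar>) (at_right t0)" using tendsto_mult_left[OF lim, of sgm] by (simp add: sl)
  hence "\<forall>\<^sub>F s in at_right t0. \<bar>l\<bar> / 2 < sgm * (p s * y s)" by (rule order_tendstoD) (use l0 in auto)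
  then obtain d1 where d1: "t0 < d1" "!!s. t0 < s ==> s < d1 ==> \<bar>l\<bar> / 2 < sgm * (p s * y s)"
   by (auto simp: eventually_at_right_field)
  define c where "c = \<bar>l\<bar> / (2 * C)"
  have c: "0 < c" using l0 C by (simp add: c_def)
  obtain d2 where d2: "0 < d2" "!!s. t0 < s ==> s < t0 + d2 ==> \<bar>z s - z t0\<bar> <= c * sqrt (s - t0)"
   using small[OF c] by blast
  define s where "s = t0 + min (min ((d1 - t0) / 2) (d2 / 2)) (m - t0)"
  have s: "t0 < s" "s < d1" "s < t0 + d2" "s <= m" using d1(1) d2(1) m by (auto simp: s_def min_def field_simps)
  have ybig: "c / sqrt (x - t0) <= sgm * y x" if x: "t0 < x" "x <= s" for x
  proof -
   have r: "0 < sqrt (x - t0)" using x by simp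
   have px: "0 < p x" using p_pos x s m by auto
   have "\<bar>l\<bar> / 2 <= p x * (sgm * y x)" using d1(2)[of x] x s by (simp add: mult_ac)
   moreover have sy: "0 < sgm * y x" using calculation px l0 by (smt (verit) zero_less_abs_iff mult_nonneg_nonpos half_gt_zero)
   moreover have "p x * (sgm * y x) <= C * sqrt (x - t0) * (sgm * y x)" using pC[of x] x s sy by (intro mult_right_mono) auto
   ultimately have "\<bar>l\<bar> / 2 <= C * sqrt (x - t0) * (sgm * y x)" by linarith
   hence "c <= sgm * y x * sqrt (x - t0)" using C by (simp add: c_def field_simps)
   thus ?thesis by (simp only: pos_divide_le_eq[OF r])
  qed
  have grow: "2 * c * sqrt (s - t0) - 2 * c * sqrt (x - t0) <= sgm * z s - sgm * z x" if x: "t0 < x" "x <= s" for x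
  proof -
   have "sgm * z x - 2 * c * sqrt (x - t0) <= sgm * z s - 2 * c * sqrt (s - t0)"
   proof (rule DERIV_nonneg_imp_nondecreasing[OF x(2), of "%s. sgm * z s - 2 * c * sqrt (s - t0)"])
   fix r assume r: "x <= r" "r <= s"
   have "((%s. sgm * z s - 2 * c * sqrt (s - t0)) has_real_derivative sgm * y r - 2 * c * (inverse (sqrt (r - t0)) / 2 * (1 - 0))) (at r)"
   by (intro DERIV_diff DERIV_cmult z DERIV_chain2[OF DERIV_real_sqrt] DERIV_ident DERIV_const) (use r x s m in auto)
   moreover have "0 <= sgm * y r - 2 * c * (inverse (sqrt (r - t0)) / 2 * (1 - 0))"
   proof -
   have eq: "2 * c * (inverse S / 2 * (1 - 0)) = c / S" for S :: real by (simp add: inverse_eq_divide)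
   have "c / sqrt (r - t0) <= sgm * y r" by (rule ybig) (use r x in auto)
   thus ?thesis unfolding eq by simp
   qed
   ultimately show "EX y. ((%s. sgm * z s - 2 * c * sqrt (s - t0)) has_real_derivative y) (at r) & 0 <= y" by blast
   qed
   thus ?thesis by linarith
  qed
  have zx: "((%x. z x) ---> z t0) (at_right t0)"
  proof (rule Lim_null[THEN iffD2], rule tendsto_rabs_zero_cancel, rule tendsto_sandwich[OF _ _ tendsto_const])
   show "\<forall>\<^sub>F x in at_right t0. 0 <= \<bar>z x - z t0\<bar>" by simp
   show "\<forall>\<^sub>F x in at_right t0. \<bar>z x - z t0\<bar> <= c * sqrt (x - t0)"
   using d2 by (auto simp: eventually_at_right_field intro!: exI[of _ "t0 + d2"])
   have "((%x. c * sqrt (x - t0)) ---> c * sqrt (t0 - t0)) (at_right t0)" by (intro tendsto_intros)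
   thus "((%x. c * sqrt (x - t0)) ---> 0) (at_right t0)" by simp
  qed
  have "2 * c * sqrt (s - t0) - 2 * c * sqrt (t0 - t0) <= sgm * z s - sgm * z t0"
  proof (rule tendsto_le[OF trivial_limit_at_right_real])
   show "((%x. sgm * z s - sgm * z x) ---> sgm * z s - sgm * z t0) (at_right t0)" by (intro tendsto_intros zx)
   show "((%x. 2 * c * sqrt (s - t0) - 2 * c * sqrt (x - t0)) ---> 2 * c * sqrt (s - t0) - 2 * c * sqrt (t0 - t0)) (at_right t0)"
   by (intro tendsto_intros)
   show "\<forall>\<^sub>F x in at_right t0. 2 * c * sqrt (s - t0) - 2 * c * sqrt (x - t0) <= sgm * z s - sgm * z x"
   using s grow by (auto simp: eventually_at_right_field intro!: exI[of _ s])
  qed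
  hence "2 * c * sqrt (s - t0) <= \<bar>sgm * (z s - z t0)\<bar>" by (simp add: right_diff_distrib)
  also have "... <= c * sqrt (s - t0)" using d2(2)[OF s(1,3)] by (simp add: abs_mult sl)
  finally show False using c s by simp
 qed
 thus ?thesis using lim by simp
qed

end


section \<open>Bifurcation for the ordinary differential equation\<close>

lemma DERIV_reflect_within:
 fixes f :: "real => real"
 assumes "(f has_real_derivative d) (at (- s) within {l..u})"
 shows "((%s. f (- s)) has_real_derivative - d) (at s within {- u..- l})"
proof -
 have um: "(uminus has_real_derivative - 1) (at s within {- u..- l})" by (auto intro!: derivative_eq_intros)
 have "uminus ` {- u..- l} = {l..u}" by simp
 thus ?thesis using DERIV_image_chain[of f d uminus s "{- u..- l}" "-1"] assms um by (simp add: o_def)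
qed

lemma antiderivative_open_interval:
 fixes f :: "real => real"
 assumes "l < u" "continuous_on {l<..<u} f"
 shows "EX F. ALL x. l < x --> x < u --> (F has_real_derivative f x) (at x)"
proof -
 have "EX F. \<forall>x::real. ereal l < ereal x --> ereal x < ereal u --> (F has_vector_derivative f x) (at x)"
 proof (rule einterval_antiderivative)
  show "isCont f x" if "ereal l < ereal x" "ereal x < ereal u" for x
   using assms(2) that by (simp add: continuous_on_eq_continuous_at)
 qed (use assms in simp)
 thus ?thesis by (simp add: has_real_derivative_iff_has_vector_derivative)
qed

context smooth2_singular_ode
begin

lemma mirror_smooth2:
 "smooth2_singular_ode (%s. - a (- s)) (%s. b (- s)) (%s. p (- s)) (- t1) (- t0) b1 b0
   (%s. a1 (- s)) (%s. - bb1 (- s)) (%s. bb2 (- s)) (%s. - a2 (- s))"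
proof -
 interpret m: singular_ode "%s. - a (- s)" "%s. b (- s)" "%s. p (- s)" "- t1" "- t0" b1 b0 by (rule mirror)
 show ?thesis
 proof
  fix s assume "s \<in> {- t1..- t0}"
  hence s: "- s \<in> {t0..t1}" by auto
  show "((%s. - a (- s)) has_real_derivative a1 (- s)) (at s within {- t1..- t0})"
   using DERIV_minus[OF DERIV_reflect_within[OF a_deriv[OF s]]] by simp
  show "((%s. b (- s)) has_real_derivative - bb1 (- s)) (at s within {- t1..- t0})" by (rule DERIV_reflect_within[OF b_deriv[OF s]])
  show "((%s. - bb1 (- s)) has_real_derivative bb2 (- s)) (at s within {- t1..- t0})"
   using DERIV_minus[OF DERIV_reflect_within[OF bb1_deriv[OF s]]] by simp
  show "((%s. a1 (- s)) has_real_derivative - a2 (- s)) (at s within {- t1..- t0})"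
   by (rule DERIV_reflect_within[OF a1_deriv[OF s]])
 next
  show "continuous_on {- t1..- t0} (%s. a1 (- s))" unfolding continuous_on_mirror by (rule a1_cont)
  show "continuous_on {- t1..- t0} (%s. bb2 (- s))" unfolding continuous_on_mirror by (rule bb2_cont)
  show "continuous_on {- t1..- t0} (%s. - a2 (- s))" by (intro continuous_on_minus) (simp add: continuous_on_mirror a2_cont)
  show "- bb1 (- (- t1)) = b1" "- bb1 (- (- t0)) = - b0" by (simp_all add: bb1_t0 bb1_t1)
 qed
qed

lemma flux_vanishes_right:
 assumes ab: "2 * a t1 <= - b1"
  and z: "!!s. t0 < s ==> s < t1 ==> (z has_real_derivative y s) (at s)"
  and y: "!!s. t0 < s ==> s < t1 ==> (y has_real_derivative (k s - a s * y s) / b s) (at s)"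
  and k: "continuous_on {t0..t1} k"
  and small: "!!e. 0 < e ==> \<exists>d>0. ALL s. t1 - d < s --> s < t1 --> \<bar>z s - z t1\<bar> <= e * sqrt (t1 - s)"
 shows "((%s. p s * y s) ---> 0) (at_left t1)"
proof -
 interpret m: smooth2_singular_ode "%s. - a (- s)" "%s. b (- s)" "%s. p (- s)" "- t1" "- t0" b1 b0
   "%s. a1 (- s)" "%s. - bb1 (- s)" "%s. bb2 (- s)" "%s. - a2 (- s)" by (rule mirror_smooth2)
 have "((%s. p (- s) * - y (- s)) ---> 0) (at_right (- t1))"
 proof (rule m.flux_vanishes[of "%s. z (- s)" "%s. - y (- s)" "%s. k (- s)"])
  show "b1 <= 2 * - a (- (- t1))" using ab by simp
  fix s assume s: "- t1 < s" "s < - t0"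
  hence s': "t0 < - s" "- s < t1" by auto
  show "((%s. z (- s)) has_real_derivative - y (- s)) (at s)" using DERIV_reflect[of z "- y (- s)" s] z[OF s'] by simp
  have "((%s. y (- s)) has_real_derivative - ((k (- s) - a (- s) * y (- s)) / b (- s))) (at s)"
   using DERIV_reflect[of y "- ((k (- s) - a (- s) * y (- s)) / b (- s))" s] y[OF s'] by simp
  from DERIV_minus[OF this]
  show "((%s. - y (- s)) has_real_derivative (k (- s) - - a (- s) * - y (- s)) / b (- s)) (at s)" by simp
 next
  show "continuous_on {- t1..- t0} (%s. k (- s))" unfolding continuous_on_mirror by (rule k)
  fix e :: real assume "0 < e"
  then obtain d where d: "0 < d" "!!s. t1 - d < s ==> s < t1 ==> \<bar>z s - z t1\<bar> <= e * sqrt (t1 - s)" using small by blast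
  have "\<bar>z (- s) - z (- (- t1))\<bar> <= e * sqrt (s - - t1)" if "- t1 < s" "s < - t1 + d" for s
   using d(2)[of "- s"] that by (simp add: add.commute)
  thus "\<exists>d>0. ALL s. - t1 < s --> s < - t1 + d --> \<bar>z (- s) - z (- (- t1))\<bar> <= e * sqrt (s - - t1)"
   using d(1) by blast
 qed
 hence "((%s. - (p s * y s)) ---> 0) (at_left t1)" by (simp add: at_right_minus filterlim_filtermap)
 from tendsto_minus[OF this] show ?thesis by simp
qed

end

lemma (in singular_ode) bvp_sol_add_const:
 assumes "bvp_sol z y k"
 shows "bvp_sol (%s. c + z s) y k" unfolding bvp_sol_def prim_sol_def
proof (intro conjI allI impI)
 show "continuous_on {t0..t1} (%s. c + z s)" by (intro continuous_intros bvp_solD(1)[OF assms])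
 show "((%s. c + z s) has_real_derivative y s) (at s)" if "t0 < s" "s < t1" for s
  using DERIV_add[OF DERIV_const bvp_solD(2)[OF assms that]] by simp
qed (use assms in "auto simp: bvp_sol_def prim_sol_def")

text \<open>The integrating factor is the exponential of an antiderivative of \<open>a /
b\<close>. The smallness of \<open>psi\<close> at the ends is what makes its flux vanish
there.\<close>

theorem ode_bifurcation:
 fixes a a1 a2 b bb1 bb2 psi y :: "real => real" and t0 t1 q \<mu> :: real
 assumes t01: "t0 < t1"
  and a: "!!s. s \<in> {t0..t1} ==> (a has_real_derivative a1 s) (at s within {t0..t1})"
   "!!s. s \<in> {t0..t1} ==> (a1 has_real_derivative a2 s) (at s within {t0..t1})" "continuous_on {t0..t1} a2"
  and b: "!!s. s \<in> {t0..t1} ==> (b has_real_derivative bb1 s) (at s within {t0..t1})"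
   "!!s. s \<in> {t0..t1} ==> (bb1 has_real_derivative bb2 s) (at s within {t0..t1})" "continuous_on {t0..t1} bb2"
  and b_pos: "!!s. t0 < s ==> s < t1 ==> 0 < b s" and b_ends: "b t0 = 0" "b t1 = 0"
  and ends0: "0 < bb1 t0" "bb1 t0 <= 2 * a t0" and ends1: "bb1 t1 < 0" "2 * a t1 <= bb1 t1"
  and q: "1 < q" and \<mu>: "0 < \<mu>"
  and psi: "continuous_on {t0..t1} psi" "!!s. t0 < s ==> s < t1 ==> (psi has_real_derivative y s) (at s)"
   "!!s. t0 < s ==> s < t1 ==> (y has_real_derivative (- \<mu> * psi s - a s * y s) / b s) (at s)"
  and nz: "EX m. t0 < m & m < t1 & psi m ~= 0"
  and small0: "!!e. 0 < e ==> \<exists>d>0. ALL s. t0 < s --> s < t0 + d --> \<bar>psi s - psi t0\<bar> <= e * sqrt (s - t0)"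
  and small1: "!!e. 0 < e ==> \<exists>d>0. ALL s. t1 - d < s --> s < t1 --> \<bar>psi s - psi t1\<bar> <= e * sqrt (t1 - s)"
 obtains eps :: real and U U1 U2 U3 :: "real => real => real" and lam :: "real => real" where
  "0 < eps" "lam 0 = \<mu> / (q - 1)" "continuous_on {-eps<..<eps} lam"
  "!!t. t \<in> {-eps<..<eps} ==> 0 < lam t"
  "!!s. s \<in> {t0..t1} ==> U 0 s = 1"
  "!!t. t \<in> {-eps<..<eps} ==> t ~= 0 ==> \<exists>s\<in>{t0..t1}. U t s ~= 1"
  "!!t s. t \<in> {-eps<..<eps} ==> s \<in> {t0..t1} ==> 0 < U t s"
  "!!t s. t \<in> {-eps<..<eps} ==> s \<in> {t0..t1} ==> (U t has_real_derivative U1 t s) (at s within {t0..t1})"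
  "!!t s. t \<in> {-eps<..<eps} ==> s \<in> {t0..t1} ==> (U1 t has_real_derivative U2 t s) (at s within {t0..t1})"
  "!!t s. t \<in> {-eps<..<eps} ==> s \<in> {t0..t1} ==> (U2 t has_real_derivative U3 t s) (at s within {t0..t1})"
  "!!t s. t \<in> {-eps<..<eps} ==> s \<in> {t0..t1} ==> b s * U2 t s + a s * U1 t s = lam t * (U t s - U t s powr q)"
  "!!t. t \<in> {-eps<..<eps} ==> continuous_on {t0..t1} (U3 t)"
  "!!s. s \<in> {-eps<..<eps} ==> uniform_limit {t0..t1} U (U s) (at s within {-eps<..<eps})"
  "!!s. s \<in> {-eps<..<eps} ==> uniform_limit {t0..t1} U1 (U1 s) (at s within {-eps<..<eps})"
  "!!s. s \<in> {-eps<..<eps} ==> uniform_limit {t0..t1} U2 (U2 s) (at s within {-eps<..<eps})"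
  "!!s. s \<in> {-eps<..<eps} ==> uniform_limit {t0..t1} U3 (U3 s) (at s within {-eps<..<eps})"
proof -
 have ac: "continuous_on {t0..t1} a" and bc: "continuous_on {t0..t1} b"
  and a1c: "continuous_on {t0..t1} a1" using a b by (meson DERIV_continuous_on)+
 have "continuous_on {t0<..<t1} (%s. a s / b s)"
  by (intro continuous_intros continuous_on_subset[OF ac] continuous_on_subset[OF bc]) (use b_pos in force)+
 then obtain P where P: "!!s. t0 < s ==> s < t1 ==> (P has_real_derivative a s / b s) (at s)"
  using antiderivative_open_interval[OF t01] by blast
 define p where "p s = exp (P s)" for s
 interpret O: singular_ode a b p t0 t1 "bb1 t0" "- bb1 t1"
 proof
  show "(p has_real_derivative p s * a s / b s) (at s)" if "t0 < s" "s < t1" for s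
   unfolding p_def using P[OF that] by (auto intro!: derivative_eq_intros)
 qed (use t01 ac bc b_pos b_ends b(1) ends0 ends1 in "auto simp: p_def")
 interpret O: smooth2_singular_ode a b p t0 t1 "bb1 t0" "- bb1 t1" a1 bb1 bb2 a2 by unfold_locales (use a b a1c in auto)
 have kc: "continuous_on {t0..t1} (%s. - \<mu> * psi s)" by (intro continuous_intros psi)
 have e: "O.bvp_sol psi y (%s. - \<mu> * psi s)" unfolding O.bvp_sol_def O.prim_sol_def O.reg_sol_def
 proof (intro conjI allI impI)
  show "((%s. p s * y s) ---> 0) (at_right t0)" by (rule O.flux_vanishes[OF ends0(2) psi(2,3) kc small0])
  show "((%s. p s * y s) ---> 0) (at_left t1)" by (rule O.flux_vanishes_right[OF _ psi(2,3) kc small1]) (use ends1 in auto)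
 qed (use psi in auto)
 interpret E: singular_eigen a b p t0 t1 "bb1 t0" "- bb1 t1" \<mu> psi y by unfold_locales (use \<mu> e nz in auto)
 obtain kap Lam where kap: "0 <= Lam" "kap 0 = 0" "continuous_on {- 1 / 2..1 / 2} kap"
  "!!x. \<bar>x\<bar> <= 1 / 2 ==> (1 + x) - (1 + x) powr q = x * (kap x - (q - 1))"
  "!!x y. \<bar>x\<bar> <= 1 / 2 ==> \<bar>y\<bar> <= 1 / 2 ==> \<bar>kap x - kap y\<bar> <= Lam * \<bar>x - y\<bar>"
  by (rule power_nonlinearity_quotient[OF q]) (blast intro: that)
 show ?thesis
 proof (rule E.bifurcation_branch[OF q kap(1-3,5)])
 fix eps L :: real and W Y :: "real => real => real" and lam :: "real => real"
 assume eps: "0 < eps" and lam0: "lam 0 = \<mu> / (q - 1)"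
  and sol: "!!t. \<bar>t\<bar> <= eps ==> 0 < lam t & O.bvp_sol (W t) (Y t) (%s. lam t * (W t s * (kap (t * W t s) - (q - 1))))"
  and small: "!!t s. \<bar>t\<bar> <= eps ==> s \<in> {t0..t1} ==> \<bar>t * W t s\<bar> <= 1 / 2"
  and Wnz: "!!t. \<bar>t\<bar> <= eps ==> \<exists>s\<in>{t0..t1}. W t s ~= 0"
  and Wlip: "!!t t' s. \<bar>t\<bar> <= eps ==> \<bar>t'\<bar> <= eps ==> s \<in> {t0..t1} ==> \<bar>W t s - W t' s\<bar> <= L * \<bar>t - t'\<bar>"
  and llip: "!!t t'. \<bar>t\<bar> <= eps ==> \<bar>t'\<bar> <= eps ==> \<bar>lam t - lam t'\<bar> <= L * \<bar>t - t'\<bar>"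
 let ?T = "{-eps<..<eps}" and ?I = "{t0..t1}"
 have T: "\<bar>t\<bar> <= eps" if "t \<in> ?T" for t using that by auto
 define U where "U t s = 1 + t * W t s" for t s
 have lim0: "((%t. L * \<bar>t - s\<bar>) ---> 0) (at s within ?T)" for s
 proof -
  have "((%t. L * \<bar>t - s\<bar>) ---> L * \<bar>s - s\<bar>) (at s within ?T)" by (intro tendsto_intros)
  thus ?thesis by simp
 qed
 have evT: "\<forall>\<^sub>F t in at s within ?T. t \<in> ?T" for s by (auto simp: eventually_at_filter)
 have lamc: "continuous_on ?T lam" unfolding continuous_on_def
 proof
  fix s assume s: "s \<in> ?T"
  show "(lam ---> lam s) (at s within ?T)"
  proof (rule Lim_null[THEN iffD2], rule Lim_null_comparison[OF _ lim0])
   show "\<forall>\<^sub>F t in at s within ?T. norm (lam t - lam s) <= L * \<bar>t - s\<bar>"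
   using evT by eventually_elim (use llip[OF T T[OF s]] in auto)
  qed
 qed
 have Wc: "continuous_on ?I (W t)" if "t \<in> ?T" for t using sol[OF T[OF that]] O.bvp_solD(1) by blast
 have ulW: "uniform_limit ?I W (W s) (at s within ?T)" if s: "s \<in> ?T" for s
 proof (rule uniform_limitI)
  fix e :: real assume e: "0 < e"
  show "\<forall>\<^sub>F t in at s within ?T. \<forall>x\<in>?I. dist (W t x) (W s x) < e"
   using order_tendstoD(2)[OF lim0 e, of s] evT
  proof eventually_elim
   case (elim t)
   show ?case
   proof
   fix x assume x: "x \<in> ?I"
   show "dist (W t x) (W s x) < e" using Wlip[OF T[OF elim(2)] T[OF s] x] elim(1) by (simp add: dist_real_def)
   qed
  qed
 qed
 have ulU: "uniform_limit ?I U (U s) (at s within ?T)" if s: "s \<in> ?T" for s unfolding U_def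
  by (intro uniform_limit_add uniform_limit_const uniform_limit_mult_continuous[OF compact_Icc]
   uniform_limit_of_tendsto tendsto_ident_at ulW s continuous_intros Wc)
 have solU: "O.bvp_sol (U t) (%s. t * Y t s) (%s. lam t * (U t s - U t s powr q))" if t: "t \<in> ?T" for t
 proof -
  have "O.bvp_sol (U t) (%s. t * Y t s) (%s. t * (lam t * (W t s * (kap (t * W t s) - (q - 1)))))"
   unfolding U_def by (rule O.bvp_sol_add_const[OF O.bvp_sol_cmult]) (use sol[OF T[OF t]] in blast)
  thus ?thesis
  proof (rule O.bvp_sol_cong)
   fix s assume s: "t0 < s" "s < t1"
   have "U t s - U t s powr q = t * W t s * (kap (t * W t s) - (q - 1))"
   unfolding U_def by (rule kap(4)[OF small[OF T[OF t]]]) (use s in auto)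
   thus "t * (lam t * (W t s * (kap (t * W t s) - (q - 1)))) = lam t * (U t s - U t s powr q)" by simp
  qed
 qed
 have UJ: "U t s \<in> {1 / 2..3 / 2}" if "t \<in> ?T" "s \<in> ?I" for t s
  using small[OF T[OF that(1)] that(2)] unfolding U_def abs_le_iff by simp
 obtain U1 U2 U3 where
  U: "!!t s. t \<in> ?T ==> s \<in> ?I ==> (U t has_real_derivative U1 t s) (at s within ?I)"
   "!!t s. t \<in> ?T ==> s \<in> ?I ==> (U1 t has_real_derivative U2 t s) (at s within ?I)"
   "!!t s. t \<in> ?T ==> s \<in> ?I ==> (U2 t has_real_derivative U3 t s) (at s within ?I)"
   "!!t s. t \<in> ?T ==> s \<in> ?I ==> b s * U2 t s + a s * U1 t s = lam t * (U t s - U t s powr q)"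
   "!!t. t \<in> ?T ==> continuous_on ?I (U3 t)"
   "!!s. s \<in> ?T ==> uniform_limit ?I U1 (U1 s) (at s within ?T)"
   "!!s. s \<in> ?T ==> uniform_limit ?I U2 (U2 s) (at s within ?T)"
   "!!s. s \<in> ?T ==> uniform_limit ?I U3 (U3 s) (at s within ?T)"
 proof (rule O.regularity[where G = "%x. x - x powr q" and ?G1.0 = "%x. 1 - q * x powr (q - 1)"
   and ?G2.0 = "%x. - (q * ((q - 1) * x powr (q - 2)))" and J = "{1 / 2..3 / 2}" and T = ?T, OF solU UJ])
  show "((%x. x - x powr q) has_real_derivative 1 - q * x powr (q - 1)) (at x)" if "x \<in> {1 / 2..3 / 2}" for x
   using that by (auto intro!: derivative_eq_intros)
  show "((%x. 1 - q * x powr (q - 1)) has_real_derivative - (q * ((q - 1) * x powr (q - 2)))) (at x)" if "x \<in> {1 / 2..3 / 2}" for x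
   using that by (auto intro!: derivative_eq_intros)
  show "continuous_on {1 / 2..3 / 2} (%x. - (q * ((q - 1) * x powr (q - 2))))" by (intro continuous_intros) auto
 qed (use ulU lamc in "auto intro: that")
 show thesis
 proof (rule that[OF eps lam0 lamc])
  show "U 0 s = 1" for s by (simp add: U_def)
  show "\<exists>s\<in>?I. U t s ~= 1" if "t \<in> ?T" "t ~= 0" for t using Wnz[OF T[OF that(1)]] that(2) by (auto simp: U_def)
  show "0 < U t s" if "t \<in> ?T" "s \<in> ?I" for t s using UJ[OF that] by auto
  show "0 < lam t" if "t \<in> ?T" for t using sol[OF T[OF that]] by blast
 qed (fact U ulU)+
 qed
qed


section \<open>Partial derivatives\<close>

lemma has_derivative_pd:
 fixes h :: "real^'n::finite => real"
 assumes "h differentiable (at x)"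
 shows "(h has_derivative (%v. (\<chi> i. pd i h x) \<bullet> v)) (at x)"
proof -
 let ?D = "frechet_derivative h (at x)"
 have D: "(h has_derivative ?D) (at x)" using assms by (simp add: frechet_derivative_works)
 hence lin: "linear ?D" by (rule has_derivative_linear)
 have "?D v = (\<chi> i. pd i h x) \<bullet> v" for v
 proof -
  have "?D v = ?D (\<Sum>i\<in>UNIV. v $ i *\<^sub>R axis i 1)" using basis_expansion[of v] by (simp add: scalar_mult_eq_scaleR)
  also have "... = (\<Sum>i\<in>UNIV. v $ i * pd i h x)" by (simp add: linear_sum[OF lin] linear_scale[OF lin] pd_def o_def)
  finally show ?thesis by (simp add: inner_vec_def mult.commute)
 qed
 hence "?D = (%v. (\<chi> i. pd i h x) \<bullet> v)" by auto
 with D show ?thesis by simp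
qed

lemma pd_eqI:
 assumes "(h has_derivative D) (at x)"
 shows "pd i h x = D (axis i 1)" using frechet_derivative_at[OF assms] by (simp add: pd_def)

lemma pd_cong:
 assumes "open S" "x \<in> S" "!!y. y \<in> S ==> h y = h' y"
 shows "pd i h x = pd i h' x"
proof -
 have "(h has_derivative D) (at x) \<longleftrightarrow> (h' has_derivative D) (at x)" for D
  using assms has_derivative_transform_within_open by (metis (mono_tags, lifting))
 thus ?thesis by (simp add: pd_def frechet_derivative_def)
qed

lemma Ck_on_cong:
 assumes S: "open S"
 shows "(!!x. x \<in> S ==> h x = h' x) ==> Ck_on k h S = Ck_on k h' S"
proof (induction k arbitrary: h h')
 case 0
 show ?case unfolding Ck_on.simps by (rule continuous_on_cong) (use 0 in auto)
next
 case (Suc k)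
 have "h differentiable_on S \<longleftrightarrow> h' differentiable_on S"
  using Suc.prems by (auto simp: differentiable_on_def intro: differentiable_transform_within[of _ _ _ 1])
 moreover have "Ck_on k (pd i h) S = Ck_on k (pd i h') S" for i by (rule Suc.IH) (use pd_cong[OF S] Suc.prems in blast)
 ultimately show ?case by simp
qed

lemma smooth_on_pd: "smooth_on h S ==> smooth_on (pd i h) S"
 unfolding smooth_on_def by (metis Ck_on.simps(2))

lemma smooth_on_differentiable: "smooth_on h S ==> open S ==> x \<in> S ==> h differentiable (at x)"
 unfolding smooth_on_def by (metis Ck_on.simps(2) differentiable_on_eq_differentiable_at)

lemma smooth_on_continuous: "smooth_on h S ==> continuous_on S h"
 unfolding smooth_on_def by (metis Ck_on.simps(1))

section \<open>Linear algebra\<close>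

lemma norm_matrix_vector_le:
 fixes M :: "real^'n::finite^'m::finite"
 shows "norm (M *v w) <= (\<Sum>i\<in>UNIV. \<Sum>j\<in>UNIV. \<bar>M $ i $ j\<bar>) * norm w"
proof -
 have "norm (M *v w) <= onorm ((*v) M) * norm w" by (rule onorm[OF matrix_vector_mul_bounded_linear])
 also have "... <= (\<Sum>i\<in>UNIV. \<Sum>j\<in>UNIV. \<bar>M $ i $ j\<bar>) * norm w"
  by (intro mult_right_mono onorm_le_matrix_component_sum) auto
 finally show ?thesis .
qed

definition spd :: "real^'n::finite^'n => bool" where
 "spd M \<longleftrightarrow> transpose M = M & (ALL v. v ~= 0 --> v \<bullet> (M *v v) > 0)"

lemma symmetric_matrix_inner:
 fixes M :: "real^'n::finite^'n"
 assumes "transpose M = M"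
 shows "v \<bullet> (M *v w) = (M *v v) \<bullet> w"
 using dot_lmul_matrix[of v M w] vector_transpose_matrix[of v "transpose M"] assms by simp

lemma spd_nonneg: "spd M ==> 0 <= v \<bullet> (M *v v)"
 unfolding spd_def by (cases "v = 0") (auto simp: less_imp_le)

lemma spd_invertible:
 fixes M :: "real^'n::finite^'n"
 assumes "spd M"
 shows "invertible M"
proof -
 have "inj ((*v) M)"
 proof (rule injI)
  fix v w assume eq: "M *v v = M *v w"
  hence "M *v (v - w) = 0" by (simp add: matrix_vector_mult_diff_distrib)
  hence "(v - w) \<bullet> (M *v (v - w)) = 0" by simp
  thus "v = w" using assms unfolding spd_def by (metis less_irrefl right_minus_eq)
 qed
 thus ?thesis by (simp add: invertible_left_inverse matrix_left_invertible_injective)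
qed

lemma matrix_inv_mult:
 fixes M :: "real^'n::finite^'n"
 assumes "invertible M"
 shows "M ** matrix_inv M = mat 1" "matrix_inv M ** M = mat 1"
proof -
 have "M ** matrix_inv M = mat 1 & matrix_inv M ** M = mat 1"
  unfolding matrix_inv_def using assms unfolding invertible_def by (rule someI_ex)
 thus "M ** matrix_inv M = mat 1" "matrix_inv M ** M = mat 1" by auto
qed

lemma matrix_inv_vector:
 fixes M :: "real^'n::finite^'n"
 assumes "invertible M"
 shows "M *v (matrix_inv M *v v) = v" "matrix_inv M *v (M *v v) = v"
 using matrix_inv_mult[OF assms] by (simp_all add: matrix_vector_mul_assoc)

lemma spd_matrix_inv:
 fixes M :: "real^'n::finite^'n"
 assumes "spd M"
 shows "spd (matrix_inv M)" unfolding spd_def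
proof (intro conjI allI impI)
 note inv = spd_invertible[OF assms]
 have "transpose (matrix_inv M) ** M = mat 1" using arg_cong[OF matrix_inv_mult(1)[OF inv], of transpose] assms
  by (simp add: matrix_transpose_mul spd_def)
 hence "transpose (matrix_inv M) ** M ** matrix_inv M = matrix_inv M" by simp
 thus "transpose (matrix_inv M) = matrix_inv M" by (simp add: matrix_mul_assoc[symmetric] matrix_inv_mult(1)[OF inv])
 fix v :: "real^'n" assume v: "v ~= 0"
 define w where "w = matrix_inv M *v v"
 have vw: "v = M *v w" by (simp add: w_def matrix_inv_vector[OF inv])
 hence "w ~= 0" using v by auto
 hence "0 < w \<bullet> (M *v w)" using assms by (simp add: spd_def)
 hence "0 < (M *v w) \<bullet> w" by (simp only: inner_commute)
 thus "0 < v \<bullet> (matrix_inv M *v v)" unfolding w_def[symmetric] by (subst vw)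
qed

lemma spd_cauchy_schwarz:
 fixes M :: "real^'n::finite^'n"
 assumes M: "spd M"
 shows "(v \<bullet> (M *v w))\<^sup>2 <= (v \<bullet> (M *v v)) * (w \<bullet> (M *v w))"
proof (cases "w = 0")
 case False
 define bet where "bet = w \<bullet> (M *v w)"
 define gam where "gam = v \<bullet> (M *v w)"
 have bet: "0 < bet" using M False by (simp add: spd_def bet_def)
 have sym: "w \<bullet> (M *v v) = gam" using M symmetric_matrix_inner[of M w v] by (simp add: gam_def spd_def inner_commute)
 define u where "u = bet *\<^sub>R v - gam *\<^sub>R w"
 have "0 <= u \<bullet> (M *v u)" by (rule spd_nonneg[OF M])
 also have "u \<bullet> (M *v u) = bet * (bet * (v \<bullet> (M *v v)) - gam\<^sup>2)"
  using sym by (simp add: u_def matrix_vector_mult_diff_distrib scaleR_matrix_vector_assoc[symmetric]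
   matrix_vector_mult_scaleR inner_diff_left inner_diff_right bet_def[symmetric] gam_def[symmetric] power2_eq_square algebra_simps)
 finally have "gam\<^sup>2 <= bet * (v \<bullet> (M *v v))" using bet by (simp add: zero_le_mult_iff)
 thus ?thesis by (simp add: gam_def bet_def mult.commute)
qed simp

section \<open>Charts\<close>

locale riemannian =
 fixes X :: "'m topology" and A :: "('m, 'n::finite) chart set"
  and g :: "('m, 'n) chart => 'm => real^'n^'n"
 assumes M: "closed_connected_riemannian_manifold X A g"
begin

abbreviation dom :: "('m, 'n) chart => 'm set" where "dom c \<equiv> fst c"
abbreviation img :: "('m, 'n) chart => (real^'n) set" where "img c \<equiv> snd c ` fst c"
abbreviation ichart :: "('m, 'n) chart => real^'n => 'm" where "ichart c \<equiv> inv_into (fst c) (snd c)"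

lemma atlas: "smooth_atlas X A" and metric: "riemannian_metric A g"
 and compact_X: "compact_space X" and connected_X: "connected_space X"
 using M unfolding closed_connected_riemannian_manifold_def by blast+

lemma chart: assumes "c \<in> A"
 shows "openin X (dom c)" "open (img c)"
  "homeomorphic_map (subtopology X (dom c)) (top_of_set (img c)) (snd c)"
 using atlas assms unfolding smooth_atlas_def is_chart_def by blast+

lemma dom_subset: "c \<in> A ==> dom c <= topspace X"
 using chart(1) openin_subset by blast

lemma chart_inj: assumes "c \<in> A" shows "inj_on (snd c) (dom c)"
 using homeomorphic_imp_injective_map[OF chart(3)[OF assms]] dom_subset[OF assms] by (simp add: topspace_subtopology Int_absorb1)

lemma ichart: assumes "c \<in> A"
 shows "p \<in> dom c ==> ichart c (snd c p) = p" "x \<in> img c ==> snd c (ichart c x) = x"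
  "x \<in> img c ==> ichart c x \<in> dom c" using chart_inj[OF assms] by (auto simp: f_inv_into_f inv_into_into)

lemma chart_at: assumes "p \<in> topspace X"
 shows "chart_at A p \<in> A" "p \<in> dom (chart_at A p)"
proof -
 have "EX c. c \<in> A & p \<in> fst c" using atlas assms unfolding smooth_atlas_def by blast
 hence "chart_at A p \<in> A & p \<in> fst (chart_at A p)" unfolding chart_at_def by (rule someI_ex)
 thus "chart_at A p \<in> A" "p \<in> dom (chart_at A p)" by auto
qed

lemma openin_chart_preimage:
 assumes c: "c \<in> A" and W: "open W"
 shows "openin X {p \<in> dom c. snd c p \<in> W}"
proof -
 have "continuous_map (subtopology X (dom c)) (top_of_set (img c)) (snd c)"
  by (rule homeomorphic_imp_continuous_map[OF chart(3)[OF c]])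
 hence cm: "continuous_map (subtopology X (dom c)) euclidean (snd c)" by (simp add: continuous_map_in_subtopology)
 have "openin (subtopology X (dom c)) {p \<in> topspace (subtopology X (dom c)). snd c p \<in> W}"
  by (rule openin_continuous_map_preimage[OF cm]) (use W in "simp add: open_openin[symmetric]")
 moreover have "topspace (subtopology X (dom c)) = dom c" using dom_subset[OF c] by auto
 ultimately have "openin (subtopology X (dom c)) {p \<in> dom c. snd c p \<in> W}" by metis
 thus ?thesis using openin_open_subtopology[OF chart(1)[OF c]] by blast
qed

lemma open_chart_image:
 assumes c: "c \<in> A" and T: "openin X T"
 shows "open (snd c ` (dom c \<inter> T))"
proof -
 have "openin (subtopology X (dom c)) (dom c \<inter> T)" using T by (metis inf_commute openin_subtopology_Int)
 hence "openin (top_of_set (img c)) (snd c ` (dom c \<inter> T))"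
  using homeomorphic_imp_open_map[OF chart(3)[OF c]] by (auto simp: open_map_def)
 thus ?thesis using chart(2)[OF c] openin_open_trans by blast
qed

lemma continuous_map_ichart:
 assumes c: "c \<in> A"
 shows "continuous_map (top_of_set (img c)) X (ichart c)" unfolding continuous_map_def
proof (intro conjI allI impI)
 show "ichart c \<in> topspace (top_of_set (img c)) \<rightarrow> topspace X" using ichart(3)[OF c] dom_subset[OF c] by auto
 fix T assume T: "openin X T"
 have "{x \<in> topspace (top_of_set (img c)). ichart c x \<in> T} = snd c ` (dom c \<inter> T)"
  using ichart[OF c] by (auto simp: image_iff)
 thus "openin (top_of_set (img c)) {x \<in> topspace (top_of_set (img c)). ichart c x \<in> T}"
  using open_chart_image[OF c T] by (simp add: open_subset image_mono)
qed

lemma local_rep_apply: "local_rep c u x = u (ichart c x)"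
 by (simp add: local_rep_def)

lemma local_rep_chart: "c \<in> A ==> p \<in> dom c ==> local_rep c u (snd c p) = u p"
 by (simp add: local_rep_apply ichart)

lemma continuous_map_locally:
 assumes "!!c. c \<in> A ==> continuous_on (img c) (local_rep c u)"
 shows "continuous_map X euclideanreal u"
proof (subst continuous_map_def, intro conjI allI impI)
 fix T :: "real set" assume "openin euclideanreal T"
 hence T: "open T" by (metis open_openin)
 show "openin X {p \<in> topspace X. u p \<in> T}"
 proof (subst openin_subopen, clarify)
  fix p assume p: "p \<in> topspace X" "u p \<in> T"
  define c where "c = chart_at A p"
  have c: "c \<in> A" "p \<in> dom c" using chart_at[OF p(1)] by (auto simp: c_def)
  define W where "W = img c \<inter> local_rep c u -` T"
  have W: "open W" unfolding W_def by (rule continuous_open_preimage[OF assms[OF c(1)] chart(2)[OF c(1)] T])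
  have "openin X {r \<in> dom c. snd c r \<in> W}" by (rule openin_chart_preimage[OF c(1) W])
  moreover have "p \<in> {r \<in> dom c. snd c r \<in> W}" using c p by (auto simp: W_def local_rep_chart)
  moreover have "{r \<in> dom c. snd c r \<in> W} <= {p \<in> topspace X. u p \<in> T}"
  proof
   fix r assume "r \<in> {r \<in> dom c. snd c r \<in> W}"
   hence "r \<in> dom c" "local_rep c u (snd c r) \<in> T" by (simp_all add: W_def)
   thus "r \<in> {p \<in> topspace X. u p \<in> T}" using local_rep_chart[OF c(1), of r u] dom_subset[OF c(1)] by auto
  qed
  ultimately show "EX S. openin X S & p \<in> S & S <= {p \<in> topspace X. u p \<in> T}" by blast
 qed
qed auto

lemma connected_induct:
 assumes S: "S <= topspace X" "S ~= {}"
  and local: "!!p. p \<in> topspace X ==> EX U. openin X U & p \<in> U & (U <= S | U \<inter> S = {})"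
 shows "S = topspace X"
proof -
 have "openin X S"
 proof (subst openin_subopen, clarify)
  fix p assume "p \<in> S"
  thus "EX T. openin X T & p \<in> T & T <= S" using local[of p] S(1) by blast
 qed
 moreover have "openin X (topspace X - S)"
 proof (subst openin_subopen, clarify)
  fix p assume p: "p \<in> topspace X" "p \<notin> S"
  then obtain U where U: "openin X U" "p \<in> U" "U <= S | U \<inter> S = {}" using local by blast
  thus "EX T. openin X T & p \<in> T & T <= topspace X - S" using p openin_subset[OF U(1)] by blast
 qed
 ultimately show ?thesis using connected_X S unfolding connected_space_clopen_in closedin_def by blast
qed

section \<open>Change of coordinates\<close>

lemma open_overlap:
 assumes "c \<in> A" "c' \<in> A"
 shows "open (snd c ` (dom c \<inter> dom c'))" by (rule open_chart_image[OF assms(1) chart(1)[OF assms(2)]])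

lemma transition_smooth:
 assumes "c \<in> A" "c' \<in> A"
 shows "smooth_on (local_rep c (snd c')) (snd c ` (dom c \<inter> dom c'))"
 using atlas assms unfolding smooth_atlas_def compatible_def by blast

definition jac :: "('m, 'n) chart => ('m, 'n) chart => 'm => real^'n^'n" where
 "jac c c' p = matrix (frechet_derivative (local_rep c (snd c')) (at (snd c p)))"

lemma transition_derivative:
 assumes "c \<in> A" "c' \<in> A" "p \<in> dom c" "p \<in> dom c'"
 shows "(local_rep c (snd c') has_derivative (*v) (jac c c' p)) (at (snd c p))"
proof -
 have "local_rep c (snd c') differentiable (at (snd c p))"
  by (rule smooth_on_differentiable[OF transition_smooth[OF assms(1,2)] open_overlap[OF assms(1,2)]])
   (use assms in auto)
 hence D: "(local_rep c (snd c') has_derivative frechet_derivative (local_rep c (snd c')) (at (snd c p))) (at (snd c p))"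
  by (simp add: frechet_derivative_works)
 thus ?thesis unfolding jac_def using matrix_works[of "frechet_derivative (local_rep c (snd c')) (at (snd c p))"]
   has_derivative_linear[OF D] by (simp add: linear_matrix_vector_mul_eq matrix_vector_mul)
qed

lemma metric_spd: "c \<in> A ==> p \<in> dom c ==> spd (g c p)"
 using metric unfolding riemannian_metric_def spd_def by blast

lemma metric_transform:
 assumes "c \<in> A" "c' \<in> A" "p \<in> dom c" "p \<in> dom c'"
 shows "g c p = transpose (jac c c' p) ** g c' p ** jac c c' p"
 using metric[unfolded riemannian_metric_def Let_def, THEN conjunct2, THEN conjunct2,
   rule_format, of c c' p] assms by (simp add: jac_def)

lemma metric_transform_inner:
 assumes "c \<in> A" "c' \<in> A" "p \<in> dom c" "p \<in> dom c'"
 shows "v \<bullet> (g c p *v w) = (jac c c' p *v v) \<bullet> (g c' p *v (jac c c' p *v w))"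
proof -
 have "v \<bullet> (g c p *v w) = v \<bullet> (transpose (jac c c' p) *v (g c' p *v (jac c c' p *v w)))"
  by (subst metric_transform[OF assms]) (simp add: matrix_vector_mul_assoc[symmetric])
 also have "... = (jac c c' p *v v) \<bullet> (g c' p *v (jac c c' p *v w))"
  by (metis dot_lmul_matrix vector_transpose_matrix transpose_transpose)
 finally show ?thesis .
qed

definition grad_norm_sq :: "('m, 'n) chart => ('m => real) => 'm => real" where
 "grad_norm_sq c u p = gradient g c u p \<bullet> (g c p *v gradient g c u p)"

definition coord_grad :: "('m, 'n) chart => ('m => real) => real^'n => real^'n" where
 "coord_grad c u x = (\<chi> i. pd i (local_rep c u) x)"

lemma gradient_eq: "gradient g c u p = matrix_inv (g c p) *v coord_grad c u (snd c p)"
 by (simp add: gradient_def coord_grad_def)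

lemma metric_gradient:
 assumes "c \<in> A" "p \<in> dom c"
 shows "g c p *v gradient g c u p = coord_grad c u (snd c p)"
 unfolding gradient_eq by (rule matrix_inv_vector[OF spd_invertible[OF metric_spd[OF assms]]])

lemma grad_norm_sq_eq:
 assumes "c \<in> A" "p \<in> dom c"
 shows "grad_norm_sq c u p = gradient g c u p \<bullet> coord_grad c u (snd c p)"
 by (simp add: grad_norm_sq_def metric_gradient[OF assms])

text \<open>The differential applied to \<open>w\<close> is the metric product of the gradient
with \<open>w\<close>.\<close>

lemma grad_norm_sq_cauchy_schwarz:
 assumes "c \<in> A" "p \<in> dom c"
 shows "(coord_grad c u (snd c p) \<bullet> w)\<^sup>2 <= grad_norm_sq c u p * (w \<bullet> (g c p *v w))"
proof -
 have "coord_grad c u (snd c p) \<bullet> w = gradient g c u p \<bullet> (g c p *v w)"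
  using metric_spd[OF assms] symmetric_matrix_inner[of "g c p" "gradient g c u p" w]
  by (simp add: metric_gradient[OF assms] spd_def)
 thus ?thesis using spd_cauchy_schwarz[OF metric_spd[OF assms]] by (simp add: grad_norm_sq_def)
qed

lemma coord_grad_transform:
 assumes c: "c \<in> A" "c' \<in> A" "p \<in> dom c" "p \<in> dom c'"
  and u: "local_rep c' u differentiable (at (snd c' p))"
 shows "coord_grad c u (snd c p) \<bullet> v = coord_grad c' u (snd c' p) \<bullet> (jac c c' p *v v)"
proof -
 let ?tau = "local_rep c (snd c')"
 have taup: "?tau (snd c p) = snd c' p" using c by (simp add: local_rep_chart)
 have D': "(local_rep c' u has_derivative (%v. coord_grad c' u (snd c' p) \<bullet> v)) (at (?tau (snd c p)))"
  unfolding taup coord_grad_def by (rule has_derivative_pd[OF u])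
 have "((%x. local_rep c' u (?tau x)) has_derivative (%v. coord_grad c' u (snd c' p) \<bullet> (jac c c' p *v v))) (at (snd c p))"
  by (rule has_derivative_compose[OF transition_derivative[OF c] D'])
 hence D: "(local_rep c u has_derivative (%v. coord_grad c' u (snd c' p) \<bullet> (jac c c' p *v v))) (at (snd c p))"
 proof (rule has_derivative_transform_within_open[OF _ open_overlap[OF c(1,2)]])
  show "snd c p \<in> snd c ` (dom c \<inter> dom c')" using c by blast
  fix x assume "x \<in> snd c ` (dom c \<inter> dom c')"
  then obtain r where "r \<in> dom c" "r \<in> dom c'" "x = snd c r" by blast
  thus "local_rep c' u (?tau x) = local_rep c u x" using c by (simp add: local_rep_chart)
 qed
 hence "local_rep c u differentiable (at (snd c p))" by (auto simp: differentiable_def)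
 from has_derivative_unique[OF has_derivative_pd[OF this] D]
 show ?thesis unfolding coord_grad_def by metis
qed

lemma grad_norm_sq_indep:
 assumes c: "c \<in> A" "c' \<in> A" "p \<in> dom c" "p \<in> dom c'"
  and u: "local_rep c' u differentiable (at (snd c' p))"
 shows "grad_norm_sq c u p = grad_norm_sq c' u p"
proof -
 let ?J = "jac c c' p" and ?v = "gradient g c u p" and ?v' = "gradient g c' u p"
 have inj: "inj ((*v) ?J)"
 proof (rule injI)
  fix v w assume eq: "?J *v v = ?J *v w"
  hence 0: "?J *v (v - w) = 0" by (simp add: matrix_vector_mult_diff_distrib)
  have "(v - w) \<bullet> (g c p *v (v - w)) = 0" unfolding metric_transform_inner[OF c] 0 by simp
  thus "v = w" using metric_spd[OF c(1,3)] unfolding spd_def by (metis less_irrefl right_minus_eq)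
 qed
 hence surj: "surj ((*v) ?J)" by (rule linear_injective_imp_surjective[rotated]) auto
 have "z \<bullet> (g c' p *v (?J *v ?v)) = z \<bullet> (g c' p *v ?v')" for z
 proof -
  obtain w where w: "z = ?J *v w" using surj by (metis surjD)
  have "z \<bullet> (g c' p *v (?J *v ?v)) = w \<bullet> (g c p *v ?v)" unfolding w metric_transform_inner[OF c] ..
  also have "... = coord_grad c u (snd c p) \<bullet> w" by (simp add: metric_gradient c inner_commute)
  also have "... = coord_grad c' u (snd c' p) \<bullet> z" unfolding w by (rule coord_grad_transform[OF c u])
  also have "... = z \<bullet> (g c' p *v ?v')" by (simp add: metric_gradient c inner_commute)
  finally show ?thesis .
 qed
 hence "g c' p *v (?J *v ?v) = g c' p *v ?v'" by (metis vector_eq_ldot)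
 hence "?J *v ?v = ?v'" using matrix_inv_vector(2)[OF spd_invertible[OF metric_spd[OF c(2,4)]]] by metis
 thus ?thesis by (simp add: grad_norm_sq_def metric_transform_inner[OF c])
qed

lemma gradient_norm_sq_chart:
 assumes c: "c \<in> A" "p \<in> dom c" and u: "!!c. c \<in> A ==> p \<in> dom c ==> local_rep c u differentiable (at (snd c p))"
 shows "gradient_norm_sq A g u p = grad_norm_sq c u p"
proof -
 have "p \<in> topspace X" using c dom_subset by blast
 note ch = chart_at[OF this]
 show ?thesis using grad_norm_sq_indep[OF ch(1) c(1) ch(2) c(2) u[OF c]]
  by (simp add: gradient_norm_sq_def grad_norm_sq_def Let_def)
qed

end


section \<open>Curves, lengths and distances\<close>

lemma continuous_on_matrix_vector_mult:
 fixes G :: "'a::topological_space => real^'n::finite^'m::finite"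
 assumes "continuous_on S G" "continuous_on S v"
 shows "continuous_on S (%s. G s *v v s)" unfolding matrix_vector_mult_def by (intro continuous_intros assms)

context riemannian
begin

lemma curve_eventually_in_open:
 assumes gam: "continuous_map (top_of_set {a..b}) X gam" and U: "openin X U" and t: "t \<in> {a..b}" "gam t \<in> U"
 shows "\<exists>d>0. \<forall>s\<in>{a..b}. dist s t < d --> gam s \<in> U"
proof -
 have "openin (top_of_set {a..b}) {s \<in> topspace (top_of_set {a..b}). gam s \<in> U}"
  by (rule openin_continuous_map_preimage[OF gam U])
 hence o: "openin (top_of_set {a..b}) {s \<in> {a..b}. gam s \<in> U}" by simp
 have "t \<in> {s \<in> {a..b}. gam s \<in> U}" using t by simp
 then obtain d where "d > 0" "ball t d \<inter> {a..b} <= {s \<in> {a..b}. gam s \<in> U}"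
  using o unfolding openin_contains_ball by meson
 thus ?thesis by (auto simp: subset_iff mem_ball dist_commute)
qed

lemma C1_curveD:
 assumes "C1_curve X A gam a b"
 shows "a < b" "continuous_map (top_of_set {a..b}) X gam"
  "c \<in> A ==> t \<in> {a..b} ==> gam t \<in> dom c ==> (snd c \<circ> gam) differentiable (at t within {a..b})"
  "c \<in> A ==> continuous_on {t\<in>{a..b}. gam t \<in> dom c} (%t. vector_derivative (snd c \<circ> gam) (at t within {a..b}))"
 using assms unfolding C1_curve_def by blast+

definition velocity :: "('m, 'n) chart => (real => 'm) => real => real => real => real^'n" where
 "velocity c gam a b t = vector_derivative (snd c \<circ> gam) (at t within {a..b})"

definition speed :: "(real => 'm) => real => real => real => real" where
 "speed gam a b t = (let c = chart_at A (gam t); v = velocity c gam a b t in sqrt (v \<bullet> (g c (gam t) *v v)))"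

lemma curve_length_speed: "curve_length A g gam a b = integral {a..b} (speed gam a b)"
 unfolding curve_length_def speed_def velocity_def Let_def ..

lemma velocity:
 assumes "C1_curve X A gam a b" "c \<in> A" "t \<in> {a..b}" "gam t \<in> dom c"
 shows "((snd c \<circ> gam) has_vector_derivative velocity c gam a b t) (at t within {a..b})"
 unfolding velocity_def using C1_curveD(3)[OF assms] by (simp add: vector_derivative_works)

lemma velocity_transform:
 assumes gam: "C1_curve X A gam a b" and c: "c \<in> A" "c' \<in> A" and t: "t \<in> {a..b}" "gam t \<in> dom c" "gam t \<in> dom c'"
 shows "velocity c' gam a b t = jac c c' (gam t) *v velocity c gam a b t"
proof -
 let ?tau = "local_rep c (snd c')"
 obtain d where d: "d > 0" "!!s. s \<in> {a..b} ==> dist s t < d ==> gam s \<in> dom c \<inter> dom c'"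
  using curve_eventually_in_open[OF C1_curveD(2)[OF gam], of "dom c \<inter> dom c'" t] chart(1) c t by blast
 have d1: "((snd c \<circ> gam) has_derivative (%h. h *\<^sub>R velocity c gam a b t)) (at t within {a..b})"
   using velocity[OF gam c(1) t(1,2)] by (simp add: has_vector_derivative_def)
 have d2: "(?tau has_derivative (*v) (jac c c' (gam t))) (at ((snd c \<circ> gam) t))"
   using transition_derivative[OF c t(2,3)] by simp
 have "((%s. ?tau ((snd c \<circ> gam) s)) has_derivative (%h. jac c c' (gam t) *v (h *\<^sub>R velocity c gam a b t))) (at t within {a..b})"
  by (rule has_derivative_compose[OF d1 d2])
 hence "((%s. ?tau ((snd c \<circ> gam) s)) has_vector_derivative jac c c' (gam t) *v velocity c gam a b t) (at t within {a..b})"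
  by (simp add: has_vector_derivative_def matrix_vector_mult_scaleR)
 hence "((snd c' \<circ> gam) has_vector_derivative jac c c' (gam t) *v velocity c gam a b t) (at t within {a..b})"
 proof (rule has_vector_derivative_transform_within[OF _ d(1) t(1)])
  show "?tau ((snd c \<circ> gam) s) = (snd c' \<circ> gam) s" if "s \<in> {a..b}" "dist s t < d" for s
   using d(2)[OF that] c by (simp add: local_rep_chart)
 qed
 from vector_derivative_within_cbox[of a b t, unfolded box_real, OF _ _ this]
 show ?thesis using C1_curveD(1)[OF gam] t(1) by (simp add: velocity_def)
qed

lemma speed_chart:
 assumes gam: "C1_curve X A gam a b" and c: "c \<in> A" and t: "t \<in> {a..b}" "gam t \<in> dom c"
 shows "speed gam a b t = sqrt (velocity c gam a b t \<bullet> (g c (gam t) *v velocity c gam a b t))"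
proof -
 have "gam t \<in> topspace X" using t c dom_subset by blast
 note ch = chart_at[OF this]
 show ?thesis unfolding speed_def Let_def velocity_transform[OF gam c ch(1) t ch(2)]
  by (simp add: metric_transform_inner[OF c ch(1) t(2) ch(2)])
qed

lemma curve_in_X: "C1_curve X A gam a b ==> t \<in> {a..b} ==> gam t \<in> topspace X"
 using C1_curveD(2) by (fastforce simp: continuous_map_def)

lemma metric_continuous:
 assumes "c \<in> A"
 shows "continuous_on (img c) (local_rep c (g c))" using metric assms smooth_on_continuous unfolding riemannian_metric_def by blast

lemma speed_continuous:
 assumes gam: "C1_curve X A gam a b"
 shows "continuous_on {a..b} (speed gam a b)" unfolding continuous_on_eq_continuous_within
proof
 fix t assume t: "t \<in> {a..b}"
 define c where "c = chart_at A (gam t)"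
 have c: "c \<in> A" "gam t \<in> dom c" using chart_at[OF curve_in_X[OF gam t]] by (auto simp: c_def)
 obtain d where d: "d > 0" "!!s. s \<in> {a..b} ==> dist s t < d ==> gam s \<in> dom c"
  using curve_eventually_in_open[OF C1_curveD(2)[OF gam] chart(1)[OF c(1)] t c(2)] by blast
 let ?S = "{s\<in>{a..b}. gam s \<in> dom c}"
 let ?h = "%s. sqrt (velocity c gam a b s \<bullet> (g c (gam s) *v velocity c gam a b s))"
 have v: "continuous_on ?S (velocity c gam a b)" using C1_curveD(4)[OF gam c(1)] by (simp add: velocity_def[abs_def])
 have x: "continuous_on ?S (snd c \<circ> gam)" unfolding continuous_on_eq_continuous_within
 proof
  fix s assume "s \<in> ?S"
  hence "(snd c \<circ> gam) differentiable (at s within {a..b})" using C1_curveD(3)[OF gam c(1)] by auto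
  hence "continuous (at s within {a..b}) (snd c \<circ> gam)" by (rule differentiable_imp_continuous_within)
  thus "continuous (at s within ?S) (snd c \<circ> gam)" by (rule continuous_within_subset) auto
 qed
 have "continuous_on ?S (%s. local_rep c (g c) ((snd c \<circ> gam) s))"
  by (rule continuous_on_compose2[OF metric_continuous[OF c(1)] x]) auto
 hence G: "continuous_on ?S (%s. g c (gam s))" by (rule continuous_on_eq) (use c in "simp add: local_rep_chart")
 have "continuous_on ?S (%s. g c (gam s) *v velocity c gam a b s)" by (rule continuous_on_matrix_vector_mult[OF G v])
 hence "continuous_on ?S ?h" by (intro continuous_intros v)
 hence "continuous_on ({a..b} \<inter> ball t d) ?h" by (rule continuous_on_subset) (use d(2) in "auto simp: dist_commute")
 hence "continuous (at t within ({a..b} \<inter> ball t d)) ?h" using t d(1) by (simp add: continuous_on_eq_continuous_within)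
 moreover have "at t within ({a..b} \<inter> ball t d) = at t within {a..b}"
  by (rule at_within_nhd[of t "ball t d"]) (use d(1) in auto)
 ultimately have "continuous (at t within {a..b}) ?h" by simp
 thus "continuous (at t within {a..b}) (speed gam a b)" by (rule continuous_transform_within[OF _ d(1) t])
   (use speed_chart[OF gam c(1) _ d(2)] in auto)
qed

lemma speed_nonneg: "C1_curve X A gam a b ==> t \<in> {a..b} ==> 0 <= speed gam a b t"
 using chart_at[OF curve_in_X, of gam a b t] spd_nonneg[OF metric_spd] by (simp add: speed_def Let_def)

lemma curve_length_nonneg:
 assumes "C1_curve X A gam a b"
 shows "0 <= curve_length A g gam a b" unfolding curve_length_speed
 by (rule integral_nonneg[OF integrable_continuous_real[OF speed_continuous[OF assms]]])
   (rule speed_nonneg[OF assms])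

lemma curve_derivative:
 assumes gam: "C1_curve X A gam a b" and c: "c \<in> A" and t: "t \<in> {a..b}" "gam t \<in> dom c"
  and u: "local_rep c u differentiable (at (snd c (gam t)))"
 shows "((%s. u (gam s)) has_real_derivative coord_grad c u (snd c (gam t)) \<bullet> velocity c gam a b t) (at t within {a..b})"
proof -
 obtain d where d: "d > 0" "!!s. s \<in> {a..b} ==> dist s t < d ==> gam s \<in> dom c"
  using curve_eventually_in_open[OF C1_curveD(2)[OF gam] chart(1)[OF c] t] by blast
 have d1: "((snd c \<circ> gam) has_derivative (%h. h *\<^sub>R velocity c gam a b t)) (at t within {a..b})"
   using velocity[OF gam c t] by (simp add: has_vector_derivative_def)
 have d2: "(local_rep c u has_derivative (%v. coord_grad c u (snd c (gam t)) \<bullet> v)) (at ((snd c \<circ> gam) t))"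
   unfolding coord_grad_def using has_derivative_pd[OF u] by simp
 have "((%s. local_rep c u ((snd c \<circ> gam) s)) has_derivative
   (%h. coord_grad c u (snd c (gam t)) \<bullet> (h *\<^sub>R velocity c gam a b t))) (at t within {a..b})"
  by (rule has_derivative_compose[OF d1 d2])
 hence "((%s. local_rep c u ((snd c \<circ> gam) s)) has_real_derivative coord_grad c u (snd c (gam t)) \<bullet> velocity c gam a b t) (at t within {a..b})"
 proof -
  have "(%h. coord_grad c u (snd c (gam t)) \<bullet> (h *\<^sub>R velocity c gam a b t)) =
   (*) (coord_grad c u (snd c (gam t)) \<bullet> velocity c gam a b t)" by (rule ext) simp
  with \<open>((%s. local_rep c u ((snd c \<circ> gam) s)) has_derivative
   (%h. coord_grad c u (snd c (gam t)) \<bullet> (h *\<^sub>R velocity c gam a b t))) (at t within {a..b})\<close>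
  show ?thesis unfolding has_field_derivative_def by metis
 qed
 thus ?thesis by (rule has_field_derivative_transform_within[OF _ d(1) t(1)])
   (use d(2) c in "simp add: local_rep_chart")
qed

lemma curve_length_ge:
 assumes gam: "C1_curve X A gam a b"
  and u: "!!c p. c \<in> A ==> p \<in> dom c ==> local_rep c u differentiable (at (snd c p))"
  and S: "!!p. p \<in> topspace X ==> u p \<in> S"
  and eta: "!!s. s \<in> S ==> (eta has_real_derivative eta' s) (at s within S)"
  and le: "!!p. p \<in> topspace X ==> (eta' (u p))\<^sup>2 * gradient_norm_sq A g u p <= 1"
 shows "\<bar>eta (u (gam b)) - eta (u (gam a))\<bar> <= curve_length A g gam a b"
proof -
 have ab: "a < b" by (rule C1_curveD(1)[OF gam])
 define D where "D t = eta' (u (gam t)) * (coord_grad (chart_at A (gam t)) u (snd (chart_at A (gam t)) (gam t)) \<bullet> velocity (chart_at A (gam t)) gam a b t)" for t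
 have der: "((%t. eta (u (gam t))) has_vector_derivative D t) (at t within {a..b})"
  and bd: "\<bar>D t\<bar> <= speed gam a b t" if t: "t \<in> {a..b}" for t
 proof -
  have p: "gam t \<in> topspace X" by (rule curve_in_X[OF gam t])
  define c where "c = chart_at A (gam t)"
  have c: "c \<in> A" "gam t \<in> dom c" using chart_at[OF p] by (auto simp: c_def)
  let ?w = "coord_grad c u (snd c (gam t)) \<bullet> velocity c gam a b t"
  have 1: "((%s. u (gam s)) has_real_derivative ?w) (at t within {a..b})" by (rule curve_derivative[OF gam c(1) t c(2) u[OF c]])
  have sub: "(%s. u (gam s)) ` {a..b} <= S" using S curve_in_X[OF gam] by auto
  have 2: "(eta has_real_derivative eta' (u (gam t))) (at (u (gam t)) within (%s. u (gam s)) ` {a..b})"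
   by (rule has_field_derivative_subset[OF eta[OF S[OF p]] sub])
  have "((eta \<circ> (%s. u (gam s))) has_real_derivative eta' (u (gam t)) * ?w) (at t within {a..b})"
   by (rule DERIV_image_chain[OF 2 1])
  thus "((%t. eta (u (gam t))) has_vector_derivative D t) (at t within {a..b})"
   by (simp add: D_def c_def o_def has_real_derivative_iff_has_vector_derivative)
  let ?v = "velocity c gam a b t"
  have G: "0 <= ?v \<bullet> (g c (gam t) *v ?v)" by (rule spd_nonneg[OF metric_spd[OF c]])
  have "(D t)\<^sup>2 = (eta' (u (gam t)))\<^sup>2 * ?w\<^sup>2" by (simp add: D_def c_def power_mult_distrib)
  also have "... <= (eta' (u (gam t)))\<^sup>2 * (grad_norm_sq c u (gam t) * (?v \<bullet> (g c (gam t) *v ?v)))"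
   by (intro mult_left_mono grad_norm_sq_cauchy_schwarz c) auto
  also have "grad_norm_sq c u (gam t) = gradient_norm_sq A g u (gam t)" using gradient_norm_sq_chart[OF c u] by simp
  also have "(eta' (u (gam t)))\<^sup>2 * (gradient_norm_sq A g u (gam t) * (?v \<bullet> (g c (gam t) *v ?v))) <= 1 * (?v \<bullet> (g c (gam t) *v ?v))"
   unfolding mult.assoc[symmetric] using le[OF p] G by (intro mult_right_mono)
  finally have "(D t)\<^sup>2 <= ?v \<bullet> (g c (gam t) *v ?v)" by simp
  hence "sqrt ((D t)\<^sup>2) <= sqrt (?v \<bullet> (g c (gam t) *v ?v))" by (rule real_sqrt_le_mono)
  thus "\<bar>D t\<bar> <= speed gam a b t" by (simp add: speed_chart[OF gam c(1) t c(2)])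
 qed
 have i: "(D has_integral eta (u (gam b)) - eta (u (gam a))) {a..b}" by (rule fundamental_theorem_of_calculus) (use ab der in auto)
 have j: "(speed gam a b has_integral curve_length A g gam a b) {a..b}" unfolding curve_length_speed
  by (rule integrable_integral[OF integrable_continuous_real[OF speed_continuous[OF gam]]])
 have "eta (u (gam b)) - eta (u (gam a)) <= curve_length A g gam a b"
  by (rule has_integral_le[OF i j]) (use bd in "auto simp: abs_le_iff")
 moreover have "- (eta (u (gam b)) - eta (u (gam a))) <= curve_length A g gam a b"
  by (rule has_integral_le[OF has_integral_neg[OF i] j]) (use bd in "auto simp: abs_le_iff")
 ultimately show ?thesis by (simp add: abs_le_iff)
qed

section \<open>Piecewise paths\<close>

lemma path_nonneg: "pw_C1_path X A g p q L ==> 0 <= L"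
proof (induction rule: pw_C1_path.induct)
 case (append p gam a L b)
 thus ?case using curve_length_nonneg[OF append.hyps(2)] by linarith
qed simp

lemma path_in_X: "pw_C1_path X A g p q L ==> p \<in> topspace X & q \<in> topspace X"
proof (induction rule: pw_C1_path.induct)
 case (append p gam a L b)
 thus ?case using curve_in_X[OF append.hyps(2), of b] C1_curveD(1)[OF append.hyps(2)] by auto
qed auto

lemma path_trans:
 "pw_C1_path X A g q r L' ==> pw_C1_path X A g p q L ==> pw_C1_path X A g p r (L + L')"
proof (induction rule: pw_C1_path.induct)
 case (append q gam a L' b)
 have "pw_C1_path X A g p (gam b) ((L + L') + curve_length A g gam a b)"
  by (rule pw_C1_path.append[OF append.IH[OF append.prems] append.hyps(2)])
 thus ?case by (simp add: add.assoc)
qed simp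

text \<open>A function whose gradient has length at most one cannot vary along a path by more than
its length.\<close>

lemma path_length_ge:
 assumes "pw_C1_path X A g p q L"
  and u: "!!c p. c \<in> A ==> p \<in> dom c ==> local_rep c u differentiable (at (snd c p))"
  and S: "!!p. p \<in> topspace X ==> u p \<in> S"
  and eta: "!!s. s \<in> S ==> (eta has_real_derivative eta' s) (at s within S)"
  and le: "!!p. p \<in> topspace X ==> (eta' (u p))\<^sup>2 * gradient_norm_sq A g u p <= 1"
 shows "\<bar>eta (u q) - eta (u p)\<bar> <= L" using assms(1)
proof (induction rule: pw_C1_path.induct)
 case (append p gam a L b)
 thus ?case using curve_length_ge[OF append.hyps(2) u S eta le] by linarith
qed simp

text \<open>Coordinate segments, and chains of them, are the only curves that have to be
constructed.\<close>

lemma segment_path: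
 assumes c: "c \<in> A" and seg: "!!t. t \<in> {0..1} ==> x + t *\<^sub>R v \<in> img c"
  and K: "0 <= K" "!!t. t \<in> {0..1} ==> v \<bullet> (g c (ichart c (x + t *\<^sub>R v)) *v v) <= K\<^sup>2"
 shows "\<exists>L \<le> K. pw_C1_path X A g (ichart c x) (ichart c (x + v)) L"
proof -
 define gam where "gam t = ichart c (x + t *\<^sub>R v)" for t
 have dom: "gam t \<in> dom c" if "t \<in> {0..1}" for t unfolding gam_def using ichart(3)[OF c seg[OF that]] .
 have val: "snd c (gam t) = x + t *\<^sub>R v" if "t \<in> {0..1}" for t unfolding gam_def using ichart(2)[OF c seg[OF that]] .
 have cont: "continuous_map (top_of_set {0..1}) X gam"
 proof -
  have "continuous_map (top_of_set {0..1}) (top_of_set (img c)) (%t. x + t *\<^sub>R v)"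
   using seg by (auto simp: continuous_map_in_subtopology intro!: continuous_intros)
  from continuous_map_compose[OF this continuous_map_ichart[OF c]]
  show ?thesis by (simp add: gam_def[abs_def] o_def)
 qed
 have der: "((snd c' \<circ> gam) has_vector_derivative jac c c' (gam t) *v v) (at t within {0..1})"
  if c': "c' \<in> A" and t: "t \<in> {0..1}" "gam t \<in> dom c'" for c' t
 proof -
  let ?tau = "local_rep c (snd c')"
  have eq: "(%s. ?tau (x + s *\<^sub>R v)) = snd c' \<circ> gam" by (auto simp: local_rep_apply gam_def)
  have d1: "((%s. x + s *\<^sub>R v) has_derivative (%h. h *\<^sub>R v)) (at t within {0..1})"
   by (auto intro!: derivative_eq_intros)
  have d2: "(?tau has_derivative (*v) (jac c c' (gam t))) (at (x + t *\<^sub>R v))"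
   using transition_derivative[OF c c' dom[OF t(1)] t(2)] val[OF t(1)] by simp
  have "((%s. ?tau (x + s *\<^sub>R v)) has_derivative (%h. jac c c' (gam t) *v (h *\<^sub>R v))) (at t within {0..1})"
   by (rule has_derivative_compose[OF d1 d2])
  thus ?thesis unfolding eq by (simp add: has_vector_derivative_def matrix_vector_mult_scaleR)
 qed
 have vel: "vector_derivative (snd c' \<circ> gam) (at t within {0..1}) = jac c c' (gam t) *v v"
  if "c' \<in> A" "t \<in> {0..1}" "gam t \<in> dom c'" for c' t
  by (rule vector_derivative_within_closed_interval[OF _ _ der[OF that]]) (use that in auto)
 have C1: "C1_curve X A gam 0 1" unfolding C1_curve_def
 proof (intro conjI ballI impI)
  fix c' t assume "c' \<in> A" "t \<in> {0..1::real}" "gam t \<in> dom c'"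
  thus "(snd c' \<circ> gam) differentiable (at t within {0..1})"
   using der unfolding has_vector_derivative_def differentiable_def by blast
 next
  fix c' assume c': "c' \<in> A"
  let ?T = "{t \<in> {0..1}. gam t \<in> dom c'}" let ?W = "snd c ` (dom c \<inter> dom c')"
  let ?tau = "local_rep c (snd c')"
  have W: "open ?W" by (rule open_overlap[OF c c'])
  have mem: "x + t *\<^sub>R v \<in> ?W" if "t \<in> ?T" for t
   using that dom[of t] val[of t] by (metis (mono_tags, lifting) IntI image_eqI mem_Collect_eq)
  have comp: "jac c c' (gam t) *v v = (\<Sum>i\<in>UNIV. v $ i *\<^sub>R pd i ?tau (x + t *\<^sub>R v))" if t: "t \<in> ?T" for t
  proof -
   have D: "(?tau has_derivative (*v) (jac c c' (gam t))) (at (x + t *\<^sub>R v))"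
   using transition_derivative[OF c c', of "gam t"] t dom[of t] val[of t] by simp
   have "pd i ?tau (x + t *\<^sub>R v) = jac c c' (gam t) *v axis i 1" for i by (rule pd_eqI[OF D])
   hence "(\<Sum>i\<in>UNIV. v $ i *\<^sub>R pd i ?tau (x + t *\<^sub>R v)) = jac c c' (gam t) *v (\<Sum>i\<in>UNIV. v $ i *\<^sub>R axis i 1)"
   by (simp add: linear_sum[OF matrix_vector_mul_linear] matrix_vector_mult_scaleR)
   also have "(\<Sum>i\<in>UNIV. v $ i *\<^sub>R axis i 1) = v" using basis_expansion[of v] by (simp add: scalar_mult_eq_scaleR)
   finally show ?thesis ..
  qed
  have "continuous_on ?T (%t. \<Sum>i\<in>UNIV. v $ i *\<^sub>R pd i ?tau (x + t *\<^sub>R v))"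
   by (intro continuous_intros continuous_on_compose2[OF smooth_on_continuous[OF smooth_on_pd[OF transition_smooth[OF c c']]]])
   (use mem in auto)
  thus "continuous_on ?T (%t. vector_derivative (snd c' \<circ> gam) (at t within {0..1}))"
   by (rule continuous_on_eq) (use vel[OF c'] comp in auto)
 qed (use cont in auto)
 have sp: "speed gam 0 1 t <= K" if t: "t \<in> {0..1}" for t
 proof -
  have vq: "velocity c gam 0 1 t = v" unfolding velocity_def
  proof (rule vector_derivative_within_closed_interval)
   have "((%t. x + t *\<^sub>R v) has_vector_derivative v) (at t within {0..1})" by (auto intro!: derivative_eq_intros)
   thus "((snd c \<circ> gam) has_vector_derivative v) (at t within {0..1})"
   by (rule has_vector_derivative_transform[OF t, rotated]) (simp add: val)
  qed (use t in auto)
  have gt: "gam t = ichart c (x + t *\<^sub>R v)" by (simp add: gam_def)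
  have "speed gam 0 1 t = sqrt (v \<bullet> (g c (ichart c (x + t *\<^sub>R v)) *v v))"
   by (simp only: speed_chart[OF C1 c t dom[OF t]] vq gt)
  also have "... <= sqrt (K\<^sup>2)" by (rule real_sqrt_le_mono[OF K(2)[OF t]])
  finally show ?thesis using K(1) by simp
 qed
 have "curve_length A g gam 0 1 <= integral {0..1} (%t::real. K)" unfolding curve_length_speed
  by (rule integral_le[OF integrable_continuous_real[OF speed_continuous[OF C1]]]) (use sp in auto)
 hence len: "curve_length A g gam 0 1 <= K" by simp
 have "gam 0 \<in> topspace X" using curve_in_X[OF C1, of 0] by simp
 from pw_C1_path.append[OF pw_C1_path.const[OF this] C1]
 have "pw_C1_path X A g (gam 0) (gam 1) (curve_length A g gam 0 1)" by simp
 thus ?thesis using len by (auto simp: gam_def)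
qed

lemma metric_bounded:
 assumes c: "c \<in> A" and K: "compact K" "K <= img c"
 obtains C where "0 < C" "!!x v. x \<in> K ==> v \<bullet> (g c (ichart c x) *v v) <= (C * norm v)\<^sup>2"
proof -
 define S where "S x = (\<Sum>i\<in>UNIV. \<Sum>j\<in>UNIV. \<bar>g c (ichart c x) $ i $ j\<bar>)" for x
 have "continuous_on (img c) (%x. g c (ichart c x))" using metric_continuous[OF c] by (simp add: local_rep_def o_def)
 hence "continuous_on K (%x. g c (ichart c x))" by (rule continuous_on_subset[OF _ K(2)])
 hence "continuous_on K S" unfolding S_def by (intro continuous_intros)
 from compact_imp_bounded[OF compact_continuous_image[OF this K(1)]]
 obtain B where B: "\<forall>x\<in>K. \<bar>S x\<bar> <= B" by (auto simp: bounded_iff)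
 define C where "C = sqrt (\<bar>B\<bar> + 1)"
 have "v \<bullet> (g c (ichart c x) *v v) <= (C * norm v)\<^sup>2" if x: "x \<in> K" for x v
 proof -
  have "v \<bullet> (g c (ichart c x) *v v) <= norm v * norm (g c (ichart c x) *v v)" by (rule norm_cauchy_schwarz)
  also have "... <= norm v * (S x * norm v)" unfolding S_def by (intro mult_left_mono norm_matrix_vector_le) auto
  also have "... <= norm v * ((\<bar>B\<bar> + 1) * norm v)"
   using B x by (intro mult_left_mono mult_right_mono) (auto simp: abs_le_iff)
  finally show ?thesis by (simp add: C_def power_mult_distrib power2_eq_square mult_ac)
 qed
 moreover have "0 < C" by (simp add: C_def)
 ultimately show ?thesis using that by blast
qed

lemma chart_cball:
 assumes "c \<in> A" "p \<in> dom c"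
 obtains r where "0 < r" "cball (snd c p) r <= img c" using open_contains_cball_eq[OF chart(2)[OF assms(1)]] assms(2) by blast

lemma local_paths:
 assumes p: "p \<in> topspace X"
 obtains U C where "openin X U" "p \<in> U" "0 < C"
  "!!q r. q \<in> U ==> r \<in> U ==> \<exists>L \<le> C * dist (snd (chart_at A p) q) (snd (chart_at A p) r). pw_C1_path X A g q r L"
  "U <= dom (chart_at A p)"
proof -
 define c where "c = chart_at A p"
 have c: "c \<in> A" "p \<in> dom c" using chart_at[OF p] by (auto simp: c_def)
 obtain e where e: "0 < e" "cball (snd c p) e <= img c" by (rule chart_cball[OF c])
 obtain C where C: "0 < C" "!!x v. x \<in> cball (snd c p) e ==> v \<bullet> (g c (ichart c x) *v v) <= (C * norm v)\<^sup>2"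
  using metric_bounded[OF c(1) compact_cball e(2)] by blast
 define U where "U = {q \<in> dom c. snd c q \<in> ball (snd c p) e}"
 have "\<exists>L \<le> C * dist (snd c q) (snd c r). pw_C1_path X A g q r L" if q: "q \<in> U" and r: "r \<in> U" for q r
 proof -
  let ?x = "snd c q" and ?y = "snd c r"
  have cb: "?x + t *\<^sub>R (?y - ?x) \<in> cball (snd c p) e" if t: "t \<in> {0..1}" for t
  proof -
   have "convex (cball (snd c p) e)" by (rule convex_cball)
   moreover have "?x \<in> cball (snd c p) e" "?y \<in> cball (snd c p) e" using q r by (auto simp: U_def)
   ultimately have "(1 - t) *\<^sub>R ?x + t *\<^sub>R ?y \<in> cball (snd c p) e" using t by (intro convexD_alt) auto
   moreover have "(1 - t) *\<^sub>R ?x + t *\<^sub>R ?y = ?x + t *\<^sub>R (?y - ?x)" by (simp add: algebra_simps)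
   ultimately show ?thesis by simp
  qed
  have "\<exists>L \<le> C * norm (?y - ?x). pw_C1_path X A g (ichart c ?x) (ichart c (?x + (?y - ?x))) L"
   by (rule segment_path[OF c(1)]) (use cb e(2) C in "auto simp: less_imp_le")
  thus ?thesis using q r c by (simp add: U_def ichart dist_norm norm_minus_commute)
 qed
 moreover have "openin X U" unfolding U_def by (rule openin_chart_preimage[OF c(1)]) simp
 moreover have "p \<in> U" using c e(1) by (simp add: U_def)
 moreover have "U <= dom c" by (auto simp: U_def)
 ultimately show ?thesis using that C(1) unfolding c_def by blast
qed

lemma path_exists:
 assumes x: "x \<in> topspace X" and p: "p \<in> topspace X"
 shows "EX L. pw_C1_path X A g p x L"
proof -
 define S where "S = {p \<in> topspace X. EX L. pw_C1_path X A g p x L}"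
 have "S = topspace X"
 proof (rule connected_induct)
  show "S <= topspace X" by (auto simp: S_def)
  show "S ~= {}" using pw_C1_path.const[OF x] x by (auto simp: S_def)
  fix p assume p: "p \<in> topspace X"
  obtain U C where U: "openin X U" "p \<in> U" "0 < C"
   "!!q r. q \<in> U ==> r \<in> U ==> \<exists>L \<le> C * dist (snd (chart_at A p) q) (snd (chart_at A p) r). pw_C1_path X A g q r L"
   using local_paths[OF p] by metis
  have "q \<in> S" if "r \<in> U" "r \<in> S" "q \<in> U" for q r
   using U(4)[OF that(3,1)] that path_trans path_in_X unfolding S_def by blast
  thus "EX U. openin X U & p \<in> U & (U <= S | U \<inter> S = {})" using U(1,2) by blast
 qed
 thus ?thesis using p by (auto simp: S_def)
qed

section \<open>The distance\<close>

lemma riem_dist_le: "pw_C1_path X A g p q L ==> riem_dist X A g p q <= L"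
 unfolding riem_dist_def by (rule cInf_lower) (auto intro!: bdd_belowI[of _ 0] dest: path_nonneg)

lemma riem_dist_ge:
 assumes "p \<in> topspace X" "q \<in> topspace X" "!!L. pw_C1_path X A g p q L ==> l <= L"
 shows "l <= riem_dist X A g p q" unfolding riem_dist_def by (rule cInf_greatest) (use path_exists[OF assms(2,1)] assms(3) in auto)

lemma riem_dist_nonneg: "p \<in> topspace X ==> q \<in> topspace X ==> 0 <= riem_dist X A g p q"
 by (rule riem_dist_ge) (auto dest: path_nonneg)

lemma riem_dist_self: "p \<in> topspace X ==> riem_dist X A g p p = 0"
 using riem_dist_le[OF pw_C1_path.const] riem_dist_nonneg by (simp add: order_antisym)

lemma riem_dist_path_triangle:
 assumes "pw_C1_path X A g p q L" "r \<in> topspace X"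
 shows "riem_dist X A g p r <= L + riem_dist X A g q r"
proof -
 have "riem_dist X A g p r - L <= riem_dist X A g q r"
 proof (rule riem_dist_ge)
  fix L' assume "pw_C1_path X A g q r L'"
  from riem_dist_le[OF path_trans[OF this assms(1)]] show "riem_dist X A g p r - L <= L'" by simp
 qed (use assms path_in_X in auto)
 thus ?thesis by simp
qed

lemma riem_dist_path_triangle2:
 assumes "pw_C1_path X A g q r L" "p \<in> topspace X"
 shows "riem_dist X A g p r <= riem_dist X A g p q + L"
proof -
 have "riem_dist X A g p r - L <= riem_dist X A g p q"
 proof (rule riem_dist_ge)
  fix L' assume "pw_C1_path X A g p q L'"
  from riem_dist_le[OF path_trans[OF assms(1) this]] show "riem_dist X A g p r - L <= L'" by simp
 qed (use assms path_in_X in auto)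
 thus ?thesis by simp
qed

lemma riem_dist_near:
 assumes p: "p \<in> topspace X" and e: "0 < e"
 obtains U where "openin X U" "p \<in> U"
  "!!q. q \<in> U ==> (\<exists>L<e. pw_C1_path X A g p q L) & (\<exists>L<e. pw_C1_path X A g q p L)"
proof -
 define c where "c = chart_at A p"
 have c: "c \<in> A" "p \<in> dom c" using chart_at[OF p] by (auto simp: c_def)
 obtain U C where U: "openin X U" "p \<in> U" "0 < C"
  "!!q r. q \<in> U ==> r \<in> U ==> \<exists>L \<le> C * dist (snd c q) (snd c r). pw_C1_path X A g q r L"
  using local_paths[OF p] unfolding c_def by metis
 define V where "V = U \<inter> {q \<in> dom c. snd c q \<in> ball (snd c p) (e / C)}"
 have "openin X V" unfolding V_def by (intro openin_Int U openin_chart_preimage[OF c(1)]) simp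
 moreover have "p \<in> V" using U c e by (simp add: V_def)
 moreover have "(\<exists>L<e. pw_C1_path X A g p q L) & (\<exists>L<e. pw_C1_path X A g q p L)" if q: "q \<in> V" for q
 proof -
  have "C * dist (snd c p) (snd c q) < e" using q U(3) by (simp add: V_def field_simps)
  thus ?thesis using U(4)[of p q] U(4)[of q p] U(2) q by (auto simp: V_def dist_commute intro: le_less_trans)
 qed
 ultimately show ?thesis using that by blast
qed

lemma riem_dist_continuous:
 assumes x: "x \<in> topspace X"
 shows "continuous_map X euclideanreal (%z. riem_dist X A g z x)" unfolding continuous_map_atin limitin_def
proof (intro ballI conjI allI impI)
 fix z T assume z: "z \<in> topspace X"
  and "openin euclideanreal T & riem_dist X A g z x \<in> T"
 hence T: "open T" "riem_dist X A g z x \<in> T" by (metis open_openin)+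
 then obtain e where e: "0 < e" "ball (riem_dist X A g z x) e <= T" using open_contains_ball by blast
 obtain U where U: "openin X U" "z \<in> U"
  "!!q. q \<in> U ==> (\<exists>L<e. pw_C1_path X A g z q L) & (\<exists>L<e. pw_C1_path X A g q z L)"
  using riem_dist_near[OF z e(1)] by metis
 have "riem_dist X A g q x \<in> T" if "q \<in> U" for q
 proof -
  obtain L L' where L: "L < e" "pw_C1_path X A g z q L" "L' < e" "pw_C1_path X A g q z L'" using U(3)[OF \<open>q \<in> U\<close>] by blast
  have "dist (riem_dist X A g z x) (riem_dist X A g q x) < e"
   using riem_dist_path_triangle[OF L(2) x] riem_dist_path_triangle[OF L(4) x] L by (auto simp: dist_real_def abs_less_iff)
  thus ?thesis using e(2) by auto
 qed
 thus "\<forall>\<^sub>F q in atin X z. riem_dist X A g q x \<in> T" unfolding eventually_atin using U(1,2) by blast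
qed auto

end


section \<open>The Laplacian of a composition\<close>

lemma differentiable_det:
 fixes M :: "'a::real_normed_vector => real^'n::finite^'n"
 assumes "!!i j. (%x. M x $ i $ j) differentiable (at x)"
 shows "(%x. det (M x)) differentiable (at x)"
proof -
 have prod: "(%x. \<Prod>i\<in>I. M x $ i $ sgm i) differentiable (at x)" if "finite I" for I and sgm :: "'n => 'n"
  using that by (induction I rule: finite_induct) (auto intro!: differentiable_mult assms)
 show ?thesis unfolding det_def
 proof (rule differentiable_sum)
  show "finite {p. p permutes (UNIV :: 'n set)}" by (simp add: finite_permutations)
  show "\<forall>p\<in>{p. p permutes (UNIV :: 'n set)}. (%x. of_int (sign p) * (\<Prod>i\<in>UNIV. M x $ i $ p i)) differentiable (at x)"
   by (intro ballI differentiable_mult[OF differentiable_const prod[OF finite]])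
 qed
qed

text \<open>Cramer's rule, which exhibits the entries of the inverse as differentiable functions
of the matrix.\<close>

lemma matrix_inv_entry:
 fixes M :: "real^'n::finite^'n"
 assumes "det M ~= 0"
 shows "matrix_inv M $ k $ j = det (\<chi> i l. if l = k then axis j 1 $ i else M $ i $ l) / det M"
proof -
 have inv: "invertible M" using assms by (simp add: invertible_det_nz)
 have "M *v (matrix_inv M *v axis j 1) = axis j 1" by (rule matrix_inv_vector[OF inv])
 hence "matrix_inv M *v axis j 1 = (\<chi> k. det (\<chi> i l. if l = k then axis j 1 $ i else M $ i $ l) / det M)"
  using cramer[OF assms] by blast
 hence "(matrix_inv M *v axis j 1) $ k = det (\<chi> i l. if l = k then axis j 1 $ i else M $ i $ l) / det M" by simp
 moreover have "(matrix_inv M *v axis j 1) $ k = matrix_inv M $ k $ j" by (simp add: matrix_vector_mul_component inner_axis)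
 ultimately show ?thesis by simp
qed

lemma differentiable_matrix_inv:
 fixes M :: "'a::real_normed_vector => real^'n::finite^'n"
 assumes M: "!!i j. (%x. M x $ i $ j) differentiable (at x)"
  and O: "open S" "x \<in> S" "!!y. y \<in> S ==> det (M y) ~= 0"
 shows "(%x. matrix_inv (M x) $ k $ j) differentiable (at x)"
proof -
 have "(%x. det (\<chi> i l. if l = k then axis j 1 $ i else M x $ i $ l)) differentiable (at x)"
 proof (rule differentiable_det)
  fix i l :: 'n
  show "(%x. (\<chi> i l. if l = k then axis j 1 $ i else M x $ i $ l) $ i $ l) differentiable (at x)"
   using M by (cases "l = k") auto
 qed
 moreover have "(%x. det (M x)) differentiable (at x)" by (rule differentiable_det[OF M])
 ultimately have "(%x. det (\<chi> i l. if l = k then axis j 1 $ i else M x $ i $ l) / det (M x)) differentiable (at x)"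
  using O by (intro differentiable_divide) auto
 then obtain D where "((%x. det (\<chi> i l. if l = k then axis j 1 $ i else M x $ i $ l) / det (M x)) has_derivative D) (at x)"
  by (auto simp: differentiable_def)
 hence "((%x. matrix_inv (M x) $ k $ j) has_derivative D) (at x)"
  by (rule has_derivative_transform_within_open[OF _ O(1,2)]) (simp add: matrix_inv_entry O(3))
 thus ?thesis by (auto simp: differentiable_def)
qed

context riemannian
begin

lemma det_metric: "c \<in> A ==> p \<in> dom c ==> det (g c p) ~= 0"
 using spd_invertible[OF metric_spd] by (simp add: invertible_det_nz)

lemma metric_entry_differentiable:
 assumes c: "c \<in> A" and x: "x \<in> img c"
 shows "(%x. g c (ichart c x) $ i $ j) differentiable (at x)"
proof -
 have "local_rep c (g c) differentiable (at x)"
  using metric c by (intro smooth_on_differentiable[OF _ chart(2)[OF c] x]) (auto simp: riemannian_metric_def)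
 then obtain D where D: "((%x. g c (ichart c x)) has_derivative D) (at x)" by (auto simp: differentiable_def local_rep_def o_def)
 have "((%x. g c (ichart c x) $ i $ j) has_derivative (%h. D h $ i $ j)) (at x)"
  by (rule bounded_linear.has_derivative[OF bounded_linear_vec_nth], rule bounded_linear.has_derivative[OF bounded_linear_vec_nth D])
 thus ?thesis by (auto simp: differentiable_def)
qed

lemma inverse_metric_entry_differentiable:
 assumes c: "c \<in> A" and x: "x \<in> img c"
 shows "(%x. matrix_inv (g c (ichart c x)) $ i $ j) differentiable (at x)"
 by (rule differentiable_matrix_inv[OF metric_entry_differentiable[OF c x] chart(2)[OF c] x])
   (use det_metric c ichart(3) in blast)

lemma sqrt_det_differentiable:
 assumes c: "c \<in> A" and x: "x \<in> img c"
 shows "(%x. sqrt (det (g c (ichart c x)))) differentiable (at x)"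
proof -
 have "(%x. det (g c (ichart c x))) differentiable (at x)" by (rule differentiable_det[OF metric_entry_differentiable[OF c x]])
 moreover have "det (g c (ichart c x)) ~= 0" by (rule det_metric[OF c ichart(3)[OF c x]])
 hence "sqrt differentiable (at (det (g c (ichart c x))))" unfolding real_differentiable_def
  by (intro exI[of _ "if 0 < det (g c (ichart c x)) then inverse (sqrt (det (g c (ichart c x)))) / 2
   else - inverse (sqrt (det (g c (ichart c x)))) / 2"] DERIV_real_sqrt_generic) auto
 ultimately show ?thesis by (rule differentiable_compose[rotated])
qed

lemma gradient_component:
 "gradient g c u p $ i = (\<Sum>j\<in>UNIV. matrix_inv (g c p) $ i $ j * pd j (local_rep c u) (snd c p))"
 by (simp add: gradient_def matrix_vector_mult_def)

definition flux :: "('m, 'n) chart => ('m => real) => 'n => real^'n => real" where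
 "flux c u i = local_rep c (%r. sqrt (det (g c r)) * gradient g c u r $ i)"

lemma flux_eq:
 assumes "c \<in> A" "x \<in> img c"
 shows "flux c u i x = sqrt (det (g c (ichart c x))) * (\<Sum>j\<in>UNIV. matrix_inv (g c (ichart c x)) $ i $ j * pd j (local_rep c u) x)"
 unfolding flux_def local_rep_apply gradient_component using assms by (simp add: ichart)

lemma laplace_flux:
 assumes "p \<in> topspace X"
 shows "laplace_beltrami A g u p = (1 / sqrt (det (g (chart_at A p) p))) *
  (\<Sum>i\<in>UNIV. pd i (flux (chart_at A p) u i) (snd (chart_at A p) p))" by (simp add: laplace_beltrami_def Let_def flux_def)

lemma flux_differentiable:
 assumes u: "smooth_fun A u" and c: "c \<in> A" and x: "x \<in> img c"
 shows "flux c u i differentiable (at x)"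
proof -
 have pdd: "pd j (local_rep c u) differentiable (at x)" for j
  by (rule smooth_on_differentiable[OF smooth_on_pd chart(2)[OF c] x]) (use u c in "auto simp: smooth_fun_def")
 have "(%x. sqrt (det (g c (ichart c x))) * (\<Sum>j\<in>UNIV. matrix_inv (g c (ichart c x)) $ i $ j * pd j (local_rep c u) x)) differentiable (at x)"
  by (rule differentiable_mult[OF sqrt_det_differentiable[OF c x] differentiable_sum[OF finite]])
   (intro ballI differentiable_mult[OF inverse_metric_entry_differentiable[OF c x] pdd])
 then obtain D where "((%x. sqrt (det (g c (ichart c x))) * (\<Sum>j\<in>UNIV. matrix_inv (g c (ichart c x)) $ i $ j * pd j (local_rep c u) x)) has_derivative D) (at x)"
  by (auto simp: differentiable_def)
 hence "(flux c u i has_derivative D) (at x)"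
  by (rule has_derivative_transform_within_open[OF _ chart(2)[OF c] x]) (simp add: flux_eq[OF c])
 thus ?thesis by (auto simp: differentiable_def)
qed

lemma smooth_fun_differentiable:
 assumes "smooth_fun A u" "c \<in> A" "p \<in> dom c"
 shows "local_rep c u differentiable (at (snd c p))"
 using assms by (intro smooth_on_differentiable[OF _ chart(2)]) (auto simp: smooth_fun_def)

lemma smooth_fun_continuous: "smooth_fun A u ==> continuous_map X euclideanreal u"
 by (rule continuous_map_locally) (auto simp: smooth_fun_def smooth_on_continuous)

lemma pd_compose:
 fixes h :: "real^'k::finite => real"
 assumes h: "h differentiable (at x)" and O: "open W" "x \<in> W" "h ` W <= S"
  and eta: "(eta has_real_derivative d) (at (h x) within S)"
 shows "((%y. eta (h y)) has_derivative (%v. d * ((\<chi> i. pd i h x) \<bullet> v))) (at x)"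
  and "pd i (%y. eta (h y)) x = d * pd i h x"
proof -
 have "(h has_derivative (%v. (\<chi> i. pd i h x) \<bullet> v)) (at x within W)"
  by (rule has_derivative_at_withinI[OF has_derivative_pd[OF h]])
 moreover have "(eta has_derivative (*) d) (at (h x) within h ` W)"
  using has_field_derivative_subset[OF eta O(3)] by (simp add: has_field_derivative_def)
 ultimately have "((%y. eta (h y)) has_derivative (%v. d * ((\<chi> i. pd i h x) \<bullet> v))) (at x within W)"
  by (rule has_derivative_in_compose)
 thus D: "((%y. eta (h y)) has_derivative (%v. d * ((\<chi> i. pd i h x) \<bullet> v))) (at x)"
  by (simp only: at_within_open[OF O(2,1)])
 show "pd i (%y. eta (h y)) x = d * pd i h x" by (simp only: pd_eqI[OF D, of i] inner_axis vec_lambda_beta) simp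
qed

lemma open_preimage_chart:
 assumes "c \<in> A" "openin X U" "p \<in> dom c" "p \<in> U"
 shows "open (snd c ` (dom c \<inter> U))" "snd c p \<in> snd c ` (dom c \<inter> U)"
 using open_chart_image[OF assms(1,2)] assms(3,4) by auto

text \<open>The flux of \<open>eta \<circ> f\<close> is that of \<open>f\<close> times \<open>eta'
\<circ> f\<close>, and the divergence obeys the product rule.\<close>

theorem laplace_compose:
 assumes f: "smooth_fun A f" and p: "p \<in> topspace X"
  and U: "openin X U" "p \<in> U" "!!q. q \<in> U ==> f q \<in> S" "!!q. q \<in> U ==> u q = eta (f q)"
  and eta: "!!s. s \<in> S ==> (eta has_real_derivative eta1 s) (at s within S)"
   "(eta1 has_real_derivative d2) (at (f p) within S)"
 shows "laplace_beltrami A g u p = d2 * gradient_norm_sq A g f p + eta1 (f p) * laplace_beltrami A g f p"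
proof -
 define c where "c = chart_at A p"
 have c: "c \<in> A" "p \<in> dom c" using chart_at[OF p] by (auto simp: c_def)
 define x where "x = snd c p"
 define W where "W = snd c ` (dom c \<inter> U)"
 have W: "open W" "x \<in> W" using open_preimage_chart[OF c(1) U(1) c(2) U(2)] by (auto simp: W_def x_def)
 have Wi: "W <= img c" by (auto simp: W_def)
 have x: "x \<in> img c" and ix: "ichart c x = p" using c by (auto simp: x_def ichart)
 let ?f = "local_rep c f"
 have WU: "ichart c y \<in> U" if "y \<in> W" for y using that c(1) by (auto simp: W_def ichart)
 have fS: "?f ` W <= S" using WU U(3) by (auto simp: local_rep_apply)
 have fd: "?f differentiable (at y)" if "y \<in> W" for y
  using smooth_fun_differentiable[OF f c(1), of "ichart c y"] that Wi c(1) by (auto simp: ichart)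
 have pdu: "pd j (local_rep c u) y = eta1 (?f y) * pd j ?f y" if y: "y \<in> W" for j y
 proof -
  have "pd j (local_rep c u) y = pd j (%y. eta (?f y)) y" by (rule pd_cong[OF W(1) y]) (use WU U(4) in "simp add: local_rep_apply")
  also have "... = eta1 (?f y) * pd j ?f y" by (rule pd_compose(2)[OF fd[OF y] W(1) y fS eta(1)]) (use fS y in auto)
  finally show ?thesis .
 qed
 have fl: "flux c u i y = eta1 (?f y) * flux c f i y" if "y \<in> W" for i y
  using that Wi by (simp add: flux_eq[OF c(1)] subset_iff pdu sum_distrib_left mult_ac)
 have fx: "?f x = f p" using c by (simp add: x_def local_rep_chart)
 have pdf: "pd i (flux c u i) x = d2 * pd i ?f x * flux c f i x + eta1 (f p) * pd i (flux c f i) x" for i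
 proof -
  have "pd i (flux c u i) x = pd i (%y. eta1 (?f y) * flux c f i y) x" by (rule pd_cong[OF W fl])
  also have "... = eta1 (?f x) * ((\<chi> j. pd j (flux c f i) x) \<bullet> axis i 1) + d2 * ((\<chi> j. pd j ?f x) \<bullet> axis i 1) * flux c f i x"
   by (rule pd_eqI[OF has_derivative_mult[OF pd_compose(1)[OF fd[OF W(2)] W fS] has_derivative_pd[OF flux_differentiable[OF f c(1) x]]]])
   (use eta(2) fx in simp)
  finally show ?thesis by (simp add: inner_axis fx)
 qed
 have dn: "sqrt (det (g c p)) ~= 0" using det_metric[OF c] by simp
 have flx: "flux c f i x = sqrt (det (g c p)) * gradient g c f p $ i" for i
  unfolding flux_eq[OF c(1) x] gradient_component using ix by (simp add: x_def)
 have "laplace_beltrami A g u p = (1 / sqrt (det (g c p))) * (\<Sum>i\<in>UNIV. d2 * pd i ?f x * flux c f i x + eta1 (f p) * pd i (flux c f i) x)"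
  using laplace_flux[OF p, of u] by (simp add: c_def[symmetric] x_def[symmetric] pdf)
 also have "... = d2 * (\<Sum>i\<in>UNIV. gradient g c f p $ i * pd i ?f x) + eta1 (f p) * ((1 / sqrt (det (g c p))) * (\<Sum>i\<in>UNIV. pd i (flux c f i) x))"
  using dn by (simp add: sum.distrib flx distrib_left sum_distrib_left sum_divide_distrib mult_ac)
 also have "(1 / sqrt (det (g c p))) * (\<Sum>i\<in>UNIV. pd i (flux c f i) x) = laplace_beltrami A g f p"
  using laplace_flux[OF p, of f] by (simp add: c_def[symmetric] x_def[symmetric])
 also have "(\<Sum>i\<in>UNIV. gradient g c f p $ i * pd i ?f x) = grad_norm_sq c f p"
  by (simp add: grad_norm_sq_eq[OF c] inner_vec_def coord_grad_def x_def)
 also have "... = gradient_norm_sq A g f p" using gradient_norm_sq_chart[OF c] smooth_fun_differentiable[OF f] by simp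
 finally show ?thesis .
qed

end


section \<open>Second order behaviour at a minimum\<close>

lemma gronwall_zero:
 fixes phi :: "real => real"
 assumes d: "!!t. t \<in> {0..1} ==> (phi has_real_derivative phi' t) (at t within {0..1})"
  and le: "!!t. t \<in> {0..1} ==> \<bar>phi' t\<bar> <= K * \<bar>phi t\<bar>" and 0: "phi 0 = 0"
 shows "phi 1 = 0"
proof -
 let ?E = "%t. exp (- (2 * K * t)) * (phi t)\<^sup>2"
 have E: "(?E has_real_derivative exp (- (2 * K * t)) * (2 * (phi t * phi' t) - 2 * K * (phi t)\<^sup>2)) (at t within {0..1})" if "t \<in> {0..1}" for t
  by (auto intro!: derivative_eq_intros d[OF that] simp: algebra_simps power2_eq_square)
 have nonpos: "exp (- (2 * K * t)) * (2 * (phi t * phi' t) - 2 * K * (phi t)\<^sup>2) <= 0" if t: "t \<in> {0..1}" for t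
 proof -
  have "phi t * phi' t <= \<bar>phi t\<bar> * \<bar>phi' t\<bar>" by (metis abs_ge_self abs_mult)
  also have "... <= \<bar>phi t\<bar> * (K * \<bar>phi t\<bar>)" by (rule mult_left_mono[OF le[OF t]]) simp
  also have "... = K * (phi t)\<^sup>2" by (simp add: power2_eq_square mult_ac)
  finally have "2 * (phi t * phi' t) - 2 * K * (phi t)\<^sup>2 <= 0" by simp
  thus ?thesis by (simp add: mult_nonneg_nonpos)
 qed
 have "?E 1 <= ?E 0"
 proof (rule DERIV_nonpos_imp_decreasing_open[of 0 1 ?E])
  fix t :: real assume t: "0 < t" "t < 1"
  have "at t within {0..1} = at t" using t by (intro at_within_interior) auto
  thus "EX y. (?E has_real_derivative y) (at t) & y <= 0"
   using E[of t] nonpos[of t] t by (intro exI[of _ "exp (- (2 * K * t)) * (2 * (phi t * phi' t) - 2 * K * (phi t)\<^sup>2)"]) simp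
 next
  show "continuous_on {0..1} ?E" by (rule DERIV_continuous_on[OF E])
 qed simp
 thus ?thesis using 0 by (simp add: mult_le_0_iff)
qed

lemma quadratic_bound_at_double_zero:
 fixes b b1 b2 :: "real => real"
 assumes b: "!!s. s \<in> {l..r} ==> (b has_real_derivative b1 s) (at s within {l..r})"
  and b1: "!!s. s \<in> {l..r} ==> (b1 has_real_derivative b2 s) (at s within {l..r})"
  and b2: "continuous_on {l..r} b2" and c: "c \<in> {l..r}" "b c = 0" "b1 c = 0"
 obtains C where "0 <= C" "!!s. s \<in> {l..r} ==> \<bar>b s\<bar> <= C * (s - c)\<^sup>2"
proof -
 have "compact (b2 ` {l..r})" by (rule compact_continuous_image[OF b2]) simp
 then obtain C where C: "!!s. s \<in> {l..r} ==> \<bar>b2 s\<bar> <= C" "0 < C"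
  using compact_imp_bounded bounded_pos by (metis imageI real_norm_def)
 have b1C: "\<bar>b1 s\<bar> <= C * \<bar>s - c\<bar>" if s: "s \<in> {l..r}" for s
  using field_differentiable_bound[of "{l..r}" b1 b2 C s c, OF _ b1] C s c by simp
 have "\<bar>b s\<bar> <= C * (s - c)\<^sup>2" if s: "s \<in> {l..r}" for s
 proof -
  have seg: "closed_segment c s <= {l..r}" using s c by (simp add: closed_segment_subset)
  have "norm (b s - b c) <= (C * \<bar>s - c\<bar>) * norm (s - c)"
  proof (rule field_differentiable_bound[of "closed_segment c s" b b1])
   fix z assume z: "z \<in> closed_segment c s"
   show "(b has_real_derivative b1 z) (at z within closed_segment c s)" using b seg z by (meson has_field_derivative_subset subsetD)
   have "\<bar>z - c\<bar> <= \<bar>s - c\<bar>" using z by (auto simp: closed_segment_eq_real_ivl split: if_splits)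
   hence "C * \<bar>z - c\<bar> <= C * \<bar>s - c\<bar>" using C(2) by simp
   moreover have "z \<in> {l..r}" using seg z by blast
   ultimately show "norm (b1 z) <= C * \<bar>s - c\<bar>" using b1C[of z] by simp
  qed auto
  thus ?thesis using c by (simp add: power2_eq_square mult.assoc)
 qed
 thus ?thesis using C(2) that[of C] by simp
qed

text \<open>Under the hypothesis on the gradient, \<open>sqrt (h - m)\<close> has slope at least
\<open>c0 / 2\<close> wherever it is positive. Hence a maximum point of this function minus a cone
of slope \<open>c0 / 4\<close> lies on the boundary sphere, where the maximum property bounds
\<open>h\<close> from below.\<close>

lemma gradient_growth:
 fixes h :: "'a::euclidean_space => real"
 assumes R: "0 < R" and c0: "0 < c0"
  and h: "continuous_on (cball x0 R) h" "!!y. y \<in> ball x0 R ==> (h has_derivative (%w. G y \<bullet> w)) (at y)"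
  and ge: "!!y. y \<in> cball x0 R ==> m <= h y"
  and grad: "!!y. y \<in> ball x0 R ==> c0\<^sup>2 * (h y - m) <= (norm (G y))\<^sup>2"
  and y1: "dist x0 y1 <= R / 2" "m < h y1"
 obtains y where "dist x0 y = R" "(c0 / 8 * R)\<^sup>2 <= h y - m"
proof -
 let ?k = "c0 / 4"
 let ?Phi = "%y. sqrt (h y - m) - ?k * dist y y1"
 have "continuous_on (cball x0 R) ?Phi" by (intro continuous_intros h)
 moreover have "cball x0 R ~= {}" using R by simp
 ultimately have "\<exists>y\<in>cball x0 R. \<forall>z\<in>cball x0 R. ?Phi z <= ?Phi y"
  by (intro continuous_attains_sup[OF compact_cball])
 then obtain y where y: "y \<in> cball x0 R" "!!z. z \<in> cball x0 R ==> ?Phi z <= ?Phi y" by blast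
 have y1R: "y1 \<in> cball x0 R" using y1 R by simp
 have pos: "?k * dist y y1 < sqrt (h y - m)"
 proof -
  have "0 < sqrt (h y1 - m)" using y1(2) by simp
  moreover have "?Phi y1 = sqrt (h y1 - m)" by simp
  ultimately show ?thesis using y(2)[OF y1R] by linarith
 qed
 have hy: "m < h y"
 proof (rule ccontr)
  assume "~ m < h y"
  hence "sqrt (h y - m) <= 0" by simp
  moreover have "0 <= ?k * dist y y1" using c0 by simp
  ultimately show False using pos by linarith
 qed
 have "dist x0 y = R"
 proof (rule ccontr)
  assume "dist x0 y ~= R"
  hence yb: "y \<in> ball x0 R" using y(1) by simp
  define w where "w = G y"
  have w: "c0 * sqrt (h y - m) <= norm w"
  proof (rule power2_le_imp_le)
   show "(c0 * sqrt (h y - m))\<^sup>2 <= (norm w)\<^sup>2" using grad[OF yb] hy by (simp add: w_def power_mult_distrib)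
  qed simp
  let ?s = "sqrt (h y - m)"
  have s: "0 < ?s" using hy by simp
  have line: "((%tau. y + tau *\<^sub>R w) has_derivative (%tau. tau *\<^sub>R w)) (at 0)" by (auto intro!: derivative_eq_intros)
  have hy0: "(h has_derivative (%w. G y \<bullet> w)) (at (y + 0 *\<^sub>R w))" using h(2)[OF yb] by simp
  have "((%tau. h (y + tau *\<^sub>R w)) has_derivative (%tau. G y \<bullet> (tau *\<^sub>R w))) (at 0)"
   by (rule has_derivative_compose[OF line hy0])
  hence d: "((%tau. h (y + tau *\<^sub>R w)) has_real_derivative (norm w)\<^sup>2) (at 0)"
   by (simp add: has_field_derivative_def w_def power2_norm_eq_inner mult.commute[of _ "G y \<bullet> G y"])
  have "((%tau. sqrt (h (y + tau *\<^sub>R w) - m) - ?k * norm w * tau) has_real_derivative (norm w)\<^sup>2 / (2 * ?s) - ?k * norm w) (at 0)"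
  proof -
   have dm: "((%tau. h (y + tau *\<^sub>R w) - m) has_real_derivative (norm w)\<^sup>2) (at 0)"
   using DERIV_diff[OF d DERIV_const[of m]] by simp
   have "(sqrt has_real_derivative inverse ?s / 2) (at (h (y + 0 *\<^sub>R w) - m))" using DERIV_real_sqrt[of "h y - m"] hy by simp
   hence "((%tau. sqrt (h (y + tau *\<^sub>R w) - m)) has_real_derivative inverse ?s / 2 * (norm w)\<^sup>2) (at 0)"
   by (rule DERIV_chain2[OF _ dm])
   hence "((%tau. sqrt (h (y + tau *\<^sub>R w) - m) - ?k * norm w * tau) has_real_derivative
   inverse ?s / 2 * (norm w)\<^sup>2 - ?k * norm w) (at 0)" by (intro DERIV_diff DERIV_cmult_Id)
   thus ?thesis by (rule DERIV_cong) (simp add: inverse_eq_divide)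
  qed
  moreover have "0 < (norm w)\<^sup>2 / (2 * ?s) - ?k * norm w"
  proof -
   have wp: "0 < norm w" using w mult_pos_pos[OF c0 s] by linarith
   have "(c0 * ?s) * norm w <= norm w * norm w" using w by (rule mult_right_mono) simp
   moreover have "0 < norm w * norm w" using wp by simp
   moreover have "?k * norm w * (2 * ?s) = ((c0 * ?s) * norm w) / 2" by simp
   ultimately have "?k * norm w * (2 * ?s) < (norm w)\<^sup>2" unfolding power2_eq_square by linarith
   thus ?thesis using s by (simp add: pos_less_divide_eq)
  qed
  ultimately have "\<exists>d>0. \<forall>tau>0. tau < d --> sqrt (h (y + 0 *\<^sub>R w) - m) - ?k * norm w * 0 <
   sqrt (h (y + (0 + tau) *\<^sub>R w) - m) - ?k * norm w * (0 + tau)" by (rule DERIV_pos_inc_right)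
  then obtain d where d: "0 < d" "!!tau. 0 < tau ==> tau < d ==> sqrt (h y - m) < sqrt (h (y + tau *\<^sub>R w) - m) - ?k * norm w * tau"
   by auto
  define tau where "tau = min (d / 2) ((R - dist x0 y) / (norm w + 1))"
  have Ry: "0 < R - dist x0 y" using yb by simp
  have tau: "0 < tau" "tau < d" using d(1) Ry by (auto simp: tau_def min_less_iff_disj add_nonneg_pos)
  have "tau * norm w <= (R - dist x0 y) / (norm w + 1) * norm w" by (rule mult_right_mono) (auto simp: tau_def)
  also have "... = (R - dist x0 y) * (norm w / (norm w + 1))" by simp
  also have "... <= (R - dist x0 y) * 1" using Ry by (intro mult_left_mono) (auto simp: divide_le_eq_1 add_nonneg_pos)
  finally have "tau * norm w <= (R - dist x0 y) * 1" .
  hence tauw: "tau * norm w <= R - dist x0 y" by simp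
  have "dist x0 (y + tau *\<^sub>R w) <= dist x0 y + tau * norm w"
   using dist_triangle[of x0 "y + tau *\<^sub>R w" y] tau(1) by (simp add: dist_norm)
  hence "y + tau *\<^sub>R w \<in> cball x0 R" using tauw by simp
  hence "?Phi (y + tau *\<^sub>R w) <= ?Phi y" by (rule y(2))
  moreover have "dist (y + tau *\<^sub>R w) y1 <= dist y y1 + tau * norm w"
   using dist_triangle[of "y + tau *\<^sub>R w" y1 y] tau(1) by (simp add: dist_norm)
  hence "?k * dist (y + tau *\<^sub>R w) y1 <= ?k * (dist y y1 + tau * norm w)" using c0 by (intro mult_left_mono) auto
  ultimately show False using d(2)[OF tau] by (simp add: algebra_simps)
 qed
 moreover have "(c0 / 8 * R)\<^sup>2 <= h y - m"
 proof -
  have "R / 2 <= dist y y1" using dist_triangle[of x0 y y1] y1 \<open>dist x0 y = R\<close> by (simp add: dist_commute)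
  hence "c0 / 8 * R <= ?k * dist y y1" using c0 mult_left_mono[of "R/2" "dist y y1" ?k] by simp
  also have "... <= sqrt (h y - m)" using pos by simp
  finally have "(c0 / 8 * R)\<^sup>2 <= (sqrt (h y - m))\<^sup>2" using c0 R by (intro power_mono) auto
  thus ?thesis using hy by simp
 qed
 ultimately show ?thesis by (rule that)
qed

text \<open>A Taylor estimate between two points near \<open>x0\<close>, from the
differentiability of the gradient at \<open>x0\<close> alone.\<close>

lemma second_order_segment:
 fixes h :: "'a::euclidean_space => real"
 assumes O: "open S" "x0 \<in> S" and h: "!!y. y \<in> S ==> (h has_derivative (%w. G y \<bullet> w)) (at y)"
  and G: "(G has_derivative L) (at x0)" and e: "0 < e"
 obtains d where "0 < d" "ball x0 d <= S"
  "!!y. norm y < d ==> norm (G (x0 + y) - G x0 - L y) <= e * norm y"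
  "!!y w rho. rho < d ==> norm y <= rho ==> norm (y + w) <= rho ==>
   \<bar>h (x0 + y + w) - h (x0 + y) - G x0 \<bullet> w - L y \<bullet> w - (L w \<bullet> w) / 2\<bar> <= e * rho * norm w"
proof -
 have lin: "bounded_linear L" using G by (rule has_derivative_bounded_linear)
 obtain d1 where d1: "0 < d1" "!!z. norm (z - x0) < d1 ==> norm (G z - G x0 - L (z - x0)) <= e * norm (z - x0)"
  using G e by (auto simp: has_derivative_at_alt)
 obtain d2 where d2: "0 < d2" "ball x0 d2 <= S" using O openE by blast
 define d where "d = min d1 d2"
 have GL: "norm (G (x0 + y) - G x0 - L y) <= e * norm y" if "norm y < d" for y using d1(2)[of "x0 + y"] that by (simp add: d_def)
 have dS: "x0 + y \<in> S" if "norm y < d" for y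
 proof -
  have "x0 + y \<in> ball x0 d2" using that by (simp add: d_def dist_norm)
  thus ?thesis using d2 by blast
 qed
 have "\<bar>h (x0 + y + w) - h (x0 + y) - G x0 \<bullet> w - L y \<bullet> w - (L w \<bullet> w) / 2\<bar> <= e * rho * norm w"
  if yw: "rho < d" "norm y <= rho" "norm (y + w) <= rho" for y w rho
 proof -
  have inrho: "norm (y + s *\<^sub>R w) <= rho" if s: "s \<in> {0..1}" for s :: real
  proof -
   have "y + s *\<^sub>R w = (1 - s) *\<^sub>R y + s *\<^sub>R (y + w)" by (simp add: algebra_simps)
   hence "norm (y + s *\<^sub>R w) <= (1 - s) * norm y + s * norm (y + w)"
   using s norm_triangle_ineq[of "(1 - s) *\<^sub>R y" "s *\<^sub>R (y + w)"] by simp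
   also have "... <= (1 - s) * rho + s * rho" using s yw by (intro add_mono mult_left_mono) auto
   finally show ?thesis by (simp add: algebra_simps)
  qed
  let ?k = "%s. h (x0 + y + s *\<^sub>R w) - s * (G x0 \<bullet> w) - s * (L y \<bullet> w) - s\<^sup>2 * ((L w \<bullet> w) / 2)"
  let ?k' = "%s. (G (x0 + (y + s *\<^sub>R w)) - G x0 - L (y + s *\<^sub>R w)) \<bullet> w"
  have k: "(?k has_real_derivative ?k' s) (at s within {0..1})" if s: "s \<in> {0..1}" for s
  proof -
   have line: "((%s. x0 + y + s *\<^sub>R w) has_derivative (%s. s *\<^sub>R w)) (at s within {0..1})"
   by (auto intro!: derivative_eq_intros)
   have "x0 + y + s *\<^sub>R w \<in> S" using dS[of "y + s *\<^sub>R w"] inrho[OF s] yw(1) by (simp add: add.assoc)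
   hence "((%s. h (x0 + y + s *\<^sub>R w)) has_derivative (%s'. G (x0 + y + s *\<^sub>R w) \<bullet> (s' *\<^sub>R w))) (at s within {0..1})"
   by (rule has_derivative_compose[OF line h])
   hence d: "((%s. h (x0 + y + s *\<^sub>R w)) has_real_derivative G (x0 + y + s *\<^sub>R w) \<bullet> w) (at s within {0..1})"
   by (simp add: has_field_derivative_def mult.commute[of _ "G (x0 + y + s *\<^sub>R w) \<bullet> w"])
   have Ls: "L (y + s *\<^sub>R w) \<bullet> w = L y \<bullet> w + s * (L w \<bullet> w)"
   using linear_add[OF bounded_linear.linear[OF lin]] linear_scale[OF bounded_linear.linear[OF lin]] by (simp add: inner_add_left)
   show ?thesis
   proof -
   have q: "((%s. s * (G x0 \<bullet> w)) has_real_derivative G x0 \<bullet> w) (at s within {0..1})"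
   "((%s. s * (L y \<bullet> w)) has_real_derivative L y \<bullet> w) (at s within {0..1})"
   "((%s. s\<^sup>2 * ((L w \<bullet> w) / 2)) has_real_derivative s * (L w \<bullet> w)) (at s within {0..1})"
   by (auto intro!: derivative_eq_intros)
   show ?thesis by (rule DERIV_cong[OF DERIV_diff[OF DERIV_diff[OF DERIV_diff[OF d q(1)] q(2)] q(3)]])
   (simp add: inner_diff_left Ls add.assoc)
   qed
  qed
  have "norm (?k 1 - ?k 0) <= (e * rho * norm w) * norm (1 - 0 :: real)"
  proof (rule field_differentiable_bound[of "{0..1}" ?k ?k'])
   fix s :: real assume s: "s \<in> {0..1}"
   show "(?k has_real_derivative ?k' s) (at s within {0..1})" by (rule k[OF s])
   have "norm (?k' s) <= norm (G (x0 + (y + s *\<^sub>R w)) - G x0 - L (y + s *\<^sub>R w)) * norm w"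
   unfolding real_norm_def by (rule Cauchy_Schwarz_ineq2)
   also have "... <= (e * rho) * norm w"
   proof (rule mult_right_mono)
   have "norm (G (x0 + (y + s *\<^sub>R w)) - G x0 - L (y + s *\<^sub>R w)) <= e * norm (y + s *\<^sub>R w)"
   using GL inrho[OF s] yw(1) by simp
   also have "... <= e * rho" using inrho[OF s] e by simp
   finally show "norm (G (x0 + (y + s *\<^sub>R w)) - G x0 - L (y + s *\<^sub>R w)) <= e * rho" .
   qed simp
   finally show "norm (?k' s) <= e * rho * norm w" .
  qed auto
  thus ?thesis by (simp add: algebra_simps)
 qed
 moreover have "0 < d" "ball x0 d <= S" using d1 d2 by (auto simp: d_def)
 ultimately show ?thesis using that[of d] GL by blast
qed

text \<open>Compare the Taylor estimates along the sides of the triangle with the vertices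
\<open>x0\<close>, \<open>x0 + t v\<close> and \<open>x0 + t (v + w)\<close>.\<close>

lemma second_derivative_symmetric:
 fixes h :: "'a::euclidean_space => real"
 assumes O: "open S" "x0 \<in> S" and h: "!!y. y \<in> S ==> (h has_derivative (%w. G y \<bullet> w)) (at y)"
  and G: "(G has_derivative L) (at x0)"
 shows "L v \<bullet> w = L w \<bullet> v"
proof -
 have lin: "linear L" using has_derivative_bounded_linear[OF G] bounded_linear.linear by blast
 define B where "B = norm v + norm w + 1"
 have B: "norm v <= B" "norm w <= B" "norm (v + w) <= B" "0 < B"
  using norm_triangle_ineq[of v w] by (auto simp: B_def add_nonneg_pos)
 have "\<bar>(L v \<bullet> w - L w \<bullet> v) / 2\<bar> <= 0 + eta" if eta: "0 < eta" for eta
 proof -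
  define e where "e = eta / (3 * B\<^sup>2)"
  have e: "0 < e" using eta B by (simp add: e_def)
  obtain d where d: "0 < d" and est: "!!y w rho. rho < d ==> norm y <= rho ==> norm (y + w) <= rho ==>
   \<bar>h (x0 + y + w) - h (x0 + y) - G x0 \<bullet> w - L y \<bullet> w - (L w \<bullet> w) / 2\<bar> <= e * rho * norm w"
   using second_order_segment[OF O h G e] by metis
  define t where "t = d / (2 * B)"
  have t: "0 < t" "t * B < d" using d B by (auto simp: t_def)
  have le: "e * (t * B) * norm (t *\<^sub>R u) <= t\<^sup>2 * (eta / 3)" if "norm u <= B" for u :: 'a
  proof -
   have "e * (t * B) * (t * norm u) <= e * (t * B) * (t * B)" using that e t B by (intro mult_left_mono) auto
   also have "... = t\<^sup>2 * (eta / 3)" using B by (simp add: e_def power2_eq_square field_simps)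
   finally show ?thesis using t by simp
  qed
  have "norm (t *\<^sub>R v) <= t * B" "norm (t *\<^sub>R v + t *\<^sub>R w) <= t * B" "0 <= t * B"
   using B t by (auto simp: scaleR_add_right[symmetric])
  note n = this
  have "L 0 = 0" using lin by (simp add: linear_0)
  hence
   "\<bar>h (x0 + t *\<^sub>R v) - h x0 - G x0 \<bullet> (t *\<^sub>R v) - (L (t *\<^sub>R v) \<bullet> (t *\<^sub>R v)) / 2\<bar> <= t\<^sup>2 * (eta / 3)"
   "\<bar>h (x0 + t *\<^sub>R v + t *\<^sub>R w) - h x0 - G x0 \<bullet> (t *\<^sub>R v + t *\<^sub>R w) - (L (t *\<^sub>R v + t *\<^sub>R w) \<bullet> (t *\<^sub>R v + t *\<^sub>R w)) / 2\<bar> <= t\<^sup>2 * (eta / 3)"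
   "\<bar>h (x0 + t *\<^sub>R v + t *\<^sub>R w) - h (x0 + t *\<^sub>R v) - G x0 \<bullet> (t *\<^sub>R w) - L (t *\<^sub>R v) \<bullet> (t *\<^sub>R w) - (L (t *\<^sub>R w) \<bullet> (t *\<^sub>R w)) / 2\<bar> <= t\<^sup>2 * (eta / 3)"
   using est[of "t * B" 0 "t *\<^sub>R v"] est[of "t * B" 0 "t *\<^sub>R (v + w)"] est[of "t * B" "t *\<^sub>R v" "t *\<^sub>R w"] n t(2) le[OF B(1)] le[OF B(3)] le[OF B(2)]
   by (simp_all add: scaleR_add_right add.assoc)
  note est3 = this
  define p1 p2 p3 p4 where "p1 = L (t *\<^sub>R v) \<bullet> (t *\<^sub>R v)" and "p2 = L (t *\<^sub>R v) \<bullet> (t *\<^sub>R w)"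
   and "p3 = L (t *\<^sub>R w) \<bullet> (t *\<^sub>R v)" and "p4 = L (t *\<^sub>R w) \<bullet> (t *\<^sub>R w)"
  have "\<bar>(p2 - p3) / 2\<bar> <= t\<^sup>2 * eta" using est3 unfolding linear_add[OF lin] inner_add_left inner_add_right
   p1_def[symmetric] p2_def[symmetric] p3_def[symmetric] p4_def[symmetric] by argo
  moreover have "(p2 - p3) / 2 = t\<^sup>2 * ((L v \<bullet> w - L w \<bullet> v) / 2)"
   by (simp add: p2_def p3_def linear_scale[OF lin] power2_eq_square algebra_simps)
  ultimately have "t\<^sup>2 * \<bar>(L v \<bullet> w - L w \<bullet> v) / 2\<bar> <= t\<^sup>2 * eta" by (simp add: abs_mult)
  thus ?thesis using t by simp
 qed
 hence "\<bar>(L v \<bullet> w - L w \<bullet> v) / 2\<bar> <= 0" by (rule field_le_epsilon)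
 thus ?thesis by simp
qed

definition psd :: "real^'n::finite^'n => bool" where
 "psd N \<longleftrightarrow> transpose N = N & (ALL v. 0 <= v \<bullet> (N *v v))"

lemma psd_cauchy_schwarz:
 fixes N :: "real^'n::finite^'n"
 assumes "psd N"
 shows "(w \<bullet> (N *v v))\<^sup>2 <= (w \<bullet> (N *v w)) * (v \<bullet> (N *v v))"
proof -
 have sym: "v \<bullet> (N *v w) = w \<bullet> (N *v v)"
  using assms symmetric_matrix_inner[of N v w] by (simp add: psd_def inner_commute)
 have q: "0 <= w \<bullet> (N *v w) + 2 * t * (w \<bullet> (N *v v)) + t\<^sup>2 * (v \<bullet> (N *v v))" for t
 proof -
  have "0 <= (w + t *\<^sub>R v) \<bullet> (N *v (w + t *\<^sub>R v))" using assms by (simp add: psd_def)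
  thus ?thesis
   by (simp add: matrix_vector_right_distrib matrix_vector_mult_scaleR inner_add_left inner_add_right sym power2_eq_square algebra_simps)
 qed
 show ?thesis
 proof (cases "v \<bullet> (N *v v) = 0")
  case True
  have "w \<bullet> (N *v v) = 0"
  proof (rule ccontr)
   assume n: "w \<bullet> (N *v v) ~= 0"
   show False using q[of "- (w \<bullet> (N *v w) + 1) / (2 * (w \<bullet> (N *v v)))"] True n by (simp add: field_simps)
  qed
  thus ?thesis using True by simp
 next
  case False
  hence p: "0 < v \<bullet> (N *v v)" using assms by (simp add: psd_def order_less_le)
  have "0 <= w \<bullet> (N *v w) - (w \<bullet> (N *v v))\<^sup>2 / (v \<bullet> (N *v v))"
   using q[of "- (w \<bullet> (N *v v)) / (v \<bullet> (N *v v))"] p by (simp add: power2_eq_square divide_simps)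
  thus ?thesis using p by (simp add: field_simps)
 qed
qed

text \<open>Subtracting a rank one matrix annihilates the direction \<open>v\<close>; by the
Cauchy-Schwarz inequality a positive semidefinite matrix stays so.\<close>

definition peel :: "real^'n::finite^'n => real^'n => real^'n^'n" where
 "peel N v = (\<chi> i j. N $ i $ j - (N *v v) $ i * (N *v v) $ j / (v \<bullet> (N *v v)))"

lemma psd_peel:
 fixes N :: "real^'n::finite^'n"
 assumes N: "psd N" and v: "0 < v \<bullet> (N *v v)"
 shows "psd (peel N v)"
proof -
 let ?xi = "N *v v" and ?gam = "v \<bullet> (N *v v)"
 have sym: "N $ i $ j = N $ j $ i" for i j
 proof -
  have "N $ i $ j = transpose N $ i $ j" using N by (simp add: psd_def)
  thus ?thesis by (simp only: transpose_def vec_lambda_beta)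
 qed
 have q: "w \<bullet> (peel N v *v w) = w \<bullet> (N *v w) - (w \<bullet> ?xi)\<^sup>2 / ?gam" for w
 proof -
  have "(peel N v *v w) = N *v w - ((w \<bullet> ?xi) / ?gam) *\<^sub>R ?xi"
   by (simp add: vec_eq_iff peel_def matrix_vector_mult_def[of "\<chi> i j. _ i j"] left_diff_distrib sum_subtractf
   inner_vec_def[of w] sum_divide_distrib sum_distrib_right sum_distrib_left)
   (simp add: matrix_vector_mult_def mult_ac)
  thus ?thesis by (simp add: inner_diff_right power2_eq_square)
 qed
 have "0 <= w \<bullet> (peel N v *v w)" for w unfolding q using psd_cauchy_schwarz[OF N, of w v] v by (simp add: field_simps)
 moreover have "transpose (peel N v) = peel N v" by (simp add: vec_eq_iff transpose_def peel_def sym mult.commute)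
 ultimately show ?thesis by (simp add: psd_def)
qed

lemma matrix_axis: "(N *v axis i (1::real)) $ k = N $ k $ i"
 by (simp add: matrix_vector_mul_component inner_axis)

lemma axis_matrix_axis: "axis i (1::real) \<bullet> (N *v axis i 1) = N $ i $ i"
 by (simp add: inner_axis' matrix_axis)

lemma psd_zero_diagonal:
 fixes N :: "real^'n::finite^'n"
 assumes N: "psd N" and "N $ i $ i = 0"
 shows "(N *v w) $ i = 0"
proof -
 have "(axis i 1 \<bullet> (N *v w))\<^sup>2 <= 0"
  using psd_cauchy_schwarz[OF N, of "axis i 1" w] assms(2) by (simp add: axis_matrix_axis)
 thus ?thesis by (simp add: inner_axis')
qed

definition matrix_inner :: "real^'n::finite^'n => real^'n^'n => real" where
 "matrix_inner P N = (\<Sum>i\<in>UNIV. \<Sum>j\<in>UNIV. P $ i $ j * N $ i $ j)"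

lemma matrix_inner_peel:
 "matrix_inner P N = matrix_inner P (peel N v) + (N *v v) \<bullet> (P *v (N *v v)) / (v \<bullet> (N *v v))"
proof -
 have "(N *v v) \<bullet> (P *v (N *v v)) / (v \<bullet> (N *v v)) =
   (\<Sum>i\<in>UNIV. \<Sum>j\<in>UNIV. P $ i $ j * ((N *v v) $ i * (N *v v) $ j / (v \<bullet> (N *v v))))"
  by (simp add: inner_vec_def[of "N *v v"] matrix_vector_mult_def[of P] sum_distrib_left sum_divide_distrib mult_ac)
 thus ?thesis by (simp add: matrix_inner_def peel_def right_diff_distrib sum_subtractf)
qed

text \<open>Rank one matrices are peeled off along the coordinate axes; every step annihilates one
more diagonal entry, and a positive semidefinite matrix without diagonal entries is zero.\<close>

lemma matrix_inner_psd_nonneg: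
 fixes P N :: "real^'n::finite^'n"
 assumes P: "spd P" and N: "psd N"
 shows "0 <= matrix_inner P N" using N
proof (induction "card {i. N $ i $ i ~= 0}" arbitrary: N rule: less_induct)
 case less
 show ?case
 proof (cases "EX i. N $ i $ i ~= 0")
  case False
  have "N $ i $ j = 0" for i j using psd_zero_diagonal[OF less.prems, of i "axis j 1"] False by (simp add: matrix_axis)
  thus ?thesis by (simp add: matrix_inner_def)
 next
  case True
  then obtain i where i: "N $ i $ i ~= 0" by blast
  let ?v = "axis i 1 :: real^'n"
  have v: "0 < ?v \<bullet> (N *v ?v)" using i less.prems by (metis axis_matrix_axis order_less_le psd_def)
  have "{k. peel N ?v $ k $ k ~= 0} \<subset> {k. N $ k $ k ~= 0}"
  proof
   show "{k. peel N ?v $ k $ k ~= 0} <= {k. N $ k $ k ~= 0}" using psd_zero_diagonal[OF less.prems] by (auto simp: peel_def)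
   have "peel N ?v $ i $ i = 0" using i by (simp add: peel_def matrix_axis axis_matrix_axis)
   thus "{k. peel N ?v $ k $ k ~= 0} ~= {k. N $ k $ k ~= 0}" using i by blast
  qed
  hence "0 <= matrix_inner P (peel N ?v)" by (intro less.hyps psd_peel[OF less.prems v] psubset_card_mono) auto
  moreover have "0 <= (N *v ?v) \<bullet> (P *v (N *v ?v))" by (rule spd_nonneg[OF P])
  ultimately show ?thesis using matrix_inner_peel[of P N ?v] v by simp
 qed
qed

lemma matrix_inner_ge:
 fixes P N :: "real^'n::finite^'n"
 assumes P: "spd P" and N: "psd N" and v: "0 < v \<bullet> (N *v v)"
  and eq: "(N *v v) \<bullet> (P *v (N *v v)) = bet * (v \<bullet> (N *v v))"
 shows "bet <= matrix_inner P N" using matrix_inner_psd_nonneg[OF P psd_peel[OF N v]] matrix_inner_peel[of P N v] eq v by simp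

context riemannian
begin

text \<open>At a critical point the derivatives of the metric coefficients are multiplied by
zero.\<close>

lemma laplace_critical:
 assumes f: "smooth_fun A f" and p: "p \<in> topspace X" and c: "c = chart_at A p"
  and crit: "!!j. pd j (local_rep c f) (snd c p) = 0"
 shows "laplace_beltrami A g f p =
  (\<Sum>i\<in>UNIV. \<Sum>j\<in>UNIV. matrix_inv (g c p) $ i $ j * pd i (pd j (local_rep c f)) (snd c p))"
proof -
 have cA: "c \<in> A" "p \<in> dom c" using chart_at[OF p] by (auto simp: c)
 define x where "x = snd c p"
 have x: "x \<in> img c" and ix: "ichart c x = p" using cA by (auto simp: x_def ichart)
 let ?f = "local_rep c f"
 have pdd: "pd j ?f differentiable (at x)" for j
  by (rule smooth_on_differentiable[OF smooth_on_pd chart(2)[OF cA(1)] x]) (use f cA in "auto simp: smooth_fun_def")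
 have dn: "sqrt (det (g c p)) ~= 0" using det_metric[OF cA] by simp
 have 0: "pd j ?f x = 0" for j using crit by (simp add: x_def)
 have "pd i (flux c f i) x = sqrt (det (g c p)) * (\<Sum>j\<in>UNIV. matrix_inv (g c p) $ i $ j * pd i (pd j ?f) x)" for i
 proof -
  define k where "k j y = sqrt (det (g c (ichart c y))) * matrix_inv (g c (ichart c y)) $ i $ j" for j y
  have kd: "k j differentiable (at x)" for j
   unfolding k_def by (rule differentiable_mult[OF sqrt_det_differentiable[OF cA(1) x] inverse_metric_entry_differentiable[OF cA(1) x]])
  have t: "((%y. k j y * pd j ?f y) has_derivative
   (%v. k j x * ((\<chi> l. pd l (pd j ?f) x) \<bullet> v) + ((\<chi> l. pd l (k j) x) \<bullet> v) * pd j ?f x)) (at x)" for j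
   by (rule has_derivative_mult[OF has_derivative_pd[OF kd] has_derivative_pd[OF pdd]])
  have "pd i (flux c f i) x = pd i (%y. \<Sum>j\<in>UNIV. k j y * pd j ?f y) x"
   by (rule pd_cong[OF chart(2)[OF cA(1)] x]) (simp add: flux_eq[OF cA(1)] k_def sum_distrib_left mult.assoc)
  also have "... = (\<Sum>j\<in>UNIV. k j x * ((\<chi> l. pd l (pd j ?f) x) \<bullet> axis i 1) + ((\<chi> l. pd l (k j) x) \<bullet> axis i 1) * pd j ?f x)"
   by (rule pd_eqI[OF has_derivative_sum[of UNIV, OF t]])
  also have "... = (\<Sum>j\<in>UNIV. k j x * pd i (pd j ?f) x)" by (simp add: 0 inner_axis)
  also have "... = sqrt (det (g c p)) * (\<Sum>j\<in>UNIV. matrix_inv (g c p) $ i $ j * pd i (pd j ?f) x)"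
   by (simp only: k_def ix sum_distrib_left mult.assoc)
  finally show ?thesis .
 qed
 hence "laplace_beltrami A g f p = (1 / sqrt (det (g c p))) * (sqrt (det (g c p)) *
   (\<Sum>i\<in>UNIV. \<Sum>j\<in>UNIV. matrix_inv (g c p) $ i $ j * pd i (pd j ?f) x))"
  unfolding laplace_flux[OF p, of f] c[symmetric] x_def[symmetric] by (simp only: sum_distrib_left)
 also have "... = (\<Sum>i\<in>UNIV. \<Sum>j\<in>UNIV. matrix_inv (g c p) $ i $ j * pd i (pd j ?f) x)"
  using dn by (simp only: mult.assoc[symmetric]) simp
 finally show ?thesis unfolding x_def .
qed

end


section \<open>Isoparametric functions near the focal sets\<close>

lemma second_order_limit:
 fixes h :: "'a::euclidean_space => real"
 assumes O: "open S" "x0 \<in> S" and h: "!!y. y \<in> S ==> (h has_derivative (%w. G y \<bullet> w)) (at y)"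
  and G: "(G has_derivative L) (at x0)" and G0: "G x0 = 0"
 shows "((%tau. (h (x0 + tau *\<^sub>R v) - h x0) / tau\<^sup>2) ---> (L v \<bullet> v) / 2) (at 0)"
proof (rule tendstoI)
 fix e :: real assume e: "0 < e"
 have lin: "linear L" using has_derivative_bounded_linear[OF G] bounded_linear.linear by blast
 define e' where "e' = e / (2 * ((norm v)\<^sup>2 + 1))"
 have vp: "0 < (norm v)\<^sup>2 + 1" by (simp add: add_nonneg_pos)
 have e': "0 < e'" using e vp by (simp add: e'_def)
 obtain d where d: "0 < d" and est: "!!y w rho. rho < d ==> norm y <= rho ==> norm (y + w) <= rho ==>
   \<bar>h (x0 + y + w) - h (x0 + y) - G x0 \<bullet> w - L y \<bullet> w - (L w \<bullet> w) / 2\<bar> <= e' * rho * norm w"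
  using second_order_segment[OF O h G e'] by metis
 have "dist ((h (x0 + tau *\<^sub>R v) - h x0) / tau\<^sup>2) ((L v \<bullet> v) / 2) < e"
  if tau: "tau ~= 0" "\<bar>tau\<bar> < d / (norm v + 1)" for tau
 proof -
  have "\<bar>tau\<bar> * (norm v + 1) < d" using tau by (simp add: pos_less_divide_eq add_nonneg_pos)
  hence "norm (tau *\<^sub>R v) < d" by (simp add: algebra_simps)
  hence "\<bar>h (x0 + 0 + tau *\<^sub>R v) - h (x0 + 0) - G x0 \<bullet> (tau *\<^sub>R v) - L 0 \<bullet> (tau *\<^sub>R v) - (L (tau *\<^sub>R v) \<bullet> (tau *\<^sub>R v)) / 2\<bar>
   <= e' * norm (tau *\<^sub>R v) * norm (tau *\<^sub>R v)" by (intro est) auto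
  hence "\<bar>h (x0 + tau *\<^sub>R v) - h x0 - tau\<^sup>2 * ((L v \<bullet> v) / 2)\<bar> <= tau\<^sup>2 * (e' * (norm v)\<^sup>2)"
  proof -
   have "e' * norm (tau *\<^sub>R v) * norm (tau *\<^sub>R v) = e' * (norm (tau *\<^sub>R v))\<^sup>2" by (simp only: power2_eq_square mult.assoc)
   also have "... = tau\<^sup>2 * (e' * (norm v)\<^sup>2)" by (simp add: power_mult_distrib)
   finally have eq: "e' * norm (tau *\<^sub>R v) * norm (tau *\<^sub>R v) = tau\<^sup>2 * (e' * (norm v)\<^sup>2)" .
   have "(L (tau *\<^sub>R v) \<bullet> (tau *\<^sub>R v)) / 2 = tau\<^sup>2 * ((L v \<bullet> v) / 2)"
   by (simp add: linear_scale[OF lin] power2_eq_square)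
   thus "?thesis" if "\<bar>h (x0 + 0 + tau *\<^sub>R v) - h (x0 + 0) - G x0 \<bullet> (tau *\<^sub>R v) - L 0 \<bullet> (tau *\<^sub>R v) - (L (tau *\<^sub>R v) \<bullet> (tau *\<^sub>R v)) / 2\<bar>
   <= e' * norm (tau *\<^sub>R v) * norm (tau *\<^sub>R v)" using that unfolding eq by (simp add: G0 linear_0[OF lin])
  qed
  also have "... < tau\<^sup>2 * e"
  proof -
   have "e' * (norm v)\<^sup>2 < e' * (2 * ((norm v)\<^sup>2 + 1))" using e' by (intro mult_strict_left_mono) (auto simp: add_nonneg_pos)
   also have "... = e" using vp by (simp add: e'_def)
   finally show ?thesis using tau(1) by simp
  qed
  finally have "\<bar>h (x0 + tau *\<^sub>R v) - h x0 - tau\<^sup>2 * ((L v \<bullet> v) / 2)\<bar> / tau\<^sup>2 < e"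
   using tau(1) by (simp add: pos_divide_less_eq mult.commute)
  moreover have "(h (x0 + tau *\<^sub>R v) - h x0) / tau\<^sup>2 - (L v \<bullet> v) / 2 = (h (x0 + tau *\<^sub>R v) - h x0 - tau\<^sup>2 * ((L v \<bullet> v) / 2)) / tau\<^sup>2"
   using tau(1) by (simp add: diff_divide_distrib)
  ultimately show ?thesis by (simp add: dist_real_def)
 qed
 moreover have "0 < d / (norm v + 1)" using d by (simp add: add_nonneg_pos)
 ultimately show "\<forall>\<^sub>F tau in at 0. dist ((h (x0 + tau *\<^sub>R v) - h x0) / tau\<^sup>2) ((L v \<bullet> v) / 2) < e"
  unfolding eventually_at by (intro exI[of _ "d / (norm v + 1)"]) (simp add: dist_real_def)
qed

lemma Ck_on_minus:
 fixes h :: "real^'n::finite => real"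
 assumes S: "open S"
 shows "Ck_on k h S ==> Ck_on k (%x. - h x) S"
proof (induction k arbitrary: h)
 case (Suc k)
 have pd: "pd i (%x. - h x) x = - pd i h x" if "x \<in> S" for i x
 proof -
  have "h differentiable (at x)" using Suc.prems that by (simp add: differentiable_on_eq_differentiable_at[OF S])
  from pd_eqI[OF has_derivative_minus[OF has_derivative_pd[OF this]]] show ?thesis by (simp add: inner_axis)
 qed
 have "Ck_on k (pd i (%x. - h x)) S" for i
 proof -
  have "Ck_on k (pd i (%x. - h x)) S = Ck_on k (%x. - pd i h x) S" by (rule Ck_on_cong[OF S pd])
  thus ?thesis using Suc by simp
 qed
 thus ?case using Suc.prems by (auto intro: differentiable_on_minus)
qed (auto intro: continuous_on_minus)

lemma pd_minus: "h differentiable (at x) ==> pd i (%x. - h x) x = - pd i (h :: real^'n::finite => real) x"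
 using pd_eqI[OF has_derivative_minus[OF has_derivative_pd]] by (simp add: inner_axis)

lemma matrix_vector_mult_minus: "M *v (- v) = - (M *v (v :: real^'n::finite))"
 using matrix_vector_mult_scaleR[of M "- 1" v] by simp

text \<open>The functions \<open>Da k\<close> and \<open>Db k\<close> are the \<open>k\<close>-th
derivatives of \<open>a\<close> and \<open>b\<close>.\<close>

locale isoparam = riemannian X A g
 for X :: "'m topology" and A :: "('m, 'n::finite) chart set" and g +
 fixes f :: "'m => real" and t0 t1 :: real and Da Db :: "nat => real => real"
 assumes f: "smooth_fun A f" and t01: "t0 < t1" and onto: "f ` topspace X = {t0..t1}"
  and Da: "!!k s. s \<in> {t0..t1} ==> (Da k has_real_derivative Da (Suc k) s) (at s within {t0..t1})"
  and Db: "!!k s. s \<in> {t0..t1} ==> (Db k has_real_derivative Db (Suc k) s) (at s within {t0..t1})"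
  and grad: "!!p. p \<in> topspace X ==> gradient_norm_sq A g f p = Db 0 (f p)"
  and lap: "!!p. p \<in> topspace X ==> laplace_beltrami A g f p = Da 0 (f p)"
begin

lemma level: "p \<in> topspace X ==> f p \<in> {t0..t1}"
 using onto by blast

lemma level_attained: "s \<in> {t0..t1} ==> \<exists>p\<in>topspace X. f p = s"
 using onto by (metis imageE)

lemma Db_continuous: "continuous_on {t0..t1} (Db k)" and Da_continuous: "continuous_on {t0..t1} (Da k)"
 by (rule DERIV_continuous_on, rule Db, assumption) (rule DERIV_continuous_on, rule Da, assumption)

lemma level_chart: "c \<in> A ==> x \<in> img c ==> local_rep c f x \<in> {t0..t1}"
 using level ichart(3) dom_subset by (simp add: local_rep_apply subset_iff)

lemma rep_has_derivative:
 "c \<in> A ==> x \<in> img c ==> (local_rep c f has_derivative (%w. coord_grad c f x \<bullet> w)) (at x)" unfolding coord_grad_def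
 by (rule has_derivative_pd, rule smooth_on_differentiable[OF _ chart(2)]) (use f in "auto simp: smooth_fun_def")

lemma rep_continuous: "c \<in> A ==> continuous_on (img c) (local_rep c f)"
 using f smooth_on_continuous by (auto simp: smooth_fun_def)

lemma grad_norm_sq_level: "c \<in> A ==> p \<in> dom c ==> grad_norm_sq c f p = Db 0 (f p)"
 using gradient_norm_sq_chart[of c p f] grad[of p] smooth_fun_differentiable[OF f] dom_subset[of c] by auto

lemma slope_bound:
 assumes c: "c \<in> A" and x: "x \<in> img c"
 shows "(coord_grad c f x \<bullet> w)\<^sup>2 <= Db 0 (local_rep c f x) * (w \<bullet> (g c (ichart c x) *v w))"
 using grad_norm_sq_cauchy_schwarz[OF c ichart(3)[OF c x], of f w] grad_norm_sq_level[OF c ichart(3)[OF c x]]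
 by (simp add: ichart(2)[OF c x] local_rep_apply)

lemma b_nonneg: "s \<in> {t0..t1} ==> 0 <= Db 0 s"
proof -
 assume "s \<in> {t0..t1}"
 then obtain p where p: "p \<in> topspace X" "f p = s" using level_attained by blast
 have "0 <= grad_norm_sq (chart_at A p) f p" unfolding grad_norm_sq_def by (rule spd_nonneg[OF metric_spd]) (use chart_at p in auto)
 thus ?thesis using grad_norm_sq_level chart_at p by simp
qed

lemma critical:
 assumes "c \<in> A" "x \<in> img c" "Db 0 (local_rep c f x) = 0"
 shows "coord_grad c f x = 0" using slope_bound[OF assms(1,2), of "coord_grad c f x"] assms(3) by simp

text \<open>If \<open>b\<close> vanished to second order at \<open>s0\<close>, then \<open>phi = f
- s0\<close> would satisfy \<open>|phi'| \<le> K |phi|\<close> along coordinate segments. By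
Gronwall the level set would be open, hence everything.\<close>

lemma no_double_zero:
 assumes c: "s0 \<in> {t0..t1}" and C: "0 <= C" "!!s. s \<in> {t0..t1} ==> \<bar>Db 0 s\<bar> <= C * (s - s0)\<^sup>2"
 shows False
proof -
 let ?S = "{p \<in> topspace X. f p = s0}"
 have "?S = topspace X"
 proof (rule connected_induct)
  show "?S ~= {}" using level_attained[OF c] by blast
  fix p assume p: "p \<in> topspace X"
  define ch where "ch = chart_at A p"
  have ch: "ch \<in> A" "p \<in> dom ch" using chart_at[OF p] by (auto simp: ch_def)
  obtain r where r: "0 < r" "cball (snd ch p) r <= img ch" by (rule chart_cball[OF ch])
  obtain B where B: "0 < B" "!!x v. x \<in> cball (snd ch p) r ==> v \<bullet> (g ch (ichart ch x) *v v) <= (B * norm v)\<^sup>2"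
   using metric_bounded[OF ch(1) compact_cball r(2)] by metis
  have spread: "local_rep ch f z = s0"
   if y: "y \<in> cball (snd ch p) r" and z: "z \<in> cball (snd ch p) r" and ys: "local_rep ch f y = s0" for y z
  proof -
   have seg: "y + t *\<^sub>R (z - y) \<in> cball (snd ch p) r" if "t \<in> {0..1}" for t
   proof -
   have "closed_segment y z <= cball (snd ch p) r" using y z by (simp add: closed_segment_subset)
   moreover have "y + t *\<^sub>R (z - y) \<in> closed_segment y z"
   unfolding in_segment using that by (intro exI[of _ t]) (simp add: algebra_simps)
   ultimately show ?thesis by blast
   qed
   have "local_rep ch f (y + 1 *\<^sub>R (z - y)) - s0 = 0"
   proof (rule gronwall_zero[where phi = "%t. local_rep ch f (y + t *\<^sub>R (z - y)) - s0"
   and phi' = "%t. coord_grad ch f (y + t *\<^sub>R (z - y)) \<bullet> (z - y)" and K = "sqrt C * (B * norm (z - y))"])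
   fix t :: real assume t: "t \<in> {0..1}"
   let ?x = "y + t *\<^sub>R (z - y)"
   have x: "?x \<in> img ch" using seg[OF t] r(2) by blast
   have line: "((%t. y + t *\<^sub>R (z - y)) has_derivative (%s. s *\<^sub>R (z - y))) (at t within {0..1})"
   by (auto intro!: derivative_eq_intros)
   have "((%t. local_rep ch f (y + t *\<^sub>R (z - y))) has_derivative (%s. coord_grad ch f ?x \<bullet> (s *\<^sub>R (z - y)))) (at t within {0..1})"
   by (rule has_derivative_compose[OF line rep_has_derivative[OF ch(1) x]])
   hence "((%t. local_rep ch f (y + t *\<^sub>R (z - y))) has_real_derivative coord_grad ch f ?x \<bullet> (z - y)) (at t within {0..1})"
   by (simp add: has_field_derivative_def mult.commute[of _ "coord_grad ch f ?x \<bullet> (z - y)"])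
   from DERIV_diff[OF this DERIV_const[of s0]]
   show "((%t. local_rep ch f (y + t *\<^sub>R (z - y)) - s0) has_real_derivative coord_grad ch f ?x \<bullet> (z - y)) (at t within {0..1})"
   by simp
   have "(coord_grad ch f ?x \<bullet> (z - y))\<^sup>2 <= Db 0 (local_rep ch f ?x) * ((z - y) \<bullet> (g ch (ichart ch ?x) *v (z - y)))"
   by (rule slope_bound[OF ch(1) x])
   also have "... <= (C * (local_rep ch f ?x - s0)\<^sup>2) * (B * norm (z - y))\<^sup>2"
   using C(2)[OF level_chart[OF ch(1) x]] B(2)[OF seg[OF t]] b_nonneg[OF level_chart[OF ch(1) x]] C(1)
   spd_nonneg[OF metric_spd[OF ch(1) ichart(3)[OF ch(1) x]]] by (intro mult_mono) auto
   also have "... = (sqrt C * (B * norm (z - y)) * \<bar>local_rep ch f ?x - s0\<bar>)\<^sup>2"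
   using C(1) by (simp add: power_mult_distrib)
   finally show "\<bar>coord_grad ch f ?x \<bullet> (z - y)\<bar> <= sqrt C * (B * norm (z - y)) * \<bar>local_rep ch f ?x - s0\<bar>"
   using C(1) B(1) by (intro power2_le_imp_le[of "\<bar>_\<bar>"]) auto
   qed (use ys in auto)
   thus ?thesis by simp
  qed
  let ?U = "{q \<in> dom ch. snd ch q \<in> ball (snd ch p) r}"
  have "openin X ?U" by (rule openin_chart_preimage[OF ch(1) open_ball])
  moreover have "p \<in> ?U" using ch r by simp
  moreover have "?U <= ?S | ?U \<inter> ?S = {}"
  proof (cases "?U \<inter> ?S = {}")
   case False
   then obtain q where q: "q \<in> dom ch" "snd ch q \<in> ball (snd ch p) r" "f q = s0" by blast
   have "f q' = s0" if "q' \<in> ?U" for q' using spread[of "snd ch q" "snd ch q'"] q that ch(1) by (simp add: local_rep_chart)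
   thus ?thesis using dom_subset[OF ch(1)] by blast
  qed simp
  ultimately show "EX U. openin X U & p \<in> U & (U <= ?S | U \<inter> ?S = {})" by blast
 qed auto
 hence "!!s. s \<in> {t0..t1} ==> s = s0" using level_attained by blast
 from this[of t0] this[of t1] show False using t01 by simp
qed

lemma simple_zeros:
 assumes "s \<in> {t0..t1}" "Db 0 s = 0"
 shows "Db 1 s ~= 0"
proof
 assume z: "Db 1 s = 0"
 obtain C where "0 <= C" "!!r. r \<in> {t0..t1} ==> \<bar>Db 0 r\<bar> <= C * (r - s)\<^sup>2"
  using quadratic_bound_at_double_zero[of t0 t1 "Db 0" "Db 1" "Db 2" s] Db[of _ 0] Db[of _ 1] Db_continuous[of 2] assms z
  by (auto simp: numeral_2_eq_2)
 thus False using no_double_zero[OF assms(1)] by blast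
qed

lemma b_pos:
 assumes s: "t0 < s" "s < t1"
 shows "0 < Db 0 s"
proof (rule ccontr)
 assume "~ 0 < Db 0 s"
 hence z: "Db 0 s = 0" using b_nonneg[of s] s by simp
 have "at s within {t0..t1} = at s" using s by (intro at_within_interior) auto
 hence d: "(Db 0 has_real_derivative Db 1 s) (at s)" using Db[of s 0] s by simp
 have "Db 1 s = 0" by (rule DERIV_local_min[OF d, of "min (s - t0) (t1 - s)"]) (use s z b_nonneg in "auto simp: abs_less_iff")
 thus False using simple_zeros[of s] z s by simp
qed

lemma b_zero: "Db 0 t0 = 0" "Db 0 t1 = 0"
proof -
 have "Db 0 s = 0" if s: "s = t0 | s = t1" for s
 proof -
  obtain p where p: "p \<in> topspace X" "f p = s" using level_attained[of s] s t01 by auto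
  define c where "c = chart_at A p"
  have c: "c \<in> A" "p \<in> dom c" using chart_at[OF p(1)] by (auto simp: c_def)
  have x: "snd c p \<in> img c" using c by simp
  have fx: "local_rep c f (snd c p) = s" by (simp add: local_rep_chart[OF c] p)
  have "(%w. coord_grad c f (snd c p) \<bullet> w) = (%v. 0)"
  proof (rule differential_zero_maxmin[OF x chart(2)[OF c(1)] rep_has_derivative[OF c(1) x]])
   show "(\<forall>y\<in>img c. local_rep c f y <= local_rep c f (snd c p)) | (\<forall>y\<in>img c. local_rep c f (snd c p) <= local_rep c f y)"
   unfolding fx using level_chart[OF c(1)] s by auto
  qed
  from fun_cong[OF this, of "coord_grad c f (snd c p)"] have "coord_grad c f (snd c p) = 0" by (simp only: inner_eq_zero_iff)
  thus ?thesis using grad_norm_sq_level[OF c] grad_norm_sq_eq[OF c, of f] p by simp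
 qed
 thus "Db 0 t0 = 0" "Db 0 t1 = 0" by blast+
qed

lemma b_slope: "((%s. Db 0 s / (s - t0)) ---> Db 1 t0) (at t0 within {t0..t1})"
 using Db[of t0 0] t01 b_zero by (simp add: has_field_derivative_iff)

lemma b_slope_pos: "0 < Db 1 t0"
proof -
 have "0 <= Db 1 t0"
 proof (rule tendsto_lowerbound[OF b_slope])
  show "\<forall>\<^sub>F s in at t0 within {t0..t1}. 0 <= Db 0 s / (s - t0)"
   by (auto simp: eventually_at_filter intro!: always_eventually divide_nonneg_nonneg b_nonneg)
  show "at t0 within {t0..t1} ~= bot" using t01 by (simp add: trivial_limit_within islimpt_Icc)
 qed
 thus ?thesis using simple_zeros[of t0] b_zero t01 by simp
qed

lemma b_linear_below:
 obtains d where "0 < d" "!!s. t0 <= s ==> s < t0 + d ==> s <= t1 ==> Db 1 t0 / 2 * (s - t0) <= Db 0 s"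
proof -
 have "Db 1 t0 / 2 < Db 1 t0" using b_slope_pos by simp
 hence "\<forall>\<^sub>F s in at t0 within {t0..t1}. Db 1 t0 / 2 < Db 0 s / (s - t0)" using b_slope by (rule order_tendstoD(1)[rotated])
 then obtain d where d: "0 < d" "!!s. s \<in> {t0..t1} ==> s ~= t0 ==> dist s t0 < d ==> Db 1 t0 / 2 < Db 0 s / (s - t0)"
  unfolding eventually_at by blast
 have "Db 1 t0 / 2 * (s - t0) <= Db 0 s" if s: "t0 <= s" "s < t0 + d" "s <= t1" for s
 proof (cases "s = t0")
  case False
  hence "Db 1 t0 / 2 < Db 0 s / (s - t0)" using d(2)[of s] s by (simp add: dist_real_def)
  hence "Db 1 t0 / 2 * (s - t0) < Db 0 s" using s False by (subst (asm) pos_less_divide_eq) auto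
  thus ?thesis by simp
 qed (simp add: b_zero)
 thus ?thesis using that d(1) by blast
qed

definition hessian :: "('m, 'n) chart => real^'n => real^'n^'n" where
 "hessian c x = (\<chi> j i. pd i (pd j (local_rep c f)) x)"

lemma pd_rep_differentiable: "c \<in> A ==> x \<in> img c ==> pd j (local_rep c f) differentiable (at x)"
 by (rule smooth_on_differentiable[OF smooth_on_pd chart(2)]) (use f in "auto simp: smooth_fun_def")

lemma coord_grad_derivative:
 assumes c: "c \<in> A" and x: "x \<in> img c"
 shows "(coord_grad c f has_derivative (%v. hessian c x *v v)) (at x)"
 unfolding has_derivative_componentwise_within[of "coord_grad c f"]
proof
 fix b :: "real^'n" assume "b \<in> Basis"
 then obtain j where b: "b = axis j 1" by (auto simp: Basis_vec_def)
 have "(hessian c x *v v) $ j = (\<chi> i. pd i (pd j (local_rep c f)) x) \<bullet> v" for v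
  by (simp add: hessian_def matrix_vector_mult_def inner_vec_def)
 thus "((%x. coord_grad c f x \<bullet> b) has_derivative (%v. (hessian c x *v v) \<bullet> b)) (at x)"
  unfolding b inner_axis by (simp add: coord_grad_def has_derivative_pd[OF pd_rep_differentiable[OF c x]])
qed

lemma hessian_symmetric:
 assumes c: "c \<in> A" and x: "x \<in> img c"
 shows "transpose (hessian c x) = hessian c x"
proof -
 have "hessian c x $ i $ j = hessian c x $ j $ i" for i j
  using second_derivative_symmetric[OF chart(2)[OF c] x rep_has_derivative[OF c] coord_grad_derivative[OF c x], of "axis j 1" "axis i 1"]
  by (simp add: inner_axis matrix_axis)
 thus ?thesis by (simp add: transpose_def vec_eq_iff)
qed

lemma second_order_at_minimum:
 assumes c: "c \<in> A" "p \<in> dom c" and p: "f p = t0"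
 shows "coord_grad c f (snd c p) = 0"
  "((%tau. (local_rep c f (snd c p + tau *\<^sub>R v) - t0) / tau\<^sup>2) ---> (v \<bullet> (hessian c (snd c p) *v v)) / 2) (at 0)"
  "psd (hessian c (snd c p))"
proof -
 have x: "snd c p \<in> img c" using c by simp
 have fx: "local_rep c f (snd c p) = t0" by (simp add: local_rep_chart[OF c] p)
 show 0: "coord_grad c f (snd c p) = 0" by (rule critical[OF c(1) x]) (simp add: fx b_zero)
 have lim: "((%tau. (local_rep c f (snd c p + tau *\<^sub>R v) - t0) / tau\<^sup>2) ---> (v \<bullet> (hessian c (snd c p) *v v)) / 2) (at 0)" for v
  using second_order_limit[OF chart(2)[OF c(1)] x rep_has_derivative[OF c(1)] coord_grad_derivative[OF c(1) x] 0, of v]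
  by (simp add: fx inner_commute)
 thus "((%tau. (local_rep c f (snd c p + tau *\<^sub>R v) - t0) / tau\<^sup>2) ---> (v \<bullet> (hessian c (snd c p) *v v)) / 2) (at 0)" .
 have "0 <= (v \<bullet> (hessian c (snd c p) *v v)) / 2" for v
 proof (rule tendsto_lowerbound[OF lim])
  have "((%tau. snd c p + tau *\<^sub>R v) ---> snd c p + 0 *\<^sub>R v) (at 0)" by (intro tendsto_intros)
  hence "\<forall>\<^sub>F tau in at 0. snd c p + tau *\<^sub>R v \<in> img c"
   using topological_tendstoD[OF _ chart(2)[OF c(1)]] x by simp
  thus "\<forall>\<^sub>F tau in at 0. 0 <= (local_rep c f (snd c p + tau *\<^sub>R v) - t0) / tau\<^sup>2"
   by (rule eventually_mono) (use level_chart[OF c(1)] in "auto intro!: divide_nonneg_nonneg")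
 qed simp
 thus "psd (hessian c (snd c p))" using hessian_symmetric[OF c(1) x] by (simp add: psd_def)
qed

text \<open>Divide \<open>|\<nabla>f|\<^sup>2 = b(f)\<close> by \<open>tau\<^sup>2\<close> along
the line \<open>x + tau v\<close> and let \<open>tau\<close> tend to zero.\<close>

lemma hessian_eikonal:
 assumes c: "c \<in> A" "p \<in> dom c" and p: "f p = t0" and v: "0 < v \<bullet> (hessian c (snd c p) *v v)"
 shows "(hessian c (snd c p) *v v) \<bullet> (matrix_inv (g c p) *v (hessian c (snd c p) *v v)) =
  Db 1 t0 / 2 * (v \<bullet> (hessian c (snd c p) *v v))"
proof -
 define x where "x = snd c p"
 define N where "N = hessian c x"
 let ?h = "%tau. local_rep c f (x + tau *\<^sub>R v)"
 let ?P = "%y. matrix_inv (g c (ichart c y))"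
 have x: "x \<in> img c" and ix: "ichart c x = p" using c by (auto simp: x_def ichart)
 have fx: "local_rep c f x = t0" by (simp add: local_rep_chart[OF c] p x_def)
 note so = second_order_at_minimum[OF c p, folded x_def, folded N_def]
 have lin: "((%tau. x + tau *\<^sub>R v) ---> x + 0 *\<^sub>R v) (at 0)" by (intro tendsto_intros)
 hence in_img: "\<forall>\<^sub>F tau in at 0. x + tau *\<^sub>R v \<in> img c"
  using topological_tendstoD[OF _ chart(2)[OF c(1)]] x by simp
 have gi: "((%tau. coord_grad c f (x + tau *\<^sub>R v) $ i / tau) ---> (N *v v) $ i) (at 0)" for i
 proof -
  have line: "((%tau. x + tau *\<^sub>R v) has_derivative (%s. s *\<^sub>R v)) (at 0)" by (auto intro!: derivative_eq_intros)
  have "(coord_grad c f has_derivative (%v. N *v v)) (at (x + 0 *\<^sub>R v))"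
   using coord_grad_derivative[OF c(1) x] by (simp add: N_def)
  from has_derivative_compose[OF line this]
  have "((%tau. coord_grad c f (x + tau *\<^sub>R v) $ i) has_derivative (%s. (N *v (s *\<^sub>R v)) $ i)) (at 0)"
   by (rule bounded_linear.has_derivative[OF bounded_linear_vec_nth])
  hence "((%tau. coord_grad c f (x + tau *\<^sub>R v) $ i) has_real_derivative (N *v v) $ i) (at 0)"
   by (simp add: has_field_derivative_def matrix_vector_mult_scaleR mult.commute[of _ "(N *v v) $ i"])
  thus ?thesis using so(1) by (simp add: has_field_derivative_iff)
 qed
 have Pij: "((%tau. ?P (x + tau *\<^sub>R v) $ i $ j) ---> ?P x $ i $ j) (at 0)" for i j
 proof -
  have "isCont (%y. ?P y $ i $ j) (x + 0 *\<^sub>R v)"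
   using differentiable_imp_continuous_within[OF inverse_metric_entry_differentiable[OF c(1) x]] by simp
  from isCont_tendsto_compose[OF this lin] show ?thesis by simp
 qed
 have sums: "((%tau. \<Sum>i\<in>UNIV. \<Sum>j\<in>UNIV. (coord_grad c f (x + tau *\<^sub>R v) $ i / tau) * (?P (x + tau *\<^sub>R v) $ i $ j * (coord_grad c f (x + tau *\<^sub>R v) $ j / tau)))
   ---> (\<Sum>i\<in>UNIV. \<Sum>j\<in>UNIV. (N *v v) $ i * (?P x $ i $ j * (N *v v) $ j))) (at 0)"
  by (intro tendsto_sum tendsto_mult gi Pij)
 have lim_eq: "(\<Sum>i\<in>UNIV. \<Sum>j\<in>UNIV. (N *v v) $ i * (?P x $ i $ j * (N *v v) $ j)) = (N *v v) \<bullet> (?P x *v (N *v v))"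
  by (simp add: inner_vec_def matrix_vector_mult_def[of "?P x"] sum_distrib_left)
 have "\<forall>\<^sub>F tau in at 0. (\<Sum>i\<in>UNIV. \<Sum>j\<in>UNIV. (coord_grad c f (x + tau *\<^sub>R v) $ i / tau) * (?P (x + tau *\<^sub>R v) $ i $ j * (coord_grad c f (x + tau *\<^sub>R v) $ j / tau)))
   = Db 0 (?h tau) / tau\<^sup>2" using in_img
 proof (rule eventually_mono)
  fix tau assume y: "x + tau *\<^sub>R v \<in> img c"
  let ?y = "x + tau *\<^sub>R v" and ?G = "coord_grad c f (x + tau *\<^sub>R v)"
  have "Db 0 (?h tau) = (?P ?y *v ?G) \<bullet> ?G"
   using grad_norm_sq_level[OF c(1) ichart(3)[OF c(1) y]] grad_norm_sq_eq[OF c(1) ichart(3)[OF c(1) y], of f]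
   by (simp add: gradient_eq ichart(2)[OF c(1) y] local_rep_apply)
  also have "... = (\<Sum>i\<in>UNIV. \<Sum>j\<in>UNIV. ?G $ i * (?P ?y $ i $ j * ?G $ j))"
   by (subst inner_commute) (simp add: inner_vec_def matrix_vector_mult_def[of "?P ?y"] sum_distrib_left)
  finally show "(\<Sum>i\<in>UNIV. \<Sum>j\<in>UNIV. (?G $ i / tau) * (?P ?y $ i $ j * (?G $ j / tau))) = Db 0 (?h tau) / tau\<^sup>2"
   by (simp add: sum_divide_distrib power2_eq_square)
 qed
 with sums have 1: "((%tau. Db 0 (?h tau) / tau\<^sup>2) ---> (N *v v) \<bullet> (?P x *v (N *v v))) (at 0)"
  unfolding lim_eq by (rule Lim_transform_eventually)
 let ?gam = "(v \<bullet> (N *v v)) / 2"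
 have gam: "0 < ?gam" using v by (simp add: N_def x_def)
 have quot: "((%tau. (?h tau - t0) / tau\<^sup>2) ---> ?gam) (at 0)" by (rule so(2))
 have ne: "\<forall>\<^sub>F tau in at 0. ?h tau ~= t0" using order_tendstoD(1)[OF quot gam] by (rule eventually_mono) auto
 have "isCont (local_rep c f) (x + 0 *\<^sub>R v)" using has_derivative_continuous[OF rep_has_derivative[OF c(1) x]] by simp
 from isCont_tendsto_compose[OF this lin] have "(?h ---> t0) (at 0)" using fx by simp
 hence "filterlim ?h (at t0 within {t0..t1}) (at 0)"
  unfolding filterlim_at using ne in_img level_chart[OF c(1)] by (auto elim: eventually_elim2)
 from filterlim_compose[OF b_slope this]
 have prod: "((%tau. Db 0 (?h tau) / (?h tau - t0) * ((?h tau - t0) / tau\<^sup>2)) ---> Db 1 t0 * ?gam) (at 0)"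
  by (rule tendsto_mult[OF _ quot])
 have "\<forall>\<^sub>F tau in at 0. Db 0 (?h tau) / (?h tau - t0) * ((?h tau - t0) / tau\<^sup>2) = Db 0 (?h tau) / tau\<^sup>2"
  using ne by (rule eventually_mono) simp
 with prod have "((%tau. Db 0 (?h tau) / tau\<^sup>2) ---> Db 1 t0 * ?gam) (at 0)" by (rule Lim_transform_eventually)
 from tendsto_unique[OF _ 1 this] show ?thesis by (simp add: N_def[symmetric] x_def[symmetric] ix)
qed

lemma focal_boundary_point:
 obtains p where "p \<in> topspace X" "f p = t0" "!!U. openin X U ==> p \<in> U ==> \<exists>q\<in>U. t0 < f q"
proof (rule ccontr)
 assume no: "~ thesis"
 note that' = that
 let ?S = "{p \<in> topspace X. f p = t0}"
 have fc: "continuous_map X euclideanreal f" by (rule smooth_fun_continuous[OF f])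
 have "?S = topspace X"
 proof (rule connected_induct)
  show "?S ~= {}" using level_attained[of t0] t01 by auto
  fix p assume p: "p \<in> topspace X"
  show "EX U. openin X U & p \<in> U & (U <= ?S | U \<inter> ?S = {})"
  proof (cases "f p = t0")
   case True
   have "EX U. openin X U & p \<in> U & (\<forall>q\<in>U. ~ t0 < f q)"
   proof (rule ccontr)
   assume "~ ?thesis"
   hence "\<exists>q\<in>U. t0 < f q" if "openin X U" "p \<in> U" for U using that by blast
   from that'[OF p True this] no show False by contradiction
   qed
   then obtain U where U: "openin X U" "p \<in> U" "!!q. q \<in> U ==> ~ t0 < f q" by blast
   have "q \<in> ?S" if q: "q \<in> U" for q
   proof -
   have "q \<in> topspace X" using q openin_subset[OF U(1)] by blast
   moreover from level[OF this] have "f q = t0" using U(3)[OF q] by simp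
   ultimately show ?thesis by blast
   qed
   hence "U <= ?S" ..
   thus ?thesis using U(1,2) by (intro exI[of _ U]) simp
  next
   case False
   have "openin X {q \<in> topspace X. f q \<in> - {t0}}"
   using openin_continuous_map_preimage[OF fc, of "- {t0}"] by (simp add: open_Compl)
   thus ?thesis using False p by (intro exI[of _ "{q \<in> topspace X. f q \<in> - {t0}}"]) auto
  qed
 qed auto
 thus False using level_attained[of t1] t01 by force
qed

lemma inverse_metric_bounded:
 assumes c: "c \<in> A" and K: "compact K" "K <= img c"
 obtains C where "0 < C" "!!x w. x \<in> K ==> w \<bullet> (matrix_inv (g c (ichart c x)) *v w) <= C * (norm w)\<^sup>2"
proof -
 let ?s = "%x. \<Sum>i\<in>UNIV. \<Sum>j\<in>UNIV. \<bar>matrix_inv (g c (ichart c x)) $ i $ j\<bar>"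
 have "continuous_on K (%x. matrix_inv (g c (ichart c x)) $ i $ j)" for i j
  by (intro continuous_at_imp_continuous_on ballI differentiable_imp_continuous_within[OF inverse_metric_entry_differentiable[OF c]])
   (use K in blast)
 hence "continuous_on K ?s" by (intro continuous_on_sum continuous_on_rabs)
 hence "bounded (?s ` K)" by (intro compact_imp_bounded compact_continuous_image K(1))
 then obtain C where C: "0 < C" "!!x. x \<in> K ==> \<bar>?s x\<bar> <= C" unfolding bounded_pos by auto
 have "w \<bullet> (matrix_inv (g c (ichart c x)) *v w) <= C * (norm w)\<^sup>2" if "x \<in> K" for x w
 proof -
  have "w \<bullet> (matrix_inv (g c (ichart c x)) *v w) <= norm w * norm (matrix_inv (g c (ichart c x)) *v w)"
   by (rule norm_cauchy_schwarz)
  also have "... <= norm w * (?s x * norm w)" by (intro mult_left_mono norm_matrix_vector_le) simp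
  also have "... <= norm w * (C * norm w)" using C(2)[OF that] by (intro mult_left_mono mult_right_mono) auto
  finally show ?thesis by (simp add: power2_eq_square mult_ac)
 qed
 thus ?thesis using that C(1) by blast
qed

text \<open>With a vanishing Hessian, \<open>f - t0\<close> would be \<open>o(R\<^sup>2)\<close>
on balls of radius \<open>R\<close>. But \<open>|\<nabla>f|\<^sup>2\<close> is at least a multiple
of \<open>f - t0\<close>, so \<open>f - t0\<close> reaches a fixed multiple of
\<open>R\<^sup>2\<close> on the sphere, by \<open>gradient_growth\<close>.\<close>

lemma hessian_nonzero:
 assumes c: "c \<in> A" "p \<in> dom c" and p: "f p = t0"
  and lim: "!!U. openin X U ==> p \<in> U ==> \<exists>q\<in>U. t0 < f q"
 shows "hessian c (snd c p) ~= 0"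
proof
 assume N0: "hessian c (snd c p) = 0"
 define x where "x = snd c p"
 have x: "x \<in> img c" using c by (simp add: x_def)
 have fx: "local_rep c f x = t0" by (simp add: local_rep_chart[OF c] p x_def)
 obtain r where r: "0 < r" "cball x r <= img c" using chart_cball[OF c] unfolding x_def by metis
 obtain C where C: "0 < C" "!!y w. y \<in> cball x r ==> w \<bullet> (matrix_inv (g c (ichart c y)) *v w) <= C * (norm w)\<^sup>2"
  using inverse_metric_bounded[OF c(1) compact_cball r(2)] by metis
 obtain db where db: "0 < db" "!!s. t0 <= s ==> s < t0 + db ==> s <= t1 ==> Db 1 t0 / 2 * (s - t0) <= Db 0 s"
  using b_linear_below by metis
 \<comment> \<open>The constant is such that \<open>c0\<^sup>2 (f - t0) \<le> |\<nabla>f|\<^sup>2\<close> in coordinates.\<close>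
 define c0 where "c0 = sqrt (Db 1 t0 / (2 * C))"
 have c0: "0 < c0" "c0\<^sup>2 * C = Db 1 t0 / 2" using b_slope_pos C(1) by (auto simp: c0_def)
 have G0: "coord_grad c f x = 0" using second_order_at_minimum(1)[OF c p] by (simp add: x_def)
 have "0 < c0\<^sup>2 / 128" using c0 by simp
 from second_order_segment[OF chart(2)[OF c(1)] x rep_has_derivative[OF c(1)] coord_grad_derivative[OF c(1) x] this]
 obtain d where d: "0 < d" "!!y w rho. rho < d ==> norm y <= rho ==> norm (y + w) <= rho ==>
   \<bar>local_rep c f (x + y + w) - local_rep c f (x + y) - coord_grad c f x \<bullet> w - (hessian c x *v y) \<bullet> w - ((hessian c x *v w) \<bullet> w) / 2\<bar> <= c0\<^sup>2 / 128 * rho * norm w"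
  by metis
 have "isCont (local_rep c f) x" using has_derivative_continuous[OF rep_has_derivative[OF c(1) x]] by simp
 then obtain d2 where d2: "0 < d2" "!!y. dist y x < d2 ==> dist (local_rep c f y) t0 < db"
  using db(1) fx unfolding continuous_at_eps_delta by (metis dist_commute)
 define R where "R = min (min (d / 2) (d2 / 2)) r"
 have R: "0 < R" "R < d" "R < d2" "R <= r" using d d2 r by (auto simp: R_def min_def)
 have sub: "cball x R <= img c" using R r by (meson cball_subset_cball_iff order_trans subset_cball)
 let ?U = "{q \<in> dom c. snd c q \<in> ball x (R / 2)}"
 obtain q where q: "q \<in> dom c" "snd c q \<in> ball x (R / 2)" "t0 < f q"
  using lim[OF openin_chart_preimage[OF c(1) open_ball, of x "R/2"]] c R by (auto simp: x_def)
 have "EX y. dist x y = R & (c0 / 8 * R)\<^sup>2 <= local_rep c f y - t0"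
 proof (rule gradient_growth[of R c0 x "local_rep c f" "coord_grad c f" t0 "snd c q"])
  show "continuous_on (cball x R) (local_rep c f)" using continuous_on_subset[OF rep_continuous[OF c(1)] sub] .
  fix z assume z: "z \<in> ball x R"
  hence zc: "z \<in> cball x R" by simp
  hence zi: "z \<in> img c" using sub by blast
  show "(local_rep c f has_derivative (%w. coord_grad c f z \<bullet> w)) (at z)" by (rule rep_has_derivative[OF c(1) zi])
  have lv: "local_rep c f z \<in> {t0..t1}" by (rule level_chart[OF c(1) zi])
  have "dist z x < d2" using z R by (simp add: dist_commute)
  hence "local_rep c f z < t0 + db" using d2(2)[of z] by (simp add: dist_real_def)
  hence "Db 1 t0 / 2 * (local_rep c f z - t0) <= Db 0 (local_rep c f z)" using db(2) lv by simp
  also have "... = coord_grad c f z \<bullet> (matrix_inv (g c (ichart c z)) *v coord_grad c f z)"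
   using grad_norm_sq_level[OF c(1) ichart(3)[OF c(1) zi]] grad_norm_sq_eq[OF c(1) ichart(3)[OF c(1) zi], of f]
   by (simp add: gradient_eq ichart(2)[OF c(1) zi] local_rep_apply inner_commute)
  also have "... <= C * (norm (coord_grad c f z))\<^sup>2" by (rule C(2)) (use zc R in auto)
  finally have "C * (c0\<^sup>2 * (local_rep c f z - t0)) <= C * (norm (coord_grad c f z))\<^sup>2"
   unfolding c0(2)[symmetric] by (simp add: mult_ac)
  thus "c0\<^sup>2 * (local_rep c f z - t0) <= (norm (coord_grad c f z))\<^sup>2" using C(1) by simp
 next
  fix z assume "z \<in> cball x R"
  thus "t0 <= local_rep c f z" using level_chart[OF c(1), of z] sub by auto
 next
  fix y assume "dist x y = R" "(c0 / 8 * R)\<^sup>2 <= local_rep c f y - t0"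
  thus "EX y. dist x y = R & (c0 / 8 * R)\<^sup>2 <= local_rep c f y - t0" by blast
 qed (use R c0 q c(1) in "auto simp: local_rep_chart")
 then obtain y where y: "dist x y = R" "(c0 / 8 * R)\<^sup>2 <= local_rep c f y - t0" by blast
 have nR: "norm (y - x) = R" using y(1) by (simp add: dist_norm norm_minus_commute)
 have "\<bar>local_rep c f (x + 0 + (y - x)) - local_rep c f (x + 0) - coord_grad c f x \<bullet> (y - x) - (hessian c x *v 0) \<bullet> (y - x) - ((hessian c x *v (y - x)) \<bullet> (y - x)) / 2\<bar> <= c0\<^sup>2 / 128 * R * norm (y - x)"
  by (rule d(2)) (use R nR in auto)
 hence "\<bar>local_rep c f y - t0\<bar> <= c0\<^sup>2 / 128 * R * R" using N0 G0 fx nR by (simp add: x_def[symmetric])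
 from order_trans[OF abs_ge_self this]
 have "(c0 / 8 * R)\<^sup>2 <= c0\<^sup>2 / 128 * R * R" using y(2) by simp
 hence "c0\<^sup>2 * R\<^sup>2 <= 0" by (simp add: power_mult_distrib power_divide power2_eq_square mult_ac)
 moreover have "0 < c0\<^sup>2 * R\<^sup>2" using c0 R by simp
 ultimately show False by simp
qed

lemma psd_nonzero_direction:
 fixes N :: "real^'k::finite^'k"
 assumes N: "psd N" and "N ~= 0"
 obtains v where "0 < v \<bullet> (N *v v)"
proof (rule ccontr)
 assume no: "~ thesis"
 hence "v \<bullet> (N *v v) = 0" for v using that N by (metis psd_def order_less_le)
 hence "N $ i $ i = 0" for i by (metis axis_matrix_axis)
 hence "N $ i $ j = 0" for i j using psd_zero_diagonal[OF N, of i "axis j 1"] by (simp add: matrix_axis)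
 thus False using assms(2) by (simp add: vec_eq_iff)
qed

lemma laplace_at_minimum:
 assumes p: "p \<in> topspace X" "f p = t0" and c: "c = chart_at A p"
 shows "Da 0 t0 = matrix_inner (matrix_inv (g c p)) (hessian c (snd c p))"
proof -
 have cA: "c \<in> A" "p \<in> dom c" using chart_at[OF p(1)] by (auto simp: c)
 have x: "snd c p \<in> img c" using cA by simp
 have "coord_grad c f (snd c p) = 0" by (rule second_order_at_minimum(1)[OF cA p(2)])
 hence crit: "pd j (local_rep c f) (snd c p) = 0" for j by (simp add: coord_grad_def vec_eq_iff)
 have "hessian c (snd c p) $ i $ j = pd i (pd j (local_rep c f)) (snd c p)" for i j
 proof -
  have "hessian c (snd c p) $ i $ j = transpose (hessian c (snd c p)) $ i $ j" using hessian_symmetric[OF cA(1) x] by simp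
  thus ?thesis by (simp add: transpose_def hessian_def)
 qed
 thus ?thesis using laplace_critical[OF f p(1) c crit] lap[OF p(1)] p(2) by (simp add: matrix_inner_def)
qed

text \<open>The value \<open>a(t0)\<close> is the trace of the Hessian. By the eikonal identity
one rank one part of the Hessian has trace \<open>b'(t0) / 2\<close>, and what remains is positive
semidefinite.\<close>

theorem focal_slope: "Db 1 t0 <= 2 * Da 0 t0"
proof -
 obtain p where p: "p \<in> topspace X" "f p = t0" "!!U. openin X U ==> p \<in> U ==> \<exists>q\<in>U. t0 < f q"
  using focal_boundary_point by metis
 define c where "c = chart_at A p"
 have c: "c \<in> A" "p \<in> dom c" using chart_at[OF p(1)] by (auto simp: c_def)
 have N: "psd (hessian c (snd c p))" by (rule second_order_at_minimum(3)[OF c p(2)])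
 obtain v where v: "0 < v \<bullet> (hessian c (snd c p) *v v)" by (rule psd_nonzero_direction[OF N hessian_nonzero[OF c p(2,3)]])
 have "Db 1 t0 / 2 <= matrix_inner (matrix_inv (g c p)) (hessian c (snd c p))"
  by (rule matrix_inner_ge[OF spd_matrix_inv[OF metric_spd[OF c]] N v hessian_eikonal[OF c p(2) v]])
 thus ?thesis using laplace_at_minimum[OF p(1,2) c_def] by simp
qed

text \<open>The trace \<open>a(t0)\<close> of the Hessian is positive, so the Hessian is nonzero
at every point of the focal set.\<close>

theorem focal_direction:
 assumes p: "p \<in> topspace X" "f p = t0" and c: "c = chart_at A p"
 obtains v gam where "0 < gam" "((%tau. (local_rep c f (snd c p + tau *\<^sub>R v) - t0) / tau\<^sup>2) ---> gam) (at 0)"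
proof -
 have cA: "c \<in> A" "p \<in> dom c" using chart_at[OF p(1)] by (auto simp: c)
 have "hessian c (snd c p) ~= 0" using laplace_at_minimum[OF p c] focal_slope b_slope_pos by (auto simp: matrix_inner_def)
 then obtain v where "0 < v \<bullet> (hessian c (snd c p) *v v)"
  by (rule psd_nonzero_direction[OF second_order_at_minimum(3)[OF cA p(2)]])
 thus ?thesis using that[OF _ second_order_at_minimum(2)[OF cA p(2), of v]] by simp
qed

lemma negated: "isoparam X A g (%p. - f p) (- t1) (- t0) (%k s. (- 1) ^ Suc k * Da k (- s)) (%k s. (- 1) ^ k * Db k (- s))"
proof -
 have rep: "local_rep c (%p. - f p) = (%x. - local_rep c f x)" for c :: "('m, 'n) chart" by (simp add: local_rep_def o_def)
 have D: "((%s. eps * D k (- s)) has_real_derivative - eps * D (Suc k) (- s)) (at s within {- t1..- t0})"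
  if D: "!!k s. s \<in> {t0..t1} ==> (D k has_real_derivative D (Suc k) s) (at s within {t0..t1})"
   and s: "s \<in> {- t1..- t0}" for D :: "nat => real => real" and k s and eps :: real
 proof -
  have "(D k has_real_derivative D (Suc k) (- s)) (at (- s) within uminus ` {- t1..- t0})" using D[of "- s" k] s by simp
  moreover have "(uminus has_real_derivative - 1) (at s within {- t1..- t0})" by (auto intro!: derivative_eq_intros)
  ultimately have "((D k \<circ> uminus) has_real_derivative D (Suc k) (- s) * - 1) (at s within {- t1..- t0})"
   by (rule DERIV_image_chain)
  from DERIV_cmult[OF this, of eps] show ?thesis by (simp add: o_def)
 qed
 show ?thesis
 proof (unfold_locales)
  show "smooth_fun A (%p. - f p)" using f Ck_on_minus[OF chart(2)] by (auto simp: smooth_fun_def smooth_on_def rep)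
  show "- t1 < - t0" using t01 by simp
  show "(%p. - f p) ` topspace X = {- t1..- t0}" using onto by (metis image_image image_uminus_atLeastAtMost)
 next
  fix k s assume s: "s \<in> {- t1..- t0}"
  show "((%s. (- 1) ^ Suc k * Da k (- s)) has_real_derivative (- 1) ^ Suc (Suc k) * Da (Suc k) (- s)) (at s within {- t1..- t0})"
   using D[where D = Da and eps = "(- 1) ^ Suc k" and k = k, OF Da s] by simp
  show "((%s. (- 1) ^ k * Db k (- s)) has_real_derivative (- 1) ^ Suc k * Db (Suc k) (- s)) (at s within {- t1..- t0})"
   using D[where D = Db and eps = "(- 1) ^ k" and k = k, OF Db s] by simp
 next
  fix p assume p: "p \<in> topspace X"
  define c where "c = chart_at A p"
  have c: "c \<in> A" "p \<in> dom c" using chart_at[OF p] by (auto simp: c_def)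
  have "pd i (local_rep c (%p. - f p)) (snd c p) = - pd i (local_rep c f) (snd c p)" for i
   unfolding rep by (rule pd_minus[OF smooth_fun_differentiable[OF f c]])
  hence "(\<chi> i. pd i (local_rep c (%p. - f p)) (snd c p)) = - (\<chi> i. pd i (local_rep c f) (snd c p))"
   by (simp add: vec_eq_iff)
  hence "gradient g c (%p. - f p) p = - gradient g c f p" by (simp add: gradient_def matrix_vector_mult_minus)
  hence "gradient_norm_sq A g (%p. - f p) p = gradient_norm_sq A g f p"
   by (simp add: gradient_norm_sq_def Let_def c_def[symmetric] matrix_vector_mult_minus)
  thus "gradient_norm_sq A g (%p. - f p) p = (- 1) ^ 0 * Db 0 (- (- f p))" using grad[OF p] by simp
  have "laplace_beltrami A g (%p. - f p) p = 0 * gradient_norm_sq A g f p + (- 1) * laplace_beltrami A g f p"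
  proof (rule laplace_compose[OF f p openin_topspace p])
   show "(uminus has_real_derivative - 1) (at s within UNIV)" for s :: real by (auto intro!: derivative_eq_intros)
   show "((%s. - 1 :: real) has_real_derivative 0) (at (f p) within UNIV)" by simp
  qed auto
  thus "laplace_beltrami A g (%p. - f p) p = (- 1) ^ Suc 0 * Da 0 (- (- f p))" using lap[OF p] by simp
 qed
qed

end


section \<open>The distance from the focal set\<close>

context isoparam
begin

lemma inverse_sqrt_b_majorant:
 obtains K where "0 < K" "!!s. t0 < s ==> s < t1 ==> 1 / sqrt (Db 0 s) <= K / sqrt (s - t0) + K / sqrt (t1 - s)"
proof -
 interpret neg: isoparam X A g "%p. - f p" "- t1" "- t0" "%k s. (- 1) ^ Suc k * Da k (- s)" "%k s. (- 1) ^ k * Db k (- s)"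
  by (rule negated)
 obtain d0 where d0: "0 < d0" "!!s. t0 <= s ==> s < t0 + d0 ==> s <= t1 ==> Db 1 t0 / 2 * (s - t0) <= Db 0 s"
  using b_linear_below by metis
 obtain d1 where d1: "0 < d1" "!!s. - t1 <= s ==> s < - t1 + d1 ==> s <= - t0 ==> - Db 1 t1 / 2 * (s + t1) <= Db 0 (- s)"
  using neg.b_linear_below by auto
 have k: "0 < Db 1 t0 / 2" "0 < - Db 1 t1 / 2" using b_slope_pos neg.b_slope_pos by auto
 define d where "d = min (min d0 d1) (t1 - t0) / 2"
 have d: "0 < d" "d < d0" "d < d1" "d <= (t1 - t0) / 2" using d0(1) d1(1) t01 by (auto simp: d_def)
 have "{t0 + d..t1 - d} ~= {}" using d by simp
 moreover have "continuous_on {t0 + d..t1 - d} (Db 0)" by (rule continuous_on_subset[OF Db_continuous]) (use d in auto)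
 ultimately obtain s0 where s0: "s0 \<in> {t0 + d..t1 - d}" "!!s. s \<in> {t0 + d..t1 - d} ==> Db 0 s0 <= Db 0 s"
  using continuous_attains_inf[of "{t0 + d..t1 - d}" "Db 0"] by auto
 have m: "0 < Db 0 s0" using b_pos[of s0] s0(1) d by auto
 define K where "K = 1 / sqrt (Db 1 t0 / 2) + 1 / sqrt (- Db 1 t1 / 2) + sqrt (t1 - t0) / sqrt (Db 0 s0)"
 have Kp: "0 < K" using k m t01 by (simp add: K_def add_pos_pos)
 have K: "1 / sqrt (Db 1 t0 / 2) <= K" "1 / sqrt (- Db 1 t1 / 2) <= K" "sqrt (t1 - t0) / sqrt (Db 0 s0) <= K"
  using k m t01 by (simp_all add: K_def)
 have part: "1 / sqrt (Db 0 s) <= K / sqrt r" if r: "0 < r" "0 < kap" "kap * r <= Db 0 s" "1 / sqrt kap <= K" for s r kap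
 proof -
  have "sqrt kap * sqrt r <= sqrt (Db 0 s)" using r(3) by (simp add: real_sqrt_mult[symmetric])
  moreover have "0 < sqrt kap * sqrt r" using r by simp
  ultimately have "1 / sqrt (Db 0 s) <= 1 / (sqrt kap * sqrt r)" by (intro frac_le) auto
  also have "... = (1 / sqrt kap) / sqrt r" by simp
  also have "... <= K / sqrt r" using r by (intro divide_right_mono) auto
  finally show ?thesis .
 qed
 have "1 / sqrt (Db 0 s) <= K / sqrt (s - t0) + K / sqrt (t1 - s)" if s: "t0 < s" "s < t1" for s
 proof -
  have nn: "0 <= K / sqrt (s - t0)" "0 <= K / sqrt (t1 - s)" using Kp s by auto
  consider "s < t0 + d" | "t1 - d < s" | "s \<in> {t0 + d..t1 - d}" by force
  thus ?thesis
  proof cases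
   case 1
   have "1 / sqrt (Db 0 s) <= K / sqrt (s - t0)" by (rule part[OF _ k(1) d0(2) K(1)]) (use 1 s d in auto)
   thus ?thesis using nn by linarith
  next
   case 2
   have "1 / sqrt (Db 0 s) <= K / sqrt (t1 - s)" by (rule part[OF _ k(2) _ K(2)]) (use d1(2)[of "- s"] 2 s d in auto)
   thus ?thesis using nn by linarith
  next
   case 3
   have "1 / sqrt (Db 0 s) <= K / sqrt (s - t0)"
   proof (rule part[of _ "Db 0 s0 / (t1 - t0)"])
   have "Db 0 s0 / (t1 - t0) * (s - t0) <= Db 0 s0 / (t1 - t0) * (t1 - t0)" using m s t01 by (intro mult_left_mono) auto
   also have "... = Db 0 s0" using t01 by simp
   also have "... <= Db 0 s" by (rule s0(2)[OF 3])
   finally show "Db 0 s0 / (t1 - t0) * (s - t0) <= Db 0 s" .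
   show "1 / sqrt (Db 0 s0 / (t1 - t0)) <= K" using K(3) by (simp add: real_sqrt_divide)
   qed (use m s t01 in auto)
   thus ?thesis using nn by linarith
  qed
 qed
 thus ?thesis using that Kp by blast
qed

text \<open>The distance between the level sets of \<open>t0\<close> and \<open>s\<close>, as
\<open>focal_dist\<close> shows.\<close>

definition arclen :: "real => real" where
 "arclen s = integral {t0..s} (%r. 1 / sqrt (Db 0 r))"

text \<open>The slope of \<open>arclen\<close> is infinite at the end points. These functions with
bounded slope approximate it from below.\<close>

definition arclen_approx :: "nat => real => real" where
 "arclen_approx k s = integral {t0..s} (%r. 1 / sqrt (Db 0 r + 1 / real (Suc k)))"

lemma inverse_sqrt_b_continuous: "continuous_on {t0<..<t1} (%r. 1 / sqrt (Db 0 r))"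
proof (intro continuous_intros)
 show "continuous_on {t0<..<t1} (Db 0)" by (rule continuous_on_subset[OF Db_continuous]) auto
qed (use b_pos in force)

lemma inverse_sqrt_b_integrable: "(%r. 1 / sqrt (Db 0 r)) integrable_on {t0..t1}"
proof -
 obtain K where K: "0 < K" "!!s. t0 < s ==> s < t1 ==> 1 / sqrt (Db 0 s) <= K / sqrt (s - t0) + K / sqrt (t1 - s)"
  using inverse_sqrt_b_majorant by metis
 have "(%r. 1 / sqrt (Db 0 r)) absolutely_integrable_on {t0..t1}"
 proof (rule absolutely_integrable_on_dominated_by_derivative)
  show "continuous_on {t0..t1} (%s. 2 * K * sqrt (s - t0) - 2 * K * sqrt (t1 - s))" by (intro continuous_intros)
  fix s assume s: "s \<in> {t0<..<t1}"
  show "((%s. 2 * K * sqrt (s - t0) - 2 * K * sqrt (t1 - s)) has_real_derivative (K / sqrt (s - t0) + K / sqrt (t1 - s))) (at s)"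
   using s by (auto intro!: derivative_eq_intros simp: field_simps)
  show "\<bar>1 / sqrt (Db 0 s)\<bar> <= K / sqrt (s - t0) + K / sqrt (t1 - s)" using K(2)[of s] b_pos[of s] s by simp
 qed (use t01 inverse_sqrt_b_continuous in auto)
 thus ?thesis using absolutely_integrable_on_def by blast
qed

lemma arclen_continuous: "continuous_on {t0..t1} arclen"
 unfolding arclen_def by (rule indefinite_integral_continuous_1[OF inverse_sqrt_b_integrable])

lemma arclen_start: "arclen t0 = 0"
 by (simp add: arclen_def)

lemma arclen_derivative:
 assumes s: "t0 < s" "s < t1"
 shows "(arclen has_real_derivative 1 / sqrt (Db 0 s)) (at s)"
proof -
 have "(arclen has_vector_derivative 1 / sqrt (Db 0 s)) (at s within {t0..t1})" unfolding arclen_def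
 proof -
  have "isCont (%r. 1 / sqrt (Db 0 r)) s" using inverse_sqrt_b_continuous s by (simp add: continuous_on_eq_continuous_at)
  hence "continuous (at s within {t0..t1} - {}) (%r. 1 / sqrt (Db 0 r))" by (simp add: continuous_at_imp_continuous_within)
  from integral_has_vector_derivative_continuous_at[OF inverse_sqrt_b_integrable _ _ this]
  show "((%s. integral {t0..s} (%r. 1 / sqrt (Db 0 r))) has_vector_derivative 1 / sqrt (Db 0 s)) (at s within {t0..t1})"
   using s by simp
 qed
 moreover have "at s within {t0..t1} = at s" using s by (intro at_within_interior) auto
 ultimately show ?thesis by (simp add: has_real_derivative_iff_has_vector_derivative)
qed

lemma arclen_strict_mono:
 assumes "t0 <= s" "s < r" "r <= t1"
 shows "arclen s < arclen r"
proof (rule DERIV_pos_imp_increasing_open[OF assms(2)])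
 fix x assume "s < x" "x < r"
 thus "EX y. DERIV arclen x :> y & 0 < y"
  using arclen_derivative[of x] b_pos[of x] assms by (intro exI[of _ "1 / sqrt (Db 0 x)"]) auto
next
 show "continuous_on {s..r} arclen" by (rule continuous_on_subset[OF arclen_continuous]) (use assms in auto)
qed

lemma arclen_approx_derivative:
 assumes s: "s \<in> {t0..t1}"
 shows "(arclen_approx k has_real_derivative 1 / sqrt (Db 0 s + 1 / real (Suc k))) (at s within {t0..t1})"
 unfolding arclen_approx_def
proof (rule integral_has_real_derivative[OF _ s])
 have "0 < Db 0 r + 1 / real (Suc k)" if "r \<in> {t0..t1}" for r using b_nonneg[OF that] by (simp add: add_nonneg_pos)
 thus "continuous_on {t0..t1} (%r. 1 / sqrt (Db 0 r + 1 / real (Suc k)))" by (intro continuous_intros Db_continuous) force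
qed

lemma arclen_approx_limit:
 assumes s: "s \<in> {t0..t1}"
 shows "(%k. arclen_approx k s) \<longlonglongrightarrow> arclen s"
proof -
 have open_eq: "integral {t0..s} h = integral {t0<..<s} h" for h :: "real => real"
  using integral_open_interval_real[of t0 s h] by (simp add: box_real)
 have sub: "{t0..s} <= {t0..t1}" using s by auto
 have int: "(%r. 1 / sqrt (Db 0 r)) integrable_on {t0<..<s}"
  using integrable_subinterval_real[OF inverse_sqrt_b_integrable sub] integrable_on_Icc_iff_Ioo by blast
 have "(%k. integral {t0<..<s} (%r. 1 / sqrt (Db 0 r + 1 / real (Suc k)))) \<longlonglongrightarrow> integral {t0<..<s} (%r. 1 / sqrt (Db 0 r))"
 proof (rule dominated_convergence(2)[OF _ int])
  fix k
  have "0 < Db 0 r + 1 / real (Suc k)" if "r \<in> {t0..t1}" for r using b_nonneg[OF that] by (simp add: add_nonneg_pos)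
  hence "continuous_on {t0..t1} (%r. 1 / sqrt (Db 0 r + 1 / real (Suc k)))" by (intro continuous_intros Db_continuous) force
  hence "(%r. 1 / sqrt (Db 0 r + 1 / real (Suc k))) integrable_on {t0..s}"
   by (intro integrable_continuous_real continuous_on_subset[OF _ sub])
  thus "(%r. 1 / sqrt (Db 0 r + 1 / real (Suc k))) integrable_on {t0<..<s}" using integrable_on_Icc_iff_Ioo by blast
  fix r assume r: "r \<in> {t0<..<s}"
  hence b: "0 < Db 0 r" using b_pos s by simp
  have "sqrt (Db 0 r) <= sqrt (Db 0 r + 1 / real (Suc k))" by simp
  thus "norm (1 / sqrt (Db 0 r + 1 / real (Suc k))) <= 1 / sqrt (Db 0 r)" using b by (simp add: frac_le add_pos_nonneg)
 next
  fix r assume r: "r \<in> {t0<..<s}"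
  hence b: "0 < Db 0 r" using b_pos s by simp
  have "(%k. 1 / sqrt (Db 0 r + 1 / real (Suc k))) \<longlonglongrightarrow> 1 / sqrt (Db 0 r + 0)"
   by (intro tendsto_intros LIMSEQ_Suc[OF lim_1_over_n]) (use b in auto)
  thus "(%k. 1 / sqrt (Db 0 r + 1 / real (Suc k))) \<longlonglongrightarrow> 1 / sqrt (Db 0 r)" by simp
 qed
 thus ?thesis by (simp add: arclen_approx_def arclen_def open_eq)
qed

lemma path_length_ge_arclen:
 assumes L: "pw_C1_path X A g p q L" and p: "f p = t0"
 shows "arclen (f q) <= L"
proof (rule LIMSEQ_le_const2)
 have q: "q \<in> topspace X" using path_in_X[OF L] by simp
 show "(%k. arclen_approx k (f q)) \<longlonglongrightarrow> arclen (f q)" by (rule arclen_approx_limit[OF level[OF q]])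
 have "arclen_approx k (f q) <= L" for k
 proof -
  have "\<bar>arclen_approx k (f q) - arclen_approx k (f p)\<bar> <= L"
  proof (rule path_length_ge[OF L smooth_fun_differentiable[OF f] level arclen_approx_derivative])
   fix r assume r: "r \<in> topspace X"
   define P where "P = Db 0 (f r) + 1 / real (Suc k)"
   have "0 <= Db 0 (f r)" by (rule b_nonneg[OF level[OF r]])
   hence P: "0 < P" "Db 0 (f r) <= P" by (auto simp: P_def intro: add_nonneg_pos)
   have "(1 / sqrt P)\<^sup>2 * Db 0 (f r) = Db 0 (f r) / P" using P(1) by (simp add: power_divide)
   also have "... <= 1" using P by simp
   finally show "(1 / sqrt (Db 0 (f r) + 1 / real (Suc k)))\<^sup>2 * gradient_norm_sq A g f r <= 1" unfolding grad[OF r] P_def .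
  qed
  thus ?thesis using p by (simp add: arclen_approx_def)
 qed
 thus "EX N. \<forall>k\<ge>N. arclen_approx k (f q) <= L" by blast
qed

text \<open>A short coordinate step against the gradient decreases \<open>arclen \<circ> f\<close>
almost by its length.\<close>

lemma arclen_descent:
 assumes z: "z \<in> topspace X" "t0 < f z" "f z < t1" and e: "0 < e" "e < 1"
 obtains z' L where "pw_C1_path X A g z' z L" "arclen (f z') + (1 - e) * L < arclen (f z)"
proof -
 define c where "c = chart_at A z"
 have c: "c \<in> A" "z \<in> dom c" using chart_at[OF z(1)] by (auto simp: c_def)
 define y where "y = snd c z"
 have y: "y \<in> img c" and iy: "ichart c y = z" using c by (auto simp: y_def ichart)
 define G where "G = gradient g c f z"
 define bet where "bet = sqrt (Db 0 (f z))"
 have bp: "0 < Db 0 (f z)" by (rule b_pos[OF z(2,3)])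
 have bet: "0 < bet" "bet\<^sup>2 = Db 0 (f z)" using bp by (auto simp: bet_def)
 have Gc: "coord_grad c f y \<bullet> G = bet\<^sup>2"
  using grad_norm_sq_eq[OF c, of f] grad_norm_sq_level[OF c] bet by (simp add: G_def y_def inner_commute)
 have GG: "G \<bullet> (g c z *v G) = bet\<^sup>2" using grad_norm_sq_level[OF c] bet by (simp add: G_def grad_norm_sq_def)
 have line: "((%tau. y - tau *\<^sub>R G) has_derivative (%s. - (s *\<^sub>R G))) (at 0)" by (auto intro!: derivative_eq_intros)
 have "(local_rep c f has_derivative (%w. coord_grad c f y \<bullet> w)) (at (y - 0 *\<^sub>R G))"
  using rep_has_derivative[OF c(1) y] by simp
 from has_derivative_compose[OF line this]
 have fd: "((%tau. local_rep c f (y - tau *\<^sub>R G)) has_real_derivative - bet\<^sup>2) (at 0)"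
 proof -
  assume "((%tau. local_rep c f (y - tau *\<^sub>R G)) has_derivative (%s. coord_grad c f y \<bullet> - (s *\<^sub>R G))) (at 0)"
  moreover have "(%s. coord_grad c f y \<bullet> - (s *\<^sub>R G)) = (*) (- bet\<^sup>2)" by (simp add: fun_eq_iff Gc)
  ultimately show ?thesis by (simp only: has_field_derivative_def)
 qed
 have fz: "local_rep c f y = f z" by (simp add: local_rep_apply iy)
 have "(arclen has_real_derivative 1 / bet) (at (local_rep c f (y - 0 *\<^sub>R G)))"
  using arclen_derivative[OF z(2,3)] by (simp add: fz bet_def)
 from DERIV_chain2[OF this fd]
 have "((%tau. arclen (local_rep c f (y - tau *\<^sub>R G))) has_real_derivative - bet) (at 0)"
  using bet(1) by (simp add: power2_eq_square)
 hence "((%tau. arclen (local_rep c f (y - tau *\<^sub>R G)) + (1 - e / 2) * bet * tau) has_real_derivative - bet + (1 - e / 2) * bet) (at 0)"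
  by (intro DERIV_add DERIV_cmult_Id)
 moreover have "- bet + (1 - e / 2) * bet < 0" using e bet by (simp add: algebra_simps)
 ultimately have "\<exists>d>0. \<forall>h>0. h < d --> arclen (local_rep c f (y - (0 + h) *\<^sub>R G)) + (1 - e / 2) * bet * (0 + h) <
   arclen (local_rep c f (y - 0 *\<^sub>R G)) + (1 - e / 2) * bet * 0" by (rule DERIV_neg_dec_right)
 then obtain d where d: "0 < d" "!!h. 0 < h ==> h < d ==> arclen (local_rep c f (y - h *\<^sub>R G)) + (1 - e / 2) * bet * h < arclen (f z)"
  by (auto simp: fz)
 have "continuous_on (img c) (%x. G \<bullet> (local_rep c (g c) x *v G))"
  by (intro continuous_on_inner continuous_on_const continuous_on_matrix_vector_mult metric_continuous[OF c(1)])
 hence "isCont (%x. G \<bullet> (local_rep c (g c) x *v G)) y"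
  using y unfolding continuous_on_eq_continuous_at[OF chart(2)[OF c(1)]] by blast
 hence lim: "((%x. G \<bullet> (local_rep c (g c) x *v G)) ---> bet\<^sup>2) (at y)" unfolding isCont_def local_rep_apply iy GG .
 \<comment> \<open>The slope may deteriorate by \<open>1 - e / 2\<close> and the length by \<open>1 + e / 2\<close>, since \<open>(1 - e) (1 + e / 2) < 1 - e / 2\<close>.\<close>
 have "bet\<^sup>2 < (bet * (1 + e / 2))\<^sup>2" using bet e by (intro power_strict_mono) auto
 from order_tendstoD(2)[OF lim this]
 obtain r1 where r1: "0 < r1" "!!x. x ~= y ==> dist x y < r1 ==> G \<bullet> (local_rep c (g c) x *v G) < (bet * (1 + e / 2))\<^sup>2"
  unfolding eventually_at by auto
 have near: "G \<bullet> (g c (ichart c x) *v G) <= (bet * (1 + e / 2))\<^sup>2" if "dist x y < r1" for x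
  using r1(2)[of x] that GG iy \<open>bet\<^sup>2 < (bet * (1 + e / 2))\<^sup>2\<close> by (cases "x = y") (auto simp: local_rep_apply)
 obtain r2 where r2: "0 < r2" "cball y r2 <= img c" using chart_cball[OF c] unfolding y_def by metis
 define r where "r = min r1 r2"
 have r: "0 < r" "r <= r1" "r <= r2" using r1 r2 by (auto simp: r_def)
 define tau where "tau = min (d / 2) (r / (2 * (norm G + 1)))"
 have nG: "0 < norm G + 1" by (simp add: add_nonneg_pos)
 have tau: "0 < tau" "tau < d" using d r nG by (auto simp: tau_def min_less_iff_disj)
 have tauG: "tau * norm G < r"
 proof -
  have "tau * norm G <= tau * (norm G + 1)" using tau by simp
  also have "... <= r / (2 * (norm G + 1)) * (norm G + 1)" using nG by (intro mult_right_mono) (auto simp: tau_def)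
  also have "... = r / 2" using nG by (simp add: field_simps)
  finally show ?thesis using r by simp
 qed
 have seg: "dist (y - tau *\<^sub>R G + t *\<^sub>R (tau *\<^sub>R G)) y < r" if t: "t \<in> {0..1}" for t
 proof -
  have "y - tau *\<^sub>R G + t *\<^sub>R (tau *\<^sub>R G) - y = - ((1 - t) * tau) *\<^sub>R G" by (simp add: algebra_simps)
  hence "dist (y - tau *\<^sub>R G + t *\<^sub>R (tau *\<^sub>R G)) y = (1 - t) * (tau * norm G)"
   using t tau by (simp add: dist_norm abs_mult)
  also have "... <= 1 * (tau * norm G)" using t tau by (intro mult_right_mono) auto
  finally show ?thesis using tauG by simp
 qed
 have "\<exists>L\<le>tau * (bet * (1 + e / 2)). pw_C1_path X A g (ichart c (y - tau *\<^sub>R G)) (ichart c (y - tau *\<^sub>R G + tau *\<^sub>R G)) L"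
 proof (rule segment_path[OF c(1)])
  fix t :: real assume t: "t \<in> {0..1}"
  show "y - tau *\<^sub>R G + t *\<^sub>R (tau *\<^sub>R G) \<in> img c"
   using seg[OF t] r r2(2) by (auto simp: subset_iff dist_commute)
  have "(tau *\<^sub>R G) \<bullet> (g c (ichart c (y - tau *\<^sub>R G + t *\<^sub>R (tau *\<^sub>R G))) *v (tau *\<^sub>R G)) =
   tau\<^sup>2 * (G \<bullet> (g c (ichart c (y - tau *\<^sub>R G + t *\<^sub>R (tau *\<^sub>R G))) *v G))"
   by (simp add: matrix_vector_mult_scaleR power2_eq_square)
  also have "... <= tau\<^sup>2 * (bet * (1 + e / 2))\<^sup>2" using near seg[OF t] r by (intro mult_left_mono) auto
  finally show "(tau *\<^sub>R G) \<bullet> (g c (ichart c (y - tau *\<^sub>R G + t *\<^sub>R (tau *\<^sub>R G))) *v (tau *\<^sub>R G)) <= (tau * (bet * (1 + e / 2)))\<^sup>2"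
   by (simp add: power_mult_distrib)
 qed (use tau bet e in auto)
 then obtain L where L: "L <= tau * (bet * (1 + e / 2))" "pw_C1_path X A g (ichart c (y - tau *\<^sub>R G)) z L" by (auto simp: iy)
 have "(1 - e) * L <= (1 - e) * (tau * (bet * (1 + e / 2)))" using L(1) e by (intro mult_left_mono) auto
 also have "... = (1 - e / 2) * bet * tau - e\<^sup>2 / 2 * (bet * tau)" by (simp add: field_simps power2_eq_square)
 also have "... <= (1 - e / 2) * bet * tau" using bet tau by simp
 finally have "arclen (f (ichart c (y - tau *\<^sub>R G))) + (1 - e) * L < arclen (f z)"
  using d(2)[OF tau] by (simp add: local_rep_apply)
 thus ?thesis using that L(2) by blast
qed

lemma arclen_level_continuous: "continuous_map X euclideanreal (%z. arclen (f z))"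
proof -
 have "continuous_map X (top_of_set {t0..t1}) f"
  using smooth_fun_continuous[OF f] level by (auto simp: continuous_map_in_subtopology)
 moreover have "continuous_map (top_of_set {t0..t1}) euclideanreal arclen" using arclen_continuous by simp
 ultimately have "continuous_map X euclideanreal (arclen \<circ> f)" by (rule continuous_map_compose)
 thus ?thesis by (simp add: o_def)
qed

abbreviation focal :: "'m set" where "focal \<equiv> level_set X f t0"

lemma focal_dist_bdd: "x \<in> topspace X ==> bdd_below ((%p. riem_dist X A g p x) ` focal)"
 by (rule bdd_belowI[of _ 0]) (auto simp: level_set_def riem_dist_nonneg)

lemma focal_dist_ge:
 assumes x: "x \<in> topspace X"
 shows "arclen (f x) <= riem_setdist X A g focal x" unfolding riem_setdist_def
proof (rule cINF_greatest)
 show "focal ~= {}" using level_attained[of t0] t01 by (auto simp: level_set_def)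
 fix p assume "p \<in> focal"
 hence p: "p \<in> topspace X" "f p = t0" by (auto simp: level_set_def)
 show "arclen (f x) <= riem_dist X A g p x" by (rule riem_dist_ge[OF p(1) x path_length_ge_arclen[OF _ p(2)]])
qed

text \<open>At a minimum point of \<open>arclen (f z) + (1 - e) d(z, x)\<close> no descending step
can start, so this point lies in the focal set; comparing with \<open>z = x\<close> gives the
bound.\<close>

lemma focal_dist_le_interior:
 assumes x: "x \<in> topspace X" "f x < t1"
 shows "riem_setdist X A g focal x <= arclen (f x)"
proof -
 have le: "(1 - e) * riem_setdist X A g focal x <= arclen (f x)" if e: "0 < e" "e < 1" for e
 proof -
  let ?Psi = "%z. arclen (f z) + (1 - e) * riem_dist X A g z x"
  have "continuous_map X euclideanreal ?Psi"
   by (intro continuous_map_add continuous_map_real_mult_left arclen_level_continuous riem_dist_continuous x(1))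
  hence "compactin euclideanreal (?Psi ` topspace X)"
   by (rule image_compactin[rotated]) (use compact_X in "simp add: compact_space_def")
  hence "compact (?Psi ` topspace X)" by simp
  moreover have "?Psi ` topspace X ~= {}" using x by blast
  ultimately have "\<exists>m\<in>?Psi ` topspace X. \<forall>t\<in>?Psi ` topspace X. m <= t" by (rule compact_attains_inf)
  then obtain z where z: "z \<in> topspace X" "!!w. w \<in> topspace X ==> ?Psi z <= ?Psi w" by auto
  have zx: "?Psi z <= arclen (f x)" using z(2)[OF x(1)] riem_dist_self[OF x(1)] by simp
  have dn: "0 <= (1 - e) * riem_dist X A g z x" using riem_dist_nonneg[OF z(1) x(1)] e by simp
  have "f z = t0"
  proof (rule ccontr)
   assume "f z ~= t0"
   hence z0: "t0 < f z" using level[OF z(1)] by simp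
   have z1: "f z < t1"
   proof (rule ccontr)
   assume "~ f z < t1"
   hence "f z = t1" using level[OF z(1)] by simp
   hence "arclen (f x) < arclen (f z)" using arclen_strict_mono[of "f x" t1] x level[OF x(1)] by simp
   thus False using zx dn by linarith
   qed
   obtain z' L where L: "pw_C1_path X A g z' z L" "arclen (f z') + (1 - e) * L < arclen (f z)"
   by (rule arclen_descent[OF z(1) z0 z1 e])
   have "riem_dist X A g z' x <= L + riem_dist X A g z x" by (rule riem_dist_path_triangle[OF L(1) x(1)])
   hence "(1 - e) * riem_dist X A g z' x <= (1 - e) * (L + riem_dist X A g z x)" using e by (intro mult_left_mono) auto
   hence "?Psi z' < ?Psi z" using L(2) by (simp add: algebra_simps)
   moreover have "z' \<in> topspace X" using path_in_X[OF L(1)] by simp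
   ultimately show False using z(2)[of z'] by linarith
  qed
  hence "z \<in> focal" using z(1) by (simp add: level_set_def)
  hence "riem_setdist X A g focal x <= riem_dist X A g z x"
   unfolding riem_setdist_def by (rule cINF_lower[OF focal_dist_bdd[OF x(1)]])
  hence "(1 - e) * riem_setdist X A g focal x <= (1 - e) * riem_dist X A g z x" using e by (intro mult_left_mono) auto
  thus ?thesis using zx \<open>f z = t0\<close> arclen_start by simp
 qed
 have "((%e. (1 - e) * riem_setdist X A g focal x) ---> (1 - 0) * riem_setdist X A g focal x) (at_right 0)"
  by (intro tendsto_intros)
 moreover have "\<forall>\<^sub>F e in at_right 0. (1 - e) * riem_setdist X A g focal x <= arclen (f x)"
  by (rule eventually_at_rightI[of 0 1]) (auto intro: le)
 ultimately have "(1 - 0) * riem_setdist X A g focal x <= arclen (f x)" by (rule tendsto_upperbound) simp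
 thus ?thesis by simp
qed

lemma top_level_approximated:
 assumes x: "x \<in> topspace X" "f x = t1" and U: "openin X U" "x \<in> U"
 shows "\<exists>q\<in>U. f q < t1"
proof -
 interpret neg: isoparam X A g "%p. - f p" "- t1" "- t0" "%k s. (- 1) ^ Suc k * Da k (- s)" "%k s. (- 1) ^ k * Db k (- s)"
  by (rule negated)
 define c where "c = chart_at A x"
 have c: "c \<in> A" "x \<in> dom c" using chart_at[OF x(1)] by (auto simp: c_def)
 have "- f x = - t1" using x by simp
 note dir = neg.focal_direction[OF x(1) this c_def]
 obtain v gam where v: "0 < gam" "((%tau. (local_rep c (%p. - f p) (snd c x + tau *\<^sub>R v) - - t1) / tau\<^sup>2) ---> gam) (at 0)"
  by (rule dir)
 have W: "open (snd c ` (dom c \<inter> U))" "snd c x \<in> snd c ` (dom c \<inter> U)"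
  using open_preimage_chart[OF c(1) U(1) c(2) U(2)] by auto
 have "((%tau. snd c x + tau *\<^sub>R v) ---> snd c x + 0 *\<^sub>R v) (at 0)" by (intro tendsto_intros)
 hence "\<forall>\<^sub>F tau in at 0. snd c x + tau *\<^sub>R v \<in> snd c ` (dom c \<inter> U)"
  using topological_tendstoD[OF _ W(1)] W(2) by simp
 moreover have "\<forall>\<^sub>F tau in at 0. 0 < (local_rep c (%p. - f p) (snd c x + tau *\<^sub>R v) - - t1) / tau\<^sup>2"
  by (rule order_tendstoD(1)[OF v(2,1)])
 ultimately have "\<forall>\<^sub>F tau in at (0 :: real). \<exists>q\<in>U. f q < t1"
 proof eventually_elim
  case (elim tau)
  then obtain q where q: "q \<in> dom c" "q \<in> U" "snd c x + tau *\<^sub>R v = snd c q" by blast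
  have "local_rep c (%p. - f p) (snd c q) = - f q" by (rule local_rep_chart[OF c(1) q(1)])
  hence "0 < (t1 - f q) / tau\<^sup>2" using elim(2) q(3) by simp
  hence "f q < t1" by (simp add: zero_less_divide_iff)
  thus ?case using q by blast
 qed
 thus ?thesis by (simp add: eventually_const)
qed

theorem focal_dist:
 assumes x: "x \<in> topspace X"
 shows "riem_setdist X A g focal x = arclen (f x)"
proof (rule antisym)
 show "riem_setdist X A g focal x <= arclen (f x)"
 proof (cases "f x < t1")
  case False
  hence fx: "f x = t1" using level[OF x] by simp
  show ?thesis
  proof (rule field_le_epsilon)
   fix e :: real assume e: "0 < e"
   obtain U where U: "openin X U" "x \<in> U" "!!q. q \<in> U ==> (\<exists>L<e. pw_C1_path X A g x q L) & (\<exists>L<e. pw_C1_path X A g q x L)"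
   by (rule riem_dist_near[OF x e]) blast
   obtain q where q: "q \<in> U" "f q < t1" using top_level_approximated[OF x fx U(1,2)] by blast
   obtain L where L: "L < e" "pw_C1_path X A g q x L" using U(3)[OF q(1)] by blast
   have qX: "q \<in> topspace X" using path_in_X[OF L(2)] by simp
   have "riem_setdist X A g focal x - L <= riem_setdist X A g focal q" unfolding riem_setdist_def[of _ _ _ _ q]
   proof (rule cINF_greatest)
   show "focal ~= {}" using level_attained[of t0] t01 by (auto simp: level_set_def)
   fix p assume p: "p \<in> focal"
   have "riem_setdist X A g focal x <= riem_dist X A g p x"
   unfolding riem_setdist_def by (rule cINF_lower[OF focal_dist_bdd[OF x] p])
   also have "... <= riem_dist X A g p q + L" by (rule riem_dist_path_triangle2[OF L(2)]) (use p in "simp add: level_set_def")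
   finally show "riem_setdist X A g focal x - L <= riem_dist X A g p q" by simp
   qed
   also have "... <= arclen (f q)" by (rule focal_dist_le_interior[OF qX q(2)])
   also have "... <= arclen (f x)" using arclen_strict_mono[of "f q" t1] q level[OF qX] fx by simp
   finally show "riem_setdist X A g focal x <= arclen (f x) + e" using L(1) by simp
  qed
 qed (rule focal_dist_le_interior[OF x])
qed (rule focal_dist_ge[OF x])

lemma focal_dist_eq_iff:
 assumes "x \<in> topspace X" "y \<in> topspace X"
 shows "riem_setdist X A g focal x = riem_setdist X A g focal y \<longleftrightarrow> f x = f y"
proof
 assume "riem_setdist X A g focal x = riem_setdist X A g focal y"
 hence eq: "arclen (f x) = arclen (f y)" using assms focal_dist by simp
 show "f x = f y"
  using eq arclen_strict_mono[of "f x" "f y"] arclen_strict_mono[of "f y" "f x"] level[OF assms(1)] level[OF assms(2)]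
  by (cases "f x" "f y" rule: linorder_cases) auto
qed (use assms focal_dist in simp)

end


section \<open>Invariant eigenfunctions and the ordinary differential equation\<close>

text \<open>By the intermediate value theorem every value near \<open>k 0\<close> is attained at a
small parameter, so the difference quotients of \<open>omg\<close> are those of \<open>W\<close>
over those of \<open>k\<close>.\<close>

lemma has_derivative_via_curve:
 fixes k W omg :: "real => real"
 assumes d0: "0 < d0" and k: "continuous_on {-d0<..<d0} k" and W: "!!tau. \<bar>tau\<bar> < d0 ==> omg (k tau) = W tau"
  and k': "(k has_real_derivative kap) (at 0)" "kap > 0" and W': "(W has_real_derivative w) (at 0)"
 shows "(omg has_real_derivative w / kap) (at (k 0))" unfolding has_field_derivative_iff
proof (rule tendstoI)
 fix e :: real assume e: "0 < e"
 have "((%tau. ((W tau - W 0) / tau) / ((k tau - k 0) / tau)) ---> w / kap) (at 0)"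
  using k' W' by (intro tendsto_divide) (auto simp: has_field_derivative_iff)
 hence "\<forall>\<^sub>F tau in at 0. dist (((W tau - W 0) / tau) / ((k tau - k 0) / tau)) (w / kap) < e" using e by (rule tendstoD)
 then obtain d1 where d1: "0 < d1" "!!tau. tau ~= 0 ==> \<bar>tau\<bar> < d1 ==> dist (((W tau - W 0) / tau) / ((k tau - k 0) / tau)) (w / kap) < e"
  unfolding eventually_at by (auto simp: dist_real_def)
 have "\<exists>d>0. \<forall>h>0. h < d --> k 0 < k (0 + h)" by (rule DERIV_pos_inc_right[OF k'])
 then obtain d2 where d2: "0 < d2" "!!h. 0 < h ==> h < d2 ==> k 0 < k h" by auto
 have "\<exists>d>0. \<forall>h>0. h < d --> k (0 - h) < k 0" by (rule DERIV_pos_inc_left[OF k'])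
 then obtain d3 where d3: "0 < d3" "!!h. 0 < h ==> h < d3 ==> k (- h) < k 0" by auto
 define dlt where "dlt = min (min d0 d1) (min d2 d3) / 2"
 have dlt: "0 < dlt" "dlt < d0" "dlt < d1" "dlt < d2" "dlt < d3" using d0 d1 d2 d3 by (auto simp: dlt_def)
 have kc: "continuous_on {-dlt..dlt} k" by (rule continuous_on_subset[OF k]) (use dlt in auto)
 define r0 where "r0 = min (k dlt - k 0) (k 0 - k (- dlt))"
 have r0: "0 < r0" using d2(2)[of dlt] d3(2)[of dlt] dlt by (simp add: r0_def)
 have "dist ((omg r - omg (k 0)) / (r - k 0)) (w / kap) < e" if r: "r ~= k 0" "dist r (k 0) < r0" for r
 proof -
  have "k (- dlt) <= r" "r <= k dlt" using r(2) by (auto simp: r0_def dist_real_def)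
  then obtain tau where tau: "- dlt <= tau" "tau <= dlt" "k tau = r" using IVT'[of k "- dlt" r dlt] kc dlt(1) by auto
  have "tau ~= 0" using tau(3) r(1) by auto
  moreover have "\<bar>tau\<bar> < d1" "\<bar>tau\<bar> < d0" using tau dlt by auto
  ultimately have "dist (((W tau - W 0) / tau) / ((k tau - k 0) / tau)) (w / kap) < e" by (intro d1(2))
  moreover have "((W tau - W 0) / tau) / ((k tau - k 0) / tau) = (omg r - omg (k 0)) / (r - k 0)"
   using W[of tau] W[of 0] \<open>\<bar>tau\<bar> < d0\<close> d0 tau(3) \<open>tau ~= 0\<close> by simp
  ultimately show ?thesis by simp
 qed
 thus "\<forall>\<^sub>F r in at (k 0). dist ((omg r - omg (k 0)) / (r - k 0)) (w / kap) < e"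
  unfolding eventually_at using r0 by (intro exI[of _ r0]) auto
qed

text \<open>Values slightly above the minimum \<open>k 0\<close> are attained at parameters of
both signs. The linear terms of \<open>W\<close> at two such parameters have opposite signs and
cancel in a weighted mean.\<close>

lemma small_via_even_curve:
 fixes k W omg :: "real => real"
 assumes d0: "0 < d0" and k: "continuous_on {-d0..d0} k" and W: "!!tau. \<bar>tau\<bar> <= d0 ==> omg (k tau) = W tau"
  and c0: "0 < c0" and ge: "!!tau. \<bar>tau\<bar> <= d0 ==> c0\<^sup>2 * tau\<^sup>2 <= k tau - k 0" and W': "(W has_real_derivative w) (at 0)"
  and e: "0 < e"
 obtains d where "0 < d" "!!s. k 0 < s ==> s < k 0 + d ==> \<bar>omg s - omg (k 0)\<bar> <= e * sqrt (s - k 0)"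
proof -
 define e1 where "e1 = e * c0 / 2"
 have e1: "0 < e1" using e c0 by (simp add: e1_def)
 have "((%tau. (W tau - W 0) / tau) ---> w) (at 0)" using W' by (simp add: has_field_derivative_iff)
 hence "\<forall>\<^sub>F tau in at 0. dist ((W tau - W 0) / tau) w < e1" using e1 by (rule tendstoD)
 then obtain d1 where d1: "0 < d1" "!!tau. tau ~= 0 ==> \<bar>tau\<bar> < d1 ==> \<bar>(W tau - W 0) / tau - w\<bar> < e1"
  unfolding eventually_at by (auto simp: dist_real_def)
 have lin: "\<bar>W tau - W 0 - w * tau\<bar> <= e1 * \<bar>tau\<bar>" if "tau ~= 0" "\<bar>tau\<bar> < d1" for tau
 proof -
  have "W tau - W 0 - w * tau = ((W tau - W 0) / tau - w) * tau"
   using that by (simp add: left_diff_distrib[of "(W tau - W 0) / tau" w tau])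
  hence "\<bar>W tau - W 0 - w * tau\<bar> = \<bar>(W tau - W 0) / tau - w\<bar> * \<bar>tau\<bar>" by (simp add: abs_mult)
  also have "... <= e1 * \<bar>tau\<bar>" using d1(2)[OF that] by (intro mult_right_mono) auto
  finally show ?thesis .
 qed
 define dlt where "dlt = min d0 (d1 / 2)"
 have dlt: "0 < dlt" "dlt <= d0" "dlt < d1" using d0 d1 by (auto simp: dlt_def)
 have "\<bar>omg s - omg (k 0)\<bar> <= e * sqrt (s - k 0)" if s: "k 0 < s" "s < k 0 + c0\<^sup>2 * dlt\<^sup>2" for s
 proof -
  have up: "s <= k dlt" "s <= k (- dlt)" using ge[of dlt] ge[of "- dlt"] s dlt by auto
  have kc: "continuous_on {0..dlt} k" "continuous_on {-dlt..0} k" by (rule continuous_on_subset[OF k]; use dlt in auto)+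
  obtain x where x: "0 <= x" "x <= dlt" "k x = s" using IVT'[of k 0 s dlt] kc up s dlt by auto
  obtain z where z: "- dlt <= z" "z <= 0" "k z = s" using IVT2'[of k 0 s "- dlt"] kc up s dlt by auto
  define y where "y = - z"
  have nz: "x ~= 0" "z ~= 0" using x(3) z(3) s by auto
  hence xy: "0 < x" "x <= dlt" "0 < y" "y <= dlt" using x z by (auto simp: y_def)
  define D where "D = omg s - omg (k 0)"
  have Dx: "D = W x - W 0" and Dz: "D = W z - W 0" using W[of x] W[of z] W[of 0] x z xy dlt d0 by (auto simp: D_def y_def)
  have "\<bar>D - w * x\<bar> <= e1 * x" using lin[of x] xy dlt Dx by auto
  moreover have "\<bar>D + w * y\<bar> <= e1 * y" using lin[of z] xy dlt Dz nz by (auto simp: y_def)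
  ultimately have "y * \<bar>D - w * x\<bar> + x * \<bar>D + w * y\<bar> <= y * (e1 * x) + x * (e1 * y)"
   using xy by (intro add_mono mult_left_mono) auto
  moreover have "(x + y) * \<bar>D\<bar> <= y * \<bar>D - w * x\<bar> + x * \<bar>D + w * y\<bar>"
  proof -
   \<comment> \<open>The weights \<open>y\<close> and \<open>x\<close> make the linear terms cancel.\<close>
   have "(x + y) * D = y * (D - w * x) + x * (D + w * y)" by (simp add: algebra_simps)
   hence "\<bar>(x + y) * D\<bar> <= \<bar>y * (D - w * x)\<bar> + \<bar>x * (D + w * y)\<bar>" by (metis abs_triangle_ineq)
   thus ?thesis using xy by (simp add: abs_mult)
  qed
  moreover have "y * (e1 * x) + x * (e1 * y) <= (x + y) * (2 * e1 * x)"
  proof -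
   have "(x + y) * (2 * e1 * x) - (y * (e1 * x) + x * (e1 * y)) = 2 * e1 * (x * x)" by (simp add: algebra_simps)
   moreover have "0 <= 2 * e1 * (x * x)" using e1 by simp
   ultimately show ?thesis by linarith
  qed
  ultimately have "(x + y) * \<bar>D\<bar> <= (x + y) * (2 * e1 * x)" by linarith
  hence "\<bar>D\<bar> <= 2 * e1 * x" using xy by simp
  also have "... = e * (c0 * x)" by (simp add: e1_def)
  also have "... <= e * sqrt (s - k 0)"
  proof (intro mult_left_mono real_le_rsqrt)
   show "(c0 * x)\<^sup>2 <= s - k 0" using ge[of x] x xy dlt by (simp add: power_mult_distrib)
  qed (use e in simp)
  finally show ?thesis by (simp add: D_def)
 qed
 moreover have "0 < c0\<^sup>2 * dlt\<^sup>2" using c0 dlt by simp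
 ultimately show ?thesis using that by blast
qed

lemma C2_differentiable:
 assumes "Ck_on 2 h S" and S: "open S" and "x \<in> S"
 shows "h differentiable (at x)" "pd i h differentiable (at x)"
 using assms(1,3) by (simp_all add: numeral_2_eq_2 differentiable_on_eq_differentiable_at[OF S])

context isoparam
begin

lemma rep_line:
 assumes c: "c \<in> A" and x: "x \<in> img c"
 shows "((%tau. local_rep c f (x + tau *\<^sub>R v)) has_real_derivative coord_grad c f x \<bullet> v) (at 0)"
  "\<exists>d>0. (\<forall>tau. \<bar>tau\<bar> <= d --> x + tau *\<^sub>R v \<in> img c) & continuous_on {-d..d} (%tau. local_rep c f (x + tau *\<^sub>R v))"
proof -
 have line: "((%tau. x + tau *\<^sub>R v) has_derivative (%s. s *\<^sub>R v)) (at 0)" by (auto intro!: derivative_eq_intros)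
 have "(local_rep c f has_derivative (%w. coord_grad c f x \<bullet> w)) (at (x + 0 *\<^sub>R v))"
  using rep_has_derivative[OF c x] by simp
 from has_derivative_compose[OF line this]
 show "((%tau. local_rep c f (x + tau *\<^sub>R v)) has_real_derivative coord_grad c f x \<bullet> v) (at 0)"
  by (simp add: has_field_derivative_def mult.commute[of _ "coord_grad c f x \<bullet> v"])
 obtain r where r: "0 < r" "ball x r <= img c" using chart(2)[OF c] x openE by blast
 define d where "d = r / (2 * (norm v + 1))"
 have nv: "0 < norm v + 1" by (simp add: add_nonneg_pos)
 have d: "0 < d" using r nv by (simp add: d_def)
 have inimg: "x + tau *\<^sub>R v \<in> img c" if "\<bar>tau\<bar> <= d" for tau
 proof -
  have "\<bar>tau\<bar> * norm v <= d * (norm v + 1)" using that by (intro mult_mono) (use d in auto)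
  also have "... = r / 2" using nv by (simp add: d_def field_simps)
  finally have "dist x (x + tau *\<^sub>R v) < r" using r by (simp add: dist_norm)
  thus ?thesis using r(2) by auto
 qed
 have "continuous_on {-d..d} (%tau. local_rep c f (x + tau *\<^sub>R v))"
 proof (rule continuous_on_compose2[OF rep_continuous[OF c]])
  show "continuous_on {-d..d} (%tau. x + tau *\<^sub>R v)" by (intro continuous_intros)
  show "(%tau. x + tau *\<^sub>R v) ` {-d..d} <= img c" using inimg by (auto simp del: image_eqI simp: abs_le_iff)
 qed
 thus "\<exists>d>0. (\<forall>tau. \<bar>tau\<bar> <= d --> x + tau *\<^sub>R v \<in> img c) & continuous_on {-d..d} (%tau. local_rep c f (x + tau *\<^sub>R v))"
  using d inimg by (intro exI[of _ d]) blast
qed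

text \<open>The curve is the coordinate line in the direction of the gradient, along which
\<open>f\<close> has positive derivative.\<close>

lemma descend_derivative:
 assumes w: "!!q. q \<in> topspace X ==> t0 < f q ==> f q < t1 ==> w q = omg (f q)"
  and p: "p \<in> topspace X" "t0 < f p" "f p < t1" and c: "c \<in> A" "p \<in> dom c"
  and d: "local_rep c w differentiable (at (snd c p))"
 shows "EX D. (omg has_real_derivative D) (at (f p))"
proof -
 define x where "x = snd c p"
 have x: "x \<in> img c" and ix: "ichart c x = p" using c by (auto simp: x_def ichart)
 define G where "G = gradient g c f p"
 let ?k = "%tau. local_rep c f (x + tau *\<^sub>R G)" and ?W = "%tau. local_rep c w (x + tau *\<^sub>R G)"
 have Gc: "coord_grad c f x \<bullet> G = Db 0 (f p)"
  using grad_norm_sq_eq[OF c, of f] grad_norm_sq_level[OF c] by (simp add: G_def x_def inner_commute)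
 have k': "(?k has_real_derivative Db 0 (f p)) (at 0)" using rep_line(1)[OF c(1) x, of G] Gc by simp
 have k0: "?k 0 = f p" by (simp add: local_rep_apply ix)
 obtain d1 where d1: "0 < d1" "!!tau. \<bar>tau\<bar> <= d1 ==> x + tau *\<^sub>R G \<in> img c" "continuous_on {-d1..d1} ?k"
  using rep_line(2)[OF c(1) x, of G] by blast
 define m where "m = min (f p - t0) (t1 - f p)"
 have m: "0 < m" using p by (simp add: m_def)
 have "isCont ?k 0" by (rule DERIV_isCont[OF k'])
 with m obtain d2 where d2: "0 < d2" "!!tau. \<bar>tau\<bar> < d2 ==> \<bar>?k tau - f p\<bar> < m"
  unfolding continuous_at_eps_delta k0 dist_real_def by auto
 define d0 where "d0 = min d1 d2"
 have d0: "0 < d0" "d0 <= d1" "d0 <= d2" using d1 d2 by (auto simp: d0_def)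
 obtain Dw where Dw: "(local_rep c w has_derivative Dw) (at (x + 0 *\<^sub>R G))" using d by (auto simp: differentiable_def x_def)
 have line: "((%tau. x + tau *\<^sub>R G) has_derivative (%s. s *\<^sub>R G)) (at 0)" by (auto intro!: derivative_eq_intros)
 from has_derivative_compose[OF line Dw]
 have W': "(?W has_real_derivative Dw G) (at 0)"
  using linear_scale[OF bounded_linear.linear[OF has_derivative_bounded_linear[OF Dw]]]
  by (simp add: has_field_derivative_def mult.commute[of _ "Dw G"])
 have "(omg has_real_derivative Dw G / Db 0 (f p)) (at (?k 0))"
 proof (rule has_derivative_via_curve[OF d0(1) _ _ k' b_pos[OF p(2,3)] W'])
  show "continuous_on {-d0<..<d0} ?k" by (rule continuous_on_subset[OF d1(3)]) (use d0 in auto)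
  fix tau :: real assume tau: "\<bar>tau\<bar> < d0"
  have i: "x + tau *\<^sub>R G \<in> img c" using d1(2) tau d0 by simp
  have "ichart c (x + tau *\<^sub>R G) \<in> topspace X" using ichart(3)[OF c(1) i] dom_subset[OF c(1)] by blast
  thus "omg (?k tau) = ?W tau"
   using w[of "ichart c (x + tau *\<^sub>R G)"] d2(2)[of tau] tau d0 by (simp add: local_rep_apply abs_less_iff m_def)
 qed
 thus ?thesis unfolding k0 by blast
qed

lemma interior_levels_open: "openin X {q \<in> topspace X. f q \<in> {t0<..<t1}}"
 using openin_continuous_map_preimage[OF smooth_fun_continuous[OF f], of "{t0<..<t1}"] by simp

lemma interior_chart_open:
 assumes c: "c \<in> A"
 shows "open (snd c ` (dom c \<inter> {q \<in> topspace X. f q \<in> {t0<..<t1}}))"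
 by (rule open_chart_image[OF c interior_levels_open])

text \<open>Differentiability descends from \<open>u\<close> to \<open>psi\<close>, and once more
from the quotient of a partial derivative of \<open>u\<close> by that of \<open>f\<close> to the
derivative of \<open>psi\<close>.\<close>

theorem invariant_eigenfunction_ode:
 assumes u: "!!c. c \<in> A ==> Ck_on 2 (local_rep c u) (img c)"
  and psi: "!!p. p \<in> topspace X ==> u p = psi (f p)"
  and eq: "!!p. p \<in> topspace X ==> - laplace_beltrami A g u p = \<mu> * u p"
 obtains y where
  "!!s. t0 < s ==> s < t1 ==> (psi has_real_derivative y s) (at s)"
  "!!s. t0 < s ==> s < t1 ==> (y has_real_derivative (- \<mu> * psi s - Da 0 s * y s) / Db 0 s) (at s)"
proof -
 have ud: "local_rep c u differentiable (at x)" "pd i (local_rep c u) differentiable (at x)"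
  if "c \<in> A" "x \<in> img c" for c x i using C2_differentiable[OF u[OF that(1)] chart(2)[OF that(1)] that(2)] by auto
 have "EX D. (psi has_real_derivative D) (at s)" if s: "t0 < s" "s < t1" for s
 proof -
  obtain p where p: "p \<in> topspace X" "f p = s" using level_attained[of s] s by auto
  have c: "chart_at A p \<in> A" "p \<in> dom (chart_at A p)" using chart_at[OF p(1)] by auto
  show ?thesis using descend_derivative[of u psi p, OF psi p(1) _ _ c] ud(1)[OF c(1)] c s p by auto
 qed
 then obtain y where y: "!!s. t0 < s ==> s < t1 ==> (psi has_real_derivative y s) (at s)" by metis
 have y': "EX D. (y has_real_derivative D) (at s)" if s: "t0 < s" "s < t1" for s
 proof -
  obtain p where p: "p \<in> topspace X" "f p = s" using level_attained[of s] s by auto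
  define c where "c = chart_at A p"
  have c: "c \<in> A" "p \<in> dom c" using chart_at[OF p(1)] by (auto simp: c_def)
  define W where "W = snd c ` (dom c \<inter> {q \<in> topspace X. f q \<in> {t0<..<t1}})"
  have W: "open W" unfolding W_def by (rule interior_chart_open[OF c(1)])
  define x where "x = snd c p"
  have x: "x \<in> W" "x \<in> img c" using c p s by (auto simp: W_def x_def)
  have Wi: "z \<in> img c" "local_rep c f z \<in> {t0<..<t1}" "ichart c z \<in> topspace X" if "z \<in> W" for z
   using that c(1) dom_subset[OF c(1)] by (auto simp: W_def local_rep_apply ichart)
  have pdu: "pd i (local_rep c u) z = y (local_rep c f z) * pd i (local_rep c f) z" if z: "z \<in> W" for i z
  proof -
   have "pd i (local_rep c u) z = pd i (%z. psi (local_rep c f z)) z"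
   by (rule pd_cong[OF W z]) (use psi Wi(3) in "simp add: local_rep_apply")
   also have "... = y (local_rep c f z) * pd i (local_rep c f) z"
   proof (rule pd_compose(2)[OF _ W z])
   show "local_rep c f differentiable (at z)" using rep_has_derivative[OF c(1) Wi(1)[OF z]] by (auto simp: differentiable_def)
   show "(psi has_real_derivative y (local_rep c f z)) (at (local_rep c f z) within UNIV)" using y Wi(2)[OF z] by simp
   qed simp
   finally show ?thesis .
  qed
  have "grad_norm_sq c f p = Db 0 s" using grad_norm_sq_level[OF c] p by simp
  hence "coord_grad c f x ~= 0" using grad_norm_sq_eq[OF c, of f] b_pos[OF s] by (auto simp: x_def)
  then obtain i where i: "pd i (local_rep c f) x ~= 0" by (auto simp: coord_grad_def vec_eq_iff)
  have fd: "pd i (local_rep c f) differentiable (at x)" by (rule pd_rep_differentiable[OF c(1) x(2)])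
  have "(%z. pd i (local_rep c u) z / pd i (local_rep c f) z) differentiable (at x)"
   using differentiable_divide[OF ud(2)[OF c(1) x(2)] fd i] by simp
  then obtain D where D: "((%z. pd i (local_rep c u) z / pd i (local_rep c f) z) has_derivative D) (at x)" by (auto simp: differentiable_def)
  have "(pd i (local_rep c f) ---> pd i (local_rep c f) x) (at x)"
   using differentiable_imp_continuous_within[OF fd] by (simp add: continuous_within)
  from tendsto_imp_eventually_ne[OF this i] have "\<forall>\<^sub>F z in nhds x. pd i (local_rep c f) z ~= 0"
   using i by (simp add: eventually_nhds_conv_at)
  then obtain V where V: "open V" "x \<in> V" "!!z. z \<in> V ==> pd i (local_rep c f) z ~= 0" unfolding eventually_nhds by blast
  have "(local_rep c (%q. y (f q)) has_derivative D) (at x)"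
  proof (rule has_derivative_transform_within_open[OF D open_Int[OF W V(1)]])
   fix z assume "z \<in> W \<inter> V"
   thus "pd i (local_rep c u) z / pd i (local_rep c f) z = local_rep c (%q. y (f q)) z"
   using pdu[of z i] V(3)[of z] by (simp add: local_rep_apply)
  qed (use x V in auto)
  hence "local_rep c (%q. y (f q)) differentiable (at (snd c p))" by (auto simp: differentiable_def x_def)
  from descend_derivative[of "%q. y (f q)" y p, OF refl p(1) _ _ c this] show ?thesis using p s by simp
 qed
 have "(y has_real_derivative (- \<mu> * psi s - Da 0 s * y s) / Db 0 s) (at s)" if s: "t0 < s" "s < t1" for s
 proof -
  obtain D where D: "(y has_real_derivative D) (at s)" using y'[OF s] by blast
  obtain p where p: "p \<in> topspace X" "f p = s" using level_attained[of s] s by auto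
  have "laplace_beltrami A g u p = D * gradient_norm_sq A g f p + y (f p) * laplace_beltrami A g f p"
  proof (rule laplace_compose[OF f p(1) interior_levels_open])
   show "p \<in> {q \<in> topspace X. f q \<in> {t0<..<t1}}" using p s by simp
   show "(psi has_real_derivative y r) (at r within {t0<..<t1})" if "r \<in> {t0<..<t1}" for r
   using y[of r] that by (auto intro: has_field_derivative_at_within)
   show "(y has_real_derivative D) (at (f p) within {t0<..<t1})" using D p by (auto intro: has_field_derivative_at_within)
  qed (use psi in auto)
  hence "D * Db 0 s + y s * Da 0 s = - \<mu> * psi s" using eq[OF p(1)] psi[OF p(1)] grad[OF p(1)] lap[OF p(1)] p(2) by simp
  hence "D = (- \<mu> * psi s - Da 0 s * y s) / Db 0 s" using b_pos[OF s] by (simp add: field_simps)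
  thus ?thesis using D by simp
 qed
 thus ?thesis using that y by blast
qed

text \<open>The curve is a coordinate line along which \<open>f\<close> has a nondegenerate
minimum.\<close>

theorem invariant_small_at_focal:
 assumes u: "!!c. c \<in> A ==> Ck_on 2 (local_rep c u) (img c)"
  and psi: "!!p. p \<in> topspace X ==> u p = psi (f p)" and e: "0 < e"
 shows "\<exists>d>0. ALL s. t0 < s --> s < t0 + d --> \<bar>psi s - psi t0\<bar> <= e * sqrt (s - t0)"
proof -
 obtain p where p: "p \<in> topspace X" "f p = t0" using level_attained[of t0] t01 by auto
 define c where "c = chart_at A p"
 have c: "c \<in> A" "p \<in> dom c" using chart_at[OF p(1)] by (auto simp: c_def)
 define x where "x = snd c p"
 have x: "x \<in> img c" and ix: "ichart c x = p" using c by (auto simp: x_def ichart)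
 obtain v gam where v: "0 < gam" "((%tau. (local_rep c f (snd c p + tau *\<^sub>R v) - t0) / tau\<^sup>2) ---> gam) (at 0)"
  by (rule focal_direction[OF p c_def])
 let ?k = "%tau. local_rep c f (x + tau *\<^sub>R v)" and ?W = "%tau. local_rep c u (x + tau *\<^sub>R v)"
 have k0: "?k 0 = t0" by (simp add: local_rep_apply ix p)
 have "\<forall>\<^sub>F tau in at 0. gam / 2 < (?k tau - t0) / tau\<^sup>2"
  using order_tendstoD(1)[OF v(2), of "gam / 2"] v(1) by (simp add: x_def)
 then obtain d1 where d1: "0 < d1" "!!tau. tau ~= 0 ==> \<bar>tau\<bar> < d1 ==> gam / 2 < (?k tau - t0) / tau\<^sup>2"
  unfolding eventually_at by (auto simp: dist_real_def)
 obtain d2 where d2: "0 < d2" "!!tau. \<bar>tau\<bar> <= d2 ==> x + tau *\<^sub>R v \<in> img c" "continuous_on {-d2..d2} ?k"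
  using rep_line(2)[OF c(1) x, of v] by blast
 define d0 where "d0 = min (d1 / 2) d2"
 have d0: "0 < d0" "d0 < d1" "d0 <= d2" using d1 d2 by (auto simp: d0_def)
 have "local_rep c u differentiable (at x)" by (rule C2_differentiable(1)[OF u[OF c(1)] chart(2)[OF c(1)] x])
 then obtain Dw where Dw: "(local_rep c u has_derivative Dw) (at (x + 0 *\<^sub>R v))" by (auto simp: differentiable_def)
 have line: "((%tau. x + tau *\<^sub>R v) has_derivative (%s. s *\<^sub>R v)) (at 0)" by (auto intro!: derivative_eq_intros)
 from has_derivative_compose[OF line Dw]
 have W': "(?W has_real_derivative Dw v) (at 0)"
  using linear_scale[OF bounded_linear.linear[OF has_derivative_bounded_linear[OF Dw]]]
  by (simp add: has_field_derivative_def mult.commute[of _ "Dw v"])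
 have "\<exists>d>0. ALL s. ?k 0 < s --> s < ?k 0 + d --> \<bar>psi s - psi (?k 0)\<bar> <= e * sqrt (s - ?k 0)"
 proof (rule small_via_even_curve[OF d0(1) _ _ _ _ W' e])
  show "continuous_on {-d0..d0} ?k" by (rule continuous_on_subset[OF d2(3)]) (use d0 in auto)
  show "0 < sqrt (gam / 2)" using v by simp
  fix tau :: real assume tau: "\<bar>tau\<bar> <= d0"
  have i: "x + tau *\<^sub>R v \<in> img c" using d2(2) tau d0 by simp
  have "ichart c (x + tau *\<^sub>R v) \<in> topspace X" using ichart(3)[OF c(1) i] dom_subset[OF c(1)] by blast
  thus "psi (?k tau) = ?W tau" using psi by (simp add: local_rep_apply)
  show "(sqrt (gam / 2))\<^sup>2 * tau\<^sup>2 <= ?k tau - ?k 0"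
  proof (cases "tau = 0")
   case False
   hence "gam / 2 < (?k tau - t0) / tau\<^sup>2" using d1(2) tau d0 by simp
   hence "gam / 2 * tau\<^sup>2 < ?k tau - t0" using False by (subst (asm) pos_less_divide_eq) auto
   thus ?thesis using v by (simp add: k0 del: scaleR_zero_left)
  qed simp
 next
  fix d assume "0 < d" "!!s. ?k 0 < s ==> s < ?k 0 + d ==> \<bar>psi s - psi (?k 0)\<bar> <= e * sqrt (s - ?k 0)"
  thus "\<exists>d>0. ALL s. ?k 0 < s --> s < ?k 0 + d --> \<bar>psi s - psi (?k 0)\<bar> <= e * sqrt (s - ?k 0)" by blast
 qed
 thus ?thesis unfolding k0 .
qed

theorem invariant_small_at_top:
 assumes u: "!!c. c \<in> A ==> Ck_on 2 (local_rep c u) (img c)"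
  and psi: "!!p. p \<in> topspace X ==> u p = psi (f p)" and e: "0 < e"
 shows "\<exists>d>0. ALL s. t1 - d < s --> s < t1 --> \<bar>psi s - psi t1\<bar> <= e * sqrt (t1 - s)"
proof -
 interpret neg: isoparam X A g "%p. - f p" "- t1" "- t0" "%k s. (- 1) ^ Suc k * Da k (- s)" "%k s. (- 1) ^ k * Db k (- s)"
  by (rule negated)
 have "\<exists>d>0. ALL s. - t1 < s --> s < - t1 + d --> \<bar>psi (- s) - psi (- (- t1))\<bar> <= e * sqrt (s - - t1)"
  by (rule neg.invariant_small_at_focal[OF u _ e, where psi = "%s. psi (- s)"]) (use psi in auto)
 then obtain d where d: "0 < d" "!!s. - t1 < s ==> s < - t1 + d ==> \<bar>psi (- s) - psi t1\<bar> <= e * sqrt (s + t1)" by auto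
 have "\<bar>psi s - psi t1\<bar> <= e * sqrt (t1 - s)" if "t1 - d < s" "s < t1" for s using d(2)[of "- s"] that by simp
 thus ?thesis using d(1) by blast
qed

lemma invariant_continuous:
 assumes d: "!!s. t0 < s ==> s < t1 ==> (psi has_real_derivative y s) (at s)"
  and s0: "\<exists>d>0. ALL s. t0 < s --> s < t0 + d --> \<bar>psi s - psi t0\<bar> <= 1 * sqrt (s - t0)"
  and s1: "\<exists>d>0. ALL s. t1 - d < s --> s < t1 --> \<bar>psi s - psi t1\<bar> <= 1 * sqrt (t1 - s)"
 shows "continuous_on {t0..t1} psi" unfolding continuous_on_def
proof
 fix s assume s: "s \<in> {t0..t1}"
 consider "s = t0" | "s = t1" | "t0 < s" "s < t1" using s by fastforce
 thus "(psi ---> psi s) (at s within {t0..t1})"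
 proof cases
  case 1
  obtain d where d: "0 < d" "!!s. t0 < s ==> s < t0 + d ==> \<bar>psi s - psi t0\<bar> <= sqrt (s - t0)" using s0 by auto
  have lim: "((%r. sqrt (r - t0)) ---> sqrt (t0 - t0)) (at t0 within {t0..t1})" by (intro tendsto_intros)
  have "((%r. psi r - psi t0) ---> 0) (at t0 within {t0..t1})"
  proof (rule Lim_null_comparison)
   show "\<forall>\<^sub>F r in at t0 within {t0..t1}. norm (psi r - psi t0) <= sqrt (r - t0)"
   unfolding eventually_at using d by (intro exI[of _ d]) (auto simp: dist_real_def)
  qed (use lim in simp)
  thus ?thesis unfolding 1 by (simp add: LIM_zero_iff)
 next
  case 2
  obtain d where d: "0 < d" "!!s. t1 - d < s ==> s < t1 ==> \<bar>psi s - psi t1\<bar> <= sqrt (t1 - s)" using s1 by auto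
  have lim: "((%r. sqrt (t1 - r)) ---> sqrt (t1 - t1)) (at t1 within {t0..t1})" by (intro tendsto_intros)
  have "((%r. psi r - psi t1) ---> 0) (at t1 within {t0..t1})"
  proof (rule Lim_null_comparison)
   show "\<forall>\<^sub>F r in at t1 within {t0..t1}. norm (psi r - psi t1) <= sqrt (t1 - r)"
   unfolding eventually_at using d by (intro exI[of _ d]) (auto simp: dist_real_def)
  qed (use lim in simp)
  thus ?thesis unfolding 2 by (simp add: LIM_zero_iff)
 next
  case 3
  have "(psi ---> psi s) (at s)" using DERIV_isCont[OF d[OF 3]] by (simp add: isCont_def)
  thus ?thesis by (rule tendsto_within_subset) simp
 qed
qed

end


section \<open>Hoelder norms of invariant functions\<close>

text \<open>Close points of \<open>K\<close> are joined by a segment inside a compact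
neighbourhood, where the derivative is bounded; for distant points the boundedness of
\<open>h\<close> suffices.\<close>

lemma lipschitz_on_compact:
 fixes h :: "real^'n::finite => real"
 assumes S: "open S" and K: "compact K" "K <= S"
  and h: "!!x. x \<in> S ==> h differentiable (at x)" and pd: "!!i. continuous_on S (pd i h)"
 obtains L where "0 <= L" "!!x y. x \<in> K ==> y \<in> K ==> \<bar>h x - h y\<bar> <= L * dist x y"
proof (cases "K = {}")
 case False
 obtain e where e: "0 < e" "{x. infdist x K <= e} <= S" using compact_in_open_separated[OF False K(1) S K(2)] by blast
 let ?K' = "{x. infdist x K <= e}"
 have K': "compact ?K'" by (rule compact_infdist_le[OF False K(1) e(1)])
 have ball: "cball x e <= ?K'" if "x \<in> K" for x
 proof
  fix y assume "y \<in> cball x e"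
  thus "y \<in> ?K'" using infdist_le2[OF that, of y e] by (simp add: dist_commute)
 qed
 let ?s = "%x. \<Sum>i\<in>UNIV. \<bar>pd i h x\<bar>"
 have "continuous_on ?K' ?s" by (intro continuous_on_sum continuous_on_rabs continuous_on_subset[OF pd e(2)])
 hence "bounded (?s ` ?K')" by (intro compact_imp_bounded compact_continuous_image K')
 then obtain B where B: "0 < B" "!!x. x \<in> ?K' ==> \<bar>?s x\<bar> <= B" unfolding bounded_pos by auto
 have near: "\<bar>h x - h y\<bar> <= B * dist x y" if x: "x \<in> K" and y: "dist x y <= e" for x y
 proof -
  have "norm (h x - h y) <= B * norm (x - y)"
  proof (rule differentiable_bound[of "cball x e" h "%z w. (\<chi> i. pd i h z) \<bullet> w"])
   fix z assume z: "z \<in> cball x e"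
   hence zK: "z \<in> ?K'" using ball[OF x] by blast
   hence "h differentiable (at z)" using h e(2) by blast
   from has_derivative_at_withinI[OF has_derivative_pd[OF this]]
   show "(h has_derivative (%w. (\<chi> i. pd i h z) \<bullet> w)) (at z within cball x e)" .
   show "onorm (%w. (\<chi> i. pd i h z) \<bullet> w) <= B"
   proof (rule onorm_le)
   fix w :: "real^'n"
   have "norm ((\<chi> i. pd i h z) \<bullet> w) <= norm (\<chi> i. pd i h z) * norm w"
   unfolding real_norm_def by (rule Cauchy_Schwarz_ineq2)
   also have "... <= B * norm w"
   proof (rule mult_right_mono)
   have "norm (\<chi> i. pd i h z) <= ?s z" using norm_le_l1_cart[of "\<chi> i. pd i h z"] by simp
   thus "norm (\<chi> i. pd i h z) <= B" using B(2)[OF zK] by linarith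
   qed simp
   finally show "norm ((\<chi> i. pd i h z) \<bullet> w) <= B * norm w" .
   qed
  qed (use y e in auto)
  thus ?thesis by (simp add: dist_norm)
 qed
 have "continuous_on K h" by (intro continuous_at_imp_continuous_on ballI differentiable_imp_continuous_within h) (use K in blast)
 hence "bounded (h ` K)" by (intro compact_imp_bounded compact_continuous_image K(1))
 then obtain H where H: "0 < H" "!!x. x \<in> K ==> \<bar>h x\<bar> <= H" unfolding bounded_pos by auto
 have "\<bar>h x - h y\<bar> <= (B + 2 * H / e) * dist x y" if xy: "x \<in> K" "y \<in> K" for x y
 proof (cases "dist x y <= e")
  case True
  have "0 <= 2 * H / e * dist x y" using H(1) e(1) by simp
  thus ?thesis using near[OF xy(1) True] by (simp add: distrib_right)
 next
  case False
  have "\<bar>h x - h y\<bar> <= 2 * H" using H(2)[OF xy(1)] H(2)[OF xy(2)] by linarith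
  also have "... = 2 * H / e * e" using e by simp
  also have "... <= 2 * H / e * dist x y" using False H(1) e(1) by (intro mult_left_mono) auto
  also have "... <= (B + 2 * H / e) * dist x y" using B(1) by (intro mult_right_mono) auto
  finally show ?thesis .
 qed
 thus ?thesis using that[of "B + 2 * H / e"] B(1) H(1) e(1) by simp
qed (use that[of 0] in auto)

lemma smooth_bounds:
 fixes h :: "real^'n::finite => real"
 assumes h: "smooth_on h S" and S: "open S" and K: "compact K" "K <= S"
 obtains B where "1 <= B" "!!x. x \<in> K ==> \<bar>h x\<bar> <= B"
  "!!x y. x \<in> K ==> y \<in> K ==> \<bar>h x - h y\<bar> <= B * dist x y"
proof -
 obtain L where L: "0 <= L" "!!x y. x \<in> K ==> y \<in> K ==> \<bar>h x - h y\<bar> <= L * dist x y"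
  using lipschitz_on_compact[OF S K smooth_on_differentiable[OF h S] smooth_on_continuous[OF smooth_on_pd[OF h]]] by metis
 have "continuous_on K h" by (rule continuous_on_subset[OF smooth_on_continuous[OF h] K(2)])
 hence "bounded (h ` K)" by (intro compact_imp_bounded compact_continuous_image K(1))
 then obtain H where H: "0 < H" "!!x. x \<in> K ==> \<bar>h x\<bar> <= H" unfolding bounded_pos by auto
 show ?thesis
 proof (rule that[of "1 + L + H"])
  show "1 <= 1 + L + H" using L(1) H(1) by simp
  show "\<bar>h x\<bar> <= 1 + L + H" if "x \<in> K" for x using H(2)[OF that] L(1) by linarith
  show "\<bar>h x - h y\<bar> <= (1 + L + H) * dist x y" if "x \<in> K" "y \<in> K" for x y
   by (rule order_trans[OF L(2)[OF that] mult_right_mono]) (use H(1) in auto)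
 qed
qed

lemma product_difference_bound:
 fixes a b :: real
 assumes a: "\<bar>a\<bar> <= A" "\<bar>a - a'\<bar> <= LA * r" and b: "\<bar>b'\<bar> <= B" "\<bar>b - b'\<bar> <= LB * r"
  and n: "0 <= A" "0 <= B" "0 <= LA * r"
 shows "\<bar>a * b - a' * b'\<bar> <= (A * LB + LA * B) * r"
proof -
 have "a * b - a' * b' = a * (b - b') + (a - a') * b'" by (simp add: algebra_simps)
 hence "\<bar>a * b - a' * b'\<bar> <= \<bar>a\<bar> * \<bar>b - b'\<bar> + \<bar>a - a'\<bar> * \<bar>b'\<bar>" by (metis abs_mult abs_triangle_ineq)
 also have "... <= A * (LB * r) + (LA * r) * B" using a b n by (intro add_mono mult_mono) auto
 finally show ?thesis by (simp add: algebra_simps)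
qed

context isoparam
begin

lemma compose_derivatives:
 assumes c: "c \<in> A" and x: "x \<in> img c"
  and eta: "!!s. s \<in> {t0..t1} ==> (eta has_real_derivative eta1 s) (at s within {t0..t1})"
   "!!s. s \<in> {t0..t1} ==> (eta1 has_real_derivative eta2 s) (at s within {t0..t1})"
 shows "local_rep c (%p. eta (f p)) differentiable (at x)"
  "pd j (local_rep c (%p. eta (f p))) x = eta1 (local_rep c f x) * pd j (local_rep c f) x"
  "pd j (local_rep c (%p. eta (f p))) differentiable (at x)"
  "pd i (pd j (local_rep c (%p. eta (f p)))) x =
   eta2 (local_rep c f x) * (pd i (local_rep c f) x * pd j (local_rep c f) x) + eta1 (local_rep c f x) * pd i (pd j (local_rep c f)) x"
proof -
 have rep: "local_rep c (%p. eta (f p)) = (%x. eta (local_rep c f x))" by (simp add: local_rep_def o_def)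
 have sub: "local_rep c f ` img c <= {t0..t1}" using level_chart[OF c] by blast
 have fd: "local_rep c f differentiable (at x)" if "x \<in> img c" for x
  using rep_has_derivative[OF c that] by (auto simp: differentiable_def)
 note comp = pd_compose[OF fd chart(2)[OF c] _ sub]
 show "local_rep c (%p. eta (f p)) differentiable (at x)"
  unfolding rep using comp(1)[OF x x eta(1)[OF level_chart[OF c x]]] by (auto simp: differentiable_def)
 have 1: "pd j (local_rep c (%p. eta (f p))) x = eta1 (local_rep c f x) * pd j (local_rep c f) x" if x: "x \<in> img c" for x j
  unfolding rep by (rule comp(2)[OF x x eta(1)[OF level_chart[OF c x]]])
 thus "pd j (local_rep c (%p. eta (f p))) x = eta1 (local_rep c f x) * pd j (local_rep c f) x" using x .
 have D: "((%x. eta1 (local_rep c f x) * pd j (local_rep c f) x) has_derivative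
   (%v. eta1 (local_rep c f x) * ((\<chi> i. pd i (pd j (local_rep c f)) x) \<bullet> v) +
   (eta2 (local_rep c f x) * ((\<chi> i. pd i (local_rep c f) x) \<bullet> v)) * pd j (local_rep c f) x)) (at x)"
  by (rule has_derivative_mult[OF comp(1)[OF x x eta(2)[OF level_chart[OF c x]]] has_derivative_pd[OF pd_rep_differentiable[OF c x]]])
 have D': "(pd j (local_rep c (%p. eta (f p))) has_derivative
   (%v. eta1 (local_rep c f x) * ((\<chi> i. pd i (pd j (local_rep c f)) x) \<bullet> v) +
   (eta2 (local_rep c f x) * ((\<chi> i. pd i (local_rep c f) x) \<bullet> v)) * pd j (local_rep c f) x)) (at x)"
  by (rule has_derivative_transform_within_open[OF D chart(2)[OF c] x]) (simp only: 1)
 thus "pd j (local_rep c (%p. eta (f p))) differentiable (at x)" by (auto simp: differentiable_def)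
 show "pd i (pd j (local_rep c (%p. eta (f p)))) x =
   eta2 (local_rep c f x) * (pd i (local_rep c f) x * pd j (local_rep c f) x) + eta1 (local_rep c f x) * pd i (pd j (local_rep c f)) x"
  using pd_eqI[OF D', of i] by (simp add: inner_axis algebra_simps)
qed

lemma rep_smooth: "c \<in> A ==> smooth_on (local_rep c f) (img c)"
 using f by (simp add: smooth_fun_def)

lemma compose_C2:
 assumes c: "c \<in> A"
  and eta: "!!s. s \<in> {t0..t1} ==> (eta has_real_derivative eta1 s) (at s within {t0..t1})"
   "!!s. s \<in> {t0..t1} ==> (eta1 has_real_derivative eta2 s) (at s within {t0..t1})"
   "continuous_on {t0..t1} eta2"
 shows "Ck_on 2 (local_rep c (%p. eta (f p))) (img c)"
proof -
 let ?h = "local_rep c f" and ?v = "local_rep c (%p. eta (f p))"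
 note d = compose_derivatives[OF c _ eta(1,2)]
 have S: "open (img c)" by (rule chart(2)[OF c])
 have lev: "?h ` img c <= {t0..t1}" using level_chart[OF c] by blast
 have "continuous_on {t0..t1} eta1" by (rule DERIV_continuous_on, rule eta(2), assumption)
 hence ch: "continuous_on (img c) (%x. eta1 (?h x))" "continuous_on (img c) (%x. eta2 (?h x))"
  using eta(3) continuous_on_compose2[OF _ rep_continuous[OF c] lev] by blast+
 have "continuous_on (img c) (%x. eta2 (?h x) * (pd i ?h x * pd j ?h x) + eta1 (?h x) * pd i (pd j ?h) x)" for i j
  by (intro continuous_on_add continuous_on_mult ch smooth_on_continuous smooth_on_pd rep_smooth c)
 hence "continuous_on (img c) (pd i (pd j ?v))" for i j by (rule continuous_on_eq) (simp only: d(4))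
 moreover have "?v differentiable_on img c" "!!j. pd j ?v differentiable_on img c"
  unfolding differentiable_on_eq_differentiable_at[OF S] using d(1,3) by blast+
 ultimately show ?thesis by (simp add: numeral_2_eq_2)
qed

definition C3_bounded ::
  "(real => real) => (real => real) => (real => real) => (real => real) => real => bool" where
 "C3_bounded eta eta1 eta2 eta3 M \<longleftrightarrow> (\<forall>s\<in>{t0..t1}.
   (eta has_real_derivative eta1 s) (at s within {t0..t1}) & (eta1 has_real_derivative eta2 s) (at s within {t0..t1}) &
   (eta2 has_real_derivative eta3 s) (at s within {t0..t1}) & \<bar>eta s\<bar> <= M & \<bar>eta1 s\<bar> <= M & \<bar>eta2 s\<bar> <= M & \<bar>eta3 s\<bar> <= M)"

text \<open>By the chain rule three derivatives of \<open>eta\<close> make the second partial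
derivatives of \<open>eta \<circ> f\<close> Lipschitz, and on a bounded set a Lipschitz bound
implies a Hoelder bound.\<close>

lemma C2a_norm_compose:
 assumes c: "c \<in> A" and K: "compact K" "K <= img c" and \<alpha>: "0 < \<alpha>" "\<alpha> < 1"
 obtains C :: real where "0 <= C"
  "!!eta eta1 eta2 eta3 M. C3_bounded eta eta1 eta2 eta3 M ==> C2a_norm \<alpha> K (local_rep c (%p. eta (f p))) <= ennreal (C * M)"
proof -
 let ?h = "local_rep c f"
 have S: "open (img c)" by (rule chart(2)[OF c])
 note sm = rep_smooth[OF c]
 obtain B0 where B0: "1 <= B0" "!!x y. x \<in> K ==> y \<in> K ==> \<bar>?h x - ?h y\<bar> <= B0 * dist x y"
  using smooth_bounds[OF sm S K] by metis
 have "ALL i. \<exists>B\<ge>1. (\<forall>x\<in>K. \<bar>pd i ?h x\<bar> <= B) & (\<forall>x\<in>K. \<forall>y\<in>K. \<bar>pd i ?h x - pd i ?h y\<bar> <= B * dist x y)"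
  using smooth_bounds[OF smooth_on_pd[OF sm] S K] by metis
 then obtain B1 where B1: "!!i. 1 <= B1 i" "!!i x. x \<in> K ==> \<bar>pd i ?h x\<bar> <= B1 i"
  "!!i x y. x \<in> K ==> y \<in> K ==> \<bar>pd i ?h x - pd i ?h y\<bar> <= B1 i * dist x y" by metis
 have "ALL i j. \<exists>B\<ge>1. (\<forall>x\<in>K. \<bar>pd i (pd j ?h) x\<bar> <= B) & (\<forall>x\<in>K. \<forall>y\<in>K. \<bar>pd i (pd j ?h) x - pd i (pd j ?h) y\<bar> <= B * dist x y)"
  using smooth_bounds[OF smooth_on_pd[OF smooth_on_pd[OF sm]] S K] by metis
 then obtain B2 where B2: "!!i j. 1 <= B2 i j" "!!i j x. x \<in> K ==> \<bar>pd i (pd j ?h) x\<bar> <= B2 i j"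
  "!!i j x y. x \<in> K ==> y \<in> K ==> \<bar>pd i (pd j ?h) x - pd i (pd j ?h) y\<bar> <= B2 i j * dist x y" by metis
 define R where "R = diameter K"
 have R: "dist x y <= R" if "x \<in> K" "y \<in> K" for x y
  unfolding R_def by (rule diameter_bounded_bound[OF compact_imp_bounded[OF K(1)] that])
 define B where "B = B0 + (\<Sum>i\<in>UNIV. B1 i) + (\<Sum>i\<in>UNIV. \<Sum>j\<in>UNIV. B2 i j) + \<bar>R\<bar>"
 have nn: "0 <= B1 i" "0 <= B2 i j" for i j using B1(1)[of i] B2(1)[of i j] by auto
 have s1: "0 <= (\<Sum>i\<in>UNIV. B1 i)" "0 <= (\<Sum>i\<in>UNIV. \<Sum>j\<in>UNIV. B2 i j)" using nn by (auto intro!: sum_nonneg)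
 have le1: "B1 i <= (\<Sum>i\<in>UNIV. B1 i)" for i by (rule member_le_sum) (use nn in auto)
 have le2: "B2 i j <= (\<Sum>i\<in>UNIV. \<Sum>j\<in>UNIV. B2 i j)" for i j
 proof -
  have "B2 i j <= (\<Sum>j\<in>UNIV. B2 i j)" by (rule member_le_sum) (use nn in auto)
  also have "... <= (\<Sum>i\<in>UNIV. \<Sum>j\<in>UNIV. B2 i j)" by (rule member_le_sum) (use nn in "auto intro!: sum_nonneg")
  finally show ?thesis .
 qed
 have BB: "B0 <= B" "B1 i <= B" "B2 i j <= B" "R <= B" "1 <= B" for i j using le1[of i] le2[of i j] s1 B0(1) by (auto simp: B_def)
 have h0: "\<bar>?h x - ?h y\<bar> <= B * dist x y" if "x \<in> K" "y \<in> K" for x y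
  by (rule order_trans[OF B0(2)[OF that] mult_right_mono[OF BB(1)]]) simp
 have h1: "\<bar>pd i ?h x\<bar> <= B" if "x \<in> K" for i x using B1(2)[OF that, of i] BB(2)[of i] by linarith
 have h1': "\<bar>pd i ?h x - pd i ?h y\<bar> <= B * dist x y" if "x \<in> K" "y \<in> K" for i x y
  by (rule order_trans[OF B1(3)[OF that] mult_right_mono[OF BB(2)]]) simp
 have h2: "\<bar>pd i (pd j ?h) x\<bar> <= B" if "x \<in> K" for i j x using B2(2)[OF that, of i j] BB(3)[of i j] by linarith
 have h2': "\<bar>pd i (pd j ?h) x - pd i (pd j ?h) y\<bar> <= B * dist x y" if "x \<in> K" "y \<in> K" for i j x y
  by (rule order_trans[OF B2(3)[OF that] mult_right_mono[OF BB(3)]]) simp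
 define T where "T = 1 + B + B\<^sup>2 + (B * B\<^sup>2 + 2 * B\<^sup>2 + B * B + B) * B"
 have Bp: "0 < B" using BB(5) by simp
 have T: "1 <= T" "B <= T" "B\<^sup>2 + B <= T" "(B * B\<^sup>2 + 2 * B\<^sup>2 + B * B + B) * B <= T"
  using Bp by (auto simp: T_def add_nonneg_nonneg)
 define N where "N = real CARD('n)"
 define C where "C = T + N * T + N * (N * T) + N * (N * T)"
 have C: "0 <= C" using T(1) by (simp add: C_def N_def)
 have "C2a_norm \<alpha> K (local_rep c (%p. eta (f p))) <= ennreal (C * M)" if C3: "C3_bounded eta eta1 eta2 eta3 M" for eta eta1 eta2 eta3 M
 proof -
  note H = bspec[OF C3[unfolded C3_bounded_def]]
  note eta = conjunct1[OF H] conjunct1[OF conjunct2[OF H]] conjunct1[OF conjunct2[OF conjunct2[OF H]]]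
  note bd = conjunct2[OF conjunct2[OF conjunct2[OF H]]]
  let ?v = "local_rep c (%p. eta (f p))"
  have M: "0 <= M" using bd[of t0] t01 by fastforce
  have kI: "x \<in> img c" "?h x \<in> {t0..t1}" if "x \<in> K" for x using that K(2) level_chart[OF c] by auto
  note d = compose_derivatives[OF c kI(1) eta(1,2)]
  have d4: "pd i (pd j ?v) x = eta2 (?h x) * (pd i ?h x * pd j ?h x) + eta1 (?h x) * pd i (pd j ?h) x" if "x \<in> K" for i j x
   by (rule d(4)[OF that])
  have lip1: "\<bar>eta1 (?h x) - eta1 (?h y)\<bar> <= (M * B) * dist x y" if xy: "x \<in> K" "y \<in> K" for x y
  proof -
   have "norm (eta1 (?h x) - eta1 (?h y)) <= M * norm (?h x - ?h y)"
   by (rule field_differentiable_bound[of "{t0..t1}" eta1 eta2]) (use eta(2) bd kI xy in auto)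
   also have "... <= M * (B * dist x y)" using h0[OF xy] M by (intro mult_left_mono) auto
   finally show ?thesis by (simp add: mult.assoc)
  qed
  have lip2: "\<bar>eta2 (?h x) - eta2 (?h y)\<bar> <= (M * B) * dist x y" if xy: "x \<in> K" "y \<in> K" for x y
  proof -
   have "norm (eta2 (?h x) - eta2 (?h y)) <= M * norm (?h x - ?h y)"
   by (rule field_differentiable_bound[of "{t0..t1}" eta2 eta3]) (use eta(3) bd kI xy in auto)
   also have "... <= M * (B * dist x y)" using h0[OF xy] M by (intro mult_left_mono) auto
   finally show ?thesis by (simp add: mult.assoc)
  qed
  have scale: "ennreal r <= ennreal (T * M)" if "r <= t * M" "t <= T" for r t
   by (rule ennreal_leI, rule order_trans[OF that(1)], rule mult_right_mono[OF that(2) M])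
  have b0: "(SUP x\<in>K. ennreal \<bar>?v x\<bar>) <= ennreal (T * M)"
  proof (rule SUP_least)
   fix x assume "x \<in> K"
   hence "\<bar>?v x\<bar> <= 1 * M" using bd[OF kI(2)[of x]] by (simp add: local_rep_apply)
   thus "ennreal \<bar>?v x\<bar> <= ennreal (T * M)" by (rule scale[OF _ T(1)])
  qed
  have b1: "(SUP x\<in>K. ennreal \<bar>pd i ?v x\<bar>) <= ennreal (T * M)" for i
  proof (rule SUP_least)
   fix x assume x: "x \<in> K"
   have "\<bar>eta1 (?h x)\<bar> * \<bar>pd i ?h x\<bar> <= M * B" using bd[OF kI(2)[OF x]] h1[OF x, of i] M by (intro mult_mono) auto
   hence "\<bar>pd i ?v x\<bar> <= B * M" using d(2)[OF x, of i] by (simp add: abs_mult mult.commute)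
   thus "ennreal \<bar>pd i ?v x\<bar> <= ennreal (T * M)" by (rule scale[OF _ T(2)])
  qed
  have b2: "(SUP x\<in>K. ennreal \<bar>pd i (pd j ?v) x\<bar>) <= ennreal (T * M)" for i j
  proof (rule SUP_least)
   fix x assume x: "x \<in> K"
   have "\<bar>eta2 (?h x) * (pd i ?h x * pd j ?h x)\<bar> <= M * (B * B)"
   unfolding abs_mult using bd[OF kI(2)[OF x]] h1[OF x, of i] h1[OF x, of j] M Bp by (intro mult_mono) auto
   moreover have "\<bar>eta1 (?h x) * pd i (pd j ?h) x\<bar> <= M * B"
   unfolding abs_mult using bd[OF kI(2)[OF x]] h2[OF x, of i j] M by (intro mult_mono) auto
   moreover have "(B\<^sup>2 + B) * M = M * (B * B) + M * B" by (simp add: algebra_simps power2_eq_square)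
   ultimately have "\<bar>pd i (pd j ?v) x\<bar> <= (B\<^sup>2 + B) * M" unfolding d4[OF x] by linarith
   thus "ennreal \<bar>pd i (pd j ?v) x\<bar> <= ennreal (T * M)" by (rule scale[OF _ T(3)])
  qed
  have b3: "(SUP x\<in>K. SUP y\<in>K - {x}. ennreal (\<bar>pd i (pd j ?v) x - pd i (pd j ?v) y\<bar> / dist x y powr \<alpha>)) <= ennreal (T * M)" for i j
  proof (rule SUP_least, rule SUP_least)
   fix x y assume x: "x \<in> K" and y': "y \<in> K - {x}"
   hence y: "y \<in> K" and ne: "0 < dist x y" by auto
   let ?r = "dist x y"
   have p1: "\<bar>pd i ?h x * pd j ?h x - pd i ?h y * pd j ?h y\<bar> <= (B * B + B * B) * ?r"
   by (rule product_difference_bound) (use h1 h1' x y Bp in auto)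
   have p2: "\<bar>eta2 (?h x) * (pd i ?h x * pd j ?h x) - eta2 (?h y) * (pd i ?h y * pd j ?h y)\<bar> <= (M * (B * B + B * B) + (M * B) * (B * B)) * ?r"
   proof (rule product_difference_bound[OF _ lip2[OF x y] _ p1])
   show "\<bar>pd i ?h y * pd j ?h y\<bar> <= B * B" unfolding abs_mult using h1[OF y] Bp by (intro mult_mono) auto
   qed (use bd[OF kI(2)[OF x]] M Bp in auto)
   have p3: "\<bar>eta1 (?h x) * pd i (pd j ?h) x - eta1 (?h y) * pd i (pd j ?h) y\<bar> <= (M * B + (M * B) * B) * ?r"
   by (rule product_difference_bound[OF _ lip1[OF x y] h2[OF y] h2'[OF x y]]) (use bd[OF kI(2)[OF x]] M Bp in auto)
   define Q where "Q = B * B\<^sup>2 + 2 * B\<^sup>2 + B * B + B"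
   have "(M * (B * B + B * B) + (M * B) * (B * B)) * ?r + (M * B + (M * B) * B) * ?r = Q * M * ?r"
   by (simp add: Q_def algebra_simps power2_eq_square)
   hence dif: "\<bar>pd i (pd j ?v) x - pd i (pd j ?v) y\<bar> <= Q * M * ?r" unfolding d4[OF x] d4[OF y] using p2 p3 by linarith
   have "?r = ?r powr (1 - \<alpha>) * ?r powr \<alpha>" using ne by (simp add: powr_add[symmetric])
   moreover have "?r powr (1 - \<alpha>) <= B"
   proof -
   have "?r powr (1 - \<alpha>) <= B powr (1 - \<alpha>)" using R[OF x y] BB(4) \<alpha> by (intro powr_mono2) auto
   also have "... <= B powr 1" using BB(5) \<alpha> by (intro powr_mono) auto
   finally show ?thesis using Bp by simp
   qed
   ultimately have rB: "?r <= B * ?r powr \<alpha>" by (metis mult_right_mono powr_ge_zero)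
   have Q: "0 <= Q * M" using M Bp by (simp add: Q_def)
   have "Q * M * ?r <= Q * M * (B * ?r powr \<alpha>)" by (rule mult_left_mono[OF rB Q])
   hence "\<bar>pd i (pd j ?v) x - pd i (pd j ?v) y\<bar> <= ((Q * B) * M) * ?r powr \<alpha>" using dif by (simp add: mult_ac)
   hence "\<bar>pd i (pd j ?v) x - pd i (pd j ?v) y\<bar> / ?r powr \<alpha> <= (Q * B) * M" using ne by (simp add: pos_divide_le_eq)
   thus "ennreal (\<bar>pd i (pd j ?v) x - pd i (pd j ?v) y\<bar> / ?r powr \<alpha>) <= ennreal (T * M)"
   by (rule scale) (use T(4) in "simp add: Q_def")
  qed
  have sum_le: "(\<Sum>i\<in>(UNIV :: 'n set). F i) <= ennreal (N * r)" if "!!i. F i <= ennreal r" "0 <= r" for F :: "'n => ennreal" and r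
  proof -
   have "(\<Sum>i\<in>(UNIV :: 'n set). F i) <= of_nat (card (UNIV :: 'n set)) * ennreal r" by (rule sum_bounded_above) (rule that(1))
   also have "... = ennreal (N * r)" using that(2) by (simp add: N_def ennreal_of_nat_eq_real_of_nat ennreal_mult)
   finally show ?thesis .
  qed
  have TM: "0 <= T * M" "0 <= N * (T * M)" using T(1) M by (auto simp: N_def)
  have "C2a_norm \<alpha> K ?v <= ennreal (T * M) + ennreal (N * (T * M)) + ennreal (N * (N * (T * M))) + ennreal (N * (N * (T * M)))"
   unfolding C2a_norm_def by (intro add_mono b0 sum_le b1 b2 b3 TM)
  also have "... = ennreal (C * M)"
  proof -
   have plus: "ennreal r1 + ennreal r2 + ennreal r3 + ennreal r4 = ennreal (r1 + r2 + r3 + r4)"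
   if "0 <= r1" "0 <= r2" "0 <= r3" "0 <= r4" for r1 r2 r3 r4 using that by simp
   have "T * M + N * (T * M) + N * (N * (T * M)) + N * (N * (T * M)) = C * M" by (simp add: C_def algebra_simps)
   moreover have NN: "0 <= N * (N * (T * M))" using TM(2) by (simp add: N_def)
   ultimately show ?thesis unfolding plus[OF TM NN NN] by simp
  qed
  finally show ?thesis .
 qed
 thus ?thesis by (rule that[OF C])
qed

end


section \<open>The branch on the manifold\<close>

lemma bounded_on_interval:
 fixes h :: "real => real"
 assumes "continuous_on {l..r} h"
 shows "EX B. \<forall>s\<in>{l..r}. \<bar>h s\<bar> <= B"
proof -
 have "bounded (h ` {l..r})" by (intro compact_imp_bounded compact_continuous_image assms) simp
 thus ?thesis unfolding bounded_iff by auto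
qed

context isoparam
begin

text \<open>Points at the same distance from the focal set have the same level.\<close>

lemma invariant_compose: "f_invariant X A g f t0 (%p. eta (f p))"
 unfolding f_invariant_def
proof (intro exI[of _ "%d. eta (f (SOME p. p \<in> topspace X & riem_setdist X A g focal p = d))"] ballI)
 fix x assume x: "x \<in> topspace X"
 let ?p = "SOME p. p \<in> topspace X & riem_setdist X A g focal p = riem_setdist X A g focal x"
 have "?p \<in> topspace X & riem_setdist X A g focal ?p = riem_setdist X A g focal x" by (rule someI[of _ x]) (use x in simp)
 hence "f ?p = f x" using focal_dist_eq_iff x by blast
 thus "eta (f x) = eta (f ?p)" by simp
qed

lemma compose_in_C2a:
 assumes \<alpha>: "0 < \<alpha>" "\<alpha> < 1"
  and eta: "!!s. s \<in> {t0..t1} ==> (eta has_real_derivative eta1 s) (at s within {t0..t1})"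
   "!!s. s \<in> {t0..t1} ==> (eta1 has_real_derivative eta2 s) (at s within {t0..t1})"
   "!!s. s \<in> {t0..t1} ==> (eta2 has_real_derivative eta3 s) (at s within {t0..t1})"
   "continuous_on {t0..t1} eta3"
 shows "(%p. eta (f p)) \<in> C2a A \<alpha>"
proof -
 have c: "continuous_on {t0..t1} eta" "continuous_on {t0..t1} eta1" "continuous_on {t0..t1} eta2"
  by (rule DERIV_continuous_on, rule eta, assumption)+
 obtain M0 M1 M2 M3 where M: "\<forall>s\<in>{t0..t1}. \<bar>eta s\<bar> <= M0" "\<forall>s\<in>{t0..t1}. \<bar>eta1 s\<bar> <= M1"
  "\<forall>s\<in>{t0..t1}. \<bar>eta2 s\<bar> <= M2" "\<forall>s\<in>{t0..t1}. \<bar>eta3 s\<bar> <= M3"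
  using bounded_on_interval[OF c(1)] bounded_on_interval[OF c(2)] bounded_on_interval[OF c(3)] bounded_on_interval[OF eta(4)] by blast
 define M where "M = max (max M0 M1) (max M2 M3)"
 have C3: "C3_bounded eta eta1 eta2 eta3 M" unfolding C3_bounded_def using M eta by (simp add: M_def le_max_iff_disj)
 have "C2a_norm \<alpha> K (local_rep c (%p. eta (f p))) < \<infinity>" if cA: "c \<in> A" and K: "compact K" "K <= img c" for c K
 proof (rule C2a_norm_compose[OF cA K \<alpha>])
  fix C :: real
  assume "!!eta eta1 eta2 eta3 M. C3_bounded eta eta1 eta2 eta3 M ==> C2a_norm \<alpha> K (local_rep c (%p. eta (f p))) <= ennreal (C * M)"
  from this[OF C3] show ?thesis by (rule order_le_less_trans) auto
 qed
 thus ?thesis using compose_C2[OF _ eta(1,2) c(3)] by (auto simp: C2a_def)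
qed

lemma compose_C2a_continuous:
 fixes U U1 U2 U3 :: "real => real => real"
 assumes \<alpha>: "0 < \<alpha>" "\<alpha> < 1"
  and U: "!!t s. t \<in> T ==> s \<in> {t0..t1} ==> (U t has_real_derivative U1 t s) (at s within {t0..t1})"
   "!!t s. t \<in> T ==> s \<in> {t0..t1} ==> (U1 t has_real_derivative U2 t s) (at s within {t0..t1})"
   "!!t s. t \<in> T ==> s \<in> {t0..t1} ==> (U2 t has_real_derivative U3 t s) (at s within {t0..t1})"
  and lim: "!!s. s \<in> T ==> uniform_limit {t0..t1} U (U s) (at s within T)"
   "!!s. s \<in> T ==> uniform_limit {t0..t1} U1 (U1 s) (at s within T)"
   "!!s. s \<in> T ==> uniform_limit {t0..t1} U2 (U2 s) (at s within T)"
   "!!s. s \<in> T ==> uniform_limit {t0..t1} U3 (U3 s) (at s within T)"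
 shows "C2a_continuous A \<alpha> T (%t p. U t (f p))" unfolding C2a_continuous_def
proof (intro ballI allI impI)
 fix s c K assume s: "s \<in> T" and cA: "c \<in> A" and K: "compact K & K <= img c"
 let ?F = "%t. C2a_norm \<alpha> K (local_rep c (%p. U t (f p) - U s (f p)))"
 have ev: "\<forall>\<^sub>F t in at s within T. ?F t <= ennreal e" if e: "0 < e" for e
 proof (rule C2a_norm_compose[OF cA conjunct1[OF K] conjunct2[OF K] \<alpha>])
  fix C :: real
  assume C: "0 <= C" "!!eta eta1 eta2 eta3 M. C3_bounded eta eta1 eta2 eta3 M ==>
   C2a_norm \<alpha> K (local_rep c (%p. eta (f p))) <= ennreal (C * M)"
  define e' where "e' = e / (C + 1)"
  have e': "0 < e'" "C * e' <= e" using e C(1) by (auto simp: e'_def field_simps)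
  have "\<forall>\<^sub>F t in at s within T. t \<in> T" by (auto simp: eventually_at_filter)
  moreover have "\<forall>\<^sub>F t in at s within T. \<forall>x\<in>{t0..t1}. dist (U t x) (U s x) < e'"
   "\<forall>\<^sub>F t in at s within T. \<forall>x\<in>{t0..t1}. dist (U1 t x) (U1 s x) < e'"
   "\<forall>\<^sub>F t in at s within T. \<forall>x\<in>{t0..t1}. dist (U2 t x) (U2 s x) < e'"
   "\<forall>\<^sub>F t in at s within T. \<forall>x\<in>{t0..t1}. dist (U3 t x) (U3 s x) < e'"
   by (rule uniform_limitD[OF lim(1)[OF s] e'(1)] uniform_limitD[OF lim(2)[OF s] e'(1)]
   uniform_limitD[OF lim(3)[OF s] e'(1)] uniform_limitD[OF lim(4)[OF s] e'(1)])+
  ultimately show "\<forall>\<^sub>F t in at s within T. ?F t <= ennreal e"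
  proof eventually_elim
   case (elim t)
   have "C2a_norm \<alpha> K (local_rep c (%p. (%r. U t r - U s r) (f p))) <= ennreal (C * e')"
   proof (rule C(2), unfold C3_bounded_def, intro ballI conjI)
   fix r assume r: "r \<in> {t0..t1}"
   show "((%r. U t r - U s r) has_real_derivative U1 t r - U1 s r) (at r within {t0..t1})"
   by (rule DERIV_diff[OF U(1)[OF elim(1) r] U(1)[OF s r]])
   show "((%r. U1 t r - U1 s r) has_real_derivative U2 t r - U2 s r) (at r within {t0..t1})"
   by (rule DERIV_diff[OF U(2)[OF elim(1) r] U(2)[OF s r]])
   show "((%r. U2 t r - U2 s r) has_real_derivative U3 t r - U3 s r) (at r within {t0..t1})"
   by (rule DERIV_diff[OF U(3)[OF elim(1) r] U(3)[OF s r]])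
   qed (use elim(2-5) in "simp_all add: dist_real_def less_imp_le")
   also have "... <= ennreal e" using e'(2) by (rule ennreal_leI)
   finally show ?case .
  qed
 qed
 show "(?F ---> 0) (at s within T)"
 proof (rule order_tendstoI)
  fix a :: ennreal assume a: "0 < a"
  obtain e where e: "0 < e" "ennreal e < a"
  proof (cases a rule: ennreal_cases)
   case (real r)
   hence r: "0 < r" using a by simp
   hence "ennreal (r / 2) < a" using real by (simp add: ennreal_less_iff)
   thus ?thesis using that[of "r / 2"] r by simp
  next
   case top
   thus ?thesis using that[of 1] by simp
  qed
  show "\<forall>\<^sub>F t in at s within T. ?F t < a"
   using ev[OF e(1)] by (rule eventually_mono) (rule order_le_less_trans[OF _ e(2)])
 qed simp
qed

theorem bifurcation_branch_at_eigenvalue: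
 assumes \<alpha>: "0 < \<alpha>" "\<alpha> < 1" and q: "1 < q"
  and \<mu>: "\<mu> \<in> positive_invariant_eigenvalues X A g f t0 \<alpha>"
 shows "\<exists>eps>0. \<exists>(u :: real => 'm => real) (lam :: real => real).
  (\<forall>t\<in>{-eps<..<eps}. u t \<in> C2a_inv X A g f t0 \<alpha> & lam t > 0) &
  C2a_continuous A \<alpha> {-eps<..<eps} u & continuous_on {-eps<..<eps} lam &
  (\<forall>t\<in>{-eps<..<eps}. \<forall>p\<in>topspace X. u t p > 0 &
   - laplace_beltrami A g (u t) p + lam t * u t p = lam t * u t p powr q) &
  lam 0 = \<mu> / (q - 1) & (\<forall>p\<in>topspace X. u 0 p = 1) &
  (\<forall>t\<in>{-eps<..<eps}. t ~= 0 --> (\<exists>p\<in>topspace X. u t p ~= 1))" (is ?thesis)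
proof -
 obtain u where \<mu>0: "0 < \<mu>" and u: "u \<in> C2a_inv X A g f t0 \<alpha>" and unz: "\<exists>p\<in>topspace X. u p ~= 0"
  and eq: "!!p. p \<in> topspace X ==> - laplace_beltrami A g u p = \<mu> * u p"
  using \<mu> unfolding positive_invariant_eigenvalues_def by blast
 have u2: "Ck_on 2 (local_rep c u) (img c)" if "c \<in> A" for c using u that by (simp add: C2a_inv_def C2a_def)
 obtain phi where phi: "!!x. x \<in> topspace X ==> u x = phi (riem_setdist X A g focal x)"
  using u unfolding C2a_inv_def f_invariant_def by blast
 define psi where "psi = (%s. phi (arclen s))"
 have psi: "u p = psi (f p)" if "p \<in> topspace X" for p using phi[OF that] focal_dist[OF that] by (simp add: psi_def)
 note small = invariant_small_at_focal[of u psi, OF u2 psi] invariant_small_at_top[of u psi, OF u2 psi]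
 have "EX y. (ALL s. t0 < s --> s < t1 --> (psi has_real_derivative y s) (at s)) &
   (ALL s. t0 < s --> s < t1 --> (y has_real_derivative (- \<mu> * psi s - Da 0 s * y s) / Db 0 s) (at s))"
 proof (rule invariant_eigenfunction_ode[OF u2 psi eq])
  fix y assume y: "!!s. t0 < s ==> s < t1 ==> (psi has_real_derivative y s) (at s)"
   "!!s. t0 < s ==> s < t1 ==> (y has_real_derivative (- \<mu> * psi s - Da 0 s * y s) / Db 0 s) (at s)"
  show "EX y. (ALL s. t0 < s --> s < t1 --> (psi has_real_derivative y s) (at s)) &
   (ALL s. t0 < s --> s < t1 --> (y has_real_derivative (- \<mu> * psi s - Da 0 s * y s) / Db 0 s) (at s))"
   by (intro exI[of _ y] conjI allI impI y)
 qed
 then obtain y where y: "!!s. t0 < s ==> s < t1 ==> (psi has_real_derivative y s) (at s)"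
  "!!s. t0 < s ==> s < t1 ==> (y has_real_derivative (- \<mu> * psi s - Da 0 s * y s) / Db 0 s) (at s)" by blast
 have cont: "continuous_on {t0..t1} psi" by (rule invariant_continuous[OF y(1) small(1) small(2)]) auto
 have nz: "EX m. t0 < m & m < t1 & psi m ~= 0"
 proof (rule ccontr)
  assume no: "~ ?thesis"
  have cl: "closure {t0<..<t1} = {t0..t1}" by (rule closure_greaterThanLessThan[OF t01])
  have "psi s = 0" if "s \<in> {t0..t1}" for s
   by (rule continuous_constant_on_closure[of "{t0<..<t1}" psi 0]) (use cont no that cl in auto)
  thus False using unz psi level by metis
 qed
 interpret neg: isoparam X A g "%p. - f p" "- t1" "- t0" "%k s. (- 1) ^ Suc k * Da k (- s)" "%k s. (- 1) ^ k * Db k (- s)"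
  by (rule negated)
 have ends: "Db 1 t1 < 0" "2 * Da 0 t1 <= Db 1 t1" using neg.b_slope_pos neg.focal_slope by simp_all
 have der: "(Da 0 has_real_derivative Da 1 s) (at s within {t0..t1})" "(Da 1 has_real_derivative Da 2 s) (at s within {t0..t1})"
  "(Db 0 has_real_derivative Db 1 s) (at s within {t0..t1})" "(Db 1 has_real_derivative Db 2 s) (at s within {t0..t1})"
  if "s \<in> {t0..t1}" for s
  using Da[OF that, of 0] Da[OF that, of 1] Db[OF that, of 0] Db[OF that, of 1] by (simp_all add: numeral_2_eq_2)
 show ?thesis
 proof (rule ode_bifurcation[of t0 t1 "Da 0" "Da 1" "Da 2" "Db 0" "Db 1" "Db 2" q \<mu> psi y])
  fix eps :: real and U U1 U2 U3 :: "real => real => real" and lam :: "real => real"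
  assume eps: "0 < eps" and lam: "lam 0 = \<mu> / (q - 1)" "continuous_on {-eps<..<eps} lam"
   "!!t. t \<in> {-eps<..<eps} ==> 0 < lam t"
   and U0: "!!s. s \<in> {t0..t1} ==> U 0 s = 1"
   and Une: "!!t. t \<in> {-eps<..<eps} ==> t ~= 0 ==> \<exists>s\<in>{t0..t1}. U t s ~= 1"
   and Upos: "!!t s. t \<in> {-eps<..<eps} ==> s \<in> {t0..t1} ==> 0 < U t s"
   and U: "!!t s. t \<in> {-eps<..<eps} ==> s \<in> {t0..t1} ==> (U t has_real_derivative U1 t s) (at s within {t0..t1})"
   "!!t s. t \<in> {-eps<..<eps} ==> s \<in> {t0..t1} ==> (U1 t has_real_derivative U2 t s) (at s within {t0..t1})"
   "!!t s. t \<in> {-eps<..<eps} ==> s \<in> {t0..t1} ==> (U2 t has_real_derivative U3 t s) (at s within {t0..t1})"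
   and Ueq: "!!t s. t \<in> {-eps<..<eps} ==> s \<in> {t0..t1} ==> Db 0 s * U2 t s + Da 0 s * U1 t s = lam t * (U t s - U t s powr q)"
   and U3: "!!t. t \<in> {-eps<..<eps} ==> continuous_on {t0..t1} (U3 t)"
   and lim: "!!s. s \<in> {-eps<..<eps} ==> uniform_limit {t0..t1} U (U s) (at s within {-eps<..<eps})"
   "!!s. s \<in> {-eps<..<eps} ==> uniform_limit {t0..t1} U1 (U1 s) (at s within {-eps<..<eps})"
   "!!s. s \<in> {-eps<..<eps} ==> uniform_limit {t0..t1} U2 (U2 s) (at s within {-eps<..<eps})"
   "!!s. s \<in> {-eps<..<eps} ==> uniform_limit {t0..t1} U3 (U3 s) (at s within {-eps<..<eps})"
  let ?u = "%t p. U t (f p)"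
  have mem: "?u t \<in> C2a_inv X A g f t0 \<alpha>" if t: "t \<in> {-eps<..<eps}" for t
   using compose_in_C2a[OF \<alpha> U(1)[OF t] U(2)[OF t] U(3)[OF t] U3[OF t]] invariant_compose[of "U t"]
   by (simp add: C2a_inv_def)
  have cont_u: "C2a_continuous A \<alpha> {-eps<..<eps} ?u" by (rule compose_C2a_continuous[OF \<alpha> U lim])
  have equ: "- laplace_beltrami A g (?u t) p + lam t * ?u t p = lam t * ?u t p powr q"
   if t: "t \<in> {-eps<..<eps}" and p: "p \<in> topspace X" for t p
  proof -
   have "laplace_beltrami A g (?u t) p = U2 t (f p) * gradient_norm_sq A g f p + U1 t (f p) * laplace_beltrami A g f p"
   by (rule laplace_compose[OF f p openin_topspace p level refl U(1)[OF t] U(2)[OF t level[OF p]]])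
   also have "... = lam t * (U t (f p) - U t (f p) powr q)"
   using Ueq[OF t level[OF p]] grad[OF p] lap[OF p] by (simp add: mult.commute)
   finally show ?thesis by (simp add: algebra_simps)
  qed
  have ne: "\<exists>p\<in>topspace X. ?u t p ~= 1" if t: "t \<in> {-eps<..<eps}" "t ~= 0" for t
  proof -
   obtain s where s: "s \<in> {t0..t1}" "U t s ~= 1" using Une[OF t] by blast
   obtain p where "p \<in> topspace X" "f p = s" using level_attained[OF s(1)] by blast
   thus ?thesis using s(2) by blast
  qed
  show ?thesis
   by (intro exI[of _ eps] conjI exI[of _ ?u] exI[of _ lam] ballI impI eps cont_u lam mem equ ne Upos U0 level; assumption)
 next
  show "\<exists>d>0. ALL s. t0 < s --> s < t0 + d --> \<bar>psi s - psi t0\<bar> <= e * sqrt (s - t0)" if "0 < e" for e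
   by (rule small(1)) (use that in auto)
  show "\<exists>d>0. ALL s. t1 - d < s --> s < t1 --> \<bar>psi s - psi t1\<bar> <= e * sqrt (t1 - s)" if "0 < e" for e
   by (rule small(2)) (use that in auto)
  show "0 < Db 0 s" if "t0 < s" "s < t1" for s by (rule b_pos[OF that])
 qed (use t01 der Da_continuous Db_continuous b_zero b_slope_pos focal_slope ends q \<mu>0 cont y nz in simp_all)
qed

end

theorem theorem1p1:
  fixes X :: "'m topology"
    and A :: "('m, 'n::finite) chart set"
    and g :: "('m, 'n) chart \<Rightarrow> 'm \<Rightarrow> real^'n^'n"
    and f :: "'m \<Rightarrow> real"
    and t0 t1 \<alpha> q :: real
    and \<mu> :: "nat \<Rightarrow> real"
    and k :: nat
  assumes "closed_connected_riemannian_manifold X A g"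
    and "CARD('n) \<ge> 3"
    and "proper_isoparametric X A g f t0 t1"
    and "0 < \<alpha>" and "\<alpha> < 1"
    and "strict_mono_on {1..} \<mu>"
    and "\<mu> ` {1..} = positive_invariant_eigenvalues X A g f t0 \<alpha>"
    and "q > 1"
    and "k \<ge> 1"
  shows "\<exists>\<epsilon>>0. \<exists>(u :: real \<Rightarrow> 'm \<Rightarrow> real) (lam :: real \<Rightarrow> real).
    (\<forall>t\<in>{-\<epsilon><..<\<epsilon>}. u t \<in> C2a_inv X A g f t0 \<alpha> \<and> lam t > 0) \<and>
    C2a_continuous A \<alpha> {-\<epsilon><..<\<epsilon>} u \<and> continuous_on {-\<epsilon><..<\<epsilon>} lam \<and>
    (\<forall>t\<in>{-\<epsilon><..<\<epsilon>}. \<forall>p\<in>topspace X. u t p > 0 \<and>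
       - laplace_beltrami A g (u t) p + lam t * u t p = lam t * u t p powr q) \<and>
    lam 0 = \<mu> k / (q - 1) \<and> (\<forall>p\<in>topspace X. u 0 p = 1) \<and>
    (\<forall>t\<in>{-\<epsilon><..<\<epsilon>}. t \<noteq> 0 \<longrightarrow> (\<exists>p\<in>topspace X. u t p \<noteq> 1))"
proof -
  interpret riemannian X A g using assms(1) by (rule riemannian.intro)
  obtain a b where iso: "smooth_fun A f" "t0 < t1" "f ` topspace X = {t0..t1}"
    "smooth_on_interval a t0 t1" "smooth_on_interval b t0 t1"
    "\<And>p. p \<in> topspace X \<Longrightarrow> gradient_norm_sq A g f p = b (f p)"
    "\<And>p. p \<in> topspace X \<Longrightarrow> laplace_beltrami A g f p = a (f p)"
    using assms(3) unfolding proper_isoparametric_def isoparametric_def by blast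
  obtain Da where Da: "Da 0 = a" "\<And>k s. s \<in> {t0..t1} \<Longrightarrow> (Da k has_real_derivative Da (Suc k) s) (at s within {t0..t1})"
    using iso(4) unfolding smooth_on_interval_def by blast
  obtain Db where Db: "Db 0 = b" "\<And>k s. s \<in> {t0..t1} \<Longrightarrow> (Db k has_real_derivative Db (Suc k) s) (at s within {t0..t1})"
    using iso(5) unfolding smooth_on_interval_def by blast
  interpret isoparam X A g f t0 t1 Da Db
    by unfold_locales (use iso Da Db in simp_all)
  have "\<mu> k \<in> positive_invariant_eigenvalues X A g f t0 \<alpha>" using assms(7,9) by (metis atLeast_iff imageI)
  from bifurcation_branch_at_eigenvalue[OF assms(4,5,8) this] show ?thesis .
qed

end
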